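(* Let $p$ be an odd prime, $\mathbb{F}=\mathbb{F}_p$, and let $n$ be a positive integer. The free unstable module $F(n)$ has a finite filtration (by sub unstable modules) with associated graded $$\bigoplus_{\substack{a+2b=n\\ a\ge 0}}\mathcal{O}\,r'(\Lambda^a\otimes\Gamma^b)\ \oplus\ \bigoplus_{\substack{a+2b=n\\ a\ge1}}\Sigma\,\mathcal{O}\,r'(\Lambda^{a-1}\otimes\Gamma^b),$$ where $a,b$ range over non-negative integers.
   Context: $\mathcal{U}$ is the category of unstable modules over the mod-$p$ Steenrod algebra $\mathcal{A}$; $F(n)$ is the free unstable module on one generator of degree $n$, i.e. $\mathrm{Hom}_{\mathcal{U}}(F(n),M)\cong M^n$ naturally in $M\in\mathcal U$. $\Sigma$ is the suspension functor of $\mathcal{U}$. $\mathcal{U}'\subset\mathcal{U}$ is the full subcategory of unstable modules concentrated in even degrees and $\mathcal{O}\colon\mathcal{U}'\to\mathcal{U}$ is the forgetful (inclusion) functor. $\mathcal{F}$ is the category of functors from finite-dimensional $\mathbb{F}$-vector spaces to $\mathbb{F}$-vector spaces. $\Gamma^b(V)=(V^{\otimes b})^{\mathfrak{S}_b}$ is the divided power functor and $\Lambda^a$ the exterior power functor; tensor products of functors are formed pointwise. The functor $r'\colon\mathcal{F}\to\mathcal{U}'$ is given by $r'(F)^{2b}=\mathrm{Hom}_{\mathcal{F}}(\Gamma^b,F)$ ($b\ge0$), with zero components in odd degrees. The Steenrod action is by precomposition: the Bockstein acts trivially, and for a finitely supported sequence $R=(r_1,r_2,\ldots)$ of non-negative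 integers the Milnor basis element $P^R$ (dual to $\prod_{j\geq 1}\xi_j^{r_j}$) sends $f\in\mathrm{Hom}_{\mathcal{F}}(\Gamma^a,F)$ to $0$ if $r_0:=a-\sum_{j\ge1}r_j<0$, and otherwise to $f\circ\theta$, where, with $b=\sum_{j\ge0}r_jp^j$, $\theta$ is the composite $$\Gamma^b\to\bigotimes_j\Gamma^{r_jp^j}\to\bigotimes_j\Gamma^{r_j}\to\Gamma^a$$ of the coproduct, the iterated Verschiebungs $\Gamma^{r_jp^j}\to\Gamma^{r_j}$ (dual to the $p^j$-th power Frobenius maps $S^{r_j}\to S^{r_jp^j}$), and the product. *)

theory Defs
  imports
    "Jordan_Normal_Form.VS_Connect"
    "HOL-Algebra.AbelCoset"
    "HOL-Library.Cardinality"
    "HOL-Library.Poly_Mapping"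
    "HOL-Combinatorics.Permutations"
begin

text \<open>
  The ground field is a finite type \<open>'k\<close> of class \<open>field\<close>; its cardinality \<open>CARD('k)\<close> plays
  the role of the prime \<open>p\<close> in all formulas below (so \<open>'k\<close> is a copy of the prime field as
  soon as \<open>CARD('k)\<close> is assumed to be prime). Vector spaces are \<open>module\<close> records over
  \<open>class_ring\<close>.
\<close>

section \<open>Vector spaces\<close>

text \<open>The fields \<open>mult\<close> and \<open>one\<close> of a \<open>module\<close> record play no role.\<close>

definition mk_vs ::
    "'v set \<Rightarrow> 'v \<Rightarrow> ('v \<Rightarrow> 'v \<Rightarrow> 'v) \<Rightarrow> ('k \<Rightarrow> 'v \<Rightarrow> 'v) \<Rightarrow> ('k, 'v) module" where
  "mk_vs C z ad sm = \<lparr>carrier = C, mult = (\<lambda>_ _. z), one = z, zero = z, add = ad, smult = sm\<rparr>"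

definition zero_vs :: "('k, 'v) module \<Rightarrow> ('k, 'v) module" where
  "zero_vs V = V\<lparr>carrier := {\<zero>\<^bsub>V\<^esub>}\<rparr>"

definition linear_maps ::
    "('k::field, 'v) module \<Rightarrow> ('k, 'w) module \<Rightarrow> ('v \<Rightarrow> 'w) set" where
  "linear_maps V W = LinearCombinations.module_hom class_ring V W \<inter> extensional (carrier V)"

abbreviation lspan :: "('k::field, 'v) module \<Rightarrow> 'v set \<Rightarrow> 'v set" where
  "lspan V S \<equiv> LinearCombinations.module.span class_ring V S"

definition quot_vs :: "('k::field, 'v) module \<Rightarrow> 'v set \<Rightarrow> ('k, 'v set) module" where
  "quot_vs V H = mk_vs (a_rcosets\<^bsub>V\<^esub> H) H (\<lambda>X Y. X <+>\<^bsub>V\<^esub> Y)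
     (\<lambda>c X. \<Union>x\<in>X. H +>\<^bsub>V\<^esub> (c \<odot>\<^bsub>V\<^esub> x))"

text \<open>The map induced on cosets by \<open>f\<close>, where \<open>H\<close> is the subspace of the target \<open>W\<close> that is
  divided out.\<close>

definition quot_map :: "('k, 'w) module \<Rightarrow> 'w set \<Rightarrow> ('v \<Rightarrow> 'w) \<Rightarrow> 'v set \<Rightarrow> 'w set" where
  "quot_map W H f X = (\<Union>x\<in>X. H +>\<^bsub>W\<^esub> f x)"

definition free_vs :: "'s set \<Rightarrow> ('k::field, 's \<Rightarrow>\<^sub>0 'k) module" where
  "free_vs S = mk_vs {t. Poly_Mapping.keys t \<subseteq> S} 0 (+) (\<lambda>c t. Poly_Mapping.map ((*) c) t)"

definition tensor_rel ::
    "('k::field, 'v) module \<Rightarrow> ('k, 'w) module \<Rightarrow> ('v \<times> 'w \<Rightarrow>\<^sub>0 'k) set" where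
  "tensor_rel V W = lspan (free_vs (carrier V \<times> carrier W))
     ({Poly_Mapping.single (x \<oplus>\<^bsub>V\<^esub> x', y) 1 - Poly_Mapping.single (x, y) 1
         - Poly_Mapping.single (x', y) 1 | x x' y.
         x \<in> carrier V \<and> x' \<in> carrier V \<and> y \<in> carrier W}
    \<union> {Poly_Mapping.single (x, y \<oplus>\<^bsub>W\<^esub> y') 1 - Poly_Mapping.single (x, y) 1
         - Poly_Mapping.single (x, y') 1 | x y y'.
         x \<in> carrier V \<and> y \<in> carrier W \<and> y' \<in> carrier W}
    \<union> {Poly_Mapping.single (c \<odot>\<^bsub>V\<^esub> x, y) 1 - Poly_Mapping.single (x, y) c | c x y.
         x \<in> carrier V \<and> y \<in> carrier W}
    \<union> {Poly_Mapping.single (x, c \<odot>\<^bsub>W\<^esub> y) 1 - Poly_Mapping.single (x, y) c | c x y.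
         x \<in> carrier V \<and> y \<in> carrier W})"

definition tensor_vs ::
    "('k::field, 'v) module \<Rightarrow> ('k, 'w) module \<Rightarrow> ('k, ('v \<times> 'w \<Rightarrow>\<^sub>0 'k) set) module" where
  "tensor_vs V W = quot_vs (free_vs (carrier V \<times> carrier W)) (tensor_rel V W)"

definition tensor_map ::
    "('k::field, 'v) module \<Rightarrow> ('k, 'w) module \<Rightarrow> ('v \<Rightarrow> 'v) \<Rightarrow> ('w \<Rightarrow> 'w) \<Rightarrow>
     ('v \<times> 'w \<Rightarrow>\<^sub>0 'k) set \<Rightarrow> ('v \<times> 'w \<Rightarrow>\<^sub>0 'k) set" where
  "tensor_map V' W' f g =
     quot_map (free_vs (carrier V' \<times> carrier W')) (tensor_rel V' W')
       (\<lambda>t. \<Sum>(x, y)\<in>Poly_Mapping.keys t.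
              Poly_Mapping.single (f x, g y) (Poly_Mapping.lookup t (x, y)))"


section \<open>Functors from finite-dimensional vector spaces to vector spaces\<close>

text \<open>
  The source category is the skeleton with objects \<open>k\<^sup>d\<close>, one for each natural number \<open>d\<close>; the
  linear maps from \<open>k\<^sup>d\<close> to \<open>k\<^sup>e\<close> are the matrices in \<open>carrier_mat e d\<close>.
\<close>

record ('k, 'v) vfunctor =
  fobj :: "nat \<Rightarrow> ('k, 'v) module"
  fmor :: "'k mat \<Rightarrow> 'v \<Rightarrow> 'v"

definition is_vfunctor :: "('k::field, 'v) vfunctor \<Rightarrow> bool" where
  "is_vfunctor F \<longleftrightarrow>
     (\<forall>d. vectorspace class_ring (fobj F d)) \<and>
     (\<forall>d e. \<forall>A\<in>carrier_mat e d.
        fmor F A \<in> LinearCombinations.module_hom class_ring (fobj F d) (fobj F e)) \<and>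
     (\<forall>d. \<forall>x\<in>carrier (fobj F d). fmor F (1\<^sub>m d) x = x) \<and>
     (\<forall>c d e. \<forall>A\<in>carrier_mat d c. \<forall>B\<in>carrier_mat e d. \<forall>x\<in>carrier (fobj F c).
        fmor F (B * A) x = fmor F B (fmor F A x))"

definition nat_trans ::
    "('k::field, 'v) vfunctor \<Rightarrow> ('k, 'w) vfunctor \<Rightarrow> (nat \<Rightarrow> 'v \<Rightarrow> 'w) set" where
  "nat_trans G F = {\<eta>.
     (\<forall>d. \<eta> d \<in> linear_maps (fobj G d) (fobj F d)) \<and>
     (\<forall>d e. \<forall>A\<in>carrier_mat e d. \<forall>x\<in>carrier (fobj G d).
        \<eta> e (fmor G A x) = fmor F A (\<eta> d x))}"

definition nat_trans_vs ::
    "('k::field, 'v) vfunctor \<Rightarrow> ('k, 'w) vfunctor \<Rightarrow> ('k, nat \<Rightarrow> 'v \<Rightarrow> 'w) module" where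
  "nat_trans_vs G F = mk_vs (nat_trans G F)
     (\<lambda>d. \<lambda>x\<in>carrier (fobj G d). \<zero>\<^bsub>fobj F d\<^esub>)
     (\<lambda>\<eta> \<eta>' d. \<lambda>x\<in>carrier (fobj G d). \<eta> d x \<oplus>\<^bsub>fobj F d\<^esub> \<eta>' d x)
     (\<lambda>c \<eta> d. \<lambda>x\<in>carrier (fobj G d). c \<odot>\<^bsub>fobj F d\<^esub> \<eta> d x)"

definition tensor_functor ::
    "('k::field, 'v) vfunctor \<Rightarrow> ('k, 'w) vfunctor \<Rightarrow>
     ('k, ('v \<times> 'w \<Rightarrow>\<^sub>0 'k) set) vfunctor" where
  "tensor_functor F G = \<lparr>
     fobj = (\<lambda>d. tensor_vs (fobj F d) (fobj G d)),
     fmor = (\<lambda>A. tensor_map (fobj F (dim_row A)) (fobj G (dim_row A)) (fmor F A) (fmor G A))\<rparr>"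


section \<open>Tensor, exterior and divided powers\<close>

text \<open>
  The \<open>b\<close>-th tensor power of \<open>k\<^sup>d\<close> is represented in its standard basis, which is indexed by the
  words of length \<open>b\<close> over \<open>{..<d}\<close>: a tensor is the function giving its coordinates.
\<close>

definition words :: "nat \<Rightarrow> nat \<Rightarrow> nat list set" where
  "words b d = {w. length w = b \<and> set w \<subseteq> {..<d}}"

definition tpow_vs :: "nat \<Rightarrow> nat \<Rightarrow> ('k::field, nat list \<Rightarrow> 'k) module" where
  "tpow_vs b d = mk_vs {x. \<forall>w. x w \<noteq> 0 \<longrightarrow> w \<in> words b d}
     (\<lambda>w. 0) (\<lambda>x y w. x w + y w) (\<lambda>c x w. c * x w)"

definition pure_tensor :: "nat \<Rightarrow> 'k::field vec list \<Rightarrow> nat list \<Rightarrow> 'k" where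
  "pure_tensor d vs w =
     (if w \<in> words (length vs) d then \<Prod>i<length vs. (vs ! i) $ (w ! i) else 0)"

definition tpow_map :: "nat \<Rightarrow> 'k::field mat \<Rightarrow> (nat list \<Rightarrow> 'k) \<Rightarrow> nat list \<Rightarrow> 'k" where
  "tpow_map b A x w =
     (if w \<in> words b (dim_row A)
      then \<Sum>u\<in>words b (dim_col A). (\<Prod>i<b. A $$ (w ! i, u ! i)) * x u else 0)"

definition divided_power :: "nat \<Rightarrow> ('k::field, nat list \<Rightarrow> 'k) vfunctor" where
  "divided_power b = \<lparr>
     fobj = (\<lambda>d. (tpow_vs b d)\<lparr>carrier := {x \<in> carrier (tpow_vs b d).
       \<forall>\<sigma> w. \<sigma> permutes {..<b} \<longrightarrow> length w = b \<longrightarrow> x (permute_list \<sigma> w) = x w}\<rparr>),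
     fmor = tpow_map b\<rparr>"

definition ext_rel :: "nat \<Rightarrow> nat \<Rightarrow> (nat list \<Rightarrow> 'k::field) set" where
  "ext_rel a d = lspan (tpow_vs a d)
     {pure_tensor d vs | vs. length vs = a \<and> set vs \<subseteq> carrier_vec d \<and> \<not> distinct vs}"

definition exterior_power :: "nat \<Rightarrow> ('k::field, (nat list \<Rightarrow> 'k) set) vfunctor" where
  "exterior_power a = \<lparr>
     fobj = (\<lambda>d. quot_vs (tpow_vs a d) (ext_rel a d)),
     fmor = (\<lambda>A. quot_map (tpow_vs a (dim_row A)) (ext_rel a (dim_row A)) (tpow_map a A))\<rparr>"


section \<open>The Steenrod algebra as graded dual of Milnor's Hopf algebra\<close>

text \<open>
  The dual Steenrod algebra is the free graded commutative algebra on generators \<open>\<xi>\<^sub>j\<close> (\<open>j \<ge> 1\<close>) of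
  degree \<open>2 (p^j - 1)\<close> and \<open>\<tau>\<^sub>i\<close> (\<open>i \<ge> 0\<close>) of degree \<open>2 p^i - 1\<close>. The pair \<open>(E, R)\<close> stands for the
  monomial \<open>\<tau>\<^sub>E \<xi>\<^sup>R\<close>, with the factors \<open>\<tau>\<^sub>i\<close>, \<open>i \<in> E\<close>, in increasing order.
\<close>

type_synonym milnor_monomial = "nat set \<times> (nat \<Rightarrow>\<^sub>0 nat)"

definition milnor_monomials :: "milnor_monomial set" where
  "milnor_monomials = {(E, R). finite E \<and> Poly_Mapping.lookup R 0 = 0}"

definition exponent_sum :: "(nat \<Rightarrow>\<^sub>0 nat) \<Rightarrow> nat" where
  "exponent_sum R = (\<Sum>j\<in>Poly_Mapping.keys R. Poly_Mapping.lookup R j)"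

definition milnor_degree :: "nat \<Rightarrow> milnor_monomial \<Rightarrow> nat" where
  "milnor_degree p = (\<lambda>(E, R). (\<Sum>i\<in>E. 2 * p ^ i - 1) +
     (\<Sum>j\<in>Poly_Mapping.keys R. Poly_Mapping.lookup R j * (2 * (p ^ j - 1))))"

fun monomial_times :: "milnor_monomial \<Rightarrow> milnor_monomial \<Rightarrow> milnor_monomial" where
  "monomial_times (E, R) (F, S) = (E \<union> F, R + S)"

text \<open>\<open>\<tau>\<^sub>E \<xi>\<^sup>R \<cdot> \<tau>\<^sub>F \<xi>\<^sup>S = \<plusminus> \<tau>\<^bsub>E \<union> F\<^esub> \<xi>\<^bsup>R + S\<^esup>\<close>, or \<open>0\<close> if some \<open>\<tau>\<^sub>i\<close> is repeated.\<close>

fun monomial_sign :: "milnor_monomial \<Rightarrow> milnor_monomial \<Rightarrow> 'k::field" where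
  "monomial_sign (E, R) (F, S) =
     (if E \<inter> F = {} then (- 1) ^ card {(i, j) \<in> E \<times> F. j < i} else 0)"

text \<open>The tensor square of the dual Steenrod algebra; in
  \<open>(x' \<otimes> x'') (y' \<otimes> y'') = (- 1)^(|x''| |y'|) (x' y') \<otimes> (x'' y'')\<close> the degree of a monomial is
  congruent modulo 2 to its number of factors \<open>\<tau>\<^sub>i\<close>.\<close>

type_synonym 'k dual2 = "milnor_monomial \<times> milnor_monomial \<Rightarrow>\<^sub>0 'k"

definition dual2_times :: "'k::field dual2 \<Rightarrow> 'k dual2 \<Rightarrow> 'k dual2" where
  "dual2_times f g =
     (\<Sum>(x', x'')\<in>Poly_Mapping.keys f. \<Sum>(y', y'')\<in>Poly_Mapping.keys g.
        Poly_Mapping.single (monomial_times x' y', monomial_times x'' y'')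
          ((- 1) ^ (card (fst x'') * card (fst y')) * monomial_sign x' y' * monomial_sign x'' y''
           * Poly_Mapping.lookup f (x', x'') * Poly_Mapping.lookup g (y', y'')))"

text \<open>\<open>xi_power j e\<close> is \<open>\<xi>\<^sub>j^e\<close>, where \<open>\<xi>\<^sub>0 = 1\<close>.\<close>

definition xi_power :: "nat \<Rightarrow> nat \<Rightarrow> milnor_monomial" where
  "xi_power j e = ({}, if j = 0 then 0 else Poly_Mapping.single j e)"

definition tau :: "nat \<Rightarrow> milnor_monomial" where
  "tau i = ({i}, 0)"

definition coproduct_xi :: "nat \<Rightarrow> 'k::{field,finite} dual2" where
  "coproduct_xi n =
     (\<Sum>i\<le>n. Poly_Mapping.single (xi_power (n - i) (CARD('k) ^ i), xi_power i 1) 1)"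

definition coproduct_tau :: "nat \<Rightarrow> 'k::{field,finite} dual2" where
  "coproduct_tau n = Poly_Mapping.single (tau n, ({}, 0)) 1 +
     (\<Sum>i\<le>n. Poly_Mapping.single (xi_power (n - i) (CARD('k) ^ i), tau i) 1)"

fun coproduct :: "milnor_monomial \<Rightarrow> 'k::{field,finite} dual2" where
  "coproduct (E, R) = foldr dual2_times
     (map coproduct_tau (sorted_list_of_set E) @
      concat (map (\<lambda>j. replicate (Poly_Mapping.lookup R j) (coproduct_xi j))
        (sorted_list_of_set (Poly_Mapping.keys R))))
     (Poly_Mapping.single (({}, 0), ({}, 0)) 1)"

text \<open>\<open>steenrod k\<close> is the degree \<open>k\<close> part of the Steenrod algebra: the linear forms on the degree
  \<open>k\<close> part of its dual, given by their values on monomials. The product is dual to the coproduct.\<close>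

type_synonym 'k steenrod_element = "milnor_monomial \<Rightarrow> 'k"

definition steenrod :: "nat \<Rightarrow> 'k::{field,finite} steenrod_element set" where
  "steenrod k = {\<theta>. \<forall>m. \<theta> m \<noteq> 0 \<longrightarrow> m \<in> milnor_monomials \<and> milnor_degree (CARD('k)) m = k}"

definition steenrod_times ::
    "'k::{field,finite} steenrod_element \<Rightarrow> 'k steenrod_element \<Rightarrow> 'k steenrod_element" where
  "steenrod_times \<theta> \<theta>' m =
     (if m \<in> milnor_monomials
      then \<Sum>(m', m'')\<in>Poly_Mapping.keys (coproduct m :: 'k dual2).
             Poly_Mapping.lookup (coproduct m) (m', m'') * \<theta> m' * \<theta>' m''
      else 0)"

definition milnor_dual :: "milnor_monomial \<Rightarrow> 'k::{field,finite} steenrod_element" where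
  "milnor_dual m = (\<lambda>m'. if m' = m then 1 else 0)"

definition steenrod_one :: "'k::{field,finite} steenrod_element" where
  "steenrod_one = milnor_dual ({}, 0)"

definition bockstein :: "'k::{field,finite} steenrod_element" where
  "bockstein = milnor_dual (tau 0)"

definition reduced_power :: "nat \<Rightarrow> 'k::{field,finite} steenrod_element" where
  "reduced_power i = milnor_dual (xi_power 1 i)"


section \<open>Unstable modules\<close>

text \<open>\<open>act M k n \<theta> x\<close> is the action of \<open>\<theta>\<close> in degree \<open>k\<close> of the Steenrod algebra on \<open>x\<close> in degree
  \<open>n\<close> of \<open>M\<close>.\<close>

record ('k, 'u) graded_module =
  component :: "nat \<Rightarrow> ('k, 'u) module"
  act :: "nat \<Rightarrow> nat \<Rightarrow> 'k steenrod_element \<Rightarrow> 'u \<Rightarrow> 'u"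

definition steenrod_module :: "('k::{field,finite}, 'u) graded_module \<Rightarrow> bool" where
  "steenrod_module M \<longleftrightarrow>
     (\<forall>n. vectorspace class_ring (component M n)) \<and>
     (\<forall>k n. \<forall>\<theta>\<in>steenrod k.
        act M k n \<theta> \<in> LinearCombinations.module_hom class_ring (component M n) (component M (n + k))) \<and>
     (\<forall>k n. \<forall>\<theta>\<in>steenrod k. \<forall>\<theta>'\<in>steenrod k. \<forall>x\<in>carrier (component M n).
        act M k n (\<lambda>m. \<theta> m + \<theta>' m) x = act M k n \<theta> x \<oplus>\<^bsub>component M (n + k)\<^esub> act M k n \<theta>' x) \<and>
     (\<forall>k n c. \<forall>\<theta>\<in>steenrod k. \<forall>x\<in>carrier (component M n).
        act M k n (\<lambda>m. c * \<theta> m) x = c \<odot>\<^bsub>component M (n + k)\<^esub> act M k n \<theta> x) \<and>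
     (\<forall>n. \<forall>x\<in>carrier (component M n). act M 0 n steenrod_one x = x) \<and>
     (\<forall>k l n. \<forall>\<theta>\<in>steenrod k. \<forall>\<theta>'\<in>steenrod l. \<forall>x\<in>carrier (component M n).
        act M (k + l) n (steenrod_times \<theta> \<theta>') x = act M k (n + l) \<theta> (act M l n \<theta>' x))"

text \<open>Instability: \<open>\<beta>\<^sup>\<epsilon> P\<^sup>i x = 0\<close> whenever \<open>\<epsilon> + 2 i > |x|\<close>, for \<open>\<epsilon> \<in> {0, 1}\<close>.\<close>

definition unstable :: "('k::{field,finite}, 'u) graded_module \<Rightarrow> bool" where
  "unstable M \<longleftrightarrow> steenrod_module M \<and>
     (\<forall>n i. \<forall>x\<in>carrier (component M n).
        let k = 2 * i * (CARD('k) - 1); y = act M k n (reduced_power i) x in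
        (2 * i > n \<longrightarrow> y = \<zero>\<^bsub>component M (n + k)\<^esub>) \<and>
        (1 + 2 * i > n \<longrightarrow> act M 1 (n + k) bockstein y = \<zero>\<^bsub>component M (n + k + 1)\<^esub>))"

definition unstable_hom ::
    "('k::{field,finite}, 'u) graded_module \<Rightarrow> ('k, 'v) graded_module \<Rightarrow>
     (nat \<Rightarrow> 'u \<Rightarrow> 'v) set" where
  "unstable_hom M N = {\<phi>.
     (\<forall>n. \<phi> n \<in> linear_maps (component M n) (component N n)) \<and>
     (\<forall>k n. \<forall>\<theta>\<in>steenrod k. \<forall>x\<in>carrier (component M n).
        \<phi> (n + k) (act M k n \<theta> x) = act N k n \<theta> (\<phi> n x))}"

definition unstable_iso ::
    "('k::{field,finite}, 'u) graded_module \<Rightarrow> ('k, 'v) graded_module \<Rightarrow> bool" where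
  "unstable_iso M N \<longleftrightarrow>
     (\<exists>\<phi>\<in>unstable_hom M N. \<forall>n. bij_betw (\<phi> n) (carrier (component M n)) (carrier (component N n)))"

text \<open>The free unstable module on one generator \<open>\<iota>\<close> of degree \<open>n\<close>, in the category of unstable
  modules whose underlying sets are subsets of the type \<open>'u\<close>.\<close>

definition free_unstable :: "nat \<Rightarrow> ('k::{field,finite}, 'u) graded_module \<Rightarrow> 'u \<Rightarrow> bool" where
  "free_unstable n F \<iota> \<longleftrightarrow> unstable F \<and> \<iota> \<in> carrier (component F n) \<and>
     (\<forall>M :: ('k, 'u) graded_module. unstable M \<longrightarrow>
        bij_betw (\<lambda>\<phi>. \<phi> n \<iota>) (unstable_hom F M) (carrier (component M n)))"

definition suspension :: "('k::{field,finite}, 'u) graded_module \<Rightarrow> ('k, 'u) graded_module" where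
  "suspension M = \<lparr>
     component = (\<lambda>n. case n of 0 \<Rightarrow> zero_vs (component M 0) | Suc n' \<Rightarrow> component M n'),
     act = (\<lambda>k n \<theta> x. case n of
         0 \<Rightarrow> (case k of 0 \<Rightarrow> \<zero>\<^bsub>component M 0\<^esub> | Suc k' \<Rightarrow> \<zero>\<^bsub>component M k'\<^esub>)
       | Suc n' \<Rightarrow> ((- 1) ^ k) \<odot>\<^bsub>component M (n' + k)\<^esub> act M k n' \<theta> x)\<rparr>"

definition finite_direct_sum ::
    "'i set \<Rightarrow> ('i \<Rightarrow> ('k, 'u) graded_module) \<Rightarrow> ('k, 'i \<Rightarrow> 'u) graded_module" where
  "finite_direct_sum I M = \<lparr>
     component = (\<lambda>n. mk_vs (\<Pi>\<^sub>E i\<in>I. carrier (component (M i) n))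
       (\<lambda>i\<in>I. \<zero>\<^bsub>component (M i) n\<^esub>)
       (\<lambda>x y. \<lambda>i\<in>I. x i \<oplus>\<^bsub>component (M i) n\<^esub> y i)
       (\<lambda>c x. \<lambda>i\<in>I. c \<odot>\<^bsub>component (M i) n\<^esub> x i)),
     act = (\<lambda>k n \<theta> x. \<lambda>i\<in>I. act (M i) k n \<theta> (x i))\<rparr>"

definition direct_sum_pair ::
    "('k, 'u) graded_module \<Rightarrow> ('k, 'v) graded_module \<Rightarrow> ('k, 'u \<times> 'v) graded_module" where
  "direct_sum_pair M N = \<lparr>
     component = (\<lambda>n. mk_vs (carrier (component M n) \<times> carrier (component N n))
       (\<zero>\<^bsub>component M n\<^esub>, \<zero>\<^bsub>component N n\<^esub>)
       (\<lambda>(x, y) (x', y'). (x \<oplus>\<^bsub>component M n\<^esub> x', y \<oplus>\<^bsub>component N n\<^esub> y'))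
       (\<lambda>c (x, y). (c \<odot>\<^bsub>component M n\<^esub> x, c \<odot>\<^bsub>component N n\<^esub> y))),
     act = (\<lambda>k n \<theta> (x, y). (act M k n \<theta> x, act N k n \<theta> y))\<rparr>"

definition is_submodule ::
    "(nat \<Rightarrow> 'u set) \<Rightarrow> ('k::{field,finite}, 'u) graded_module \<Rightarrow> bool" where
  "is_submodule N M \<longleftrightarrow>
     (\<forall>n. VectorSpace.subspace class_ring (N n) (component M n)) \<and>
     (\<forall>k n. \<forall>\<theta>\<in>steenrod k. \<forall>x\<in>N n. act M k n \<theta> x \<in> N (n + k))"

text \<open>\<open>subquotient M N N'\<close> is \<open>N / N'\<close>, where \<open>N' \<subseteq> N\<close> are submodules of \<open>M\<close>.\<close>

definition subquotient ::
    "('k::field, 'u) graded_module \<Rightarrow> (nat \<Rightarrow> 'u set) \<Rightarrow> (nat \<Rightarrow> 'u set) \<Rightarrow>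
     ('k, 'u set) graded_module" where
  "subquotient M N N' = \<lparr>
     component = (\<lambda>n. quot_vs ((component M n)\<lparr>carrier := N n\<rparr>) (N' n)),
     act = (\<lambda>k n \<theta>. quot_map (component M (n + k)) (N' (n + k)) (act M k n \<theta>))\<rparr>"

definition finite_filtration ::
    "('k::{field,finite}, 'u) graded_module \<Rightarrow> nat \<Rightarrow> (nat \<Rightarrow> nat \<Rightarrow> 'u set) \<Rightarrow> bool" where
  "finite_filtration M r Fil \<longleftrightarrow>
     (\<forall>i\<le>r. is_submodule (Fil i) M) \<and>
     (\<forall>i<r. \<forall>n. Fil i n \<subseteq> Fil (Suc i) n) \<and>
     (\<forall>n. Fil 0 n = {\<zero>\<^bsub>component M n\<^esub>}) \<and>
     (\<forall>n. Fil r n = carrier (component M n))"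

definition associated_graded ::
    "('k::field, 'u) graded_module \<Rightarrow> nat \<Rightarrow> (nat \<Rightarrow> nat \<Rightarrow> 'u set) \<Rightarrow>
     ('k, nat \<Rightarrow> 'u set) graded_module" where
  "associated_graded M r Fil =
     finite_direct_sum {..<r} (\<lambda>i. subquotient M (Fil (Suc i)) (Fil i))"


section \<open>The functor \<open>r'\<close>\<close>

text \<open>
  Maps between tensor products \<open>\<Gamma>\<^bsup>s\<^sub>0\<^esup> \<otimes> \<Gamma>\<^bsup>s\<^sub>1\<^esup> \<otimes> \<dots>\<close> of divided powers of \<open>k\<^sup>d\<close>. Such a tensor
  product is the space of tensors in the tensor power of degree \<open>s\<^sub>0 + s\<^sub>1 + \<dots>\<close> that are
  invariant under the Young subgroup \<open>S\<^bsub>s\<^sub>0\<^esub> \<times> S\<^bsub>s\<^sub>1\<^esub> \<times> \<dots>\<close>, a word being cut into consecutive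
  blocks of lengths \<open>s\<^sub>0, s\<^sub>1, \<dots>\<close>. The coproduct of \<open>\<Gamma>\<close> is then an inclusion, that is, the
  identity on coordinates.
\<close>

definition block :: "nat list \<Rightarrow> nat \<Rightarrow> 'a list \<Rightarrow> 'a list" where
  "block rs j w = take (rs ! j) (drop (sum_list (take j rs)) w)"

text \<open>
  The tensor product over \<open>j\<close> of the \<open>j\<close>-fold Verschiebungs from \<open>\<Gamma>\<^bsup>r\<^sub>j p^j\<^esup>\<close> to \<open>\<Gamma>\<^bsup>r\<^sub>j\<^esup>\<close>. The
  coordinate of a symmetric tensor at a word is its pairing with the corresponding monomial in
  the dual symmetric power, and the \<open>p^j\<close>-th power of a monomial repeats each letter \<open>p^j\<close> times.
\<close>

definition verschiebungs ::
    "nat list \<Rightarrow> nat \<Rightarrow> (nat list \<Rightarrow> 'k::{field,finite}) \<Rightarrow> nat list \<Rightarrow> 'k" where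
  "verschiebungs rs d x w =
     (if w \<in> words (sum_list rs) d
      then x (concat (map (\<lambda>j. concat (map (replicate (CARD('k) ^ j)) (block rs j w)))
                [0..<length rs]))
      else 0)"

text \<open>The product is the sum over all shuffles; these correspond to the ways \<open>c\<close> of assigning
  \<open>r\<^sub>j\<close> of the positions to the \<open>j\<close>-th factor.\<close>

definition shuffle_product ::
    "nat list \<Rightarrow> nat \<Rightarrow> (nat list \<Rightarrow> 'k::field) \<Rightarrow> nat list \<Rightarrow> 'k" where
  "shuffle_product rs d y w =
     (if w \<in> words (sum_list rs) d
      then \<Sum>c | length c = sum_list rs \<and> (\<forall>j<length rs. count_list c j = rs ! j).
             y (concat (map (\<lambda>j. nths w {i. c ! i = j}) [0..<length rs]))
      else 0)"

text \<open>The list \<open>r\<^sub>0, r\<^sub>1, r\<^sub>2, \<dots>\<close> with \<open>r\<^sub>0 = a - (r\<^sub>1 + r\<^sub>2 + \<dots>)\<close>.\<close>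

definition factor_sizes :: "nat \<Rightarrow> (nat \<Rightarrow>\<^sub>0 nat) \<Rightarrow> nat list" where
  "factor_sizes a R = (a - exponent_sum R) #
     map (Poly_Mapping.lookup R) [1..<Suc (Max (insert 0 (Poly_Mapping.keys R)))]"

definition theta ::
    "nat \<Rightarrow> (nat \<Rightarrow>\<^sub>0 nat) \<Rightarrow> nat \<Rightarrow> (nat list \<Rightarrow> 'k::{field,finite}) \<Rightarrow> nat list \<Rightarrow> 'k" where
  "theta a R d = shuffle_product (factor_sizes a R) d \<circ> verschiebungs (factor_sizes a R) d"

text \<open>The action of \<open>P\<^sup>R\<close> on natural transformations from \<open>\<Gamma>\<^sup>a\<close> to \<open>F\<close>. The number \<open>b\<close> is
  \<open>\<Sum>\<^bsub>j \<ge> 0\<^esub> r\<^sub>j p^j\<close> if \<open>r\<^sub>0 \<ge> 0\<close>; in general \<open>2 b\<close> is the degree of the result.\<close>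

definition milnor_op ::
    "('k::{field,finite}, 'v) vfunctor \<Rightarrow> nat \<Rightarrow> (nat \<Rightarrow>\<^sub>0 nat) \<Rightarrow>
     (nat \<Rightarrow> (nat list \<Rightarrow> 'k) \<Rightarrow> 'v) \<Rightarrow> nat \<Rightarrow> (nat list \<Rightarrow> 'k) \<Rightarrow> 'v" where
  "milnor_op F a R f =
     (let b = a + (\<Sum>j\<in>Poly_Mapping.keys R. Poly_Mapping.lookup R j * (CARD('k) ^ j - 1)) in
      if exponent_sum R > a then \<zero>\<^bsub>nat_trans_vs (divided_power b) F\<^esub>
      else (\<lambda>d. \<lambda>x\<in>carrier (fobj (divided_power b) d). f d (theta a R d x)))"

text \<open>
  The Bockstein generates the two-sided ideal spanned by the duals of the monomials \<open>\<tau>\<^sub>E \<xi>\<^sup>R\<close> with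
  \<open>E\<close> nonempty; hence it acts trivially if and only if all these duals do, and \<open>\<theta>\<close> acts as the
  linear combination of the \<open>P\<^sup>R\<close> with coefficients \<open>\<theta> ({}, R)\<close>. The result is a module
  concentrated in even degrees, and the inclusion of such modules into all unstable modules is
  not made explicit.
\<close>

definition r_prime ::
    "('k::{field,finite}, 'v) vfunctor \<Rightarrow>
     ('k, nat \<Rightarrow> (nat list \<Rightarrow> 'k) \<Rightarrow> 'v) graded_module" where
  "r_prime F = (let C = (\<lambda>n. let V = nat_trans_vs (divided_power (n div 2)) F in
                           if even n then V else zero_vs V) in
     \<lparr>component = C,
      act = (\<lambda>k n \<theta> f.
        if even n
        then (\<Oplus>\<^bsub>C (n + k)\<^esub>R\<in>{R. ({}, R) \<in> milnor_monomials \<and> milnor_degree (CARD('k)) ({}, R) = k}.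
                \<theta> ({}, R) \<odot>\<^bsub>C (n + k)\<^esub> milnor_op F (n div 2) R f)
        else \<zero>\<^bsub>C (n + k)\<^esub>)\<rparr>)"

end

theory Submission
  imports Defs "HOL-Number_Theory.Residues" "HOL-Library.Product_Plus" "HOL-Algebra.Exponent"
begin

text \<open>
  Count the exterior generators: the operations spanned by Milnor monomials with at least \<open>e\<close>
  factors \<open>\<tau>\<^sub>i\<close> form a filtration of the Steenrod algebra that is compatible with multiplication,
  and it induces the filtration of \<open>F(n)\<close>. Freeness identifies \<open>F(n)\<close> with the quotient of the algebra
  (shifted by \<open>n\<close>) by the monomials of excess greater than \<open>n\<close>. So the graded piece with exactly \<open>e\<close>
  factors \<open>\<tau>\<^sub>i\<close> has a basis of monomials \<open>\<tau>\<^sub>E P\<^sup>R\<close> with \<open>card E = e\<close>, and the sequences \<open>R\<close>, completed by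
  \<open>r\<^sub>0\<close>, become multisets of bounded size. On the functor side, a natural transformation from \<open>\<Gamma>\<^sup>c\<close> is
  determined by its value on a generic power, which must be a combination of the additive monomials
  \<open>x\<^sup>(p\<^sup>j)\<close>; alternation forces distinct exponents in the exterior factor and symmetry gives a multiset
  in the divided power factor. The coproducts of \<open>\<xi>\<^sub>k\<close> and \<open>\<tau>\<^sub>k\<close> then match the two actions. The parity of \<open>n - e\<close>
  decides between the unsuspended summand with \<open>a = e\<close> and the suspended one with \<open>a = e + 1\<close>.
\<close>

text \<open>Instability speaks only of \<open>P^i\<close> and of the Bockstein applied after it,
  whereas the basis consists of arbitrary Milnor elements. Triangularity bridges the gap: for
  \<open>m\<close> of excess greater than \<open>n\<close> there is an operation that instability
  kills and whose expansion is \<open>m\<close> plus terms of larger excess. Independence of the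
  remaining elements on the generator needs a concrete unstable module. As freeness is only tested
  on modules with elements in the given infinite type, that module is built with finite components
  and copied into the type. Computations run on unsorted words in the generators instead of
  monomials. A word may contain the unit \<open>xi_0\<close> and powers \<open>xi_k^(p^l)\<close>,
  so that the coproduct splits it letter by letter. Padding by units to a fixed length turns
  multisets of bounded size into lists, on which alternation and symmetry can be expressed. Oddness
  of p enters as \<open>2 ~= 0\<close>: squares of tau vanish, and antisymmetrisation identifies
  exterior powers with alternating tensors without any division by factorials.\<close>

abbreviation "lookup == Poly_Mapping.lookup"
abbreviation "keys == Poly_Mapping.keys"
abbreviation "part == component"
abbreviation "single == Poly_Mapping.single"

abbreviation (input) vspace :: "('k::field, 'v) module => bool" where
 "vspace V == vectorspace class_ring V"
abbreviation (input) subsp :: "'v set => ('k::field, 'v) module => bool" where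
 "subsp H V == VectorSpace.subspace class_ring H V"
abbreviation (input) lin :: "('k::field, 'v) module => ('k, 'w) module => ('v => 'w) set" where
 "lin V W == LinearCombinations.module_hom class_ring V W"
abbreviation (input) add_in ("_ +[_] _" [65, 0, 66] 65) where "x +[V] y == x \<oplus>\<^bsub>V\<^esub> y"
abbreviation (input) smult_in ("_ *[_] _" [70, 0, 71] 70) where "c *[V] x == c \<odot>\<^bsub>V\<^esub> x"
abbreviation (input) zero_in ("0[_]") where "0[V] == \<zero>\<^bsub>V\<^esub>"
abbreviation (input) coset_in ("_ +>[_] _" [60, 0, 61] 60) where "H +>[V] x == H +>\<^bsub>V\<^esub> x"

section \<open>Finite prime fields\<close>

lemma char_prime_field: assumes "prime (CARD('k::{field,finite}))" shows "CHAR('k) = CARD('k)"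
 using CHAR_dvd_CARD[where 'a = 'k] assms CHAR_not_1'[where 'a = 'k] by (metis One_nat_def prime_nat_iff)

text \<open>Multiplication by a nonzero \<open>x\<close> permutes the nonzero elements; comparing
  their product before and after gives the identity.\<close>

lemma field_power_card: fixes x :: "'k::{field,finite}" shows "x ^ CARD('k) = x"
proof (cases "x = 0")
 case False
 have pos: "0 < CARD('k)" by (simp add: finite_UNIV_card_ge_0)
 have "x * (PROD y:UNIV-{0}. x * y) = x * x ^ (CARD('k) - 1) * \<Prod>(UNIV-{0})" by (simp add: prod.distrib mult_ac)
 also have "x * x ^ (CARD('k) - 1) = x ^ Suc (CARD('k) - 1)" by (subst power_Suc) auto
 also have "Suc (CARD('k) - 1) = CARD('k)" using pos by simp
 also have "(PROD y:UNIV-{0}. x * y) = (PROD y:UNIV-{0}. y)"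
  by (rule prod.reindex_bij_witness[of _ "%y. y / x" "%y. x * y"]) (use False in auto)
 finally show ?thesis by simp
next
 case True
 thus ?thesis using finite_UNIV_card_ge_0[where 'a = 'k] by (simp add: zero_power)
qed

lemma field_power_card_power: fixes x :: "'k::{field,finite}" shows "x ^ (CARD('k) ^ l) = x"
 by (induction l) (simp_all add: power_mult field_power_card)

lemma char_poly_mapping: "CHAR('a::comm_monoid_add \<Rightarrow>\<^sub>0 'k::comm_ring_1) = CHAR('k)"
proof (rule CHAR_eqI)
 show "of_nat CHAR('k) = (0 :: 'a \<Rightarrow>\<^sub>0 'k)" by (metis of_nat_CHAR single_of_nat single_zero)
next
 fix x assume "of_nat x = (0 :: 'a \<Rightarrow>\<^sub>0 'k)"
 hence "(of_nat x :: 'k) = 0" by (metis lookup_single_eq lookup_zero single_of_nat)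
 thus "CHAR('k) dvd x" by (simp add: of_nat_eq_0_iff_char_dvd)
qed

lemma two_neq_zero_field: assumes "prime (CARD('k::{field,finite}))" "odd (CARD('k))" shows "(2::'k) ~= 0"
proof
 assume "(2::'k) = 0"
 hence "(of_nat 2::'k) = 0" by simp
 hence "CARD('k) dvd 2" using char_prime_field[OF assms(1)] by (simp only: of_nat_eq_0_iff_char_dvd)
 thus False using assms by (metis nat_dvd_not_less odd_one pos2 prime_nat_iff primes_dvd_imp_eq two_is_prime_nat dvd_refl)
qed

text \<open>Poly mappings keyed by exponent vectors or multisets form polynomial rings of
  characteristic p. Additivity of Frobenius there yields the coproduct of \<open>xi_n^(p^l)\<close>,
  the naturality of the transformations \<open>nat_eta\<close> and the effect of
  \<open>theta\<close> on them.\<close>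

lemma poly_mapping_freshman: fixes f :: "'b => ('a::comm_monoid_add \<Rightarrow>\<^sub>0 'k::{field,finite})" assumes "prime (CARD('k))"
 shows "(SUM i:A. f i) ^ (CARD('k) ^ l) = (SUM i:A. f i ^ (CARD('k) ^ l))"
 using freshmans_dream_sum'[where 'a = "'a \<Rightarrow>\<^sub>0 'k", of "CARD('k) ^ l" l f A]
 by (simp add: char_poly_mapping char_prime_field assms)

section \<open>Sums over poly mappings\<close>

lemma sum_keys_superset: fixes H :: "'a => 'b::zero => 'c::comm_monoid_add"
 assumes "finite A" "keys f <= A" "!!x. H x 0 = 0"
 shows "(SUM x:keys f. H x (lookup f x)) = (SUM x:A. H x (lookup f x))"
 by (rule sum.mono_neutral_left) (use assms in \<open>auto simp: in_keys_iff\<close>)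

text \<open>Keys may cancel in a sum, so a sum over \<open>keys\<close> is additive only because
  \<open>H\<close> is additive in the coefficient and kills 0. The bilinear extensions below rest on
  this.\<close>

lemma sum_keys_sum:
 fixes H :: "'a => 'b::comm_monoid_add => 'c::comm_monoid_add" and f :: "'i => 'a \<Rightarrow>\<^sub>0 'b"
 assumes "!!x. H x 0 = 0" "!!x a b. H x (a + b) = H x a + H x b"
 shows "(SUM x:keys (SUM i:I. f i). H x (lookup (SUM i:I. f i) x))
  = (SUM i:I. SUM x:keys (f i). H x (lookup (f i) x))"
proof (induction I rule: infinite_finite_induct)
 case (insert i I)
 thus ?case by (simp add: setsum_keys_plus_distrib[of H, OF assms] assms)
qed auto

lemma poly_mapping_sum_single: "(SUM x:keys f. single x (lookup f x)) = f"
 by (rule poly_mapping_eqI) (simp add: lookup_sum lookup_single in_keys_iff when_def)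

section \<open>The tensor square of the dual Steenrod algebra\<close>

definition key_mult :: "milnor_monomial \<times> milnor_monomial => milnor_monomial \<times> milnor_monomial =>
  milnor_monomial \<times> milnor_monomial" where
 "key_mult x y = (monomial_times (fst x) (fst y), monomial_times (snd x) (snd y))"

definition key_sign :: "milnor_monomial \<times> milnor_monomial => milnor_monomial \<times> milnor_monomial => 'k::field" where
 "key_sign x y = (- 1) ^ (card (fst (snd x)) * card (fst (fst y))) * monomial_sign (fst x) (fst y) * monomial_sign (snd x) (snd y)"

lemma dual2_times_alt: "dual2_times f g = (SUM x:keys f. SUM y:keys g.
   single (key_mult x y) (key_sign x y * lookup f x * lookup g y))"
 by (simp add: dual2_times_def split_beta key_mult_def key_sign_def)

lemma dual2_times_sum_left: "dual2_times (SUM i:I. f i) g = (SUM i:I. dual2_times (f i) g)" unfolding dual2_times_alt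
 by (subst sum_keys_sum[where H = "%x a. SUM y:keys g.
    single (key_mult x y) (key_sign x y * a * lookup g y)"])
  (simp_all add: algebra_simps single_add sum.distrib)

lemma dual2_times_sum_right: "dual2_times f (SUM i:I. g i) = (SUM i:I. dual2_times f (g i))" unfolding dual2_times_alt
 by (subst sum.swap, subst sum_keys_sum[where H = "%y a. SUM x:keys f.
    single (key_mult x y) (key_sign x y * lookup f x * a)"])
  (simp_all add: algebra_simps single_add sum.distrib sum.swap[of _ "keys f"])

lemma dual2_times_zero_left [simp]: "dual2_times 0 g = 0" and dual2_times_zero_right [simp]: "dual2_times f 0 = 0" by (simp_all add: dual2_times_alt)

lemma dual2_times_single: "dual2_times (single x a) (single y b) =
   single (key_mult x y) (key_sign x y * a * b)" by (simp add: dual2_times_alt)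

definition dual2_scale :: "'k::field => 'k dual2 => 'k dual2" where
 "dual2_scale c f = Poly_Mapping.map ((*) c) f"

lemma lookup_dual2_scale: "lookup (dual2_scale c f) x = c * lookup f x"
 by (simp add: dual2_scale_def Poly_Mapping.map.rep_eq when_def)

lemma dual2_scale_0 [simp]: "dual2_scale 0 f = 0" "dual2_scale c 0 = 0" by (rule poly_mapping_eqI, simp add: lookup_dual2_scale)+

lemma dual2_scale_1 [simp]: "dual2_scale 1 f = f" by (rule poly_mapping_eqI) (simp add: lookup_dual2_scale)

lemma dual2_scale_scale: "dual2_scale a (dual2_scale b f) = dual2_scale (a * b) f"
 by (rule poly_mapping_eqI) (simp add: lookup_dual2_scale mult.assoc)

lemma dual2_scale_single: "dual2_scale c (single x a) = single x (c * a)"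
 by (rule poly_mapping_eqI) (simp add: lookup_dual2_scale lookup_single when_def)

lemma dual2_scale_sum: "dual2_scale c (SUM i:I. f i) = (SUM i:I. dual2_scale c (f i))"
 by (rule poly_mapping_eqI) (simp add: lookup_dual2_scale lookup_sum sum_distrib_left)

lemma dual2_times_scale_right: "dual2_times f (dual2_scale c g) = dual2_scale c (dual2_times f g)"
proof -
 have "dual2_times f (dual2_scale c (SUM y:keys g. single y (lookup g y)))
  = dual2_scale c (dual2_times f (SUM y:keys g. single y (lookup g y)))"
  unfolding dual2_scale_sum dual2_times_sum_right
  by (rule sum.cong[OF refl], simp only: dual2_scale_single, simp add: dual2_times_alt dual2_scale_sum dual2_scale_single mult_ac)
 thus ?thesis by (simp only: poly_mapping_sum_single)
qed

subsection \<open>Signs\<close>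

definition inversions :: "nat set => nat set => nat" where
 "inversions E F = card {(i, j) : E \<times> F. j < i}"

text \<open>Every pair of distinct elements is an inversion in exactly one of the two
  orders.\<close>

lemma inversions_swap: assumes "finite E" "finite F" "E \<inter> F = {}" shows "inversions E F + inversions F E = card E * card F"
proof -
 have eq: "card {(i, j) : F \<times> E. j < i} = card {(i, j) : E \<times> F. i < j}"
  by (rule bij_betw_same_card[of prod.swap]) (auto simp: bij_betw_def inj_on_def image_iff)
 have "card {(i, j) : E \<times> F. j < i} + card {(i, j) : E \<times> F. i < j}
   = card ({(i, j) : E \<times> F. j < i} \<union> {(i, j) : E \<times> F. i < j})"
  using assms by (intro card_Un_disjoint[symmetric]) (auto intro: finite_subset[of _ "E \<times> F"])
 also have "{(i, j) : E \<times> F. j < i} \<union> {(i, j) : E \<times> F. i < j} = E \<times> F"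
  using assms(3) by (auto simp: disjoint_iff) (metis linorder_neqE_nat)
 finally show ?thesis unfolding inversions_def eq card_cartesian_product .
qed

lemma inversions_Un_right: assumes "finite E" "finite F" "finite G" "F \<inter> G = {}"
 shows "inversions E (F \<union> G) = inversions E F + inversions E G"
proof -
 have "{(i, j) : E \<times> (F \<union> G). j < i} = {(i, j) : E \<times> F. j < i} \<union> {(i, j) : E \<times> G. j < i}" by auto
 thus ?thesis unfolding inversions_def using assms
  by (simp, intro card_Un_disjoint) (auto intro: finite_subset[of _ "E \<times> F"] finite_subset[of _ "E \<times> G"])
qed

lemma monomial_sign_alt: "monomial_sign m m' = (if fst m \<inter> fst m' = {} then (- 1) ^ inversions (fst m) (fst m') else (0::'k::field))"
 by (cases m; cases m') (simp add: inversions_def)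

lemma fst_monomial_times [simp]: "fst (monomial_times m m') = fst m \<union> fst m'"
 and snd_monomial_times [simp]: "snd (monomial_times m m') = snd m + snd m'" by (cases m; cases m'; simp)+

lemma monomial_times_left_commute: "monomial_times x (monomial_times y z) = monomial_times y (monomial_times x z)"
 by (rule prod_eqI) (auto simp: ac_simps)

lemma minus_one_power_eq_iff_parity: "even a = even b ==> (- 1) ^ a = ((- 1) ^ b :: 'k::ring_1)" by (cases "even a") auto

text \<open>The inversions against \<open>z\<close> are the same on both sides; those between
  \<open>x\<close> and \<open>y\<close> add up to all pairs, whence the sign. If two of the tau sets
  meet, both sides are 0.\<close>

lemma monomial_sign_left_commute: assumes "finite (fst x)" "finite (fst y)" "finite (fst z)"
 shows "monomial_sign y z * monomial_sign x (monomial_times y z) =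
  (- 1) ^ (card (fst x) * card (fst y)) * (monomial_sign x z * monomial_sign y (monomial_times x z) :: 'k::field)"
proof (cases "fst x \<inter> fst y = {} & fst x \<inter> fst z = {} & fst y \<inter> fst z = {}")
 case True
 let ?e = inversions
 have "?e (fst x) (fst y \<union> fst z) = ?e (fst x) (fst y) + ?e (fst x) (fst z)"
  "?e (fst y) (fst x \<union> fst z) = ?e (fst y) (fst x) + ?e (fst y) (fst z)" using True assms by (auto intro: inversions_Un_right)
 moreover have "?e (fst x) (fst y) + ?e (fst y) (fst x) = card (fst x) * card (fst y)" using True assms inversions_swap by blast
 ultimately have "(- 1) ^ (?e (fst y) (fst z) + ?e (fst x) (fst y \<union> fst z)) =
  ((- 1) ^ (card (fst x) * card (fst y) + (?e (fst x) (fst z) + ?e (fst y) (fst x \<union> fst z))) :: 'k)"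
  by (intro minus_one_power_eq_iff_parity) presburger
 thus ?thesis using True by (simp add: monomial_sign_alt Int_Un_distrib power_add Int_commute)
next
 case False
 thus ?thesis by (auto simp: monomial_sign_alt)
qed

definition key_parity :: "milnor_monomial \<times> milnor_monomial => nat" where
 "key_parity x = card (fst (fst x)) + card (fst (snd x))"

definition finite_key :: "milnor_monomial \<times> milnor_monomial => bool" where
 "finite_key x \<longleftrightarrow> finite (fst (fst x)) & finite (fst (snd x))"

text \<open>Graded commutativity of the tensor square on monomials. Each tensor factor contributes
  its own sign, and the Koszul crossings supply the mixed terms, so that the total parity becomes
  the product of the two total parities.\<close>

lemma key_sign_left_commute: assumes "finite_key x" "finite_key y" "finite_key z" shows "key_sign y z * key_sign x (key_mult y z) =
  (- 1) ^ (key_parity x * key_parity y) * (key_sign x z * key_sign y (key_mult x z) :: 'k::field)"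
\<comment> \<open>The crossing signs involve sizes of unions of left tau sets, which are additive
  only for disjoint sets; otherwise both sides vanish.\<close>
proof (cases "fst (fst x) \<inter> fst (fst y) = {} & fst (fst x) \<inter> fst (fst z) = {} & fst (fst y) \<inter> fst (fst z) = {}")
 case True
 obtain x1 x2 y1 y2 z1 z2 where xyz: "x = (x1, x2)" "y = (y1, y2)" "z = (z1, z2)" by (metis surj_pair)
 let ?c = "%m. card (fst m)"
 have c: "?c (monomial_times y1 z1) = ?c y1 + ?c z1" "?c (monomial_times x1 z1) = ?c x1 + ?c z1"
  using True assms by (auto simp: xyz finite_key_def card_Un_disjoint)
 have s1: "monomial_sign y1 z1 * monomial_sign x1 (monomial_times y1 z1) =
  (- 1) ^ (?c x1 * ?c y1) * (monomial_sign x1 z1 * monomial_sign y1 (monomial_times x1 z1) :: 'k)"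
  by (rule monomial_sign_left_commute) (use assms in \<open>auto simp: xyz finite_key_def\<close>)
 have s2: "monomial_sign y2 z2 * monomial_sign x2 (monomial_times y2 z2) =
  (- 1) ^ (?c x2 * ?c y2) * (monomial_sign x2 z2 * monomial_sign y2 (monomial_times x2 z2) :: 'k)"
  by (rule monomial_sign_left_commute) (use assms in \<open>auto simp: xyz finite_key_def\<close>)
 have par: "(- 1) ^ (?c y2 * ?c z1) * (- 1) ^ (?c x2 * (?c y1 + ?c z1)) * ((- 1) ^ (?c x1 * ?c y1) * (- 1) ^ (?c x2 * ?c y2))
   = (- 1) ^ ((?c x1 + ?c x2) * (?c y1 + ?c y2)) * ((- 1) ^ (?c x2 * ?c z1) * ((- 1) ^ (?c y2 * (?c x1 + ?c z1))) :: 'k)"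
  unfolding power_add[symmetric] by (rule minus_one_power_eq_iff_parity) (auto simp: algebra_simps)
 have "key_sign y z * key_sign x (key_mult y z) = ((- 1) ^ (?c y2 * ?c z1) * (- 1) ^ (?c x2 * (?c y1 + ?c z1))) *
   (monomial_sign y1 z1 * monomial_sign x1 (monomial_times y1 z1)) * (monomial_sign y2 z2 * monomial_sign x2 (monomial_times y2 z2) :: 'k)"
  by (simp only: xyz key_sign_def key_mult_def fst_conv snd_conv c mult_ac)
 also have "... = ((- 1) ^ (?c y2 * ?c z1) * (- 1) ^ (?c x2 * (?c y1 + ?c z1)) * ((- 1) ^ (?c x1 * ?c y1) * (- 1) ^ (?c x2 * ?c y2)))
   * (monomial_sign x1 z1 * monomial_sign y1 (monomial_times x1 z1)) * (monomial_sign x2 z2 * monomial_sign y2 (monomial_times x2 z2))"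
  unfolding s1 s2 by (simp only: mult_ac)
 also have "... = (- 1) ^ (key_parity x * key_parity y) * (key_sign x z * key_sign y (key_mult x z))"
  unfolding par by (simp only: xyz key_sign_def key_mult_def key_parity_def fst_conv snd_conv c mult_ac)
 finally show ?thesis .
next
 case False
 thus ?thesis by (auto simp: key_sign_def key_mult_def monomial_sign_alt)
qed

definition finite_dual2 :: "'k::field dual2 => bool" where
 "finite_dual2 f \<longleftrightarrow> (ALL x:keys f. finite_key x)"

lemma finite_dual2_sum: "(!!i. i : I ==> finite_dual2 (f i)) ==> finite_dual2 (SUM i:I. f i)"
 unfolding finite_dual2_def by (metis (no_types, lifting) in_keys_iff lookup_sum sum.neutral)

lemma finite_dual2_single: "finite_key x ==> finite_dual2 (single x a)" by (simp add: finite_dual2_def)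

lemma finite_key_mult: "finite_key x ==> finite_key y ==> finite_key (key_mult x y)"
 by (simp add: finite_key_def key_mult_def)

lemma finite_dual2_times: "finite_dual2 f ==> finite_dual2 g ==> finite_dual2 (dual2_times f g)" unfolding dual2_times_alt
 by (intro finite_dual2_sum finite_dual2_single finite_key_mult) (auto simp: finite_dual2_def)

text \<open>The coproduct is a right fold, so exchanging neighbouring factors is all that reordering
  requires; associativity is proved for even factors only. The single constant \<open>c\<close>
  expresses that both factors are homogeneous in parity.\<close>

lemma dual2_times_left_commute: assumes "finite_dual2 f" "finite_dual2 g" "finite_dual2 h"
  and sgn: "!!x y. x : keys f ==> y : keys g ==>
   (- 1) ^ (key_parity x * key_parity y) = (c::'k::field)"
 shows "dual2_times f (dual2_times g h) = dual2_scale c (dual2_times g (dual2_times f h))"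
proof -
 let ?s = "single"
 have ex: "dual2_times f (dual2_times g h) = (SUM z:keys h. SUM y:keys g. SUM x:keys f.
   dual2_times (?s x (lookup f x)) (dual2_times (?s y (lookup g y)) (?s z (lookup h z))))"
  for f g h :: "'k dual2" by (subst (1) poly_mapping_sum_single[of f, symmetric], subst (1) poly_mapping_sum_single[of g, symmetric],
    subst (1) poly_mapping_sum_single[of h, symmetric])
   (simp only: dual2_times_sum_left dual2_times_sum_right)
 have one: "dual2_times (?s x a) (dual2_times (?s y b) (?s z d)) = dual2_scale c (dual2_times (?s y b) (dual2_times (?s x a) (?s z d)))"
  if "x : keys f" "y : keys g" "z : keys h" for x y z a b d
 proof -
  have k: "key_mult x (key_mult y z) = key_mult y (key_mult x z)" by (simp add: key_mult_def monomial_times_left_commute)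
  have "key_sign y z * key_sign x (key_mult y z) = c * (key_sign x z * key_sign y (key_mult x z))"
   using key_sign_left_commute[of x y z, where 'k = 'k] that assms sgn[of x y] by (auto simp: finite_dual2_def)
  hence "key_sign x (key_mult y z) * a * (key_sign y z * b * d) = c * (key_sign y (key_mult x z) * b * (key_sign x z * a * d))"
   by (metis (no_types, opaque_lifting) mult.assoc mult.commute)
  thus ?thesis by (simp only: dual2_times_single dual2_scale_single k)
 qed
 show ?thesis unfolding ex[of f g h] ex[of g f h] by (simp add: dual2_scale_sum one sum.swap[of _ "keys f"] cong: sum.cong)
qed

subsection \<open>The even part\<close>

abbreviation even_key :: "(nat \<Rightarrow>\<^sub>0 nat) \<times> (nat \<Rightarrow>\<^sub>0 nat) => milnor_monomial \<times> milnor_monomial" where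
 "even_key k == (({}, fst k), ({}, snd k))"

text \<open>Embeds an ordinary polynomial ring, in which no signs occur, as the part without tau.
  Commutativity, powers and Frobenius then come from the ring structure on poly mappings.\<close>

definition even_dual2 :: "((nat \<Rightarrow>\<^sub>0 nat) \<times> (nat \<Rightarrow>\<^sub>0 nat) \<Rightarrow>\<^sub>0 'k) => 'k::field dual2" where
 "even_dual2 f = (SUM k:keys f. single (even_key k) (lookup f k))"

lemma even_dual2_sum: "even_dual2 (SUM i:I. f i) = (SUM i:I. even_dual2 (f i))" unfolding even_dual2_def
 by (subst sum_keys_sum[where H = "%k. single (even_key k)"]) (simp_all add: single_add)

lemma even_dual2_single: "even_dual2 (single k a) = single (even_key k) a" by (simp add: even_dual2_def)

lemma even_dual2_times_single: "dual2_times (even_dual2 (single x a)) (dual2_times (even_dual2 (single y b)) h)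
  = dual2_times (even_dual2 (single x a * single y b)) h"
proof -
 have "dual2_times (even_dual2 (single x a)) (dual2_times (even_dual2 (single y b)) (single z d))
  = dual2_times (even_dual2 (single x a * single y b)) (single z d)" for z d
  by (simp add: even_dual2_single mult_single dual2_times_single key_mult_def key_sign_def monomial_sign_alt
    inversions_def prod_eq_iff ac_simps) (cases z; auto simp: ac_simps intro!: arg_cong2[where f = single] prod_eqI)
 thus ?thesis by (subst (1 2) poly_mapping_sum_single[of h, symmetric]) (simp only: dual2_times_sum_right)
qed

lemma even_dual2_times: "dual2_times (even_dual2 f) (dual2_times (even_dual2 g) h) = dual2_times (even_dual2 (f * g)) h"
proof -
 have "dual2_times (even_dual2 (SUM x:X. single x (a x))) (dual2_times (even_dual2 (SUM y:Y. single y (b y))) h)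
   = dual2_times (even_dual2 ((SUM x:X. single x (a x)) * (SUM y:Y. single y (b y)))) h" for X Y a b
  by (simp only: sum_product even_dual2_sum dual2_times_sum_left dual2_times_sum_right even_dual2_times_single)
   (rule sum.swap)
 from this[where X = "keys f" and Y = "keys g" and a = "lookup f" and b = "lookup g"]
 show ?thesis by (simp only: poly_mapping_sum_single)
qed

lemma even_dual2_one: "even_dual2 1 = single (({}, 0), ({}, 0)) 1" using even_dual2_single[of 0 1] by simp

lemma dual2_times_one_right: "dual2_times f (single (({}, 0), ({}, 0)) 1) = f"
proof -
 have "dual2_times (SUM x:keys f. single x (lookup f x)) (single (({}, 0), ({}, 0)) 1)
  = (SUM x:keys f. single x (lookup f x))" by (simp only: dual2_times_sum_left dual2_times_single)
   (rule sum.cong[OF refl], auto simp: key_mult_def key_sign_def monomial_sign_alt inversions_def split: prod.splits)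
 thus ?thesis by (simp only: poly_mapping_sum_single)
qed

lemma even_dual2_mult: "dual2_times (even_dual2 f) (even_dual2 g) = even_dual2 (f * g)"
 using even_dual2_times[of f g "single (({}, 0), ({}, 0)) 1"] by (simp only: dual2_times_one_right)

lemma keys_sum_subset: "keys (SUM i:I. f i) <= (UN i:I. keys (f i))"
 by (auto simp: in_keys_iff lookup_sum) (metis sum.neutral)

lemma keys_even_dual2: "x : keys (even_dual2 f) ==> fst (fst x) = {} & fst (snd x) = {}"
 using keys_sum_subset[of "%k. single (even_key k) (lookup f k)" "keys f"]
 by (auto simp: even_dual2_def split: if_splits)

lemma finite_dual2_even: "finite_dual2 (even_dual2 f)" by (auto simp: finite_dual2_def finite_key_def dest: keys_even_dual2)

section \<open>Words in the generators of the dual Steenrod algebra\<close>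

text \<open>\<open>Xi k q\<close> stands for \<open>\<xi>\<^sub>k^q\<close>; in the words below \<open>q\<close> is a power of the characteristic, and
  \<open>Xi 0 q\<close> is one of the ways to write the unit.\<close>

datatype atom = Tau nat | Xi nat nat

fun is_tau :: "atom => bool" where
 "is_tau (Tau i) = True"
| "is_tau (Xi k q) = False"

fun amon :: "atom => milnor_monomial" where
 "amon (Tau i) = tau i"
| "amon (Xi k q) = xi_power k q"

fun wmon :: "atom list => milnor_monomial" where
 "wmon [] = ({}, 0)"
| "wmon (a # L) = monomial_times (amon a) (wmon L)"

fun word_sign :: "atom list => 'k::field" where
 "word_sign [] = 1"
| "word_sign (a # L) = monomial_sign (amon a) (wmon L) * word_sign L"

text \<open>The value of \<open>th\<close> on the product of the generators in the order in which
  the word lists them; sorting into normal form costs \<open>word_sign\<close>, which is 0 when a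
  tau repeats.\<close>

definition wval :: "(milnor_monomial => 'k::field) => atom list => 'k" where
 "wval th L = word_sign L * th (wmon L)"

abbreviation ntau :: "atom list => nat" where
 "ntau L == length (filter is_tau L)"

text \<open>The terms of Milnor's coproduct. The pair \<open>(Tau n, Xi 0 1)\<close> is
  \<open>tau_n\<close> tensor 1. The formula for \<open>Xi n q\<close> is the coproduct of
  \<open>xi_n^q\<close> when q is a power of p, since such a power may be taken term by
  term.\<close>

fun atom_splits :: "nat => atom => (atom \<times> atom) set" where
 "atom_splits p (Tau n) = insert (Tau n, Xi 0 1) ((%i. (Xi (n - i) (p ^ i), Tau i)) ` {..n})"
| "atom_splits p (Xi n q) = (%i. (Xi (n - i) (p ^ i * q), Xi i q)) ` {..n}"

fun splits :: "nat => atom list => (atom \<times> atom) list set" where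
 "splits p [] = {[]}"
| "splits p (a # L) = (%(s, S). s # S) ` (atom_splits p a \<times> splits p L)"

text \<open>The Koszul sign for collecting the left halves in front: every odd right half passes all
  odd left halves that come after it.\<close>

fun split_sign :: "(atom \<times> atom) list => 'k::field" where
 "split_sign [] = 1"
| "split_sign (s # S) = (- 1) ^ (of_bool (is_tau (snd s)) * ntau (map fst S)) * split_sign S"

lemma finite_atom_splits [simp]: "finite (atom_splits p a)" by (cases a) auto

lemma finite_splits [simp]: "finite (splits p L)" by (induction L) auto

lemma sum_splits_Cons: "(SUM S:splits p (a # L). f S) = (SUM s:atom_splits p a. SUM S:splits p L. f (s # S))"
 by (simp add: sum.cartesian_product sum.reindex inj_on_def split_beta)

lemma finite_wmon [simp]: "finite (fst (wmon L))"
 by (induction L) (auto elim!: amon.elims simp: tau_def xi_power_def, metis amon.cases amon.simps finite.simps fst_conv tau_def xi_power_def)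

lemma card_wmon: "(word_sign L :: 'k::field) ~= 0 ==> card (fst (wmon L)) = ntau L"
proof (induction L)
 case (Cons a L)
 thus ?case by (cases a) (auto simp: monomial_sign_alt tau_def xi_power_def split: if_splits)
qed auto

definition atom_coproduct :: "nat => atom => 'k::field dual2" where
 "atom_coproduct p a = (SUM s:atom_splits p a. single (amon (fst s), amon (snd s)) 1)"

definition word_coproduct :: "nat => atom list => 'k::field dual2" where
 "word_coproduct p L = foldr dual2_times (map (atom_coproduct p) L) (single (({}, 0), ({}, 0)) 1)"

lemma word_coproduct_expand: "word_coproduct p L = (SUM S:splits p L. single (wmon (map fst S), wmon (map snd S))
   (split_sign S * word_sign (map fst S) * word_sign (map snd S) :: 'k::field))"
proof (induction L)
 case (Cons a L)
 have "word_coproduct p (a # L) = dual2_times (atom_coproduct p a) (word_coproduct p L :: 'k dual2)" by (simp add: word_coproduct_def)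
 also have "... = (SUM s:atom_splits p a. SUM S:splits p L. dual2_times (single (amon (fst s), amon (snd s)) 1)
   (single (wmon (map fst S), wmon (map snd S)) (split_sign S * word_sign (map fst S) * word_sign (map snd S))))"
  by (simp only: Cons.IH atom_coproduct_def dual2_times_sum_left dual2_times_sum_right)
   (rule sum.swap)
 also have "... = (SUM s:atom_splits p a. SUM S:splits p L.
   single (wmon (map fst (s # S)), wmon (map snd (s # S)))
   (split_sign (s # S) * word_sign (map fst (s # S)) * word_sign (map snd (s # S))))"
 proof (intro sum.cong refl)
  fix s S
  show "dual2_times (single (amon (fst s), amon (snd s)) 1)
   (single (wmon (map fst S), wmon (map snd S)) (split_sign S * word_sign (map fst S) * word_sign (map snd S))) =
   single (wmon (map fst (s # S)), wmon (map snd (s # S)))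
   (split_sign (s # S) * word_sign (map fst (s # S)) * word_sign (map snd (s # S)) :: 'k)"
  \<comment> \<open>The sign in \<open>dual2_times\<close> counts the tau's of the sorted left
    monomial. This is the number of tau letters only if none repeats; with a repetition both sides
    are 0.\<close>
  proof (cases "(word_sign (map fst S) :: 'k) = 0")
   case False
   have c: "card (fst (amon (snd s))) = of_bool (is_tau (snd s))" by (cases "snd s") (auto simp: tau_def xi_power_def)
   show ?thesis unfolding dual2_times_single key_mult_def key_sign_def fst_conv snd_conv
     card_wmon[OF False] c by (simp add: mult_ac)
  qed (simp add: dual2_times_single)
 qed
 also have "... = (SUM S:splits p (a # L). single (wmon (map fst S), wmon (map snd S))
   (split_sign S * word_sign (map fst S) * word_sign (map snd S)))" by (rule sum_splits_Cons[symmetric])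
 finally show ?case .
qed (simp add: word_coproduct_def)

lemma coproduct_tau_eq: "(coproduct_tau n :: 'k::{field,finite} dual2) = atom_coproduct (CARD('k)) (Tau n)"
proof -
 have "inj_on (%i. (Xi (n - i) (CARD('k) ^ i), Tau i)) {..n}" by (auto simp: inj_on_def)
 thus ?thesis by (simp add: coproduct_tau_def atom_coproduct_def sum.reindex xi_power_def tau_def image_iff)
qed

definition even_xi :: "nat => nat => nat => ((nat \<Rightarrow>\<^sub>0 nat) \<times> (nat \<Rightarrow>\<^sub>0 nat) \<Rightarrow>\<^sub>0 'k::field)" where
 "even_xi p n q = (\<Sum>i\<le>n. single (snd (xi_power (n - i) (p ^ i * q)), snd (xi_power i q)) 1)"

lemma atom_coproduct_Xi: "atom_coproduct p (Xi n q) = even_dual2 (even_xi p n q)"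
proof -
 have "inj_on (%i. (Xi (n - i) (p ^ i * q), Xi i q)) {..n}" by (auto simp: inj_on_def)
 thus ?thesis by (simp add: atom_coproduct_def even_xi_def even_dual2_sum even_dual2_single sum.reindex xi_power_def)
qed

lemma coproduct_xi_eq: "(coproduct_xi n :: 'k::{field,finite} dual2) = even_dual2 (even_xi (CARD('k)) n 1)" unfolding atom_coproduct_Xi[symmetric]
proof -
 have "inj_on (%i. (Xi (n - i) (CARD('k) ^ i * 1), Xi i 1)) {..n}" by (auto simp: inj_on_def)
 thus "(coproduct_xi n :: 'k::{field,finite} dual2) = atom_coproduct (CARD('k)) (Xi n 1)"
  by (simp add: coproduct_xi_def atom_coproduct_def sum.reindex)
qed

lemma xi_power_add: "snd (xi_power j e) + snd (xi_power j e') = snd (xi_power j (e + e'))" by (simp add: xi_power_def single_add)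

lemma xi_power_0 [simp]: "snd (xi_power j 0) = 0" by (simp add: xi_power_def)

text \<open>Frobenius is additive and the coefficients are 1, so a \<open>p^l\<close>-th power of
  the coproduct of \<open>xi_n\<close> merely multiplies all exponents.\<close>

lemma even_xi_power: assumes "prime (CARD('k::{field,finite}))"
 shows "even_xi (CARD('k)) n 1 ^ (CARD('k) ^ l) = (even_xi (CARD('k)) n (CARD('k) ^ l) ::
   ((nat \<Rightarrow>\<^sub>0 nat) \<times> (nat \<Rightarrow>\<^sub>0 nat) \<Rightarrow>\<^sub>0 'k))"
proof -
 have "single (snd (xi_power a e), snd (xi_power b f)) (1::'k) ^ q =
   single (snd (xi_power a (e * q)), snd (xi_power b (f * q))) 1" for a b e f q
 proof (induction q)
  case 0
  thus ?case by (simp flip: zero_prod_def)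
 next
  case (Suc q)
  thus ?case by (simp add: mult_single xi_power_add)
 qed
 thus ?thesis by (simp add: even_xi_def poly_mapping_freshman[OF assms])
qed

lemma finite_dual2_coproduct_tau: "finite_dual2 (coproduct_tau n :: 'k::{field,finite} dual2)" unfolding coproduct_tau_eq atom_coproduct_def
 by (intro finite_dual2_sum finite_dual2_single) (auto simp: finite_key_def tau_def xi_power_def)

lemma odd_coproduct_tau: "x : keys (coproduct_tau n :: 'k::{field,finite} dual2) ==> odd (key_parity x)"
 using keys_sum_subset[of "%s. single (amon (fst s), amon (snd s)) (1::'k)"
  "atom_splits (CARD('k)) (Tau n)"] unfolding coproduct_tau_eq atom_coproduct_def
 by (fastforce simp: key_parity_def tau_def xi_power_def split: if_splits)

definition tau_product :: "nat list => 'k::{field,finite} dual2 => 'k dual2" where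
 "tau_product xs h = foldr dual2_times (map coproduct_tau xs) h"

lemma tau_product_simps [simp]: "tau_product [] h = h"
 "tau_product (x # xs) h = dual2_times (coproduct_tau x) (tau_product xs h)" by (simp_all add: tau_product_def)

lemma finite_tau_product: "finite_dual2 h ==> finite_dual2 (tau_product xs h)"
 by (induction xs) (auto intro: finite_dual2_times finite_dual2_coproduct_tau)

lemma coproduct_tau_anticommute: assumes "finite_dual2 h" shows "dual2_times (coproduct_tau m) (dual2_times (coproduct_tau n) h) =
  dual2_scale (- 1) (dual2_times (coproduct_tau n) (dual2_times (coproduct_tau m) h))"
 by (rule dual2_times_left_commute[OF finite_dual2_coproduct_tau finite_dual2_coproduct_tau assms])
  (auto dest!: odd_coproduct_tau)

lemma even_tau_product: assumes "finite_dual2 h" shows "dual2_times (even_dual2 f) (tau_product xs h) = tau_product xs (dual2_times (even_dual2 f) h)"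
proof (induction xs)
 case (Cons x xs)
 have "dual2_times (even_dual2 f) (dual2_times (coproduct_tau x) (tau_product xs h)) =
  dual2_scale 1 (dual2_times (coproduct_tau x) (dual2_times (even_dual2 f) (tau_product xs h)))" by (rule dual2_times_left_commute)
   (auto simp: finite_dual2_even finite_dual2_coproduct_tau key_parity_def finite_tau_product[OF assms] dest!: keys_even_dual2)
 thus ?case by (simp add: Cons)
qed simp

lemma dual2_neg_fixed: fixes f :: "'k::field dual2" assumes "(2::'k) ~= 0" "f = dual2_scale (- 1) f" shows "f = 0"
proof (rule poly_mapping_eqI)
 fix x
 have "lookup f x = - lookup f x" by (subst assms(2)) (simp add: lookup_dual2_scale)
 hence "2 * lookup f x = 0" by (metis add.right_inverse mult_2)
 thus "lookup f x = lookup 0 x" using assms(1) by simp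
qed

text \<open>Insertion sort with anticommuting factors: every smaller index that is passed costs a
  sign, and meeting an equal index gives a term equal to its own negative.\<close>

lemma tau_product_insert: fixes h :: "'k::{field,finite} dual2" assumes "(2::'k) ~= 0" "finite_dual2 h" "sorted xs" "distinct xs"
 shows "dual2_times (coproduct_tau n) (tau_product xs h) =
  dual2_scale (if n : set xs then 0 else (- 1) ^ card {j : set xs. j < n}) (tau_product (insort n xs) h)" using assms(3,4)
proof (induction xs)
 case (Cons x xs)
 note ac = coproduct_tau_anticommute[OF finite_tau_product[OF assms(2)]]
 consider "n < x" | "n = x" | "x < n" by linarith
 thus ?case
 proof cases
  case 1
  hence e: "{j : set (x # xs). j < n} = {}" and n: "n ~: set (x # xs)" using Cons.prems by auto
  show ?thesis unfolding e using 1 n by simp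
 next
  case 2
  have "dual2_times (coproduct_tau n) (tau_product (x # xs) h) = 0" by (rule dual2_neg_fixed[OF assms(1)]) (use 2 ac[of n n] in simp)
  thus ?thesis using 2 by simp
 next
  case 3
  have c: "card {j : set (x # xs). j < n} = Suc (card {j : set xs. j < n})"
  proof -
   have "{j : set (x # xs). j < n} = insert x {j : set xs. j < n}" using 3 by auto
   thus ?thesis using Cons.prems by simp
  qed
  have "dual2_times (coproduct_tau n) (tau_product (x # xs) h) =
   dual2_scale (- 1) (dual2_times (coproduct_tau x) (dual2_times (coproduct_tau n) (tau_product xs h)))" using ac[of n x xs] by simp
  thus ?thesis unfolding c using 3 Cons by (auto simp: dual2_times_scale_right dual2_scale_scale)
 qed
qed simp

lemma coproduct_alt: "coproduct (E, R) = tau_product (sorted_list_of_set E)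
   (even_dual2 (PROD j:keys R. even_xi (CARD('k)) j 1 ^ lookup R j) :: 'k::{field,finite} dual2)"
proof -
 have fold: "foldr dual2_times (map even_dual2 fs) (single (({}, 0), ({}, 0)) 1) = even_dual2 (prod_list fs)"
  for fs :: "((nat \<Rightarrow>\<^sub>0 nat) \<times> (nat \<Rightarrow>\<^sub>0 nat) \<Rightarrow>\<^sub>0 'k) list"
  by (induction fs) (simp_all add: even_dual2_mult flip: even_dual2_one)
 have "concat (map (%j. replicate (lookup R j) (coproduct_xi j :: 'k dual2)) js) =
   map even_dual2 (concat (map (%j. replicate (lookup R j) (even_xi (CARD('k)) j 1)) js))" for js
  by (simp add: map_concat coproduct_xi_eq o_def)
 moreover have "prod_list (concat (map (%j. replicate (lookup R j) (x j)) js)) = (\<Prod>j\<leftarrow>js. x j ^ lookup R j)"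
  for x :: "nat => ((nat \<Rightarrow>\<^sub>0 nat) \<times> (nat \<Rightarrow>\<^sub>0 nat) \<Rightarrow>\<^sub>0 'k)" and js
  by (induction js) simp_all
 ultimately show ?thesis by (simp add: foldr_append fold tau_product_def flip: prod.distinct_set_conv_list)
qed

lemma coproduct_insert_tau: assumes "(2::'k) ~= 0" "finite (fst m)" shows "dual2_times (coproduct_tau n) (coproduct m) =
  dual2_scale (monomial_sign (tau n) m) (coproduct (monomial_times (tau n) m) :: 'k::{field,finite} dual2)"
proof -
 obtain E R where m: "m = (E, R)" by (cases m)
 have inv: "inversions {n} E = card {j : E. j < n}"
  unfolding inversions_def by (rule bij_betw_same_card[of snd]) (auto simp: bij_betw_def inj_on_def image_iff)
 show ?thesis using assms(2) unfolding m by (simp add: coproduct_alt tau_product_insert[OF assms(1) finite_dual2_even] tau_def monomial_sign_alt inv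
    sorted_list_of_set_insert_remove insert_absorb del: coproduct.simps)
qed

lemma prod_keys_add_single: fixes x :: "'a => 'b::comm_monoid_mult"
 shows "x n ^ q * (PROD j:keys R. x j ^ lookup R j) =
  (PROD j:keys (single n q + R). x j ^ lookup (single n q + R) j)"
proof -
 let ?A = "insert n (keys R \<union> keys (single n q + R))"
 have sup: "(PROD j:keys S. x j ^ lookup S j) = (PROD j:?A. x j ^ lookup S j)"
  if "keys S <= ?A" for S :: "'a \<Rightarrow>\<^sub>0 nat"
  by (rule prod.mono_neutral_left) (use that in \<open>auto simp: in_keys_iff\<close>)
 have "(PROD j:?A. x j ^ lookup (single n q) j) = (PROD j:{n}. x j ^ lookup (single n q) j)"
  by (rule prod.mono_neutral_right) (auto simp: lookup_single when_def)
 thus ?thesis by (subst (1 2) sup) (auto simp: lookup_add power_add prod.distrib)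
qed

lemma coproduct_insert_xi: assumes "prime (CARD('k))" "finite (fst m)"
 shows "dual2_times (even_dual2 (even_xi (CARD('k)) n (CARD('k) ^ l))) (coproduct m) =
  (coproduct (monomial_times (xi_power n (CARD('k) ^ l)) m) :: 'k::{field,finite} dual2)"
proof -
 obtain E R where m: "m = (E, R)" by (cases m)
 let ?x = "%j. even_xi (CARD('k)) j 1 :: (nat \<Rightarrow>\<^sub>0 nat) \<times> (nat \<Rightarrow>\<^sub>0 nat) \<Rightarrow>\<^sub>0 'k"
 have "?x n ^ (CARD('k) ^ l) * (PROD j:keys R. ?x j ^ lookup R j) =
  (let R' = snd (xi_power n (CARD('k) ^ l)) + R in (PROD j:keys R'. ?x j ^ lookup R' j))"
 \<comment> \<open>The monomial of \<open>xi_0\<close> is empty, so its coproduct has to be the unit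
   of the even part.\<close>
 proof (cases "n = 0")
  case True
  have "even_xi (CARD('k)) 0 1 = (1 :: (nat \<Rightarrow>\<^sub>0 nat) \<times> (nat \<Rightarrow>\<^sub>0 nat) \<Rightarrow>\<^sub>0 'k)"
   by (simp add: even_xi_def xi_power_def flip: zero_prod_def)
  thus ?thesis using True by (simp add: xi_power_def)
 next
  case False
  thus ?thesis using prod_keys_add_single[of ?x] by (simp add: xi_power_def Let_def)
 qed
 thus ?thesis unfolding m by (simp add: coproduct_alt even_tau_product[OF finite_dual2_even] even_dual2_mult xi_power_def
    Let_def del: coproduct.simps flip: even_xi_power[OF assms(1)])
qed

definition frobenius_word :: "nat => atom list => bool" where
 "frobenius_word p L \<longleftrightarrow> (ALL a:set L. is_tau a | (EX k l. a = Xi k (p ^ l)))"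

text \<open>Multiplicativity of Milnor's coproduct: the generators may be listed in any order, and
  \<open>xi_k^(p^l)\<close> may count as one letter, at the price of
  \<open>word_sign\<close>.\<close>

lemma word_coproduct_eq: assumes "prime (CARD('k))" "odd (CARD('k))" "frobenius_word (CARD('k)) L"
 shows "word_coproduct (CARD('k)) L = dual2_scale (word_sign L) (coproduct (wmon L) :: 'k::{field,finite} dual2)" using assms(3)
proof (induction L)
 case (Cons a L)
 note two = two_neq_zero_field[OF assms(1,2)]
 have IH: "word_coproduct (CARD('k)) L = dual2_scale (word_sign L) (coproduct (wmon L) :: 'k::{field,finite} dual2)"
  using Cons by (simp add: frobenius_word_def)
 show ?case
 proof (cases a)
  case (Tau n)
  thus ?thesis using IH coproduct_insert_tau[OF two, of "wmon L" n]
   by (simp add: word_coproduct_def dual2_times_scale_right dual2_scale_scale mult_ac flip: coproduct_tau_eq)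
 next
  case (Xi n q)
  then obtain l where "q = CARD('k) ^ l" using Cons.prems by (auto simp: frobenius_word_def)
  moreover have "monomial_sign (xi_power n q) m = (1::'k)" for m by (simp add: monomial_sign_alt xi_power_def inversions_def)
  ultimately show ?thesis using IH coproduct_insert_xi[OF assms(1), of "wmon L" n l] Xi
   by (simp add: word_coproduct_def atom_coproduct_Xi dual2_times_scale_right)
 qed
qed (simp add: word_coproduct_def)

lemma wmon_milnor: "wmon L : milnor_monomials"
proof (induction L)
 case (Cons a L)
 thus ?case by (cases a; cases "wmon L") (auto simp: milnor_monomials_def tau_def xi_power_def lookup_add lookup_single)
qed (simp add: milnor_monomials_def)

text \<open>The product in the Steenrod algebra, read off from the multiplicativity of the coproduct; the
  words may contain \<open>p\<close>-th powers because Frobenius is a ring homomorphism on the even part.\<close>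

theorem wval_times: fixes th th' :: "'k::{field,finite} steenrod_element"
 assumes "prime (CARD('k))" "odd (CARD('k))" "frobenius_word (CARD('k)) L"
 shows "wval (steenrod_times th th') L = (SUM S:splits (CARD('k)) L.
   split_sign S * wval th (map fst S) * wval th' (map snd S))"
proof -
 let ?P = "%f :: 'k dual2. SUM x:keys f. lookup f x * (th (fst x) * th' (snd x))"
 have scale: "?P (dual2_scale c f) = c * ?P f" for c f
  by (subst sum_keys_superset[where A = "keys f" and H = "%x a. a * (th (fst x) * th' (snd x))"])
   (auto simp: lookup_dual2_scale in_keys_iff sum_distrib_left mult_ac)
 have "wval (steenrod_times th th') L = word_sign L * ?P (coproduct (wmon L))"
  by (simp add: wval_def steenrod_times_def wmon_milnor split_beta mult_ac)
 also have "... = ?P (word_coproduct (CARD('k)) L)" unfolding word_coproduct_eq[OF assms] scale ..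
 also have "... = (SUM S:splits (CARD('k)) L. ?P (single (wmon (map fst S), wmon (map snd S))
   (split_sign S * word_sign (map fst S) * word_sign (map snd S))))" unfolding word_coproduct_expand
  by (rule sum_keys_sum[where H = "%x a. a * (th (fst x) * th' (snd x))"]) (auto simp: algebra_simps)
 also have "... = (SUM S:splits (CARD('k)) L. split_sign S * wval th (map fst S) * wval th' (map snd S))"
  by (rule sum.cong) (auto simp: wval_def mult_ac)
 finally show ?thesis .
qed

section \<open>Vector spaces given by records\<close>

lemma class_field: "Ring.field (class_ring :: 'k::field ring)" by (rule class_field.field_axioms)

lemma vectorspace_classI: fixes V :: "('k::field, 'v) module" assumes "0[V] : carrier V"
  and "!!x y. x : carrier V ==> y : carrier V ==> x +[V] y : carrier V"
  and "!!c x. x : carrier V ==> c *[V] x : carrier V"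
  and "!!x y. x : carrier V ==> y : carrier V ==> x +[V] y = y +[V] x"
  and "!!x y z. x : carrier V ==> y : carrier V ==> z : carrier V ==>
   (x +[V] y) +[V] z = x +[V] (y +[V] z)"
  and "!!x. x : carrier V ==> x +[V] 0[V] = x"
  and "!!x. x : carrier V ==> x +[V] (- 1) *[V] x = 0[V]"
  and "!!a b x. x : carrier V ==> (a * b) *[V] x = a *[V] (b *[V] x)"
  and "!!x. x : carrier V ==> 1 *[V] x = x"
  and "!!a b x. x : carrier V ==> (a + b) *[V] x = a *[V] x +[V] b *[V] x"
  and "!!a x y. x : carrier V ==> y : carrier V ==>
   a *[V] (x +[V] y) = a *[V] x +[V] a *[V] y"
 shows "vspace V"
proof -
 have "Module.module class_ring V"
 proof (rule module_criteria)
  show "cring (class_ring :: 'k ring)" using class_field field.axioms(1) domain.axioms(1) by blast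
  show "ALL v:carrier V. EX w:carrier V. v +[V] w = 0[V]" using assms(3,7) by blast
 qed (simp_all add: assms(1-3,5-11), blast intro: assms(4))
 thus ?thesis by (simp add: vectorspace_def class_field)
qed

context fixes V :: "('k::field, 'v) module" assumes V: "vspace V"
begin

interpretation vectorspace class_ring V by (rule V)

lemma vs_zero [simp]: "0[V] : carrier V" by simp

lemma vs_add: "x : carrier V ==> y : carrier V ==> x +[V] y : carrier V" by simp

lemma vs_smult: "x : carrier V ==> c *[V] x : carrier V" by simp

lemma vs_assoc: "x : carrier V ==> y : carrier V ==> z : carrier V ==>
  (x +[V] y) +[V] z = x +[V] (y +[V] z)" by (simp add: a_assoc)

lemma vs_comm: "x : carrier V ==> y : carrier V ==> x +[V] y = y +[V] x"
 by (simp add: a_comm)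

lemma vs_lcomm: "x : carrier V ==> y : carrier V ==> z : carrier V ==>
  x +[V] (y +[V] z) = y +[V] (x +[V] z)" by (simp add: a_lcomm)

lemma vs_zero_right: "x : carrier V ==> x +[V] 0[V] = x" by simp

lemma vs_zero_left: "x : carrier V ==> 0[V] +[V] x = x" by simp

lemma vs_smult_zero: "c *[V] 0[V] = 0[V]" using smult_r_null[of c] by simp

lemma vs_zero_smult: "x : carrier V ==> 0 *[V] x = 0[V]" using smult_l_null[of x] by simp

lemma vs_smult_smult: "x : carrier V ==> a *[V] (b *[V] x) = (a * b) *[V] x"
 using smult_assoc1[of a b x] by simp

lemma vs_one_smult: "x : carrier V ==> 1 *[V] x = x" using smult_one[of x] by simp

lemma vs_add_smult: "x : carrier V ==> (a + b) *[V] x = a *[V] x +[V] b *[V] x"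
 using smult_l_distr[of a b x] by simp

lemma vs_smult_add: "x : carrier V ==> y : carrier V ==>
  a *[V] (x +[V] y) = a *[V] x +[V] a *[V] y"
 using smult_r_distr[of a x y] by simp

lemma vs_neg: "x : carrier V ==> x +[V] (- 1) *[V] x = 0[V]"
 using vs_add_smult[of x 1 "- 1"] by (simp add: vs_one_smult vs_zero_smult)

lemma vs_eq_iff_diff: "x : carrier V ==> y : carrier V ==> x +[V] (- 1) *[V] y = 0[V] \<longleftrightarrow> x = y"
proof
 assume xy: "x : carrier V" "y : carrier V" and eq: "x +[V] (- 1) *[V] y = 0[V]"
 have "x = x +[V] ((- 1) *[V] y +[V] y)"
  using xy vs_neg[of y] vs_comm[of y "(- 1) *[V] y"] by (simp add: vs_smult vs_zero_right)
 also have "... = y" using xy eq by (simp add: vs_smult vs_zero_left flip: vs_assoc)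
 finally show "x = y" .
qed (simp add: vs_neg)

lemma vs_abelian_group: "abelian_group V" by (rule abelian_group_axioms)

end

lemma module_hom_iff: "f : LinearCombinations.module_hom (class_ring :: 'k::field ring) V W \<longleftrightarrow>
  (ALL x:carrier V. f x : carrier W) &
  (ALL x:carrier V. ALL y:carrier V. f (x +[V] y) = f x +[W] f y) &
  (ALL c. ALL x:carrier V. f (c *[V] x) = c *[W] f x)"
 by (auto simp: LinearCombinations.module_hom_def)

lemma module_hom_zero: fixes V :: "('k::field, 'v) module" and W :: "('k, 'w) module" assumes "vspace V" "vspace W"
  "f : LinearCombinations.module_hom (class_ring :: 'k::field ring) V W" shows "f 0[V] = 0[W]"
proof -
 have "f (0 *[V] 0[V]) = 0 *[W] f 0[V]" "f 0[V] : carrier W"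
  using assms(3) vs_zero[OF assms(1)] unfolding module_hom_iff by blast+
 thus ?thesis by (simp add: vs_smult_zero[OF assms(1)] vs_zero_smult[OF assms(2)])
qed

lemma subspace_iff: assumes "vspace V" shows "VectorSpace.subspace (class_ring :: 'k::field ring) H V \<longleftrightarrow>
  H <= carrier V & 0[V] : H & (ALL x:H. ALL y:H. x +[V] y : H) & (ALL c. ALL x:H. c *[V] x : H)"
 using assms by (auto simp: VectorSpace.subspace_def submodule_def vectorspace_def)

lemma subspace_vectorspace: fixes V :: "('k::field, 'v) module" assumes "VectorSpace.subspace (class_ring :: 'k::field ring) H V"
 shows "vspace (V\<lparr>carrier := H\<rparr>)"
proof -
 have V: "vspace V" using assms by (simp add: VectorSpace.subspace_def)
 have HC: "!!x. x : H ==> x : carrier V" and z: "0[V] : H"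
  and a: "!!x y. x : H ==> y : H ==> x +[V] y : H" and sm: "!!c x. x : H ==> c *[V] x : H"
  using assms[unfolded subspace_iff[OF V]] by auto
 show ?thesis
 proof (rule vectorspace_classI, goal_cases)
  case (4 x y)
  thus ?case using vs_comm[OF V HC HC, of x y] by simp
 qed (use HC z in \<open>simp_all add: a sm vs_assoc[OF V] vs_smult_smult[OF V] vs_one_smult[OF V] vs_add_smult[OF V]
   vs_smult_add[OF V] vs_neg[OF V] vs_zero_right[OF V]\<close>)
qed

subsection \<open>Quotients\<close>

context fixes V :: "('k::field, 'v) module" and H :: "'v set" assumes V: "vspace V" and H: "subsp H V"
begin

lemma quot_subspaceD:
 "H <= carrier V" "0[V] : H" "x : H ==> y : H ==> x +[V] y : H" "x : H ==> c *[V] x : H"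
 "x : H ==> x : carrier V" using H by (auto simp: subspace_iff[OF V])

lemma mem_coset_iff: assumes "x : carrier V"
 shows "y : H +>[V] x \<longleftrightarrow> y : carrier V & y +[V] (- 1) *[V] x : H"
proof
 assume "y : H +>[V] x"
 then obtain h where h: "h : H" "y = h +[V] x" by (auto simp: a_r_coset_def')
 hence "y +[V] (- 1) *[V] x = h"
  using assms quot_subspaceD(5) by (simp add: vs_assoc[OF V] vs_smult[OF V] vs_neg[OF V] vs_zero_right[OF V])
 thus "y : carrier V & y +[V] (- 1) *[V] x : H"
  using h assms quot_subspaceD(5) by (simp add: vs_add[OF V])
next
 assume y: "y : carrier V & y +[V] (- 1) *[V] x : H"
 have "(y +[V] (- 1) *[V] x) +[V] x = y"
  using y assms vs_neg[OF V, of x] vs_comm[OF V, of x "(- 1) *[V] x"]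
  by (simp add: vs_assoc[OF V] vs_smult[OF V] vs_zero_right[OF V])
 thus "y : H +>[V] x" unfolding a_r_coset_def' using y by force
qed

lemma coset_self: "x : carrier V ==> x : H +>[V] x" by (simp add: mem_coset_iff vs_neg[OF V] quot_subspaceD)

lemma coset_eq_iff: assumes "x : carrier V" "y : carrier V"
 shows "H +>[V] x = H +>[V] y \<longleftrightarrow> x +[V] (- 1) *[V] y : H"
proof
 assume "H +>[V] x = H +>[V] y"
 thus "x +[V] (- 1) *[V] y : H" using coset_self[OF assms(1)] mem_coset_iff[OF assms(2)] by blast
next
 assume h: "x +[V] (- 1) *[V] y : H"
 have eq: "z +[V] (- 1) *[V] y = (z +[V] (- 1) *[V] x) +[V] (x +[V] (- 1) *[V] y)"
  if "x : carrier V" "y : carrier V" "z : carrier V" for x y z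
 proof -
  have "(z +[V] (- 1) *[V] x) +[V] (x +[V] (- 1) *[V] y) =
   (x +[V] (- 1) *[V] x) +[V] (z +[V] (- 1) *[V] y)"
   using that by (simp add: vs_assoc[OF V] vs_smult[OF V] vs_add[OF V] vs_lcomm[OF V] vs_comm[OF V])
  thus ?thesis using that by (simp add: vs_neg[OF V] vs_smult[OF V] vs_add[OF V] vs_zero_left[OF V])
 qed
 have h': "y +[V] (- 1) *[V] x : H"
 proof -
  have "(- 1) *[V] (x +[V] (- 1) *[V] y) = y +[V] (- 1) *[V] x"
   using assms by (simp add: vs_smult_add[OF V] vs_smult[OF V] vs_smult_smult[OF V] vs_one_smult[OF V] vs_comm[OF V])
  thus ?thesis using quot_subspaceD(4)[OF h, of "- 1"] by simp
 qed
 show "H +>[V] x = H +>[V] y" by (rule Set.set_eqI) (metis assms eq h h' mem_coset_iff quot_subspaceD(3))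
qed

lemma quot_carrier: "carrier (quot_vs V H) = {H +>[V] x | x. x : carrier V}"
 by (auto simp: quot_vs_def mk_vs_def A_RCOSETS_def' a_r_coset_def')

lemma quot_add: assumes "x \<in> carrier V" "y \<in> carrier V"
 shows "(H +>\<^bsub>V\<^esub> x) \<oplus>\<^bsub>quot_vs V H\<^esub> (H +>\<^bsub>V\<^esub> y) = H +>\<^bsub>V\<^esub> (x \<oplus>\<^bsub>V\<^esub> y)"
proof -
 have "(H +>\<^bsub>V\<^esub> x) <+>\<^bsub>V\<^esub> (H +>\<^bsub>V\<^esub> y) = H +>\<^bsub>V\<^esub> (x \<oplus>\<^bsub>V\<^esub> y)"
 proof (intro Set.set_eqI iffI)
  fix z assume "z \<in> (H +>\<^bsub>V\<^esub> x) <+>\<^bsub>V\<^esub> (H +>\<^bsub>V\<^esub> y)"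
  then obtain h h' where h: "h \<in> H" "h' \<in> H" "z = (h \<oplus>\<^bsub>V\<^esub> x) \<oplus>\<^bsub>V\<^esub> (h' \<oplus>\<^bsub>V\<^esub> y)"
   by (auto simp: set_add_def' a_r_coset_def')
  hence "z = (h \<oplus>\<^bsub>V\<^esub> h') \<oplus>\<^bsub>V\<^esub> (x \<oplus>\<^bsub>V\<^esub> y)"
   using assms quot_subspaceD(5) by (simp add: vs_assoc[OF V] vs_add[OF V] vs_lcomm[OF V])
  thus "z \<in> H +>\<^bsub>V\<^esub> (x \<oplus>\<^bsub>V\<^esub> y)" using h quot_subspaceD(3) by (auto simp: a_r_coset_def')
 next
  fix z assume "z \<in> H +>\<^bsub>V\<^esub> (x \<oplus>\<^bsub>V\<^esub> y)"
  then obtain h where h: "h \<in> H" "z = h \<oplus>\<^bsub>V\<^esub> (x \<oplus>\<^bsub>V\<^esub> y)" by (auto simp: a_r_coset_def')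
  hence "z = (h \<oplus>\<^bsub>V\<^esub> x) \<oplus>\<^bsub>V\<^esub> (\<zero>\<^bsub>V\<^esub> \<oplus>\<^bsub>V\<^esub> y)"
   using assms quot_subspaceD(5) by (simp add: vs_assoc[OF V] vs_zero_left[OF V])
  thus "z \<in> (H +>\<^bsub>V\<^esub> x) <+>\<^bsub>V\<^esub> (H +>\<^bsub>V\<^esub> y)"
   using h(1) quot_subspaceD(2) by (auto simp: set_add_def' a_r_coset_def')
 qed
 thus ?thesis by (simp add: quot_vs_def mk_vs_def)
qed

text \<open>Induced maps on cosets are defined as unions over all representatives. Each
  representative contributes the same coset of \<open>K\<close>, so the union is that coset. Scalar
  multiplication on the quotient is the case of a homothety.\<close>

lemma UN_coset_hom: fixes W :: "('k, 'w) module" assumes "vspace W" "subsp K W"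
  "f : lin V W" "!!h. h : H ==> f h : K" "x : carrier V"
 shows "(UN y:H +>[V] x. K +>[W] f y) = K +>[W] f x"
proof -
 note W = assms(1)
 have K: "K <= carrier W" "!!a b. a : K ==> b : K ==> a +[W] b : K"
  using assms(2) by (auto simp: subspace_iff[OF W])
 have "K +>[W] f y <= K +>[W] f x" if "y : H +>[V] x" for y
 proof -
  obtain h where h: "h : H" "y = h +[V] x"
   using \<open>y : H +>[V] x\<close> by (auto simp: a_r_coset_def')
  hence "f y = f h +[W] f x" using assms quot_subspaceD(5) by (simp add: module_hom_iff)
  moreover have "f x : carrier W" using assms by (auto simp: module_hom_iff)
  ultimately have y: "k +[W] f y = (k +[W] f h) +[W] f x" if "k : K" for k
   using K(1) assms(4)[OF h(1)] that by (simp add: vs_assoc[OF W] subset_iff)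
  show ?thesis using K(2) assms(4)[OF h(1)] y by (force simp: a_r_coset_def')
 qed
 thus ?thesis using coset_self[OF assms(5)] by blast
qed

lemma quot_smult: assumes "x : carrier V"
 shows "c *[quot_vs V H] (H +>[V] x) = H +>[V] (c *[V] x)"
 using UN_coset_hom[OF V H, of "%x. c *[V] x" x] assms
 by (simp add: quot_vs_def mk_vs_def module_hom_iff vs_smult[OF V] vs_smult_add[OF V] vs_smult_smult[OF V] mult.commute
   quot_subspaceD)

lemma quot_zero: "0[quot_vs V H] = H +>[V] 0[V]"
proof -
 have "H +>[V] 0[V] = H" using quot_subspaceD(5) by (auto simp: a_r_coset_def' vs_zero_right[OF V])
 thus ?thesis by (simp add: quot_vs_def mk_vs_def)
qed

lemma coset_in_quot: "x : carrier V ==> H +>[V] x : carrier (quot_vs V H)" by (auto simp: quot_carrier)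

lemma quot_cosetE: assumes "X : carrier (quot_vs V H)"
 obtains x where "x : carrier V" "X = H +>[V] x" using assms by (auto simp: quot_carrier)

lemma vectorspace_quot: "vspace (quot_vs V H)"
proof (rule vectorspace_classI, goal_cases)
 case 1
 thus ?case by (simp add: quot_zero coset_in_quot vs_zero[OF V])
qed (elim quot_cosetE, simp add: coset_in_quot quot_add quot_smult quot_zero vs_add[OF V] vs_smult[OF V]
  vs_assoc[OF V] vs_zero[OF V] vs_neg[OF V] vs_smult_smult[OF V] vs_one_smult[OF V] vs_add_smult[OF V]
  vs_smult_add[OF V] vs_zero_right[OF V] vs_comm[OF V] vs_lcomm[OF V])+

lemma quot_map_coset: fixes W :: "('k, 'w) module" assumes "vspace W" "subsp K W"
  "f : lin V W" "!!h. h : H ==> f h : K" "x : carrier V"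
 shows "quot_map W K f (H +>[V] x) = K +>[W] f x" unfolding quot_map_def by (rule UN_coset_hom[OF assms])

end

section \<open>Degrees and canonical words\<close>

fun taus :: "atom list => nat list" where
 "taus [] = []"
| "taus (Tau i # L) = i # taus L"
| "taus (Xi k q # L) = taus L"

lemma length_taus: "length (taus L) = ntau L" by (induction L rule: taus.induct) auto

lemma taus_append [simp]: "taus (L @ L') = taus L @ taus L'" by (induction L rule: taus.induct) auto

lemma taus_map_Tau [simp]: "taus (map Tau xs) = xs" by (induction xs) auto

lemma taus_no_tau: "(!!a. a : set L ==> ~ is_tau a) ==> taus L = []" by (induction L rule: taus.induct) force+

lemma fst_wmon: "fst (wmon L) = set (taus L)" by (induction L rule: taus.induct) (auto simp: tau_def xi_power_def)

text \<open>The sign of the permutation that sorts the list, and 0 if an entry repeats.\<close>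

fun tau_sign :: "nat list => 'k::field" where
 "tau_sign [] = 1"
| "tau_sign (i # xs) = (if i : set xs then 0 else (- 1) ^ card {j : set xs. j < i}) * tau_sign xs"

lemma inversions_empty [simp]: "inversions {} E = 0" by (simp add: inversions_def)

lemma inversions_single: "inversions {n} E = card {j : E. j < n}"
 unfolding inversions_def by (rule bij_betw_same_card[of snd]) (auto simp: bij_betw_def inj_on_def image_iff)

lemma word_sign_taus: "word_sign L = (tau_sign (taus L) :: 'k::field)" by (induction L rule: taus.induct)
  (auto simp: monomial_sign_alt tau_def xi_power_def fst_wmon inversions_single)

lemma tau_sign_nonzero_iff: "(tau_sign xs :: 'k::field) ~= 0 \<longleftrightarrow> distinct xs" by (induction xs) auto

lemma tau_sign_sorted: "sorted xs ==> distinct xs ==> tau_sign xs = (1 :: 'k::field)"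
proof (induction xs)
 case (Cons i xs)
 hence e: "{j : set xs. j < i} = {}" by auto
 show ?case using Cons by (simp add: e)
qed simp

lemma snd_wmon: "snd (wmon L) = (\<Sum>a\<leftarrow>L. snd (amon a))" by (induction L) auto

lemma lookup_wmon: "lookup (snd (wmon L)) j = (\<Sum>a\<leftarrow>L. lookup (snd (amon a)) j)"
 by (induction L) (auto simp: lookup_add)

lemma wmon_append: "wmon (L @ L') = monomial_times (wmon L) (wmon L')"
 by (rule prod_eqI) (auto simp: fst_wmon snd_wmon)

fun atom_degree :: "nat => atom => nat" where
 "atom_degree p (Tau i) = 2 * p ^ i - 1"
| "atom_degree p (Xi k q) = q * (2 * (p ^ k - 1))"

abbreviation word_degree :: "nat => atom list => nat" where
 "word_degree p L == \<Sum>a\<leftarrow>L. atom_degree p a"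

lemma milnor_degree_times: assumes "finite (fst m)" "finite (fst m')" "fst m \<inter> fst m' = {}"
 shows "milnor_degree p (monomial_times m m') = milnor_degree p m + milnor_degree p m'" using assms by (cases m; cases m')
  (simp add: milnor_degree_def sum.union_disjoint add_mult_distrib
   setsum_keys_plus_distrib[of "%j r. r * (2 * (p ^ j - Suc 0))"])

lemma milnor_degree_atom: "milnor_degree p (amon a) = atom_degree p a" by (cases a) (auto simp: milnor_degree_def tau_def xi_power_def)

lemma finite_amon: "finite (fst (amon a))" by (cases a) (auto simp: tau_def xi_power_def)

lemma milnor_degree_word: "distinct (taus L) ==> milnor_degree p (wmon L) = word_degree p L"
proof (induction L)
 case (Cons a L)
 have "fst (amon a) \<inter> fst (wmon L) = {}" "distinct (taus L)"
  using Cons.prems by (cases a; simp add: fst_wmon tau_def xi_power_def)+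
 thus ?case using Cons.IH by (simp add: milnor_degree_times finite_amon milnor_degree_atom)
qed (simp add: milnor_degree_def)

lemma wval_nonzeroD: assumes "th : steenrod k" "wval th L ~= (0 :: 'k::{field,finite})"
 shows "distinct (taus L)" "word_degree (CARD('k)) L = k" "th (wmon L) ~= 0"
proof -
 show d: "distinct (taus L)" using assms(2) tau_sign_nonzero_iff[where 'k = 'k] by (auto simp: wval_def word_sign_taus)
 show 1: "th (wmon L) ~= 0" using assms(2) by (auto simp: wval_def)
 thus "word_degree (CARD('k)) L = k"
  using assms(1) milnor_degree_word[OF d, of "CARD('k)"] unfolding steenrod_def by (metis (mono_tags, lifting) mem_Collect_eq)
qed

lemma splits_iff: "S : splits p L \<longleftrightarrow> list_all2 (%a s. s : atom_splits p a) L S"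
 by (induction L arbitrary: S) (auto simp: list_all2_Cons1)

lemma atom_splits_degree: assumes "p > 0" "s : atom_splits p a" shows "atom_degree p (fst s) + atom_degree p (snd s) = atom_degree p a"
proof (cases a)
 case (Tau n)
 have "2 * p ^ n - 1 = p ^ i * (2 * (p ^ (n - i) - 1)) + (2 * p ^ i - 1)" if "i <= n" for i
 proof -
  have "p ^ n = p ^ i * p ^ (n - i)" using that by (simp flip: power_add)
  moreover have "p ^ i > 0" "p ^ (n - i) > 0" using assms by auto
  ultimately show ?thesis by (cases "p ^ i"; cases "p ^ (n - i)") (auto simp: algebra_simps)
 qed
 thus ?thesis using assms(2) Tau by (auto simp: xi_power_def)
next
 case (Xi n q)
 have "q * (2 * (p ^ n - 1)) = p ^ i * q * (2 * (p ^ (n - i) - 1)) + q * (2 * (p ^ i - 1))" if "i <= n" for i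
 proof -
  have "p ^ n = p ^ i * p ^ (n - i)" using that by (simp flip: power_add)
  moreover have "p ^ i > 0" "p ^ (n - i) > 0" using assms by auto
  ultimately show ?thesis by (cases "p ^ i"; cases "p ^ (n - i)") (auto simp: algebra_simps)
 qed
 thus ?thesis using assms(2) Xi by auto
qed

lemma splits_sum: fixes f :: "atom => 'b::comm_monoid_add"
 assumes "S : splits p L" "!!a s. a : set L ==> s : atom_splits p a ==> f (fst s) + f (snd s) = f a"
 shows "(\<Sum>a\<leftarrow>map fst S. f a) + (\<Sum>a\<leftarrow>map snd S. f a) = (\<Sum>a\<leftarrow>L. f a)" using assms
proof (induction L arbitrary: S)
 case (Cons a L)
 then obtain s S' where "S = s # S'" "s : atom_splits p a" "S' : splits p L" by auto
 thus ?case using Cons.IH[of S'] Cons.prems(2) by (simp add: ac_simps) (metis (no_types, lifting) add.assoc add.left_commute)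
qed simp

lemma splits_degree: assumes "p > 0" "S : splits p L" shows "word_degree p (map fst S) + word_degree p (map snd S) = word_degree p L"
 by (rule splits_sum[OF assms(2)]) (rule atom_splits_degree[OF assms(1)])

lemma ntau_eq_sum: "ntau L = (\<Sum>a\<leftarrow>L. of_bool (is_tau a))" by (induction L) auto

lemma splits_ntau: assumes "S : splits p L" shows "ntau (map fst S) + ntau (map snd S) = ntau L" unfolding ntau_eq_sum
proof (rule splits_sum[OF assms])
 fix a s assume "s : atom_splits p a"
 thus "of_bool (is_tau (fst s)) + of_bool (is_tau (snd s)) = (of_bool (is_tau a) :: nat)" by (cases a) auto
qed

lemma splits_length: "S : splits p L ==> length S = length L" by (simp add: splits_iff list_all2_lengthD)

text \<open>Left halves carry exponents \<open>p ^ i * q\<close>, so iterated splitting leaves the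
  words with exponents 1. The class to which \<open>wval_times\<close> applies is closed under
  splitting.\<close>

lemma splits_frobenius: assumes "S : splits p L" "frobenius_word p L" shows "frobenius_word p (map fst S)" "frobenius_word p (map snd S)"
proof -
 have *: "(is_tau (fst s) | (EX k l. fst s = Xi k (p ^ l))) & (is_tau (snd s) | (EX k l. snd s = Xi k (p ^ l)))"
  if s: "s : set S" for s
 proof -
  obtain a where a: "a : set L" "s : atom_splits p a"
   using assms(1) s unfolding splits_iff by (metis in_set_conv_nth list_all2_conv_all_nth)
  show ?thesis
  proof (cases a)
   case (Tau n)
   moreover have "EX l. Suc 0 = p ^ l" by (metis One_nat_def power_0)
   ultimately show ?thesis using a(2) by auto
  next
   case (Xi n q)
   then obtain l where "q = p ^ l" using assms(2) a(1) by (auto simp: frobenius_word_def)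
   thus ?thesis using a(2) Xi by (auto simp flip: power_add)
  qed
 qed
 thus "frobenius_word p (map fst S)" "frobenius_word p (map snd S)" unfolding frobenius_word_def by auto
qed

section \<open>Canonical words of monomials\<close>

definition can_word :: "milnor_monomial => atom list" where
 "can_word m = map Tau (sorted_list_of_set (fst m)) @
   concat (map (%j. replicate (lookup (snd m) j) (Xi j 1)) (sorted_list_of_set (keys (snd m))))"

definition simple_word :: "atom list => bool" where
 "simple_word L \<longleftrightarrow> (ALL a:set L. is_tau a | (EX k. a = Xi k 1))"

lemma simple_frobenius: "simple_word L ==> frobenius_word p L" unfolding simple_word_def frobenius_word_def by (metis power_0)

lemma simple_can_word: "simple_word (can_word m)" by (auto simp: simple_word_def can_word_def)

lemma taus_can_word: "taus (can_word m) = sorted_list_of_set (fst m)" by (simp add: can_word_def) (rule taus_no_tau, auto)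

lemma word_sign_canonical: "word_sign (can_word m) = (1 :: 'k::field)" by (simp add: word_sign_taus taus_can_word tau_sign_sorted)

lemma lookup_simple_word:
 "simple_word L ==> lookup (snd (wmon L)) j = (if j = 0 then 0 else count_list L (Xi j 1))"
proof (induction L)
 case (Cons a L)
 thus ?case by (cases a) (auto simp: simple_word_def lookup_add tau_def xi_power_def lookup_single)
qed simp

lemma count_list_concat: "count_list (concat xss) x = (\<Sum>xs\<leftarrow>xss. count_list xs x)" by (induction xss) auto

lemma count_list_replicate: "count_list (replicate n y) x = (if x = y then n else 0)" by (induction n) auto

lemma count_can_word: "count_list (can_word m) (Xi j (Suc 0)) = lookup (snd m) j"
proof -
 have "count_list (map Tau xs) (Xi j (Suc 0)) = 0" for xs by (induction xs) auto
 thus ?thesis by (simp add: can_word_def count_list_concat o_def count_list_replicate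
    sum_list_distinct_conv_sum_set in_keys_iff)
qed

lemma wmon_canonical: assumes "m : milnor_monomials" shows "wmon (can_word m) = m"
proof (rule prod_eqI)
 show "fst (wmon (can_word m)) = fst m" using assms by (auto simp: fst_wmon taus_can_word milnor_monomials_def)
 show "snd (wmon (can_word m)) = snd m" by (rule poly_mapping_eqI)
   (use assms in \<open>auto simp: lookup_simple_word[OF simple_can_word] count_can_word milnor_monomials_def\<close>)
qed

lemma wval_canonical: "m : milnor_monomials ==> wval th (can_word m) = (th m :: 'k::field)"
 by (simp add: wval_def word_sign_canonical wmon_canonical)

lemma steenrod_times_canonical: fixes th th' :: "'k::{field,finite} steenrod_element"
 assumes "prime (CARD('k))" "odd (CARD('k))" "m : milnor_monomials"
 shows "steenrod_times th th' m = (SUM S:splits (CARD('k)) (can_word m).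
   split_sign S * wval th (map fst S) * wval th' (map snd S))"
 using wval_times[OF assms(1,2) simple_frobenius[OF simple_can_word], of th th' m]
 by (simp add: wval_canonical[OF assms(3)])

lemma steenrod_times_nonzeroD: fixes th th' :: "'k::{field,finite} steenrod_element"
 assumes "prime (CARD('k))" "odd (CARD('k))" "steenrod_times th th' m ~= 0"
 obtains S where "m : milnor_monomials" "S : splits (CARD('k)) (can_word m)"
  "wval th (map fst S) ~= 0" "wval th' (map snd S) ~= 0"
proof -
 have m: "m : milnor_monomials" using assms(3) by (auto simp: steenrod_times_def split: if_splits)
 hence "EX S:splits (CARD('k)) (can_word m). split_sign S * wval th (map fst S) * wval th' (map snd S) ~= 0"
  using assms(3) sum.neutral unfolding steenrod_times_canonical[OF assms(1,2) m] by meson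
 thus ?thesis using that m by auto
qed

lemma milnor_degree_canonical: "m : milnor_monomials ==> word_degree p (can_word m) = milnor_degree p m"
 using milnor_degree_word[of "can_word m" p] by (simp add: taus_can_word wmon_canonical)

lemma ntau_canonical: "ntau (can_word m) = card (fst m)" by (simp flip: length_taus add: taus_can_word)

lemma card_prime_pos: "prime (CARD('k::finite)) ==> 0 < CARD('k)" using prime_gt_0_nat by blast

lemma steenrod_times_closed: fixes th th' :: "'k::{field,finite} steenrod_element"
 assumes "prime (CARD('k))" "odd (CARD('k))" "th : steenrod k" "th' : steenrod l"
 shows "steenrod_times th th' : steenrod (k + l)" unfolding steenrod_def
proof safe
 fix m assume "steenrod_times th th' m ~= 0"
 then obtain S where S: "m : milnor_monomials" "S : splits (CARD('k)) (can_word m)"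
  "wval th (map fst S) ~= 0" "wval th' (map snd S) ~= 0" by (rule steenrod_times_nonzeroD[OF assms(1,2)])
 thus "m : milnor_monomials" "milnor_degree (CARD('k)) m = k + l" using splits_degree[OF card_prime_pos[OF assms(1)] S(2)]
   wval_nonzeroD[OF assms(3) S(3)] wval_nonzeroD[OF assms(4) S(4)] by (auto simp: milnor_degree_canonical)
qed

text \<open>The number of factors \<open>\<tau>\<^sub>i\<close> is a second grading of the Steenrod algebra.\<close>

lemma steenrod_times_ntau: fixes th th' :: "'k::{field,finite} steenrod_element" assumes "prime (CARD('k))" "odd (CARD('k))"
  "!!m. th m ~= 0 ==> d <= card (fst m)" "!!m. th' m ~= 0 ==> e <= card (fst m)"
  "steenrod_times th th' m ~= 0" shows "d + e <= card (fst m)"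
proof -
 obtain S where S: "m : milnor_monomials" "S : splits (CARD('k)) (can_word m)"
  "wval th (map fst S) ~= 0" "wval th' (map snd S) ~= 0" using steenrod_times_nonzeroD[OF assms(1,2,5)] by blast
 have "d <= card (fst (wmon (map fst S)))" "e <= card (fst (wmon (map snd S)))"
  using S assms(3,4) by (auto simp: wval_def)
 moreover have "card (fst (wmon (map fst S))) = ntau (map fst S)"
   "card (fst (wmon (map snd S))) = ntau (map snd S)"
  using S(3,4) card_wmon[where 'k = 'k] unfolding wval_def by (metis mult_zero_left)+
 ultimately show ?thesis using splits_ntau[OF S(2)] by (simp add: ntau_canonical)
qed

text \<open>In a canonical word every letter has degree at least 1 and, as \<open>j < p ^ j\<close>,
  an index bounded by its degree. A fixed total degree therefore bounds both the length and the
  alphabet.\<close>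

lemma finite_milnor_degree: assumes "p > 1" shows "finite {m \<in> milnor_monomials. milnor_degree p m = k}"
proof -
 let ?A = "Tau ` {..k} \<union> (%j. Xi j 1) ` {..k}"
 have "{m \<in> milnor_monomials. milnor_degree p m = k} <= wmon ` {L. set L <= ?A & length L <= k}"
 proof safe
  fix m assume m: "m : milnor_monomials" and k: "k = milnor_degree p m"
  let ?L = "can_word m"
  have a: "1 <= atom_degree p a & a : Tau ` {..atom_degree p a} \<union> (%j. Xi j 1) ` {..atom_degree p a}" if "a : set ?L" for a
  proof (cases a)
   case (Tau i)
   have "i < p ^ i" using assms by (simp add: power_gt_expt)
   thus ?thesis using Tau by auto
  next
   case (Xi j q)
   hence "q = 1" "count_list ?L (Xi j (Suc 0)) ~= 0"
    using that simple_can_word[of m] by (auto simp: simple_word_def count_list_0_iff)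
   hence "j ~= 0" using m by (auto simp: count_can_word milnor_monomials_def intro!: gr0I)
   moreover have "j < p ^ j" using assms by (simp add: power_gt_expt)
   ultimately show ?thesis using Xi \<open>q = 1\<close> by auto
  qed
  have "length ?L <= word_degree p ?L" using sum_list_mono[of ?L "%_. 1" "atom_degree p"] a by (simp add: sum_list_triv)
  moreover have "atom_degree p a <= word_degree p ?L" if "a : set ?L" for a using that by (intro member_le_sum_list) auto
  ultimately have "?L : {L. set L <= ?A & length L <= k}"
   using a unfolding k milnor_degree_canonical[OF m, symmetric, of p] by fastforce
  thus "m : wmon ` {L. set L <= Tau ` {..milnor_degree p m} \<union> (%j. Xi j 1) ` {..milnor_degree p m} & length L <= milnor_degree p m}"
   unfolding k by (intro image_eqI[of _ _ ?L]) (auto simp: wmon_canonical[OF m])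
 qed
 moreover have "finite {L. set L <= ?A & length L <= k}" by (rule finite_lists_length_le) auto
 ultimately show ?thesis by (rule finite_surj[rotated])
qed

section \<open>Milnor basis elements of large excess vanish\<close>

lemma list_all2_memD: "list_all2 P xs ys ==> y : set ys ==> EX x:set xs. P x y"
 by (induction rule: list_all2_induct) auto

lemma in_set_taus: "n : set (taus L) \<longleftrightarrow> Tau n : set L" by (induction L rule: taus.induct) auto

text \<open>Milnor's excess: by \<open>unstable_excess\<close> below, the dual of \<open>m\<close>
  annihilates all classes of degree less than this number in an unstable module.\<close>

definition excess :: "milnor_monomial => nat" where
 "excess m = card (fst m) + 2 * exponent_sum (snd m)"

fun atom_index :: "atom => nat" where
 "atom_index (Tau n) = n"
| "atom_index (Xi n q) = n"

fun lower_atom :: "atom => atom" where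
 "lower_atom (Tau n) = Tau (n - 1)"
| "lower_atom (Xi n q) = Xi (n - 1) q"

text \<open>The share of a letter in the excess. It is also what is missing from the degree to twice
  a power of p, uniformly for tau and xi (\<open>atom_degree_slots\<close>).\<close>

definition atom_slots :: "atom => nat" where
 "atom_slots a = (if is_tau a then 1 else 2)"

abbreviation word_slots :: "atom list => nat" where
 "word_slots L == \<Sum>a\<leftarrow>L. atom_slots a"

lemma word_slots_canonical: "word_slots (can_word m) = excess m"
proof -
 have "word_slots (concat (map (%j. replicate (r j) (Xi j 1)) js)) = (\<Sum>j\<leftarrow>js. 2 * r j)" for r js
  by (induction js) (simp_all add: atom_slots_def sum_list_replicate)
 moreover have "word_slots (map Tau xs) = length xs" for xs by (induction xs) (simp_all add: atom_slots_def)
 ultimately show ?thesis by (simp add: can_word_def excess_def exponent_sum_def sum_list_distinct_conv_sum_set sum_distrib_left)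
qed

lemma atom_degree_slots:
 "p > 0 ==> is_tau a | (EX k. a = Xi k 1) ==> atom_degree p a + atom_slots a = 2 * p ^ atom_index a"
 by (cases a; cases "p ^ atom_index a") (auto simp: atom_slots_def)

lemma word_degree_slots:
 "p > 0 ==> simple_word L ==> word_degree p L + word_slots L = 2 * (\<Sum>a\<leftarrow>L. p ^ atom_index a)"
proof (induction L)
 case (Cons a L)
 thus ?case using atom_degree_slots[of p a] by (simp add: simple_word_def)
qed simp

lemma no_xi_0_canonical: assumes "m : milnor_monomials" "a : set (can_word m)" shows "is_tau a | atom_index a > 0"
proof (cases a)
 case (Xi k q)
 hence "q = 1" using assms(2) simple_can_word[of m] by (auto simp: simple_word_def)
 hence "lookup (snd m) k ~= 0" using assms(2) Xi by (simp flip: count_can_word add: count_list_0_iff)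
 thus ?thesis using assms(1) Xi by (auto simp: milnor_monomials_def intro!: gr0I)
qed simp

lemma no_xi_0_canonical_ball: "m : milnor_monomials ==> ALL a:set (can_word m). is_tau a | atom_index a > 0"
 by (intro ballI) (rule no_xi_0_canonical)

text \<open>Bounds the excess within a fixed degree, so that an induction towards larger excess
  terminates.\<close>

lemma excess_le_degree: assumes "p > 1" "m : milnor_monomials" shows "excess m <= milnor_degree p m"
proof -
 have "atom_slots a <= atom_degree p a" if "a : set (can_word m)" for a
 proof (cases a)
  case (Tau n)
  have "1 <= p ^ n" using assms(1) by simp
  hence "1 <= 2 * p ^ n - 1" by linarith
  thus ?thesis using Tau by (simp add: atom_slots_def)
 next
  case (Xi k q)
  hence "q = 1" "k > 0" using that simple_can_word[of m] no_xi_0_canonical[OF assms(2) that] by (auto simp: simple_word_def)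
  moreover have "1 < p ^ k" using assms(1) \<open>k > 0\<close> by (rule one_less_power)
  ultimately show ?thesis using Xi by (simp add: atom_slots_def)
 qed
 thus ?thesis unfolding word_slots_canonical[symmetric] milnor_degree_canonical[OF assms(2), symmetric] by (rule sum_list_mono)
qed

text \<open>The term of the coproduct of \<open>tau_n\<close> or \<open>xi_n\<close> whose right
  half has its index lowered by one. Its left half is a power of \<open>xi_1\<close>, the only
  generator on which a reduced power can be nonzero.\<close>

definition raised_split :: "nat => atom => atom \<times> atom" where
 "raised_split p a = (Xi 1 (p ^ (atom_index a - 1)), lower_atom a)"

lemma sum_list_eq_imp_pointwise: fixes f g :: "'a => nat"
 assumes "!!x. x : set xs ==> f x <= g x" "(\<Sum>x\<leftarrow>xs. f x) = (\<Sum>x\<leftarrow>xs. g x)" "x : set xs"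
 shows "f x = g x" using assms
proof (induction xs)
 case (Cons y xs)
 have "(\<Sum>x\<leftarrow>xs. f x) <= (\<Sum>x\<leftarrow>xs. g x)" "f y <= g y" using Cons.prems(1) by (auto intro: sum_list_mono)
 hence "f y = g y" "(\<Sum>x\<leftarrow>xs. f x) = (\<Sum>x\<leftarrow>xs. g x)" using Cons.prems(2) by simp_all
 thus ?case using Cons by auto
qed simp

text \<open>A factor \<open>\<xi>\<^sub>1^i \<otimes> m'\<close> of the coproduct arises by lowering indices by one, and \<open>i\<close> is so large
  that lowering all of them is the only way to keep the excess.\<close>

lemma reduced_power_splits: fixes D :: "atom list" assumes p: "p > 0" "p = CARD('k::{field,finite})"
  and L: "simple_word L" "ALL a:set L. is_tau a | atom_index a > 0"
  and S: "S : splits p L" "wval (reduced_power i) (map fst S) ~= (0::'k)"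
  and D: "simple_word D" "distinct (taus D)" "distinct (taus (map snd S))"
   "wmon (map snd S) = wmon D" "i = (\<Sum>a\<leftarrow>D. p ^ atom_index a)" shows "word_slots D <= word_slots L"
  and "word_slots D = word_slots L ==> S = map (raised_split p) L & (ALL a:set L. atom_index a > 0)"
proof -
 \<comment> \<open>\<open>?f\<close> is the exponent of \<open>xi_1\<close> that a split contributes
   on the left; \<open>?c\<close> is the largest value possible for the given right half, attained
   exactly by raised splits.\<close>
 let ?f = "%s :: atom \<times> atom. lookup (snd (amon (fst s))) 1"
 let ?c = "%s :: atom \<times> atom. p ^ atom_index (snd s)"
 have wm: "wmon (map fst S) = xi_power 1 i" using S(2) by (auto simp: wval_def reduced_power_def milnor_dual_def split: if_splits)
 have look: "lookup (snd (amon (fst s))) k = 0" if "s : set S" "k > 1" for s k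
 proof -
  have "(\<Sum>a\<leftarrow>map fst S. lookup (snd (amon a)) k) = 0"
   unfolding lookup_wmon[symmetric] wm using that(2) by (simp add: xi_power_def lookup_single)
  thus ?thesis using that(1) by (simp add: sum_list_eq_0_iff)
 qed
 have notau: "~ is_tau (fst s)" if "s : set S" for s
 proof
  assume "is_tau (fst s)"
  then obtain n where n: "fst s = Tau n" by (cases "fst s") auto
  have "Tau n : set (map fst S)" using n that by force
  hence "n : set (taus (map fst S))" by (simp only: in_set_taus)
  thus False using wm by (simp flip: fst_wmon add: xi_power_def)
 qed
 \<comment> \<open>The left monomial is a power of \<open>xi_1\<close>, so every left half is a
   power of \<open>xi_1\<close> or a unit: an index either stays or drops by one.\<close>
 have rel: "(s = raised_split p a & atom_index a > 0 & ?f s = ?c s) | (snd s = a & ?f s = 0)"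
  if s: "s : set S" and a: "a : set L" "s : atom_splits p a" for a s
 proof -
  have pp: "p ^ j > 0" for j using p(1) by simp
  have dich: "i <= n ==> n - i <= 1 ==> i = n | (n > 0 & i = n - 1)" for i n :: nat by arith
  show ?thesis
  proof (cases a)
   case (Tau n)
   then obtain j where j: "j <= n" "s = (Xi (n - j) (p ^ j), Tau j)" using a notau[OF s] by auto
   have "n - j <= 1"
   proof (rule ccontr)
    assume "~ n - j <= 1"
    hence "p ^ j = 0" using look[OF s, of "n - j"] unfolding j(2) by (simp add: xi_power_def split: if_splits)
    thus False using pp[of j] by simp
   qed
   thus ?thesis using dich[OF j(1)] j Tau by (auto simp: raised_split_def xi_power_def)
  next
   case (Xi n q)
   hence "q = 1" "n > 0" using L a by (auto simp: simple_word_def)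
   then obtain j where j: "j <= n" "s = (Xi (n - j) (p ^ j), Xi j 1)" using a Xi by auto
   have "n - j <= 1"
   proof (rule ccontr)
    assume "~ n - j <= 1"
    hence "p ^ j = 0" using look[OF s, of "n - j"] unfolding j(2) by (simp add: xi_power_def split: if_splits)
    thus False using pp[of j] by simp
   qed
   thus ?thesis using dich[OF j(1)] j Xi \<open>q = 1\<close> by (auto simp: raised_split_def xi_power_def)
  qed
 qed
 have all2: "list_all2 (%a s. a : set L & s : set S & s : atom_splits p a) L S"
  using S(1) unfolding splits_iff list_all2_conv_all_nth by auto
 have mem: "EX a:set L. s : atom_splits p a" if "s : set S" for s using list_all2_memD[OF all2 that] by blast
 have fc: "?f s <= ?c s" if "s : set S" for s using mem[OF that] rel[OF that] by fastforce
 have sumf: "i = (\<Sum>s\<leftarrow>S. ?f s)" using wm lookup_wmon[of "map fst S" 1] by (simp add: xi_power_def o_def)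
 have slots: "word_slots (map snd S) = word_slots L"
 proof -
  have "list_all2 (%a s. atom_slots a = atom_slots (snd s)) L S" using all2
  proof (rule list_all2_mono)
   fix a s assume "a : set L & s : set S & s : atom_splits p a"
   thus "atom_slots a = atom_slots (snd s)" using notau[of s] by (cases a) (auto simp: atom_slots_def)
  qed
  hence "map atom_slots L = map (%s. atom_slots (snd s)) S"
   by (simp add: list_all2_map1 list_all2_map2 list_eq_iff_nth_eq list_all2_conv_all_nth)
  thus ?thesis by (simp add: o_def)
 qed
 have simpS: "simple_word (map snd S)" unfolding simple_word_def
 proof
  fix b assume "b : set (map snd S)"
  then obtain s where "s : set S" "b = snd s" by auto
  then obtain a where "b = snd s" "a : set L" "s : atom_splits p a" using mem by blast
  thus "is_tau b | (EX k. b = Xi k 1)" using L(1) by (cases a) (auto simp: simple_word_def)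
 qed
 have "word_degree p (map snd S) = word_degree p D" using milnor_degree_word[OF D(2), of p] milnor_degree_word[OF D(3), of p] D(4) by simp
 \<comment> \<open>Degree plus slots of a simple word is twice the sum of its powers of p. For the
   right halves the slots are those of \<open>L\<close>, because no tau went to the left; for
   \<open>D\<close> that sum is \<open>i\<close>, the total of \<open>?f\<close>.\<close>
 hence key: "word_slots L + 2 * (\<Sum>s\<leftarrow>S. ?f s) = word_slots D + 2 * (\<Sum>s\<leftarrow>S. ?c s)"
  using word_degree_slots[OF p(1) simpS] word_degree_slots[OF p(1) D(1)] slots D(5) sumf by (simp add: o_def)
 have "(\<Sum>s\<leftarrow>S. ?f s) <= (\<Sum>s\<leftarrow>S. ?c s)" by (rule sum_list_mono) (rule fc)
 thus "word_slots D <= word_slots L" using key by simp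
 assume "word_slots D = word_slots L"
 hence "(\<Sum>s\<leftarrow>S. ?f s) = (\<Sum>s\<leftarrow>S. ?c s)" using key by simp
 hence eq: "?f s = ?c s" if "s : set S" for s using sum_list_eq_imp_pointwise[of S ?f ?c] fc that by blast
 have "list_all2 (%a s. s = raised_split p a & atom_index a > 0) L S" using all2
 proof (rule list_all2_mono)
  fix a s assume as: "a : set L & s : set S & s : atom_splits p a"
  moreover have "?c s > 0" using p(1) by simp
  ultimately show "s = raised_split p a & atom_index a > 0" using rel[of s a] eq[of s] by auto
 qed
 thus "S = map (raised_split p) L & (ALL a:set L. atom_index a > 0)"
  by (auto simp: list_all2_conv_all_nth in_set_conv_nth intro!: nth_equalityI)
qed

lemma taus_lower: "taus (map lower_atom L) = map (%n. n - 1) (taus L)" by (induction L rule: taus.induct) auto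

lemma simple_lower: "simple_word L ==> simple_word (map lower_atom L)" unfolding simple_word_def
proof
 fix b assume L: "ALL a:set L. is_tau a | (EX k. a = Xi k 1)" and "b : set (map lower_atom L)"
 then obtain a where a: "a : set L" "b = lower_atom a" by auto
 hence "is_tau a | (EX k. a = Xi k 1)" using L by blast
 thus "is_tau b | (EX k. b = Xi k 1)" using a(2) by (cases a) auto
qed

lemma slots_lower: "word_slots (map lower_atom L) = word_slots L"
proof -
 have "atom_slots (lower_atom a) = atom_slots a" for a by (cases a) (auto simp: atom_slots_def)
 thus ?thesis by (simp add: o_def)
qed

lemma count_lower: "(!!a. a : set L ==> is_tau a | atom_index a > 0) ==>
  count_list (map lower_atom L) (Xi j q) = count_list L (Xi (Suc j) q)"
proof (induction L)
 case (Cons a L)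
 thus ?case using Cons.prems[of a] by (cases a) auto
qed simp

text \<open>Lowering turns \<open>xi_1\<close> into a unit and so forgets how often it occurred; the
  excess restores this multiplicity.\<close>

lemma lower_word_inj: assumes m: "m : milnor_monomials" "m0 : milnor_monomials" "0 ~: fst m" "0 ~: fst m0"
  and ex: "excess m = excess m0"
  and eq: "wmon (map lower_atom (can_word m)) = wmon (map lower_atom (can_word m0))" shows "m = m0"
proof -
 have fin: "finite (fst m)" "finite (fst m0)" using m by (auto simp: milnor_monomials_def)
 have "fst (wmon (map lower_atom (can_word m'))) = (%n. n - 1) ` fst m'" if "finite (fst m')" for m'
  using that by (simp add: fst_wmon taus_lower taus_can_word)
 hence "(%n. n - 1) ` fst m = (%n. n - 1) ` fst m0" using fin eq by metis
 moreover have "Suc ` (%n. n - 1) ` E = E" if "0 ~: E" for E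
 proof -
  have "Suc (n - 1) = n" if "n : E" for n using that \<open>0 ~: E\<close> by (cases n) auto
  thus ?thesis by (force simp: image_image)
 qed
 ultimately have 1: "fst m = fst m0" using m by metis
 have look: "lookup (snd (wmon (map lower_atom (can_word m')))) j = lookup (snd m') (Suc j)"
  if "m' : milnor_monomials" "j > 0" for m' j
  using that by (simp add: lookup_simple_word[OF simple_lower[OF simple_can_word]] count_lower[OF no_xi_0_canonical]
    count_can_word)
 have 2: "lookup (snd m) j = lookup (snd m0) j" if "j ~= 1" for j
 proof (cases "j = 0")
  case True
  thus ?thesis using m by (auto simp: milnor_monomials_def)
 next
  case False
  hence "j = Suc (j - 1)" "j - 1 > 0" using that by auto
  thus ?thesis using look[OF m(1), of "j - 1"] look[OF m(2), of "j - 1"] eq by metis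
 qed
 have "exponent_sum (snd m) = exponent_sum (snd m0)" using ex 1 by (simp add: excess_def)
 moreover have "exponent_sum R = lookup R 1 + (SUM j:keys R - {1}. lookup R j)" for R
  unfolding exponent_sum_def by (cases "1 : keys R") (auto simp: sum.remove in_keys_iff)
 moreover have "keys (snd m) - {1} = keys (snd m0) - {1}" using 2 by (auto simp: in_keys_iff)
 moreover have "(SUM j:keys (snd m0) - {1}. lookup (snd m) j) =
  (SUM j:keys (snd m0) - {1}. lookup (snd m0) j)" using 2 by (intro sum.cong) auto
 ultimately have "lookup (snd m) 1 = lookup (snd m0) 1" by simp
 hence "snd m = snd m0" using 2 by (intro poly_mapping_eqI) metis
 thus ?thesis using 1 by (rule prod_eqI[rotated])
qed

lemma zero_notin_of_index: assumes "finite (fst m)" "ALL a:set (can_word m). atom_index a > 0" shows "0 ~: fst m"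
proof
 assume "0 : fst m"
 hence "0 : set (taus (can_word m))" using assms(1) by (simp add: taus_can_word)
 thus False using assms(2) by (force simp: in_set_taus)
qed

definition lowered :: "milnor_monomial => milnor_monomial" where
 "lowered m = wmon (map lower_atom (can_word m))"

text \<open>The exponent of \<open>xi_1\<close> that collects on the left when every letter of the
  canonical word is lowered by its raised split.\<close>

definition lowering_power :: "nat => milnor_monomial => nat" where
 "lowering_power p m = (\<Sum>a\<leftarrow>map lower_atom (can_word m). p ^ atom_index a)"

lemma distinct_taus_lower: assumes "finite (fst m)" "0 ~: fst m" shows "distinct (taus (map lower_atom (can_word m)))"
proof -
 have "inj_on (%n. n - 1) (fst m)"
 proof (rule inj_onI)
  fix x y :: nat assume "x : fst m" "y : fst m" "x - 1 = y - 1"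
  moreover have "x ~= 0" "y ~= 0" using calculation assms(2) by metis+
  ultimately show "x = y" by simp
 qed
 thus ?thesis using assms(1) by (simp add: taus_lower taus_can_word distinct_map)
qed

text \<open>The count on which vanishing rests. With \<open>i\<close> the lowering power and
  \<open>x\<close> of degree less than the excess, the dual of \<open>lowered m\<close> takes
  \<open>x\<close> to a degree less than \<open>2 * i\<close>, where instability kills
  \<open>P^i\<close>.\<close>

lemma lowered_degree: assumes "p > 0" "m : milnor_monomials" "0 ~: fst m"
 shows "milnor_degree p (lowered m) + excess m = 2 * lowering_power p m"
proof -
 have "finite (fst m)" using assms(2) by (auto simp: milnor_monomials_def)
 from milnor_degree_word[OF distinct_taus_lower[OF this assms(3)], of p] show ?thesis
  using word_degree_slots[OF assms(1) simple_lower[OF simple_can_word], of m]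
  by (simp only: lowered_def lowering_power_def slots_lower word_slots_canonical)
qed

lemma split_sign_no_tau: "(!!s. s : set S ==> ~ is_tau (fst s)) ==> split_sign S = (1::'a::field)"
proof (induction S)
 case (Cons s S)
 hence "filter is_tau (map fst S) = []" by (auto simp: filter_empty_conv)
 thus ?case using Cons by simp
qed simp

text \<open>The term 1 tensor \<open>a\<close> of the coproduct, the unit being written with the
  exponent that the coproduct formula gives it.\<close>

definition kept_split :: "nat => atom => atom \<times> atom" where
 "kept_split p a = (Xi 0 (p ^ atom_index a), a)"

lemma can_word_insert_0: assumes "finite (fst m)" "0 : fst m" shows "can_word m = Tau 0 # can_word (fst m - {0}, snd m)"
proof -
 have "sorted_list_of_set (fst m) = 0 # sorted_list_of_set (fst m - {0})" by (rule sorted_distinct_set_unique) (use assms in auto)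
 thus ?thesis by (simp add: can_word_def)
qed

section \<open>Leading terms of products with reduced powers and with the Bockstein\<close>

context assumes prime: "prime (CARD('k::{field,finite}))" and odd: "odd (CARD('k))"
begin

text \<open>Triangularity. A contributing split of \<open>m\<close> gives excess at least that of
  \<open>m0\<close>; in the case of equality it lowers every letter, and
  \<open>lower_word_inj\<close> then recovers \<open>m0\<close>.\<close>

lemma lowering_product_nonzeroD: assumes m0: "m0 : milnor_monomials" "0 ~: fst m0"
  and nz: "steenrod_times (reduced_power (lowering_power (CARD('k)) m0)) (milnor_dual (lowered m0)) m ~= (0::'k)"
 shows "m = m0 | excess m0 < excess m"
proof -
 let ?i = "lowering_power (CARD('k)) m0" and ?D = "map lower_atom (can_word m0)"
 obtain S where m: "m : milnor_monomials" and S: "S : splits (CARD('k)) (can_word m)"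
  "wval (reduced_power ?i) (map fst S) ~= (0::'k)" "wval (milnor_dual (lowered m0)) (map snd S) ~= (0::'k)"
  by (rule steenrod_times_nonzeroD[OF prime odd nz])
 have fin: "finite (fst m0)" "finite (fst m)" using m0 m by (auto simp: milnor_monomials_def)
 have "wmon (map snd S) = wmon ?D" "distinct (taus (map snd S))"
  using S(3) by (auto simp: wval_def milnor_dual_def lowered_def word_sign_taus
    tau_sign_nonzero_iff[where 'k = 'k] split: if_splits)
 note r = reduced_power_splits[OF card_prime_pos[OF prime] refl simple_can_word no_xi_0_canonical_ball[OF m] S(1,2)
   simple_lower[OF simple_can_word] distinct_taus_lower[OF fin(1) m0(2)] this(2,1) lowering_power_def]
 show ?thesis
 proof (cases "excess m0 = excess m")
  case True
  hence "S = map (raised_split (CARD('k))) (can_word m)" "ALL a:set (can_word m). atom_index a > 0"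
   using r(2)[unfolded slots_lower word_slots_canonical, OF True] by blast+
  hence "map snd S = map lower_atom (can_word m)" "0 ~: fst m" using zero_notin_of_index[OF fin(2)] by (auto simp: raised_split_def)
  thus ?thesis using lower_word_inj[OF m m0(1) _ m0(2)] True \<open>wmon (map snd S) = wmon ?D\<close> by metis
 next
  case False
  thus ?thesis using r(1) by (simp only: slots_lower word_slots_canonical) simp
 qed
qed

text \<open>Of all splits of the canonical word only the one that lowers every letter contributes.
  Its term is nonzero because lowering keeps the tau indices distinct when 0 is not among
  them.\<close>

lemma lowering_product_nonzero: assumes m0: "m0 : milnor_monomials" "0 ~: fst m0"
 shows "steenrod_times (reduced_power (lowering_power (CARD('k)) m0)) (milnor_dual (lowered m0)) m0 ~= (0::'k)"
proof -
 let ?i = "lowering_power (CARD('k)) m0" and ?L = "can_word m0"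
 let ?D = "map lower_atom ?L" and ?S = "map (raised_split (CARD('k))) (can_word m0)"
 let ?t = "%S. split_sign S * wval (reduced_power ?i) (map fst S) * wval (milnor_dual (lowered m0)) (map snd S) :: 'k"
 have fin: "finite (fst m0)" using m0 by (auto simp: milnor_monomials_def)
 have pos: "atom_index a > 0" if "a : set ?L" for a
 proof (cases a)
  case (Tau n)
  hence "n : set (taus ?L)" using that by (simp add: in_set_taus)
  hence "n : fst m0" using fin by (simp add: taus_can_word)
  thus ?thesis using Tau m0(2) by (auto intro!: gr0I)
 next
  case (Xi n q)
  thus ?thesis using no_xi_0_canonical[OF m0(1) that] by simp
 qed
 have zero: "?t S = 0" if S: "S : splits (CARD('k)) ?L" "S ~= ?S" for S
 proof (rule ccontr)
  assume nz: "?t S ~= 0"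
  hence "wmon (map snd S) = wmon ?D" "distinct (taus (map snd S))"
   by (auto simp: wval_def milnor_dual_def lowered_def word_sign_taus
     tau_sign_nonzero_iff[where 'k = 'k] split: if_splits)
  note r = reduced_power_splits[OF card_prime_pos[OF prime] refl simple_can_word no_xi_0_canonical_ball[OF m0(1)] S(1) _
    simple_lower[OF simple_can_word] distinct_taus_lower[OF fin(1) m0(2)] this(2,1) lowering_power_def]
  have "wval (reduced_power ?i) (map fst S) ~= (0::'k)" using nz by auto
  thus False using r(2)[OF _ slots_lower] S(2) by blast
 qed
 have mem: "?S : splits (CARD('k)) ?L"
 proof -
  have "raised_split (CARD('k)) a : atom_splits (CARD('k)) a" if "a : set ?L" for a
  proof -
   have "is_tau a | (EX k. a = Xi k 1)" using that simple_can_word[of m0] unfolding simple_word_def by blast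
   thus ?thesis using pos[OF that] by (cases a) (auto simp: raised_split_def image_iff intro!: bexI[of _ "atom_index a - 1"])
  qed
  thus ?thesis by (simp add: splits_iff list_all2_conv_all_nth)
 qed
 have fstS: "map fst ?S = map (%a. Xi 1 (CARD('k) ^ (atom_index a - 1))) ?L" and sndS: "map snd ?S = ?D" by (simp_all add: raised_split_def)
 have idx: "atom_index (lower_atom a) = atom_index a - 1" for a by (cases a) auto
 have "wmon (map fst ?S) = xi_power 1 ?i"
 proof -
  have "wmon (map (%a. Xi 1 (f a)) L) = xi_power 1 (\<Sum>a\<leftarrow>L. f a)" for f and L :: "atom list"
   by (induction L) (auto simp: xi_power_def single_add)
  thus ?thesis unfolding fstS by (simp add: lowering_power_def o_def idx)
 qed
 moreover have "word_sign (map fst ?S) = (1::'k)" unfolding word_sign_taus fstS by (subst taus_no_tau) auto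
 ultimately have v1: "wval (reduced_power ?i) (map fst ?S) = (1::'k)" by (simp only: wval_def reduced_power_def milnor_dual_def) simp
 have v2: "wval (milnor_dual (lowered m0)) (map snd ?S) ~= (0::'k)" unfolding sndS using distinct_taus_lower[OF fin m0(2)]
  by (simp add: wval_def milnor_dual_def lowered_def word_sign_taus tau_sign_nonzero_iff)
 have v3: "split_sign ?S = (1::'k)" by (rule split_sign_no_tau) (auto simp: raised_split_def)
 have "steenrod_times (reduced_power ?i) (milnor_dual (lowered m0)) m0 = (SUM S:splits (CARD('k)) ?L. ?t S)"
  by (rule steenrod_times_canonical[OF prime odd m0(1)])
 also have "... = (SUM S:{?S}. ?t S)" by (rule sum.mono_neutral_right) (use mem zero in auto)
 finally show ?thesis using v1 v2 v3 by simp
qed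

text \<open>The left monomial \<open>tau_0\<close> can only come from the letter
  \<open>Tau 0\<close> going left entirely, as a \<open>Tau n\<close> goes left unchanged or leaves
  powers of xi there; all other letters must stay on the right.\<close>

lemma bockstein_splits: assumes m: "m : milnor_monomials"
  and S: "S : splits (CARD('k)) (can_word m)" "wval bockstein (map fst S) ~= (0::'k)"
 shows "0 : fst m & S = (Tau 0, Xi 0 1) # map (kept_split (CARD('k))) (can_word (fst m - {0}, snd m))"
proof -
 let ?p = "CARD('k)"
 have fin: "finite (fst m)" using m by (auto simp: milnor_monomials_def)
 have wm: "wmon (map fst S) = tau 0" using S(2) by (auto simp: wval_def bockstein_def milnor_dual_def split: if_splits)
 have look: "lookup (snd (amon (fst s))) k = 0" if "s : set S" for s k
 proof -
  have "(\<Sum>a\<leftarrow>map fst S. lookup (snd (amon a)) k) = 0"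
   unfolding lookup_wmon[symmetric] wm by (simp add: tau_def)
  thus ?thesis using that by (simp add: sum_list_eq_0_iff)
 qed
 have taus: "set (taus (map fst S)) = {0}" using wm by (simp flip: fst_wmon add: tau_def)
 have rel: "(a = Tau 0 & s = (Tau 0, Xi 0 1)) | s = kept_split ?p a"
  if s: "s : set S" and a: "a : set (can_word m)" "s : atom_splits ?p a" for a s
 proof -
  have pp: "?p ^ j > 0" for j using card_prime_pos[OF prime] by simp
  show ?thesis
  proof (cases a)
   case (Tau n)
   show ?thesis
   proof (cases "is_tau (fst s)")
    case True
    hence "s = (Tau n, Xi 0 1)" using a(2) Tau by auto
    hence "Tau n : set (map fst S)" using s by force
    hence "n = 0" using taus in_set_taus[of n "map fst S"] by auto
    thus ?thesis using Tau \<open>s = _\<close> by simp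
   next
    case False
    then obtain j where j: "j <= n" "s = (Xi (n - j) (?p ^ j), Tau j)" using a Tau by auto
    hence "n - j = 0" using look[OF s, of "n - j"] pp[of j] by (auto simp: xi_power_def split: if_splits)
    thus ?thesis using j Tau by (auto simp: kept_split_def)
   qed
  next
   case (Xi n q)
   hence "q = 1" using a simple_can_word[of m] by (auto simp: simple_word_def)
   then obtain j where j: "j <= n" "s = (Xi (n - j) (?p ^ j), Xi j 1)" using a Xi by auto
   hence "n - j = 0" using look[OF s, of "n - j"] pp[of j] by (auto simp: xi_power_def split: if_splits)
   thus ?thesis using j Xi \<open>q = 1\<close> by (auto simp: kept_split_def)
  qed
 qed
 have all2: "list_all2 (%a s. a : set (can_word m) & s : set S & s : atom_splits ?p a) (can_word m) S"
  using S(1) unfolding splits_iff list_all2_conv_all_nth by auto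
 have rel2: "list_all2 (%a s. (a = Tau 0 & s = (Tau 0, Xi 0 1)) | s = kept_split ?p a) (can_word m) S"
  using all2 by (rule list_all2_mono) (use rel in blast)
 have "Tau 0 : set (map fst S)" using taus in_set_taus[of 0 "map fst S"] by auto
 then obtain s where s: "s : set S" "fst s = Tau 0" by auto
 then obtain a where a: "a : set (can_word m)" "(a = Tau 0 & s = (Tau 0, Xi 0 1)) | s = kept_split ?p a"
  using list_all2_memD[OF rel2 s(1)] by blast
 hence "a = Tau 0" using s(2) by (auto simp: kept_split_def)
 hence zero: "0 : fst m" using a(1) fin in_set_taus[of 0 "can_word m"] by (simp add: taus_can_word)
 let ?L = "can_word (fst m - {0}, snd m)"
 obtain s0 S1 where S1: "S = s0 # S1" "(s0 = (Tau 0, Xi 0 1)) | s0 = kept_split ?p (Tau 0)"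
  "list_all2 (%a s. (a = Tau 0 & s = (Tau 0, Xi 0 1)) | s = kept_split ?p a) ?L S1"
  using rel2 unfolding can_word_insert_0[OF fin zero] list_all2_Cons1 by blast
 have notin: "Tau 0 ~: set ?L" using fin by (simp flip: in_set_taus add: taus_can_word)
 hence "list_all2 (%a s. s = kept_split ?p a) ?L S1" using S1(3) by (auto simp: list_all2_conv_all_nth) (metis nth_mem)
 hence S1': "S1 = map (kept_split ?p) ?L" by (auto simp: list_all2_conv_all_nth intro!: nth_equalityI)
 have "s0 = (Tau 0, Xi 0 1)" using \<open>Tau 0 : set (map fst S)\<close> S1(2) unfolding S1(1) S1' by (auto simp: kept_split_def)
 thus ?thesis using zero S1(1) S1' by simp
qed

text \<open>The Bockstein strips \<open>tau_0\<close>. No sign arises since \<open>tau_0\<close> is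
  the first letter of the canonical word and all later left halves are even.\<close>

lemma bockstein_times: assumes m: "m : milnor_monomials"
 shows "steenrod_times bockstein th m = (if 0 : fst m then th (fst m - {0}, snd m) else (0::'k))"
proof -
 let ?L = "can_word (fst m - {0}, snd m)"
 let ?S = "(Tau 0, Xi 0 1) # map (kept_split (CARD('k))) ?L"
 let ?t = "%S. split_sign S * wval bockstein (map fst S) * wval th (map snd S) :: 'k"
 have sum: "steenrod_times bockstein th m = (SUM S:splits (CARD('k)) (can_word m). ?t S)"
  by (rule steenrod_times_canonical[OF prime odd m])
 have fin: "finite (fst m)" and m1: "(fst m - {0}, snd m) : milnor_monomials" using m by (auto simp: milnor_monomials_def)
 show ?thesis
 proof (cases "0 : fst m")
  case True
  have "kept_split (CARD('k)) a : atom_splits (CARD('k)) a" if "a : set ?L" for a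
  proof -
   have "is_tau a | (EX k. a = Xi k 1)" using that simple_can_word[of "(fst m - {0}, snd m)"] unfolding simple_word_def by blast
   thus ?thesis by (cases a) (auto simp: kept_split_def image_iff)
  qed
  hence "map (kept_split (CARD('k))) ?L : splits (CARD('k)) ?L" by (simp add: splits_iff list_all2_conv_all_nth)
  hence mem: "?S : splits (CARD('k)) (can_word m)" unfolding can_word_insert_0[OF fin True] by (simp add: image_iff)
  have "wmon (map fst ?S) = tau 0"
  proof -
   have "wmon (map (%a. Xi 0 (f a)) L) = ({}, 0)" for f and L :: "atom list" by (induction L) (auto simp: xi_power_def)
   thus ?thesis by (simp add: kept_split_def o_def tau_def)
  qed
  moreover have "word_sign (map fst ?S) = (1::'k)" unfolding word_sign_taus by (simp add: kept_split_def o_def) (subst taus_no_tau; auto)+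
  ultimately have v1: "wval bockstein (map fst ?S) = (1::'k)" by (simp only: wval_def bockstein_def milnor_dual_def) simp
  have sn: "map snd ?S = Xi 0 1 # ?L" by (simp add: kept_split_def o_def)
  have v2: "wval th (map snd ?S) = th (fst m - {0}, snd m)"
   unfolding sn using wval_canonical[OF m1, of th] monomial_sign_alt[of "xi_power 0 1" "wmon ?L", where 'k = 'k]
   by (simp add: wval_def xi_power_def prod_eq_iff) (metis monomial_times.simps add_0 sup_bot_left surj_pair)
  have v3: "split_sign ?S = (1::'k)"
  proof -
   have "split_sign (map (kept_split (CARD('k))) ?L) = (1::'k)" by (rule split_sign_no_tau) (auto simp: kept_split_def)
   thus ?thesis by simp
  qed
  have "(SUM S:splits (CARD('k)) (can_word m). ?t S) = (SUM S:{?S}. ?t S)"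
   by (rule sum.mono_neutral_right) (use mem bockstein_splits[OF m] in fastforce)+
  thus ?thesis using sum v1 v2 v3 True by (simp del: split_sign.simps)
 next
  case False
  have "?t S = 0" if "S : splits (CARD('k)) (can_word m)" for S using bockstein_splits[OF m that] False by auto
  thus ?thesis using sum False by simp
 qed
qed

end

section \<open>Homogeneous operations and modules over the Steenrod algebra\<close>

lemma steenrodD: assumes "th : steenrod k" "th m ~= (0::'k::{field,finite})"
 shows "m : milnor_monomials" "milnor_degree (CARD('k)) m = k" using assms unfolding steenrod_def by blast+

lemma steenrod_add: "th : steenrod k ==> th' : steenrod k ==> (%m. th m + th' m) : steenrod k"
 unfolding steenrod_def by (auto, (metis add.right_neutral)+)

lemma steenrod_scale: "th : steenrod k ==> (%m. c * th m) : steenrod k" unfolding steenrod_def by auto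

lemma steenrod_zero: "(%m. 0) : steenrod k" unfolding steenrod_def by auto

lemma steenrod_restrict: "th : steenrod k ==> (%m. if P m then th m else 0) : steenrod k"
 unfolding steenrod_def by (auto split: if_splits)

lemma milnor_dual_steenrod:
 "m : milnor_monomials ==> milnor_degree (CARD('k)) m = k ==> (milnor_dual m :: 'k::{field,finite} steenrod_element) : steenrod k"
 unfolding steenrod_def milnor_dual_def by auto

lemma reduced_power_steenrod: "(reduced_power i :: 'k::{field,finite} steenrod_element) : steenrod (2 * i * (CARD('k) - 1))"
 unfolding reduced_power_def by (rule milnor_dual_steenrod) (auto simp: xi_power_def milnor_monomials_def milnor_degree_def lookup_single)

lemma bockstein_steenrod: "(bockstein :: 'k::{field,finite} steenrod_element) : steenrod 1" unfolding bockstein_def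
 by (rule milnor_dual_steenrod) (auto simp: tau_def milnor_monomials_def milnor_degree_def)

lemma steenrod_one_closed: "(steenrod_one :: 'k::{field,finite} steenrod_element) : steenrod 0" unfolding steenrod_one_def
 by (rule milnor_dual_steenrod) (auto simp: milnor_monomials_def milnor_degree_def)

lemma finite_steenrod_support: assumes "prime (CARD('k))" "th : steenrod k" shows "finite {m. th m ~= (0::'k::{field,finite})}"
 by (rule finite_subset[OF _ finite_milnor_degree[OF prime_gt_1_nat[OF assms(1)], of k]])
  (use steenrodD[OF assms(2)] in blast)

context fixes M :: "('k::{field,finite}, 'u) graded_module" assumes M: "steenrod_module M"
begin

lemma sm_vs: "vspace (part M n)" using M by (simp add: steenrod_module_def)

lemma sm_hom: "th : steenrod k ==>
  act M k n th : lin (part M n) (part M (n + k))"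
 using M by (simp add: steenrod_module_def)

lemma sm_closed: "th : steenrod k ==> x : carrier (part M n) ==> act M k n th x : carrier (part M (n + k))"
 using sm_hom by (simp add: module_hom_iff)

lemma sm_add: "th : steenrod k ==> th' : steenrod k ==> x : carrier (part M n) ==>
  act M k n (%m. th m + th' m) x = act M k n th x +[part M (n + k)] act M k n th' x"
 using M by (simp add: steenrod_module_def)

lemma sm_scale: "th : steenrod k ==> x : carrier (part M n) ==>
  act M k n (%m. c * th m) x = c *[part M (n + k)] act M k n th x"
 using M by (simp add: steenrod_module_def)

lemma sm_one: "x : carrier (part M n) ==> act M 0 n steenrod_one x = x" using M by (simp add: steenrod_module_def)

lemma sm_times: "th : steenrod k ==> th' : steenrod l ==> x : carrier (part M n) ==>
  act M (k + l) n (steenrod_times th th') x = act M k (n + l) th (act M l n th' x)"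
 using M by (simp add: steenrod_module_def)

lemma sm_zero: "x : carrier (part M n) ==> act M k n (%m. 0) x = 0[part M (n + k)]"
 using sm_scale[OF steenrod_zero[of k], of x n 0] vs_zero_smult[OF sm_vs sm_closed[OF steenrod_zero]] by simp

lemma sm_act_zero: "th : steenrod k ==> act M k n th 0[part M n] = 0[part M (n + k)]"
 by (rule module_hom_zero[OF sm_vs sm_vs sm_hom])

text \<open>A homogeneous operation is a finite combination of Milnor duals. These are added one at
  a time because the module axioms treat two summands only.\<close>

lemma sm_combination_zero: assumes "prime (CARD('k))" "th : steenrod k" "x : carrier (part M n)"
  and "!!m. th m ~= 0 ==> act M k n (milnor_dual m) x = 0[part M (n + k)]"
 shows "act M k n th x = 0[part M (n + k)]"
proof -
 have "act M k n (%m. if m : A then th m else 0) x = 0[part M (n + k)]"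
  if "finite A" "A <= {m. th m ~= 0}" for A using that
 proof (induction A)
  case empty
  thus ?case by (simp add: sm_zero assms(3))
 next
  case (insert m A)
  have m: "th m ~= 0" using insert by auto
  hence d: "(milnor_dual m :: 'k steenrod_element) : steenrod k" using steenrodD[OF assms(2) m] by (intro milnor_dual_steenrod)
  have "(%m'. if m' : insert m A then th m' else 0) = (%m'. th m * milnor_dual m m' + (if m' : A then th m' else 0))"
   using insert by (auto simp: milnor_dual_def)
  hence "act M k n (%m'. if m' : insert m A then th m' else 0) x =
   th m *[part M (n + k)] act M k n (milnor_dual m) x +[part M (n + k)] 0[part M (n + k)]"
   using sm_add[OF steenrod_scale[OF d, of "th m"] steenrod_restrict[OF assms(2)] assms(3)] sm_scale[OF d assms(3)] insert by simp
  thus ?case using assms(4)[OF m] by (simp add: vs_smult_zero[OF sm_vs] vs_zero_right[OF sm_vs] vs_zero[OF sm_vs])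
 qed
 from this[OF finite_steenrod_support[OF assms(1,2)] subset_refl]
 have "act M k n (%m. if m : {m. th m ~= 0} then th m else 0) x = 0[part M (n + k)]" .
 moreover have "(%m. if m : {m. th m ~= 0} then th m else 0) = th" by (rule ext) simp
 ultimately show ?thesis by (simp only:)
qed

end

context fixes M :: "('k::{field,finite}, 'u) graded_module" assumes U: "unstable M"
begin

lemma um_sm: "steenrod_module M" using U by (simp add: unstable_def)

lemma um_power: assumes "x : carrier (part M n)" "n < 2 * i"
 shows "act M (2 * i * (CARD('k) - 1)) n (reduced_power i) x = 0[part M (n + 2 * i * (CARD('k) - 1))]"
 using U assms unfolding unstable_def by (simp add: Let_def)

lemma um_bockstein: assumes "x : carrier (part M n)" "n < 1 + 2 * i"
 shows "act M 1 (n + 2 * i * (CARD('k) - 1)) bockstein (act M (2 * i * (CARD('k) - 1)) n (reduced_power i) x) =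
  0[part M (n + 2 * i * (CARD('k) - 1) + 1)]" using U assms unfolding unstable_def by (simp add: Let_def)

end

section \<open>Instability in terms of the excess\<close>

context fixes M :: "('k::{field,finite}, 'u) graded_module" assumes prime: "prime (CARD('k))" and odd: "odd (CARD('k))" and U: "unstable M"
begin

text \<open>Without \<open>tau_0\<close> the operation is \<open>P^i\<close> after the dual of the
  lowered monomial. A factor \<open>tau_0\<close> is stripped first and restored by the Bockstein;
  this is why the instability condition for the Bockstein after \<open>P^i\<close> is needed besides
  the one for \<open>P^i\<close>.\<close>

lemma vanishing_leading_term: assumes m0: "m0 : milnor_monomials" and x: "x : carrier (part M n)" and ex: "n < excess m0"
 obtains ps where "ps : steenrod (milnor_degree (CARD('k)) m0)" "ps m0 ~= 0"
  "!!m. ps m ~= 0 ==> m = m0 | excess m0 < excess m"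
  "act M (milnor_degree (CARD('k)) m0) n ps x = 0[part M (n + milnor_degree (CARD('k)) m0)]"
proof -
 define m1 where "m1 = (fst m0 - {0}, snd m0)"
 have fin: "finite (fst m0)" and m1: "m1 : milnor_monomials" "0 ~: fst m1" using m0 by (auto simp: milnor_monomials_def m1_def)
 define i where "i = lowering_power (CARD('k)) m1"
 define l where "l = milnor_degree (CARD('k)) (lowered m1)"
 define k where "k = 2 * i * (CARD('k) - 1)"
 define ps where "ps = steenrod_times (reduced_power i) (milnor_dual (lowered m1) :: 'k steenrod_element)"
 have low: "lowered m1 : milnor_monomials" unfolding lowered_def by (rule wmon_milnor)
 have li: "l + excess m1 = 2 * i" unfolding l_def i_def by (rule lowered_degree[OF card_prime_pos[OF prime] m1])
 have d: "milnor_dual (lowered m1) : (steenrod l :: 'k steenrod_element set)" by (rule milnor_dual_steenrod) (auto simp: low l_def)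
 note rp = reduced_power_steenrod[where 'k = 'k, of i, folded k_def]
 have ps: "ps : steenrod (k + l)" unfolding ps_def by (rule steenrod_times_closed[OF prime odd rp d])
 have ps1: "ps m1 ~= 0" unfolding ps_def i_def by (rule lowering_product_nonzero[OF prime odd m1])
 have ps2: "m = m1 | excess m1 < excess m" if "ps m ~= 0" for m
  using lowering_product_nonzeroD[OF prime odd m1] that unfolding ps_def i_def by blast
 have deg1: "milnor_degree (CARD('k)) m1 = k + l" by (rule steenrodD(2)[OF ps ps1])
 let ?y = "act M l n (milnor_dual (lowered m1)) x"
 have y: "?y : carrier (part M (n + l))" by (rule sm_closed[OF um_sm[OF U] d x])
 have act: "act M (k + l) n ps x = act M k (n + l) (reduced_power i) ?y" unfolding ps_def by (rule sm_times[OF um_sm[OF U] rp d x])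
 show ?thesis
 proof (cases "0 : fst m0")
  case False
  hence "m1 = m0" by (simp add: m1_def)
  have "act M k (n + l) (reduced_power i) ?y = 0[part M (n + l + k)]"
   unfolding k_def by (rule um_power[OF U y]) (use li ex \<open>m1 = m0\<close> in simp)
  hence "act M (k + l) n ps x = 0[part M (n + l + k)]" by (simp only: act)
  moreover have "n + l + k = n + milnor_degree (CARD('k)) m0" "k + l = milnor_degree (CARD('k)) m0" using deg1 \<open>m1 = m0\<close> by simp_all
  ultimately show ?thesis
   using ps ps1 ps2 unfolding \<open>m1 = m0\<close> by (intro that[of ps]) (simp_all only: not_False_eq_True)
 next
  case True
  \<comment> \<open>Stripping \<open>tau_0\<close> loses one unit of excess. The degree of
    \<open>?y\<close> is then at most \<open>2 * i\<close>, instead of less than it, which is just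
    what instability of the Bockstein after \<open>P^i\<close> tolerates.\<close>
  have ex1: "excess m0 = Suc (excess m1)" using card.remove[OF fin True] by (simp add: excess_def m1_def)
  let ?\<chi> = "steenrod_times bockstein ps"
  have \<chi>: "?\<chi> : steenrod (1 + (k + l))" by (rule steenrod_times_closed[OF prime odd bockstein_steenrod ps])
  have \<chi>1: "?\<chi> m0 ~= 0" using bockstein_times[OF prime odd m0, of ps] True ps1 by (simp add: m1_def)
  have deg: "milnor_degree (CARD('k)) m0 = 1 + (k + l)" by (rule steenrodD(2)[OF \<chi> \<chi>1])
  have \<chi>2: "m = m0 | excess m0 < excess m" if "?\<chi> m ~= 0" for m
  proof -
   have m: "m : milnor_monomials" by (rule steenrodD(1)[OF \<chi> that])
   hence z: "0 : fst m" "ps (fst m - {0}, snd m) ~= 0"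
    using bockstein_times[OF prime odd m, of ps] that by (auto split: if_splits)
   have "excess m = Suc (excess (fst m - {0}, snd m))"
    using card.remove[OF _ z(1)] m by (auto simp: excess_def milnor_monomials_def)
   moreover have "m = m0" if "(fst m - {0}, snd m) = m1" using that z(1) True by (intro prod_eqI) (auto simp: m1_def)
   ultimately show ?thesis using ps2[OF z(2)] ex1 by auto
  qed
  have "act M (1 + (k + l)) n ?\<chi> x = act M 1 (n + (k + l)) bockstein (act M (k + l) n ps x)"
   by (rule sm_times[OF um_sm[OF U] bockstein_steenrod ps x])
  also have "... = act M 1 (n + l + k) bockstein (act M k (n + l) (reduced_power i) ?y)" by (simp add: act ac_simps)
  also have "... = 0[part M (n + l + k + 1)]" unfolding k_def by (rule um_bockstein[OF U y]) (use li ex ex1 in simp)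
  finally have "act M (1 + (k + l)) n ?\<chi> x = 0[part M (n + l + k + 1)]" .
  moreover have "n + l + k + 1 = n + milnor_degree (CARD('k)) m0" using deg by simp
  ultimately show ?thesis using \<chi> \<chi>1 \<chi>2 unfolding deg[symmetric] by (intro that[of ?\<chi>]) (simp_all only: not_False_eq_True)
 qed
qed

text \<open>Apart from its leading term, the vanishing operation \<open>ps\<close> involves only
  larger excess, where the induction hypothesis applies; hence the leading term vanishes too. The
  excess is at most the degree \<open>k\<close>, so the measure decreases.\<close>

lemma unstable_milnor_dual: assumes "m0 : milnor_monomials" and x: "x : carrier (part M n)" and "n < excess m0"
  "milnor_degree (CARD('k)) m0 = k" shows "act M k n (milnor_dual m0) x = 0[part M (n + k)]" using assms(1,3,4)
proof (induction "k - excess m0" arbitrary: m0 rule: less_induct)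
 case less
 let ?V = "part M (n + k)"
 note V = sm_vs[OF um_sm[OF U], of "n + k"]
 obtain ps where ps: "ps : steenrod k" "ps m0 ~= 0"
  "!!m. ps m ~= 0 ==> m = m0 | excess m0 < excess m" "act M k n ps x = 0[?V]"
  using vanishing_leading_term[OF less.prems(1) x less.prems(2)] less.prems(3) by metis
 let ?ps' = "%m. if m ~= m0 then ps m else 0"
 have d: "(milnor_dual m0 :: 'k steenrod_element) : steenrod k" using less.prems by (intro milnor_dual_steenrod)
 have ps': "?ps' : steenrod k" by (rule steenrod_restrict[OF ps(1)])
 have "act M k n ?ps' x = 0[?V]"
 proof (rule sm_combination_zero[OF um_sm[OF U] prime ps' x])
  fix m assume "?ps' m ~= 0"
  hence m: "m ~= m0" "ps m ~= 0" by (auto split: if_splits)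
  hence mk: "m : milnor_monomials" "milnor_degree (CARD('k)) m = k" "excess m0 < excess m"
   using steenrodD[OF ps(1) m(2)] ps(3)[of m] by auto
  hence "excess m <= k" using excess_le_degree[OF prime_gt_1_nat[OF prime] mk(1)] by simp
  thus "act M k n (milnor_dual m) x = 0[?V]" using mk less.prems(2) by (intro less.hyps) auto
 qed
 moreover have "ps = (%m. ps m0 * milnor_dual m0 m + ?ps' m)" by (auto simp: milnor_dual_def)
 ultimately have "0[?V] = ps m0 *[?V] act M k n (milnor_dual m0) x"
  using sm_add[OF um_sm[OF U] steenrod_scale[OF d, of "ps m0"] ps' x] sm_scale[OF um_sm[OF U] d x, of "ps m0"] ps(4)
   vs_zero_right[OF V vs_smult[OF V sm_closed[OF um_sm[OF U] d x]]] by metis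
 hence "inverse (ps m0) *[?V] (ps m0 *[?V] act M k n (milnor_dual m0) x) = 0[?V]"
  by (metis vs_smult_zero[OF V])
 thus ?case using ps(2) sm_closed[OF um_sm[OF U] d x] by (simp add: vs_smult_smult[OF V] vs_one_smult[OF V])
qed

theorem unstable_excess:
 assumes "th : steenrod k" "x : carrier (part M n)" "!!m. excess m <= n ==> th m = 0"
 shows "act M k n th x = 0[part M (n + k)]"
proof (rule sm_combination_zero[OF um_sm[OF U] prime assms(1,2)])
 fix m assume m: "th m ~= 0"
 hence "m : milnor_monomials" "milnor_degree (CARD('k)) m = k" "n < excess m"
  using steenrodD[OF assms(1) m] assms(3)[of m] m by (auto simp: not_le[symmetric])
 thus "act M k n (milnor_dual m) x = 0[part M (n + k)]" by (intro unstable_milnor_dual assms(2))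
qed

end

section \<open>A module detecting all Milnor basis elements of small excess\<close>

lemma mk_vs_simps [simp]: "carrier (mk_vs C z ad sm) = C" "zero (mk_vs C z ad sm) = z"
 "add (mk_vs C z ad sm) = ad" "module.smult (mk_vs C z ad sm) = sm" by (simp_all add: mk_vs_def)

lemma vectorspace_functions: fixes C :: "('s => 'k::field) set"
 assumes "(%w. 0) : C" "!!x y. x : C ==> y : C ==> (%w. x w + y w) : C"
  "!!c x. x : C ==> (%w. c * x w) : C"
 shows "vspace (mk_vs C (%w. 0) (%x y w. x w + y w) (%c x w. c * x w))"
 by (rule vectorspace_classI) (auto simp: assms algebra_simps)

text \<open>Differs from \<open>atom_slots\<close> at \<open>Xi 0 1\<close>, which serves as padding
  and must cost nothing.\<close>

definition atom_weight :: "atom => nat" where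
 "atom_weight a = (if is_tau a then 1 else if atom_index a = 0 then 0 else 2)"

abbreviation word_weight :: "atom list => nat" where
 "word_weight L == \<Sum>a\<leftarrow>L. atom_weight a"

text \<open>Words of length exactly n, filled up by units. The bound on the weight leaves room for
  the monomials of excess at most n (\<open>padded_word\<close>) and forces instability.\<close>

definition excess_words :: "nat => atom list set" where
 "excess_words n = {L. length L = n & simple_word L & word_weight L <= n}"

definition test_module :: "nat => ('k::{field,finite}, atom list => 'k) graded_module" where
 "test_module n = \<lparr>
   component = (%m. mk_vs {y. ALL L. y L ~= 0 --> L : excess_words n & n + word_degree (CARD('k)) L = m}
    (%L. 0) (%x y L. x L + y L) (%c x L. c * x L)), act = (%k m th y L. if L : excess_words n
    then SUM S:splits (CARD('k)) L. split_sign S * wval th (map fst S) * y (map snd S) else 0)\<rparr>"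

lemma test_component_simps [simp]: "carrier (part (test_module n :: ('k::{field,finite}, _) graded_module) m) =
  {y. ALL L. y L ~= 0 --> L : excess_words n & n + word_degree (CARD('k)) L = m}"
 "0[part (test_module n :: ('k, _) graded_module) m] = (%L. 0)"
 "x +[part (test_module n :: ('k, _) graded_module) m] y = (%L. x L + y L)"
 "c *[part (test_module n :: ('k, _) graded_module) m] x = (%L. c * x L)" by (simp_all add: test_module_def)

lemma test_act: "act (test_module n) k m th y L = (if L : excess_words n
  then SUM S:splits (CARD('k)) L. split_sign S * wval th (map fst S) * y (map snd S) else (0::'k::{field,finite}))"
 by (simp add: test_module_def)

text \<open>Splitting the right or the left half of a split word once more gives the same triples of
  words: the coassociativity of the coproduct.\<close>

lemma sum_atom_splits_Tau: "(SUM s:atom_splits p (Tau n). f s) = f (Tau n, Xi 0 1) + (\<Sum>i\<le>n. f (Xi (n - i) (p ^ i), Tau i))"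
 by (simp add: image_iff sum.reindex inj_on_def)

lemma sum_atom_splits_Xi: "(SUM s:atom_splits p (Xi n q). f s) = (\<Sum>i\<le>n. f (Xi (n - i) (p ^ i * q), Xi i q))"
 by (simp add: sum.reindex inj_on_def)

lemma sum_triangle_shift: fixes f :: "nat => nat => 'b::comm_monoid_add"
 shows "(\<Sum>i\<le>n. \<Sum>j\<le>i. f i j) = (\<Sum>j\<le>n. \<Sum>i\<le>n - j. f (i + j) j)"
proof -
 have "(\<Sum>i\<le>n. \<Sum>j\<le>i. f i j) = (SUM (i, j):Sigma {..n} (%i. {..i}). f i j)" by (rule sum.Sigma) auto
 also have "... = (SUM (j, i):Sigma {..n} (%j. {..n - j}). f (i + j) j)"
  by (rule sum.reindex_bij_witness[of _ "%(j, i). (i + j, j)" "%(i, j). (j, i - j)"]) auto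
 also have "... = (\<Sum>j\<le>n. \<Sum>i\<le>n - j. f (i + j) j)" by (rule sum.Sigma[symmetric]) auto
 finally show ?thesis .
qed

lemma atom_splits_coassoc: fixes f :: "atom => atom => atom => 'b::comm_monoid_add"
 shows "(SUM s:atom_splits p a. SUM s':atom_splits p (snd s). f (fst s) (fst s') (snd s')) =
  (SUM s:atom_splits p a. SUM s':atom_splits p (fst s). f (fst s') (snd s') (snd s))"
proof (cases a)
 case (Tau n)
 have "(\<Sum>i\<le>n. \<Sum>j\<le>i. f (Xi (n - i) (p ^ i)) (Xi (i - j) (p ^ j)) (Tau j)) =
  (\<Sum>j\<le>n. \<Sum>i\<le>n - j. f (Xi (n - j - i) (p ^ i * p ^ j)) (Xi i (p ^ j)) (Tau j))"
  unfolding sum_triangle_shift by (simp add: power_add ac_simps)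
 thus ?thesis unfolding Tau sum_atom_splits_Tau fst_conv snd_conv sum_atom_splits_Xi by (simp add: sum.distrib add.assoc)
next
 case (Xi n q)
 have "(\<Sum>i\<le>n. \<Sum>j\<le>i. f (Xi (n - i) (p ^ i * q)) (Xi (i - j) (p ^ j * q)) (Xi j q)) =
  (\<Sum>j\<le>n. \<Sum>i\<le>n - j. f (Xi (n - j - i) (p ^ i * (p ^ j * q))) (Xi i (p ^ j * q)) (Xi j q))"
  unfolding sum_triangle_shift by (simp add: power_add ac_simps)
 thus ?thesis unfolding Xi fst_conv snd_conv sum_atom_splits_Xi by simp
qed

lemma splits_coassoc: fixes f :: "atom list => atom list => atom list => 'b::comm_monoid_add"
 shows "(SUM S:splits p L. SUM S':splits p (map snd S). f (map fst S) (map fst S') (map snd S')) =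
  (SUM S:splits p L. SUM S':splits p (map fst S). f (map fst S') (map snd S') (map snd S))"
proof (induction L arbitrary: f)
 case (Cons a L)
 have "(SUM S:splits p (a # L). SUM S':splits p (map snd S). f (map fst S) (map fst S') (map snd S')) =
  (SUM s:atom_splits p a. SUM s':atom_splits p (snd s). SUM S:splits p L. SUM S':splits p (map snd S).
   f (fst s # map fst S) (fst s' # map fst S') (snd s' # map snd S'))"
  by (simp only: sum_splits_Cons list.map) (rule sum.cong[OF refl], rule sum.swap)
 also have "... = (SUM s:atom_splits p a. SUM s':atom_splits p (snd s). SUM S:splits p L. SUM S':splits p (map fst S).
   f (fst s # map fst S') (fst s' # map snd S') (snd s' # map snd S))"
 proof (rule sum.cong[OF refl], rule sum.cong[OF refl])
  fix s s'
  show "(SUM S:splits p L. SUM S':splits p (map snd S). f (fst s # map fst S) (fst s' # map fst S') (snd s' # map snd S')) =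
   (SUM S:splits p L. SUM S':splits p (map fst S). f (fst s # map fst S') (fst s' # map snd S') (snd s' # map snd S))"
   by (rule Cons.IH[where f = "%X Y Z. f (fst s # X) (fst s' # Y) (snd s' # Z)"])
 qed
 also have "... = (SUM s:atom_splits p a. SUM s':atom_splits p (fst s). SUM S:splits p L. SUM S':splits p (map fst S).
   f (fst s' # map fst S') (snd s' # map snd S') (snd s # map snd S))"
  by (rule atom_splits_coassoc[where f = "%x y z. SUM S:splits p L. SUM S':splits p (map fst S).
    f (x # map fst S') (y # map snd S') (z # map snd S)"])
 also have "... = (SUM S:splits p (a # L). SUM S':splits p (map fst S). f (map fst S') (map snd S') (map snd S))"
  by (simp only: sum_splits_Cons list.map) (rule sum.cong[OF refl], rule sum.swap)
 finally show ?case .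
qed simp

text \<open>The exponent in \<open>split_sign\<close> as a function of two separate words. In this
  form it is additive in either argument under splitting, since a tau goes to exactly one
  half.\<close>

fun koszul_exponent :: "atom list => atom list => nat" where
 "koszul_exponent (y # Y) (x # X) = of_bool (is_tau y) * ntau X + koszul_exponent Y X"
| "koszul_exponent _ _ = 0"

lemma split_sign_koszul: "split_sign S = ((- 1) ^ koszul_exponent (map snd S) (map fst S) :: 'k::field)" by (induction S) (auto simp: power_add)

lemma koszul_add_left: assumes "S : splits p L" "length X = length L"
 shows "koszul_exponent L X = koszul_exponent (map fst S) X + koszul_exponent (map snd S) X" using assms
proof (induction L arbitrary: S X)
 case (Cons a L)
 then obtain x X' s S' where "X = x # X'" "S = s # S'" "s : atom_splits p a" "S' : splits p L" "length X' = length L" by (cases X) auto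
 moreover have "of_bool (is_tau a) = (of_bool (is_tau (fst s)) + of_bool (is_tau (snd s)) :: nat)"
  using \<open>s : atom_splits p a\<close> by (cases a) auto
 ultimately show ?case using Cons.IH[of S' X'] by (simp add: algebra_simps)
qed auto

lemma koszul_add_right: assumes "S : splits p L" "length Y = length L"
 shows "koszul_exponent Y L = koszul_exponent Y (map fst S) + koszul_exponent Y (map snd S)" using assms
proof (induction L arbitrary: S Y)
 case (Cons a L)
 then obtain y Y' s S' where "Y = y # Y'" "S = s # S'" "s : atom_splits p a" "S' : splits p L" "length Y' = length L" by (cases Y) auto
 thus ?case using Cons.IH[of S' Y'] splits_ntau[of S' p L] by (simp add: algebra_simps flip: add_mult_distrib2)
qed auto

text \<open>A tau that goes left leaves \<open>Xi 0 1\<close> of weight 0, and lowering a xi never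
  increases the weight. The second inequality provides the strict drop needed for the
  Bockstein.\<close>

lemma excess_words_split: assumes "L : excess_words n" "S : splits p L"
 shows "map snd S : excess_words n" "word_weight (map snd S) + ntau (map fst S) <= word_weight L"
proof -
 have L: "length L = n" "simple_word L" "word_weight L <= n" using assms(1) by (auto simp: excess_words_def)
 have all: "list_all2 (%a s. (is_tau (snd s) | (EX k. snd s = Xi k 1)) &
   atom_weight (snd s) + of_bool (is_tau (fst s)) <= atom_weight a) L S" using assms(2) unfolding splits_iff
 proof (rule list.rel_mono_strong)
  fix a s assume "a : set L" "s : atom_splits p a"
  have "(is_tau (snd s) | (EX k. snd s = Xi k 1)) &
   atom_weight (snd s) + of_bool (is_tau (fst s)) <= atom_weight a" if "is_tau a | (EX k. a = Xi k 1)" "s : atom_splits p a"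
   using that by (cases a) (auto simp: atom_weight_def)
  thus "(is_tau (snd s) | (EX k. snd s = Xi k 1)) & atom_weight (snd s) + of_bool (is_tau (fst s)) <= atom_weight a"
   using L(2) \<open>a : set L\<close> \<open>s : atom_splits p a\<close> unfolding simple_word_def by blast
 qed
 hence "(\<Sum>s\<leftarrow>S. atom_weight (snd s) + of_bool (is_tau (fst s))) <= word_weight L" by (induction rule: list_all2_induct) auto
 thus le: "word_weight (map snd S) + ntau (map fst S) <= word_weight L" unfolding ntau_eq_sum by (simp add: sum_list_addf o_def)
 have "simple_word (map snd S)" using all by (induction rule: list_all2_induct) (auto simp: simple_word_def)
 thus "map snd S : excess_words n" using le L splits_length[OF assms(2)] by (simp add: excess_words_def)
qed

lemma wval_add: "wval (%m. th m + th' m) L = wval th L + wval th' L"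
 by (simp add: wval_def algebra_simps)

lemma wval_scale: "wval (%m. c * th m) L = c * wval th L" by (simp add: wval_def algebra_simps)

definition test_unit :: "nat => atom list => 'a::field" where
 "test_unit n L = (if L = replicate n (Xi 0 1) then 1 else 0)"

lemma test_unit_closed: "test_unit n : carrier (part (test_module n :: ('k::{field,finite}, _) graded_module) n)"
 by (auto simp: test_unit_def excess_words_def simple_word_def atom_weight_def sum_list_replicate)

definition unit_split :: "atom => atom \<times> atom" where
 "unit_split a = (a, Xi 0 1)"

context assumes prime: "prime (CARD('k::{field,finite}))" and odd: "odd (CARD('k))"
begin

lemma steenrod_one_splits: assumes "simple_word L" "S : splits (CARD('k)) L" "wval steenrod_one (map fst S) ~= (0::'k)"
 shows "S = map (kept_split (CARD('k))) L"
proof -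
 have wm: "wmon (map fst S) = ({}, 0)" using assms(3) by (auto simp: wval_def steenrod_one_def milnor_dual_def split: if_splits)
 have look: "lookup (snd (amon (fst s))) k = 0" if "s : set S" for s k
 proof -
  have "(\<Sum>a\<leftarrow>map fst S. lookup (snd (amon a)) k) = 0" unfolding lookup_wmon[symmetric] wm by simp
  thus ?thesis using that by (simp add: sum_list_eq_0_iff)
 qed
 have "set (taus (map fst S)) = {}" using wm by (simp flip: fst_wmon)
 hence notau: "~ is_tau (fst s)" if "s : set S" for s using that in_set_taus[of _ "map fst S"] by (cases "fst s") force+
 have "list_all2 (%a s. s = kept_split (CARD('k)) a) L S" using assms(2) unfolding splits_iff
 proof (rule list.rel_mono_strong)
  fix a s assume a: "a : set L" "s : atom_splits (CARD('k)) a" "s : set S"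
  have "is_tau a | (EX k. a = Xi k 1)" using assms(1) a by (auto simp: simple_word_def)
  then obtain j b where j: "j <= atom_index a" "s = (Xi (atom_index a - j) (CARD('k) ^ j), b)"
   "b = a | j ~= atom_index a" using a notau[OF a(3)] by (cases a) auto
  have "atom_index a - j = 0"
  proof (rule ccontr)
   assume "atom_index a - j ~= 0"
   hence "CARD('k) ^ j = 0" using look[OF a(3), of "atom_index a - j"] unfolding j(2) by (simp add: xi_power_def split: if_splits)
   thus False using card_prime_pos[OF prime] by simp
  qed
  thus "s = kept_split (CARD('k)) a" using j by (simp add: kept_split_def)
 qed
 thus ?thesis by (auto simp: list_all2_conv_all_nth intro!: nth_equalityI)
qed

lemma kept_split_props: assumes "simple_word L" shows "map (kept_split (CARD('k))) L : splits (CARD('k)) L"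
  "map snd (map (kept_split (CARD('k))) L) = L"
  "wval steenrod_one (map fst (map (kept_split (CARD('k))) L)) = (1::'k)"
  "split_sign (map (kept_split (CARD('k))) L) = (1::'k)"
proof -
 have "kept_split (CARD('k)) a : atom_splits (CARD('k)) a" if "a : set L" for a
 proof -
  have "is_tau a | (EX k. a = Xi k 1)" using that assms unfolding simple_word_def by blast
  thus ?thesis by (cases a) (auto simp: kept_split_def image_iff)
 qed
 thus "map (kept_split (CARD('k))) L : splits (CARD('k)) L" by (simp add: splits_iff list_all2_conv_all_nth)
 have *: "map fst (map (kept_split (CARD('k))) L) = map (%a. Xi 0 (CARD('k) ^ atom_index a)) L" by (simp add: kept_split_def)
 have "wmon (map (%a. Xi 0 (f a)) L) = ({}, 0)" for f and L :: "atom list" by (induction L) (auto simp: xi_power_def)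
 moreover have "taus (map (%a. Xi 0 (f a)) L) = []" for f and L :: "atom list" by (induction L) auto
 ultimately show "wval steenrod_one (map fst (map (kept_split (CARD('k))) L)) = (1::'k)"
  unfolding * by (simp add: wval_def word_sign_taus steenrod_one_def milnor_dual_def)
 show "split_sign (map (kept_split (CARD('k))) L) = (1::'k)" by (rule split_sign_no_tau) (auto simp: kept_split_def)
qed (simp add: kept_split_def o_def)

text \<open>Coassociativity with signs: both sides are sums over triple splittings of one function,
  whose sign exponent collects the three pairwise crossings.\<close>

lemma test_module_times: fixes th th' :: "'k steenrod_element" assumes L: "L : excess_words n"
 shows "(SUM S:splits (CARD('k)) L. split_sign S * wval (steenrod_times th th') (map fst S) * y (map snd S)) =
  (SUM S:splits (CARD('k)) L. split_sign S * wval th (map fst S) *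
   (SUM S':splits (CARD('k)) (map snd S). split_sign S' * wval th' (map fst S') * y (map snd S')))"
  (is "?l = ?r")
proof -
 let ?p = "CARD('k)"
 let ?f = "%X Y Z. (- 1) ^ (koszul_exponent Z X + koszul_exponent Z Y + koszul_exponent Y X) *
  (wval th X * wval th' Y * y Z)"
 have fr: "frobenius_word ?p (map fst S)" if "S : splits ?p L" for S
  using splits_frobenius[OF that] L by (auto simp: excess_words_def intro: simple_frobenius)
 have "?l = (SUM S:splits ?p L. SUM S':splits ?p (map fst S). ?f (map fst S') (map snd S') (map snd S))"
 proof (rule sum.cong[OF refl])
  fix S assume S: "S : splits ?p L"
  show "split_sign S * wval (steenrod_times th th') (map fst S) * y (map snd S) =
   (SUM S':splits ?p (map fst S). ?f (map fst S') (map snd S') (map snd S))"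
   unfolding wval_times[OF prime odd fr[OF S]] sum_distrib_left sum_distrib_right
  proof (rule sum.cong[OF refl])
   fix S' assume S': "S' : splits ?p (map fst S)"
   show "split_sign S * (split_sign S' * wval th (map fst S') * wval th' (map snd S')) * y (map snd S) =
    ?f (map fst S') (map snd S') (map snd S)" unfolding split_sign_koszul koszul_add_right[OF S', of "map snd S", simplified] power_add
    by (simp add: mult_ac)
  qed
 qed
 also have "... = (SUM S:splits ?p L. SUM S':splits ?p (map snd S). ?f (map fst S) (map fst S') (map snd S'))"
  by (rule splits_coassoc[symmetric])
 also have "... = ?r"
 proof (rule sum.cong[OF refl])
  fix S assume S: "S : splits ?p L"
  show "(SUM S':splits ?p (map snd S). ?f (map fst S) (map fst S') (map snd S')) = split_sign S * wval th (map fst S) *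
   (SUM S':splits (CARD('k)) (map snd S). split_sign S' * wval th' (map fst S') * y (map snd S'))" unfolding sum_distrib_left
  proof (rule sum.cong[OF refl])
   fix S' assume S': "S' : splits ?p (map snd S)"
   show "?f (map fst S) (map fst S') (map snd S') = split_sign S * wval th (map fst S) *
    (split_sign S' * wval th' (map fst S') * y (map snd S'))"
    unfolding split_sign_koszul koszul_add_left[OF S', of "map fst S", simplified] power_add by (simp add: mult_ac)
  qed
 qed
 finally show ?thesis .
qed

lemma test_module_steenrod: "steenrod_module (test_module n :: ('k, _) graded_module)"
proof -
 let ?M = "test_module n :: ('k, _) graded_module" and ?p = "CARD('k)"
 have vs: "vspace (part ?M m)" for m unfolding test_module_def graded_module.simps
  by (rule vectorspace_functions) (auto, (metis add.right_neutral)+)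
 have closed: "act ?M k m th y : carrier (part ?M (m + k))"
  if th: "th : steenrod k" and y: "y : carrier (part ?M m)" for k m th y
 proof -
  have "L : excess_words n & n + word_degree ?p L = m + k" if nz: "act ?M k m th y L ~= 0" for L
  proof -
   have L: "L : excess_words n" using nz by (auto simp: test_act split: if_splits)
   obtain S where S: "S : splits ?p L" "split_sign S * wval th (map fst S) * y (map snd S) ~= 0"
    using nz L unfolding test_act by (auto elim: sum.not_neutral_contains_not_neutral)
   hence "word_degree ?p (map fst S) = k" "n + word_degree ?p (map snd S) = m" using wval_nonzeroD[OF th, of "map fst S"] y by auto
   thus ?thesis using L splits_degree[OF card_prime_pos[OF prime] S(1)] by simp
  qed
  thus ?thesis by simp
 qed
 have act_closed: "act ?M k m th : lin (part ?M m) (part ?M (m + k))"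
  if "th : steenrod k" for k m th unfolding module_hom_iff
 proof (intro conjI ballI allI)
  fix x y c assume "x : carrier (part ?M m)"
  show "act ?M k m th x : carrier (part ?M (m + k))" by (rule closed) fact+
  show "act ?M k m th (x +[part ?M m] y) = act ?M k m th x +[part ?M (m + k)] act ?M k m th y"
   by (auto simp: test_act algebra_simps sum.distrib)
  show "act ?M k m th (c *[part ?M m] x) = c *[part ?M (m + k)] act ?M k m th x"
   by (auto simp: test_act algebra_simps sum_distrib_left)
 qed
 have one: "act ?M 0 m steenrod_one y = y" if y: "y : carrier (part ?M m)" for m y
 proof
  fix L
  show "act ?M 0 m steenrod_one y L = y L"
  proof (cases "L : excess_words n")
   case True
   hence L: "simple_word L" by (simp add: excess_words_def)
   have "act ?M 0 m steenrod_one y L = (SUM S:{map (kept_split ?p) L}. split_sign S * wval steenrod_one (map fst S) * y (map snd S))"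
    unfolding test_act if_P[OF True] by (rule sum.mono_neutral_right) (use steenrod_one_splits[OF L] kept_split_props(1)[OF L] in auto)
   thus ?thesis using kept_split_props[OF L] by (simp del: map_map)
  next
   case False
   thus ?thesis using y by (auto simp: test_act)
  qed
 qed
 show ?thesis unfolding steenrod_module_def
 proof (intro conjI allI ballI vs act_closed one)
  fix k l m and th th' :: "'k steenrod_element" and x and c :: 'k
  show "act ?M k m (%m. th m + th' m) x = act ?M k m th x +[part ?M (m + k)] act ?M k m th' x"
   by (auto simp: test_act wval_add algebra_simps sum.distrib)
  show "act ?M k m (%m. c * th m) x = c *[part ?M (m + k)] act ?M k m th x"
   by (auto simp: test_act wval_scale algebra_simps sum_distrib_left)
  show "act ?M (k + l) m (steenrod_times th th') x = act ?M k (m + l) th (act ?M l m th' x)"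
  proof
   fix L
   show "act ?M (k + l) m (steenrod_times th th') x L = act ?M k (m + l) th (act ?M l m th' x) L"
    using excess_words_split(1)[of L n] by (auto simp: test_act test_module_times intro!: sum.cong)
  qed
 qed
qed

text \<open>Letter by letter: if \<open>xi_1\<close> appears on the left with exponent
  \<open>p ^ j\<close>, the right half has index \<open>j\<close>, and \<open>2 * p ^ j\<close> is
  its degree plus the weight 1 or 2 of the original letter.\<close>

lemma reduced_power_degree_bound: assumes L: "L : excess_words n" "S : splits (CARD('k)) L"
  and nz: "wval (reduced_power i) (map fst S) ~= (0::'k)" shows "2 * i <= word_degree (CARD('k)) (map snd S) + word_weight L"
proof -
 let ?p = "CARD('k)"
 have wm: "wmon (map fst S) = xi_power 1 i" using nz by (auto simp: wval_def reduced_power_def milnor_dual_def split: if_splits)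
 have i: "i = (\<Sum>s\<leftarrow>S. lookup (snd (amon (fst s))) 1)"
  using lookup_wmon[of "map fst S" 1] unfolding wm by (simp add: xi_power_def o_def)
 have "list_all2 (%a s. 2 * lookup (snd (amon (fst s))) 1 <= atom_degree ?p (snd s) + atom_weight a) L S"
  using L(2) unfolding splits_iff
 proof (rule list.rel_mono_strong)
  fix a s assume a: "a : set L" "s : atom_splits ?p a"
  have pp: "Suc 0 <= ?p ^ j" for j using card_prime_pos[OF prime] by (simp add: Suc_le_eq)
  have ns: "n - j = Suc 0 ==> n ~= 0" for n j :: nat by simp
  have "is_tau a | (EX k. a = Xi k 1)" using L(1) a by (auto simp: excess_words_def simple_word_def)
  thus "2 * lookup (snd (amon (fst s))) 1 <= atom_degree ?p (snd s) + atom_weight a"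
  proof (cases a)
   case (Tau n)
   thus ?thesis using a(2) pp by (auto simp: xi_power_def tau_def lookup_single when_def atom_weight_def)
  next
   case (Xi n q)
   hence "q = 1" using \<open>is_tau a | _\<close> by auto
   then obtain j where j: "j <= n" "s = (Xi (n - j) (?p ^ j), Xi j 1)" using a(2) Xi by auto
   show ?thesis using pp[of j] j Xi by (cases "?p ^ j") (auto simp: xi_power_def lookup_single when_def atom_weight_def)
  qed
 qed
 hence "2 * (\<Sum>s\<leftarrow>S. lookup (snd (amon (fst s))) 1) <= (\<Sum>s\<leftarrow>S. atom_degree ?p (snd s)) + word_weight L"
  by (induction rule: list_all2_induct) auto
 thus ?thesis unfolding i by (simp add: o_def)
qed

lemma test_reduced_power_nonzeroD: assumes y: "y : carrier (part (test_module n :: ('k, _) graded_module) m)"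
  and nz: "act (test_module n) k m (reduced_power i) y L ~= (0::'k)" shows "n + 2 * i <= m + word_weight L"
proof -
 let ?p = "CARD('k)"
 have L: "L : excess_words n" using nz by (auto simp: test_act split: if_splits)
 obtain S where S: "S : splits ?p L" "split_sign S * wval (reduced_power i) (map fst S) * y (map snd S) ~= 0"
  using nz L unfolding test_act by (auto elim: sum.not_neutral_contains_not_neutral)
 hence "n + word_degree ?p (map snd S) = m" using y by auto
 thus ?thesis using reduced_power_degree_bound[OF L S(1), of i] S(2) by auto
qed

lemma test_module_unstable: "unstable (test_module n :: ('k, _) graded_module)" unfolding unstable_def
proof (intro conjI allI ballI test_module_steenrod, unfold Let_def, intro conjI impI)
 let ?M = "test_module n :: ('k, _) graded_module" and ?p = "CARD('k)"
 fix m i x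
 let ?k = "2 * i * (?p - 1)"
 assume x: "x : carrier (part ?M m)"
 let ?y = "act ?M ?k m (reduced_power i) x"
 show "?y = 0[part ?M (m + ?k)]" if "m < 2 * i"
 proof -
  have "?y L = 0" for L
  proof (rule ccontr)
   assume nz: "?y L ~= 0"
   hence "word_weight L <= n" by (auto simp: test_act excess_words_def split: if_splits)
   thus False using test_reduced_power_nonzeroD[OF x nz] that by simp
  qed
  thus ?thesis by auto
 qed
 show "act ?M 1 (m + ?k) bockstein ?y = 0[part ?M (m + ?k + 1)]" if "m < 1 + 2 * i"
 proof -
  have "act ?M 1 (m + ?k) bockstein ?y L = 0" for L
  proof (rule ccontr)
   assume nz: "act ?M 1 (m + ?k) bockstein ?y L ~= 0"
   hence L: "L : excess_words n" by (rule contrapos_np) (simp add: test_act)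
   obtain S where S: "S : splits ?p L" "split_sign S * wval bockstein (map fst S) * ?y (map snd S) ~= 0"
    using nz L unfolding test_act[of n 1] by (auto elim: sum.not_neutral_contains_not_neutral)
   have "card (fst (wmon (map fst S))) = ntau (map fst S)"
    by (rule card_wmon[where 'k = 'k]) (use S(2) in \<open>auto simp: wval_def\<close>)
   moreover have "wmon (map fst S) = tau 0" using S(2) by (auto simp: wval_def bockstein_def milnor_dual_def split: if_splits)
   ultimately have "ntau (map fst S) = 1" by (simp add: tau_def)
   \<comment> \<open>The Bockstein takes exactly one tau to the left, so the right word has one unit
     of weight to spare. This is the difference between the two instability bounds.\<close>
   hence "word_weight (map snd S) < n" using excess_words_split(2)[OF L S(1)] L by (simp add: excess_words_def)
   thus False using test_reduced_power_nonzeroD[OF x, of ?k i "map snd S"] S(2) that by auto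
  qed
  thus ?thesis by auto
 qed
qed

lemma test_act_unit: assumes L: "L : excess_words n" shows "act (test_module n) k n th (test_unit n) L = (wval th L :: 'k)"
proof -
 let ?p = "CARD('k)"
 let ?t = "%S. split_sign S * wval th (map fst S) * test_unit n (map snd S) :: 'k"
 have len: "length L = n" and simple: "is_tau a | (EX k. a = Xi k 1)" if "a : set L" for a
  using L that by (auto simp: excess_words_def simple_word_def)
 have len: "length L = n" using L by (simp add: excess_words_def)
 have u: "S = map unit_split L" if S: "S : splits ?p L" "?t S ~= 0" for S
 proof -
  have r: "map snd S = replicate n (Xi 0 1)" using S(2) by (auto simp: test_unit_def split: if_splits)
  have "list_all2 (%a s. s = unit_split a) L S" using S(1) unfolding splits_iff
  proof (rule list.rel_mono_strong)
   fix a s assume a: "a : set L" "s : set S" "s : atom_splits ?p a"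
   have "snd s : set (map snd S)" using a by simp
   hence "snd s = Xi 0 1" unfolding r by simp
   thus "s = unit_split a" using a simple[OF a(1)] by (cases a) (auto simp: unit_split_def)
  qed
  thus ?thesis by (auto simp: list_all2_conv_all_nth intro!: nth_equalityI)
 qed
 have mem: "map unit_split L : splits ?p L"
 proof -
  have "unit_split a : atom_splits ?p a" if "a : set L" for a
   using simple[OF that] by (cases a) (auto simp: unit_split_def image_iff intro!: bexI[of _ 0])
  thus ?thesis by (simp add: splits_iff list_all2_conv_all_nth)
 qed
 have "koszul_exponent (replicate m (Xi 0 1)) X = 0" for m X
 proof (induction m arbitrary: X)
  case (Suc m)
  thus ?case by (cases X) auto
 qed simp
 hence "koszul_exponent (map (%a. Xi 0 1) L) X = 0" for X by (simp add: map_replicate_const)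
 hence sgn: "split_sign (map unit_split L) = (1::'k)" by (simp add: split_sign_koszul unit_split_def o_def)
 have "act (test_module n) k n th (test_unit n) L = (SUM S:{map unit_split L}. ?t S)" unfolding test_act if_P[OF L]
 proof (rule sum.mono_neutral_right)
  show "{map unit_split L} <= splits ?p L" using mem by simp
  show "ALL S:splits ?p L - {map unit_split L}. ?t S = 0" using u by blast
 qed simp
 also have "... = ?t (map unit_split L)" by simp
 also have "... = wval th L"
 proof -
  have m: "map fst (map unit_split L) = L" "map snd (map unit_split L) = replicate n (Xi 0 1)"
   using len by (simp_all add: unit_split_def o_def map_replicate_const)
  show ?thesis unfolding m sgn by (simp add: test_unit_def)
 qed
 finally show ?thesis .
qed

text \<open>Every letter of a canonical word takes at least one slot, so its length is at most the
  excess and units can fill it up to length n. Units change neither the monomial nor the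
  sign.\<close>

lemma padded_word: assumes m: "m : milnor_monomials" "excess m <= n"
 obtains L where "L : excess_words n" "!!th :: 'k steenrod_element. wval th L = th m"
proof -
 let ?C = "can_word m"
 let ?L = "?C @ replicate (n - length ?C) (Xi 0 1)"
 have w: "atom_weight a = atom_slots a" if "a : set ?C" for a
  using no_xi_0_canonical[OF m(1) that] by (auto simp: atom_weight_def atom_slots_def)
 hence ww: "word_weight ?C = excess m" by (simp flip: word_slots_canonical cong: map_cong)
 have "length ?C <= word_slots ?C" using sum_list_mono[of ?C "%_. 1" atom_slots] by (simp add: sum_list_triv atom_slots_def)
 hence "length ?C <= n" using m(2) by (simp add: word_slots_canonical)
 moreover have "simple_word ?L" using simple_can_word[of m] by (auto simp: simple_word_def)
 ultimately have L: "?L : excess_words n" using ww m(2) by (simp add: excess_words_def sum_list_replicate atom_weight_def)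
 have "taus (replicate r (Xi 0 1)) = []" for r by (induction r) auto
 moreover have "wmon (replicate r (Xi 0 1)) = ({}, 0)" for r by (induction r) (auto simp: xi_power_def)
 moreover have "monomial_times m ({}, 0) = m" by (cases m) simp
 ultimately have "wval th ?L = th m" for th :: "'k steenrod_element" using word_sign_canonical[of m, where 'k = 'k]
  by (simp add: wval_def word_sign_taus wmon_append wmon_canonical[OF m(1)])
 thus ?thesis using that L by blast
qed

text \<open>Finiteness is what allows each component to be embedded into an arbitrary infinite type,
  the only place where freeness can be tested.\<close>

lemma finite_test_component: "finite (carrier (part (test_module n :: ('k, _) graded_module) m))"
proof -
 let ?p = "CARD('k)"
 let ?W = "{L. set L <= Tau ` {..m} \<union> (%j. Xi j 1) ` {..m} & length L = n}"
 have "L : ?W" if L: "L : excess_words n" "n + word_degree ?p L = m" for L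
 proof -
  have "a : Tau ` {..m} \<union> (%j. Xi j 1) ` {..m}" if a: "a : set L" for a
  proof -
   have d: "atom_degree ?p a <= m" using member_le_sum_list[of "atom_degree ?p a" "map (atom_degree ?p) L"] a L(2) by auto
   have "is_tau a | (EX k. a = Xi k 1)" using L(1) a by (auto simp: excess_words_def simple_word_def)
   moreover have "k < ?p ^ k" for k using prime_gt_1_nat[OF prime] by (simp add: power_gt_expt)
   ultimately have "atom_index a <= atom_degree ?p a"
   proof (cases a)
    case (Tau i)
    thus ?thesis using \<open>!!k. k < ?p ^ k\<close>[of i] by simp
   next
    case (Xi i q)
    thus ?thesis using \<open>!!k. k < ?p ^ k\<close>[of i] \<open>is_tau a | _\<close> by auto
   qed
   thus ?thesis using d \<open>is_tau a | _\<close> by (cases a) auto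
  qed
  thus ?thesis using L(1) by (auto simp: excess_words_def)
 qed
 hence "carrier (part (test_module n :: ('k, _) graded_module) m) <=
   {y. ALL L. (L : ?W --> y L : (UNIV::'k set)) & (L ~: ?W --> y L = 0)}" by fastforce
 moreover have "finite ?W" by (rule finite_lists_length_eq) auto
 hence "finite {y. ALL L. (L : ?W --> y L : (UNIV::'k set)) & (L ~: ?W --> y L = 0)}"
  by (rule finite_set_of_finite_funs) auto
 ultimately show ?thesis by (rule finite_subset)
qed

end

section \<open>The structure of the free unstable module\<close>

text \<open>A copy of \<open>M\<close> along injections, one for each degree. The injections need
  not be related, since all operations are conjugated degree by degree.\<close>

definition transport_module ::
  "(nat => 'v => 'u) => ('k::{field,finite}, 'v) graded_module => ('k, 'u) graded_module" where
 "transport_module g M = (let h = (%m. inv_into (carrier (part M m)) (g m)) in \<lparr>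
   component = (%m. mk_vs (g m ` carrier (part M m)) (g m 0[part M m])
    (%x y. g m (h m x +[part M m] h m y)) (%c x. g m (c *[part M m] h m x))),
   act = (%k m th x. g (m + k) (act M k m th (h m x)))\<rparr>)"

lemma transport_component_simps [simp]: "carrier (part (transport_module g M) m) = g m ` carrier (part M m)"
 "0[part (transport_module g M) m] = g m 0[part M m]" by (simp_all add: transport_module_def)

context fixes g :: "nat => 'v => 'u" and M :: "('k::{field,finite}, 'v) graded_module"
 assumes inj: "!!m. inj_on (g m) (carrier (part M m))"
begin

lemma transport_add: "x : carrier (part M m) ==> y : carrier (part M m) ==>
  g m x +[part (transport_module g M) m] g m y = g m (x +[part M m] y)"
 by (simp add: transport_module_def inj)

lemma transport_smult: "x : carrier (part M m) ==>
  c *[part (transport_module g M) m] g m x = g m (c *[part M m] x)"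
 by (simp add: transport_module_def inj)

lemma transport_act:
 "x : carrier (part M m) ==> act (transport_module g M) k m th (g m x) = g (m + k) (act M k m th x)"
 by (simp add: transport_module_def inj)

lemma transport_steenrod_module: assumes M: "steenrod_module M" shows "steenrod_module (transport_module g M)" unfolding steenrod_module_def
proof (intro conjI allI ballI)
 let ?T = "transport_module g M"
 note V = sm_vs[OF M]
 note s = transport_add transport_smult transport_act vs_add[OF V] vs_smult[OF V] vs_zero[OF V] sm_closed[OF M]
 show "vspace (part ?T m)" for m
 proof (rule vectorspace_classI, goal_cases)
  case 1
  thus ?case by (simp add: s)
 qed ((unfold transport_component_simps)?, (elim imageE)?, simp add: s vs_assoc[OF V] vs_neg[OF V] vs_smult_smult[OF V] vs_one_smult[OF V] vs_add_smult[OF V]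
   vs_smult_add[OF V] vs_zero_right[OF V] vs_comm[OF V] vs_lcomm[OF V])+
 fix k l m and th th' :: "'k steenrod_element" and c :: 'k and x
 show "act ?T k m th : lin (part ?T m) (part ?T (m + k))" if t: "th : steenrod k"
  using sm_hom[OF M t, of m] unfolding module_hom_iff by (auto simp: s)
 show "act ?T k m (%m. th m + th' m) x = act ?T k m th x +[part ?T (m + k)] act ?T k m th' x"
  if "th : steenrod k" "th' : steenrod k" "x : carrier (part ?T m)" using that by (auto simp: s sm_add[OF M])
 show "act ?T k m (%m. c * th m) x = c *[part ?T (m + k)] act ?T k m th x"
  if "th : steenrod k" "x : carrier (part ?T m)" using that by (auto simp: s sm_scale[OF M])
 show "act ?T 0 m steenrod_one x = x" if "x : carrier (part ?T m)" using that by (auto simp: s sm_one[OF M])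
 show "act ?T (k + l) m (steenrod_times th th') x = act ?T k (m + l) th (act ?T l m th' x)"
  if "th : steenrod k" "th' : steenrod l" "x : carrier (part ?T m)"
  using that by (clarsimp simp: s sm_times[OF M]) (simp add: ac_simps)
qed

lemma transport_unstable: assumes prime: "prime (CARD('k))" and odd: "odd (CARD('k))" and U: "unstable M" shows "unstable (transport_module g M)"
proof -
 note M = um_sm[OF U]
 have "act (transport_module g M) 1 (m + 2 * i * (CARD('k) - 1)) bockstein
   (act (transport_module g M) (2 * i * (CARD('k) - 1)) m (reduced_power i) (g m x)) =
  g (m + 2 * i * (CARD('k) - 1) + 1) (act M 1 (m + 2 * i * (CARD('k) - 1)) bockstein (act M (2 * i * (CARD('k) - 1)) m (reduced_power i) x))"
  if "x : carrier (part M m)" for m i x using that by (simp only: transport_act sm_closed[OF M reduced_power_steenrod])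
 thus ?thesis unfolding unstable_def Let_def using um_power[OF U] um_bockstein[OF U]
  by (auto simp: transport_steenrod_module[OF M] transport_act)
qed

end

lemma ex_inj_on_infinite: assumes "finite A" "infinite (UNIV :: 'u set)" shows "EX f :: 'v => 'u. inj_on f A"
proof -
 obtain B :: "'u set" where "finite B" "card B = card A" using infinite_arbitrarily_large[OF assms(2)] by blast
 thus ?thesis using finite_same_card_bij[OF assms(1), of B] by (auto simp: bij_betw_def)
qed

definition restrict_module :: "('k::{field,finite}, 'u) graded_module => (nat => 'u set) => ('k, 'u) graded_module" where
 "restrict_module M N = \<lparr>component = (%m. (part M m)\<lparr>carrier := N m\<rparr>), act = act M\<rparr>"

lemma restrict_module_simps [simp]:
 "part (restrict_module M N) m = (part M m)\<lparr>carrier := N m\<rparr>" "act (restrict_module M N) = act M"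
 by (simp_all add: restrict_module_def)

lemma is_submoduleD: assumes "steenrod_module M" "is_submodule N M"
 shows "N m <= carrier (part M m)" "0[part M m] : N m"
  "x : N m ==> y : N m ==> x +[part M m] y : N m"
  "x : N m ==> c *[part M m] x : N m"
  "x : N m ==> x : carrier (part M m)"
  "th : steenrod k ==> x : N m ==> act M k m th x : N (m + k)"
  "subsp (N m) (part M m)" using assms(2) by (auto simp: is_submodule_def subspace_iff[OF sm_vs[OF assms(1)]])

lemma restrict_module_unstable: fixes M :: "('k::{field,finite}, 'u) graded_module" assumes U: "unstable M" and N: "is_submodule N M"
 shows "unstable (restrict_module M N)"
proof -
 note M = um_sm[OF U] and D = is_submoduleD[OF um_sm[OF U] N]
 have "steenrod_module (restrict_module M N)" unfolding steenrod_module_def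
 proof (intro conjI allI ballI)
  show "vspace (part (restrict_module M N) m)" for m using subspace_vectorspace[OF D(7)] by simp
  show "act (restrict_module M N) k m th : lin
   (part (restrict_module M N) m) (part (restrict_module M N) (m + k))" if t: "th : steenrod k" for k m th
   using sm_hom[OF M t, of m] D(5,6) t unfolding module_hom_iff by auto
 qed (simp_all add: D(5) sm_add[OF M] sm_scale[OF M] sm_one[OF M] sm_times[OF M])
 thus ?thesis unfolding unstable_def Let_def using um_power[OF U] um_bockstein[OF U] D(5) by auto
qed

section \<open>The filtration of the free module by the number of factors tau\<close>

definition st_tau :: "nat => nat => 'k::{field,finite} steenrod_element set" where
 "st_tau e k = {th \<in> steenrod k. ALL m. th m ~= 0 --> e <= card (fst m)}"

lemma tau_sub: "th : st_tau e k ==> th : steenrod k" by (simp add: st_tau_def)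

lemma st_tau_add: "th : st_tau e k ==> th' : st_tau e k ==> (%m. th m + th' m) : st_tau e k"
 using steenrod_add[of th k th'] unfolding st_tau_def mem_Collect_eq by (metis add.right_neutral)

lemma st_tau_scale: "th : st_tau e k ==> (%m. c * th m) : st_tau e k"
 using steenrod_scale[of th k c] unfolding st_tau_def mem_Collect_eq by (metis mult_zero_right)

lemma st_tau_zero: "(%m. 0) : st_tau e k" by (simp add: st_tau_def steenrod_zero)

lemma st_tau_mono: "e <= e' ==> st_tau e' k <= st_tau e k" by (auto simp: st_tau_def)

lemma st_tau_times: fixes th th' :: "'k::{field,finite} steenrod_element"
 assumes "prime (CARD('k))" "odd (CARD('k))" "th : st_tau d k" "th' : st_tau e l"
 shows "steenrod_times th th' : st_tau (d + e) (k + l)"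
proof -
 have "d + e <= card (fst m)" if "steenrod_times th th' m ~= 0" for m
  using assms(3,4) by (intro steenrod_times_ntau[OF assms(1,2) _ _ that]) (auto simp: st_tau_def)
 thus ?thesis using steenrod_times_closed[OF assms(1,2), of th k th' l] assms(3,4) by (auto simp: st_tau_def)
qed

lemma st_tau_0: "st_tau 0 k = steenrod k" by (simp add: st_tau_def)

text \<open>The zero is inserted for degrees below n, which no operation on the generator
  reaches.\<close>

definition tau_level :: "('k::{field,finite}, 'u) graded_module => nat => 'u => nat => nat => 'u set" where
 "tau_level M n \<iota> e m = insert 0[part M m] {act M k n th \<iota> | k th. m = n + k & th : st_tau e k}"

context fixes M :: "('k::{field,finite}, 'u) graded_module" and n :: nat and \<iota> :: 'u assumes prime: "prime (CARD('k))" and odd: "odd (CARD('k))"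
  and M: "steenrod_module M" and \<iota>: "\<iota> : carrier (part M n)"
begin

lemma tau_level_low: "m < n ==> tau_level M n \<iota> e m = {0[part M m]}" by (auto simp: tau_level_def)

lemma tau_level_add: "tau_level M n \<iota> e (n + k) = {act M k n th \<iota> | th. th : st_tau e k}"
proof -
 have "0[part M (n + k)] = act M k n (%m. 0) \<iota>" by (simp add: sm_zero[OF M \<iota>])
 thus ?thesis using st_tau_zero[of e k] by (auto simp: tau_level_def)
qed

lemma tau_level_submodule: "is_submodule (tau_level M n \<iota> e) M" unfolding is_submodule_def
proof (intro conjI allI ballI)
 fix m
 show "subsp (tau_level M n \<iota> e m) (part M m)"
 proof (cases "m < n")
  case True
  thus ?thesis
   using vs_zero[OF sm_vs[OF M]] by (simp add: subspace_iff[OF sm_vs[OF M]] tau_level_low vs_zero_right[OF sm_vs[OF M]] vs_smult_zero[OF sm_vs[OF M]])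
 next
  case False
  then obtain k where m: "m = n + k" by (metis le_add_diff_inverse not_less)
  note c = sm_closed[OF M tau_sub \<iota>]
  show ?thesis unfolding subspace_iff[OF sm_vs[OF M]] m
  proof (intro conjI ballI allI subsetI)
   show "0[part M (n + k)] : tau_level M n \<iota> e (n + k)" by (simp add: tau_level_def)
   fix x assume "x : tau_level M n \<iota> e (n + k)"
   then obtain th where x: "th : st_tau e k" "x = act M k n th \<iota>" unfolding tau_level_add by auto
   thus "x : carrier (part M (n + k))" using c by simp
   show "c *[part M (n + k)] x : tau_level M n \<iota> e (n + k)" for c
   proof -
    have "c *[part M (n + k)] x = act M k n (%m. c * th m) \<iota>"
     using x(2) sm_scale[OF M tau_sub[OF x(1)] \<iota>, of c] by simp
    thus ?thesis using st_tau_scale[OF x(1), of c] unfolding tau_level_add by blast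
   qed
   fix y assume "y : tau_level M n \<iota> e (n + k)"
   then obtain th' where y: "th' : st_tau e k" "y = act M k n th' \<iota>" unfolding tau_level_add by auto
   thus "x +[part M (n + k)] y : tau_level M n \<iota> e (n + k)"
   proof -
    have "x +[part M (n + k)] y = act M k n (%m. th m + th' m) \<iota>"
     using x(2) y(2) sm_add[OF M tau_sub[OF x(1)] tau_sub[OF y(1)] \<iota>] by simp
    thus ?thesis using st_tau_add[OF x(1) y(1)] unfolding tau_level_add by blast
   qed
  qed
 qed
next
 fix l m ps x assume ps: "ps : (steenrod l :: 'k steenrod_element set)" and x: "x : tau_level M n \<iota> e m"
 show "act M l m ps x : tau_level M n \<iota> e (m + l)"
 proof (cases "m < n")
  case True
  thus ?thesis using x sm_act_zero[OF M ps] by (simp add: tau_level_low) (simp add: tau_level_def)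
 next
  case False
  then obtain k where m: "m = n + k" by (metis le_add_diff_inverse not_less)
  obtain th where t: "th : st_tau e k" "x = act M k n th \<iota>" using x unfolding m tau_level_add by auto
  have "act M l m ps x = act M (l + k) n (steenrod_times ps th) \<iota>"
   unfolding t m by (rule sm_times[OF M ps tau_sub[OF t(1)] \<iota>, symmetric])
  moreover have "steenrod_times ps th : st_tau e (l + k)"
   using st_tau_times[OF prime odd _ t(1), of ps 0 l] ps by (simp add: st_tau_0)
  moreover have "m + l = n + (l + k)" by (simp add: m)
  ultimately show ?thesis unfolding tau_level_add[of e "l + k"] \<open>m + l = n + (l + k)\<close> by blast
 qed
qed

end

text \<open>Numbered backwards so that the filtration increases. Stage 0 is level n + 1, which is
  zero because each factor tau adds one to the excess; stage n + 1 is level 0, the whole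
  module.\<close>

definition tau_filtration :: "('k::{field,finite}, 'u) graded_module => nat => 'u => nat => nat => 'u set" where
 "tau_filtration M n \<iota> i = tau_level M n \<iota> (Suc n - i)"

context fixes F :: "('k::{field,finite}, 'u) graded_module" and n :: nat and \<iota> :: 'u assumes prime: "prime (CARD('k))" and odd: "odd (CARD('k))"
  and inf: "infinite (UNIV :: 'u set)" and free: "free_unstable n F \<iota>"
begin

lemma free_unstableD: "unstable F" "steenrod_module F" "\<iota> : carrier (part F n)" using free um_sm by (auto simp: free_unstable_def)

text \<open>One direction is \<open>unstable_excess\<close>. For the other, freeness sends the
  generator to the unit class of a copy of the test module, where padded words read off the
  coefficients of \<open>th\<close> at all monomials of excess at most n.\<close>

lemma free_kernel: assumes th: "th : steenrod k"
 shows "act F k n th \<iota> = 0[part F (n + k)] \<longleftrightarrow> (ALL m. excess m <= n --> th m = 0)"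
proof
 note F = free_unstableD
 assume z: "act F k n th \<iota> = 0[part F (n + k)]"
 let ?M = "test_module n :: ('k, atom list => 'k) graded_module"
 note UM = test_module_unstable[OF prime odd, of n] and SM = um_sm[OF test_module_unstable[OF prime odd, of n]]
 have "ALL m. EX f :: (atom list => 'k) => 'u. inj_on f (carrier (part ?M m))"
  using ex_inj_on_infinite[OF finite_test_component[OF prime odd] inf] by blast
 then obtain g :: "nat => (atom list => 'k) => 'u" where g: "!!m. inj_on (g m) (carrier (part ?M m))"
  by metis
 let ?T = "transport_module g ?M"
 have UT: "unstable ?T" by (rule transport_unstable[OF g prime odd UM])
 have "g n (test_unit n) : carrier (part ?T n)" using test_unit_closed[of n, where 'k = 'k] unfolding transport_component_simps by blast
 moreover have "bij_betw (%ph. ph n \<iota>) (unstable_hom F ?T) (carrier (part ?T n))"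
  using free UT unfolding free_unstable_def by blast
 ultimately have "g n (test_unit n) : (%ph. ph n \<iota>) ` unstable_hom F ?T" unfolding bij_betw_def by blast
 then obtain ph where ph: "ph : unstable_hom F ?T" "ph n \<iota> = g n (test_unit n)" by force
 have "g (n + k) (act ?M k n th (test_unit n)) = act ?T k n th (ph n \<iota>)"
  unfolding ph(2) by (rule transport_act[OF g test_unit_closed, symmetric])
 also have "... = ph (n + k) (act F k n th \<iota>)" using ph(1) th F(3) by (simp add: unstable_hom_def)
 also have "... = 0[part ?T (n + k)]" unfolding z
  by (rule module_hom_zero[OF sm_vs[OF F(2)] sm_vs[OF um_sm[OF UT]]]) (use ph(1) in \<open>auto simp: unstable_hom_def linear_maps_def\<close>)
 finally have "g (n + k) (act ?M k n th (test_unit n)) = g (n + k) 0[part ?M (n + k)]"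
  by (simp only: transport_component_simps)
 hence *: "act ?M k n th (test_unit n) = 0[part ?M (n + k)]"
  using g[of "n + k"] sm_closed[OF SM th test_unit_closed] vs_zero[OF sm_vs[OF SM]] by (blast dest: inj_onD)
 show "ALL m. excess m <= n --> th m = 0"
 proof (intro allI impI)
  fix m assume m: "excess m <= n"
  show "th m = 0"
  proof (cases "m : milnor_monomials")
   case True
   obtain L where L: "L : excess_words n" "!!th :: 'k steenrod_element. wval th L = th m"
    by (rule padded_word[OF prime odd True m]) blast
   have "act ?M k n th (test_unit n) L = 0" unfolding * by simp
   thus ?thesis using test_act_unit[OF prime odd L(1), of k th] L(2) by simp
  next
   case False
   thus ?thesis using steenrodD(1)[OF th] by blast
  qed
 qed
next
 assume "ALL m. excess m <= n --> th m = 0"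
 thus "act F k n th \<iota> = 0[part F (n + k)]"
  by (intro unstable_excess[OF prime odd free_unstableD(1) th free_unstableD(3)]) blast
qed

text \<open>The submodule generated by the generator receives a map from \<open>F\<close> that fixes
  it. Followed by the inclusion, this map is the identity by uniqueness, so the submodule is
  everything.\<close>

lemma free_generated: "carrier (part F m) = tau_level F n \<iota> 0 m"
proof
 note F = free_unstableD
 let ?N = "tau_level F n \<iota> 0"
 note sub = tau_level_submodule[OF prime odd F(2,3), of 0]
 let ?G = "restrict_module F ?N"
 have UG: "unstable ?G" by (rule restrict_module_unstable[OF F(1) sub])
 have \<iota>: "\<iota> : ?N n" using tau_level_add[OF prime odd F(2,3), of 0 0] sm_one[OF F(2,3)] steenrod_one_closed[where 'k = 'k]
  by (simp add: st_tau_0) metis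
 have "bij_betw (%ph. ph n \<iota>) (unstable_hom F ?G) (carrier (part ?G n))"
  using free UG unfolding free_unstable_def by blast
 hence "(%ph. ph n \<iota>) ` unstable_hom F ?G = ?N n" by (simp add: bij_betw_def)
 hence "\<iota> : (%ph. ph n \<iota>) ` unstable_hom F ?G" using \<iota> by simp
 then obtain ph where ph: "ph : unstable_hom F ?G" "ph n \<iota> = \<iota>" by fastforce
 have phF: "ph : unstable_hom F F" using ph(1) is_submoduleD(1)[OF F(2) sub]
  by (fastforce simp: unstable_hom_def linear_maps_def module_hom_iff)
 let ?id = "%m. \<lambda>x\<in>carrier (part F m). x"
 have idF: "?id : unstable_hom F F"
  by (auto simp: unstable_hom_def linear_maps_def module_hom_iff sm_closed[OF F(2)] vs_add[OF sm_vs[OF F(2)]] vs_smult[OF sm_vs[OF F(2)]])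
 have "inj_on (%ph. ph n \<iota>) (unstable_hom F F)" using free F(1) by (auto simp: free_unstable_def bij_betw_def)
 hence "ph = ?id" by (rule inj_onD) (use phF idF ph(2) F(3) in auto)
 hence "x : ?N m" if "x : carrier (part F m)" for x
  using ph(1) that by (auto simp: unstable_hom_def linear_maps_def module_hom_iff)
 thus "carrier (part F m) <= ?N m" by blast
 show "?N m <= carrier (part F m)" by (rule is_submoduleD(1)[OF F(2) sub])
qed

lemma tau_level_top: "n < e ==> tau_level F n \<iota> e m = {0[part F m]}"
proof -
 assume e: "n < e"
 have "act F k n th \<iota> = 0[part F (n + k)]" if t: "th : st_tau e k" for k th
  unfolding free_kernel[OF tau_sub[OF t]] using t e by (force simp: st_tau_def excess_def)
 thus ?thesis by (auto simp: tau_level_def)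
qed

lemma tau_filtration: "finite_filtration F (Suc n) (tau_filtration F n \<iota>)" unfolding finite_filtration_def tau_filtration_def
proof (intro conjI allI impI)
 note F = free_unstableD
 show "is_submodule (tau_level F n \<iota> (Suc n - i)) F" for i by (rule tau_level_submodule[OF prime odd F(2,3)])
 show "tau_level F n \<iota> (Suc n - i) m <= tau_level F n \<iota> (Suc n - Suc i) m" for i m
 proof -
  have "st_tau (Suc n - i) k <= (st_tau (Suc n - Suc i) k :: 'k steenrod_element set)" for k by (rule st_tau_mono) simp
  thus ?thesis unfolding tau_level_def by blast
 qed
 show "tau_level F n \<iota> (Suc n - 0) m = {0[part F m]}" for m by (rule tau_level_top) simp
 show "tau_level F n \<iota> (Suc n - Suc n) m = carrier (part F m)" for m by (simp add: free_generated)
qed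

text \<open>Both sides of the isomorphism are quotients of the same part of the Steenrod algebra.\<close>

lemma graded_piece_iso: fixes N :: "('k, 'w) graded_module" and s :: "nat => 'k steenrod_element => 'w"
 assumes V: "!!m. vspace (part N m)"
  and low: "!!m. m < n ==> carrier (part N m) = {0[part N m]}"
  and surj: "!!k. s k ` st_tau e k = carrier (part N (n + k))"
  and add: "!!k th th'. th : st_tau e k ==> th' : st_tau e k ==>
   s k (%m. th m + th' m) = s k th +[part N (n + k)] s k th'"
  and scale: "!!k th c. th : st_tau e k ==> s k (%m. c * th m) = c *[part N (n + k)] s k th"
  and ker: "!!k th. th : st_tau e k ==> s k th = 0[part N (n + k)] \<longleftrightarrow>
   (ALL m. card (fst m) = e --> excess m <= n --> th m = 0)"
  and act: "!!k l th ps. th : st_tau e k ==> ps : steenrod l ==>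
   s (l + k) (steenrod_times ps th) = act N l (n + k) ps (s k th)"
  and act0: "!!m l ps. ps : steenrod l ==> act N l m ps 0[part N m] = 0[part N (m + l)]"
 shows "unstable_iso (subquotient F (tau_level F n \<iota> e) (tau_level F n \<iota> (Suc e))) N"
proof -
 note F = free_unstableD
 let ?G = "tau_level F n \<iota> e" and ?H = "tau_level F n \<iota> (Suc e)"
 let ?V = "%m. (part F m)\<lparr>carrier := ?G m\<rparr>"
 let ?Q = "subquotient F ?G ?H"
 have subG: "is_submodule ?G F" and subH: "is_submodule ?H F" by (rule tau_level_submodule[OF prime odd F(2,3)])+
 note DG = is_submoduleD[OF F(2) subG] and DH = is_submoduleD[OF F(2) subH]
 have HG: "?H m <= ?G m" for m using st_tau_mono[of e "Suc e"] by (auto simp: tau_level_def)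
 have Vs: "vspace (?V m)" for m by (rule subspace_vectorspace[OF DG(7)])
 have Hs: "subsp (?H m) (?V m)" for m unfolding subspace_iff[OF Vs] using HG DH by auto
 have HF: "subsp (?H m) (part F m)" for m by (rule DH(7))
 let ?c = "%m x. ?H m +>[?V m] x"
 have cF: "?c m x = ?H m +>[part F m] x" for m x by (simp add: a_r_coset_def')
 have Q: "part ?Q m = quot_vs (?V m) (?H m)" for m by (simp add: subquotient_def)
 have Gn: "?G (n + k) = {act F k n th \<iota> | th. th : st_tau e k}" for k by (rule tau_level_add[OF prime odd F(2,3)])
 have Qn: "X : carrier (part ?Q (n + k)) \<longleftrightarrow> (EX th:st_tau e k. X = ?c (n + k) (act F k n th \<iota>))" for X k
  unfolding Q quot_carrier[OF Vs Hs] by (auto simp: Gn)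
 have GI: "act F k n th \<iota> : carrier (?V (n + k))" if "th : st_tau e k" for th k using that by (auto simp: Gn)
 have eq: "?c (n + k) (act F k n th \<iota>) = ?c (n + k) (act F k n th' \<iota>) \<longleftrightarrow> s k th = s k th'"
  if t: "th : st_tau e k" "th' : st_tau e k" for k th th'
 proof -
  let ?d = "%m. th m + - 1 * th' m"
  have d: "?d : st_tau e k" by (rule st_tau_add[OF t(1) st_tau_scale[OF t(2)]])
  have "act F k n ?d \<iota> = act F k n th \<iota> +[part F (n + k)] (- 1) *[part F (n + k)] act F k n th' \<iota>"
   using sm_add[OF F(2) tau_sub[OF t(1)] tau_sub[OF st_tau_scale[OF t(2), of "- 1"]] F(3)]
    sm_scale[OF F(2) tau_sub[OF t(2)] F(3), of "- 1"] by simp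
  hence "?c (n + k) (act F k n th \<iota>) = ?c (n + k) (act F k n th' \<iota>) \<longleftrightarrow> act F k n ?d \<iota> : ?H (n + k)"
   using coset_eq_iff[OF Vs Hs GI[OF t(1)] GI[OF t(2)]] by simp
  also have "... \<longleftrightarrow> (ALL m. card (fst m) = e --> excess m <= n --> ?d m = 0)"
  proof
   assume "act F k n ?d \<iota> : ?H (n + k)"
   then obtain ps where ps: "ps : st_tau (Suc e) k" "act F k n ?d \<iota> = act F k n ps \<iota>"
    unfolding tau_level_add[OF prime odd F(2,3)] by auto
   let ?g = "%m. ?d m + - 1 * ps m"
   note st = tau_sub[OF d] tau_sub[OF ps(1)]
   have "act F k n ?g \<iota> = act F k n ?d \<iota> +[part F (n + k)] (- 1) *[part F (n + k)] act F k n ps \<iota>"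
    using sm_add[OF F(2) st(1) steenrod_scale[OF st(2), of "- 1"] F(3)] sm_scale[OF F(2) st(2) F(3), of "- 1"] by simp
   hence "act F k n ?g \<iota> = 0[part F (n + k)]"
    unfolding ps(2) by (simp add: vs_neg[OF sm_vs[OF F(2)]] sm_closed[OF F(2) st(2) F(3)])
   hence "ALL m. excess m <= n --> ?g m = 0"
    using free_kernel[OF steenrod_add[OF st(1) steenrod_scale[OF st(2), of "- 1"]]] by blast
   \<comment> \<open>Representatives from the next level have more than \<open>e\<close> factors
     tau, so they do not affect the coefficients tested here.\<close>
   moreover have "ps m = 0" if "card (fst m) = e" for m
   proof (rule ccontr)
    assume "ps m ~= 0"
    hence "Suc e <= card (fst m)" using ps(1) unfolding st_tau_def by blast
    thus False using that by simp
   qed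
   ultimately have "?d m = 0" if "card (fst m) = e" "excess m <= n" for m using that by (metis add_0_right mult_zero_right)
   thus "ALL m. card (fst m) = e --> excess m <= n --> ?d m = 0" by blast
  next
   assume z: "ALL m. card (fst m) = e --> excess m <= n --> ?d m = 0"
   \<comment> \<open>\<open>?g\<close> collects the monomials with more than \<open>e\<close>
     factors tau and represents an element of the next level; the remainder \<open>?h\<close> is
     supported on excess greater than n and annihilates the generator.\<close>
   let ?g = "%m. if e < card (fst m) then ?d m else 0"
   let ?h = "%m. if ~ e < card (fst m) then ?d m else 0"
   note st = tau_sub[OF d]
   have g: "?g : st_tau (Suc e) k" using steenrod_restrict[OF st, of "%m. e < card (fst m)"] by (auto simp: st_tau_def)
   have "ALL m. excess m <= n --> ?h m = 0"
   proof (intro allI impI)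
    fix m assume m: "excess m <= n"
    consider "e < card (fst m)" | "card (fst m) = e" | "card (fst m) < e" by linarith
    thus "?h m = 0"
    proof cases
     case 3
     hence "?d m = 0" using d unfolding st_tau_def by (metis (mono_tags, lifting) mem_Collect_eq not_le)
     thus ?thesis by simp
    next
     case 2
     hence "?d m = 0" using z m by blast
     thus ?thesis by simp
    qed simp
   qed
   hence hz: "act F k n ?h \<iota> = 0[part F (n + k)]"
    using free_kernel[OF steenrod_restrict[OF st, of "%m. ~ e < card (fst m)"]] by blast
   have "?d = (%m. ?g m + ?h m)" by (rule ext) auto
   hence "act F k n ?d \<iota> = act F k n ?g \<iota> +[part F (n + k)] act F k n ?h \<iota>"
    using sm_add[OF F(2) tau_sub[OF g] steenrod_restrict[OF st, of "%m. ~ e < card (fst m)"] F(3)] by (simp only:)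
   hence "act F k n ?d \<iota> = act F k n ?g \<iota>"
    unfolding hz using vs_zero_right[OF sm_vs[OF F(2)] sm_closed[OF F(2) tau_sub[OF g] F(3)]] by simp
   thus "act F k n ?d \<iota> : ?H (n + k)" unfolding tau_level_add[OF prime odd F(2,3)] using g by blast
  qed
  also have "... \<longleftrightarrow> s k ?d = 0[part N (n + k)]" using ker[OF d] by simp
  also have "s k ?d = s k th +[part N (n + k)] (- 1) *[part N (n + k)] s k th'"
   using add[OF t(1) st_tau_scale[OF t(2), of "- 1"]] scale[OF t(2), of "- 1"] by simp
  also have "... = 0[part N (n + k)] \<longleftrightarrow> s k th = s k th'"
   by (rule vs_eq_iff_diff[OF V]) (use surj t in blast)+
  finally show ?thesis .
 qed
 \<comment> \<open>By \<open>eq\<close> the choice of a representing operation does not matter.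
   Below degree n there is none, hence the explicit value 0.\<close>
 define ph where "ph m = (\<lambda>X\<in>carrier (part ?Q m). if m < n then 0[part N m]
   else s (m - n) (SOME th. th : st_tau e (m - n) & X = ?c m (act F (m - n) n th \<iota>)))" for m
 have ph: "ph (n + k) (?c (n + k) (act F k n th \<iota>)) = s k th" if t: "th : st_tau e k" for k th
 proof -
  have X: "?c (n + k) (act F k n th \<iota>) : carrier (part ?Q (n + k))" using t Qn by blast
  let ?P = "%th'. th' : st_tau e k & ?c (n + k) (act F k n th \<iota>) = ?c (n + k) (act F k n th' \<iota>)"
  have P: "?P (SOME th'. ?P th')" by (rule someI[of ?P th]) (use t in simp)
  have "s k th = s k (SOME th'. ?P th')" by (rule iffD1[OF eq[OF t conjunct1[OF P]] conjunct2[OF P]])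
  thus ?thesis using X by (simp add: ph_def)
 qed
 have lowQ: "carrier (part ?Q m) = {?c m 0[part F m]}" if "m < n" for m
  unfolding Q quot_carrier[OF Vs Hs] using tau_level_low[OF prime odd F(2,3) that] by auto
 have phlow: "ph m X = 0[part N m]" if "m < n" "X : carrier (part ?Q m)" for m X
  using that by (simp add: ph_def)
 have VQ: "vspace (part ?Q m)" for m unfolding Q by (rule vectorspace_quot[OF Vs Hs])
 have ge: "EX k. m = n + k" if "~ m < n" for m using that by (metis le_add_diff_inverse not_less)
 have lin: "ph m : linear_maps (part ?Q m) (part N m)" for m unfolding linear_maps_def module_hom_iff
 proof (intro IntI CollectI, unfold module_hom_iff, intro conjI ballI allI)
  show "ph m : extensional (carrier (part ?Q m))" by (simp add: ph_def)
  fix X assume X: "X : carrier (part ?Q m)"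
  show "ph m X : carrier (part N m)"
  proof (cases "m < n")
   case True
   thus ?thesis using phlow X vs_zero[OF V] by simp
  next
   case False
   then obtain k where m: "m = n + k" using ge by blast
   thus ?thesis using X ph surj unfolding m Qn by blast
  qed
  show "ph m (c *[part ?Q m] X) = c *[part N m] ph m X" for c
  proof (cases "m < n")
   case True
   thus ?thesis using phlow X vs_smult_zero[OF V] vs_smult[OF VQ] by simp
  next
   case False
   then obtain k where m: "m = n + k" using ge by blast
   obtain th where t: "th : st_tau e k" "X = ?c (n + k) (act F k n th \<iota>)" using X unfolding m Qn by blast
   have "c *[part ?Q m] X = ?c (n + k) (act F k n (%m. c * th m) \<iota>)"
    unfolding m t Q quot_smult[OF Vs Hs GI[OF t(1)]] sm_scale[OF F(2) tau_sub[OF t(1)] F(3)] by simp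
   thus ?thesis using ph[OF st_tau_scale[OF t(1)]] ph[OF t(1)] scale[OF t(1)] unfolding m t(2) by simp
  qed
  fix Y assume Y: "Y : carrier (part ?Q m)"
  show "ph m (X +[part ?Q m] Y) = ph m X +[part N m] ph m Y"
  proof (cases "m < n")
   case True
   thus ?thesis using phlow X Y vs_zero_right[OF V vs_zero[OF V]] vs_add[OF VQ X Y] by simp
  next
   case False
   then obtain k where m: "m = n + k" using ge by blast
   obtain th where t: "th : st_tau e k" "X = ?c (n + k) (act F k n th \<iota>)" using X unfolding m Qn by blast
   obtain th' where t': "th' : st_tau e k" "Y = ?c (n + k) (act F k n th' \<iota>)" using Y unfolding m Qn by blast
   have "X +[part ?Q m] Y = ?c (n + k) (act F k n (%m. th m + th' m) \<iota>)"
    unfolding m t t' Q quot_add[OF Vs Hs GI[OF t(1)] GI[OF t'(1)]]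
     sm_add[OF F(2) tau_sub[OF t(1)] tau_sub[OF t'(1)] F(3)] by simp
   thus ?thesis using ph[OF st_tau_add[OF t(1) t'(1)]] ph[OF t(1)] ph[OF t'(1)] add[OF t(1) t'(1)]
    unfolding m t(2) t'(2) by simp
  qed
 qed
 have actQ: "act ?Q l m ps (?c m x) = ?c (m + l) (act F l m ps x)" if "ps : steenrod l" "x : ?G m" for l m ps x
 proof -
  have hom: "act F l m ps : lin (part F m) (part F (m + l))"
   by (rule sm_hom[OF F(2) that(1)])
  show ?thesis unfolding cF subquotient_def graded_module.simps
   by (rule quot_map_coset[OF sm_vs[OF F(2)] HF sm_vs[OF F(2)] HF hom]) (use that DH(6) DG(5) in auto)
 qed
 have "ph : unstable_hom ?Q N" unfolding unstable_hom_def
 proof (intro CollectI conjI allI ballI lin)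
  fix l m ps X assume ps: "ps : (steenrod l :: 'k steenrod_element set)" and X: "X : carrier (part ?Q m)"
  show "ph (m + l) (act ?Q l m ps X) = act N l m ps (ph m X)"
  proof (cases "m < n")
   case True
   hence "X = ?c m 0[part F m]" using X lowQ by simp
   hence "act ?Q l m ps X = 0[part ?Q (m + l)]"
    using actQ[OF ps DG(2)[of m]] unfolding Q quot_zero[OF Vs Hs] by (simp add: sm_act_zero[OF F(2) ps])
   moreover have "ph (m + l) 0[part ?Q (m + l)] = 0[part N (m + l)]"
    by (rule module_hom_zero[OF VQ V]) (use lin in \<open>auto simp: linear_maps_def\<close>)
   ultimately show ?thesis using phlow[OF True X] act0[OF ps] by simp
  next
   case False
   then obtain k where m: "m = n + k" using ge by blast
   obtain th where t: "th : st_tau e k" "X = ?c (n + k) (act F k n th \<iota>)" using X unfolding m Qn by blast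
   have times: "steenrod_times ps th : st_tau e (l + k)"
    using st_tau_times[OF prime odd _ t(1), of ps 0 l] ps by (simp add: st_tau_0)
   have "act ?Q l m ps X = ?c (n + k + l) (act F l (n + k) ps (act F k n th \<iota>))"
    unfolding m t(2) by (rule actQ[OF ps]) (use GI[OF t(1)] in simp)
   also have "... = ?c (n + (l + k)) (act F (l + k) n (steenrod_times ps th) \<iota>)"
    unfolding sm_times[OF F(2) ps tau_sub[OF t(1)] F(3)] by (simp add: ac_simps)
   finally have "ph (n + (l + k)) (act ?Q l m ps X) = s (l + k) (steenrod_times ps th)" using ph[OF times] by simp
   moreover have idx: "m + l = n + (l + k)" by (simp add: m)
   ultimately have "ph (m + l) (act ?Q l m ps X) = s (l + k) (steenrod_times ps th)" by (simp only:)
   also have "... = act N l (n + k) ps (s k th)" by (rule act[OF t(1) ps])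
   also have "s k th = ph m X" unfolding m t(2) by (rule ph[OF t(1), symmetric])
   finally show ?thesis by (simp only: m)
  qed
 qed
 moreover have "bij_betw (ph m) (carrier (part ?Q m)) (carrier (part N m))" for m
 proof (cases "m < n")
  case True
  thus ?thesis using lowQ low phlow by (simp add: bij_betw_def)
 next
  case False
  then obtain k where m: "m = n + k" using ge by blast
  show ?thesis unfolding bij_betw_def m
  proof (intro conjI inj_onI)
   show "X = Y" if "X : carrier (part ?Q (n + k))" "Y : carrier (part ?Q (n + k))" "ph (n + k) X = ph (n + k) Y" for X Y
    using that ph eq unfolding Qn by metis
   have "ph (n + k) ` carrier (part ?Q (n + k)) = s k ` st_tau e k" using ph Qn by (auto simp: image_iff) metis+
   thus "ph (n + k) ` carrier (part ?Q (n + k)) = carrier (part N (n + k))" using surj by simp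
  qed
 qed
 ultimately show ?thesis unfolding unstable_iso_def by blast
qed

end

section \<open>Natural transformations out of divided powers\<close>

lemma hom_closed: "f : LinearCombinations.module_hom (class_ring :: 'k::field ring) V W ==> x : carrier V ==> f x : carrier W"
 and hom_add: "f : LinearCombinations.module_hom (class_ring :: 'k::field ring) V W ==> x : carrier V ==> y : carrier V ==>
  f (x +[V] y) = f x +[W] f y"
 and hom_smult: "f : LinearCombinations.module_hom (class_ring :: 'k::field ring) V W ==> x : carrier V ==>
  f (c *[V] x) = c *[W] f x" by (simp_all add: module_hom_iff)

section \<open>Symmetric tensors as linear forms on polynomials\<close>

definition pm_eval :: "('a => 'k) => ('a \<Rightarrow>\<^sub>0 'k::comm_ring_1) => 'k" where
 "pm_eval \<Phi> f = (SUM k:keys f. lookup f k * \<Phi> k)"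

lemma pm_eval_sum: "pm_eval \<Phi> (SUM i:I. f i) = (SUM i:I. pm_eval \<Phi> (f i))"
 unfolding pm_eval_def by (rule sum_keys_sum[where H = "%k a. a * \<Phi> k"]) (auto simp: algebra_simps)

lemma pm_eval_single: "pm_eval \<Phi> (single k a) = a * \<Phi> k" by (simp add: pm_eval_def)

lemma words_0 [simp]: "words 0 d = {[]}" by (auto simp: words_def)

lemma words_Suc: "words (Suc b) d = (%(a, w). a # w) ` ({..<d} \<times> words b d)" by (auto simp: words_def image_iff length_Suc_conv)

lemma finite_words [simp]: "finite (words b d)" by (induction b) (simp_all add: words_Suc)

lemma sum_words_Suc: "(SUM w:words (Suc b) d. f w) = (\<Sum>a<d. SUM w:words b d. f (a # w))"
 by (simp add: words_Suc sum.reindex inj_on_def split_beta sum.cartesian_product)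

lemma words_length: "w : words b d ==> length w = b" by (simp add: words_def)

lemma words_nth: "w : words b d ==> i < b ==> w ! i < d" using nth_mem[of i w] by (auto simp: words_def subset_iff)

lemma prod_sum_words: fixes g :: "nat => nat => 'b::comm_semiring_1"
 shows "(\<Prod>i<m. \<Sum>v<d. g i v) = (SUM w:words m d. \<Prod>i<m. g i (w ! i))"
proof (induction m arbitrary: g)
 case (Suc m)
 have "(\<Prod>i<Suc m. \<Sum>v<d. g i v) = (\<Sum>v<d. g 0 v) * (SUM w:words m d. \<Prod>i<m. g (Suc i) (w ! i))"
  unfolding Suc.IH[of "%i. g (Suc i)", symmetric] by (rule prod.lessThan_Suc_shift)
 also have "... = (SUM w:words (Suc m) d. \<Prod>i<Suc m. g i (w ! i))"
  by (simp add: sum_words_Suc sum_product prod.lessThan_Suc_shift del: prod.lessThan_Suc)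
 finally show ?case .
qed simp

lemma prod_single: fixes a :: "nat => 'k::comm_ring_1" and k :: "nat => 'a::comm_monoid_add"
 shows "(\<Prod>i<m. single (k i) (a i)) = single (\<Sum>i<m. k i) (\<Prod>i<m. a i)"
 by (induction m) (simp_all add: mult_single)

type_synonym 'k bipoly = "nat multiset \<times> nat multiset \<Rightarrow>\<^sub>0 'k"

lemma single_power: "single (M, N) (a::'k::comm_ring_1) ^ q =
   (single (repeat_mset q M, repeat_mset q N) (a ^ q) :: (nat multiset \<times> nat multiset \<Rightarrow>\<^sub>0 'k))"
proof (induction q)
 case 0
 thus ?case by (simp flip: zero_prod_def)
next
 case (Suc q)
 thus ?case by (simp add: mult_single)
qed

lemma sum_pair: "(SUM i:I. (f i, g i)) = (SUM i:I. f i, SUM i:I. g i)" by (induction I rule: infinite_finite_induct) (auto simp: zero_prod_def)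

lemma tpow_vs_simps [simp]: "carrier (tpow_vs b d :: ('k::field, _) module) = {x. ALL w. x w ~= 0 --> w : words b d}"
 "0[tpow_vs b d :: ('k, _) module] = (%w. 0)"
 "x +[tpow_vs b d :: ('k, _) module] y = (%w. x w + y w)"
 "c *[tpow_vs b d :: ('k, _) module] x = (%w. c * x w)" by (simp_all add: tpow_vs_def)

lemma dpow_simps [simp]:
 "carrier (fobj (divided_power b) d :: ('k::field, _) module) = {x. (ALL w. x w ~= 0 --> w : words b d) &
   (ALL sg w. sg permutes {..<b} --> length w = b --> x (permute_list sg w) = x w)}"
 "0[fobj (divided_power b) d :: ('k, _) module] = (%w. 0)"
 "x +[fobj (divided_power b) d :: ('k, _) module] y = (%w. x w + y w)"
 "c *[fobj (divided_power b) d :: ('k, _) module] x = (%w. c * x w)"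
 "fmor (divided_power b :: ('k, _) vfunctor) = tpow_map b" by (auto simp: divided_power_def)

abbreviation dpow :: "nat => nat => (nat list => 'k::field) set" where
 "dpow b d == carrier (fobj (divided_power b) d)"

text \<open>Words with the same multiset of letters differ by a permutation of positions. Invariance
  thus becomes dependence on the multiset alone, the form in which a tensor pairs with
  polynomials.\<close>

lemma dpow_iff:
 "(x :: nat list => 'k::field) : dpow b d \<longleftrightarrow> (ALL w. x w ~= 0 --> w : words b d) & (ALL u v. mset u = mset v --> x u = x v)"
proof
 assume x: "x : dpow b d"
 have "x u = x v" if m: "mset u = mset v" for u v
 proof (cases "length v = b")
  case True
  obtain sg where "sg permutes {..<length v}" "permute_list sg v = u" using m by (rule mset_eq_permutation)
  thus ?thesis using x True by auto
 next
  case False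
  thus ?thesis
  proof -
   have "length u = length v" using m by (rule mset_eq_length)
   moreover assume "length v ~= b"
   ultimately have "u ~: words b d" "v ~: words b d" by (auto simp: words_def)
   hence "x u = 0" "x v = 0" using x by auto
   thus ?thesis by simp
  qed
 qed
 moreover have "ALL w. x w ~= 0 --> w : words b d" using x by simp
 ultimately show "(ALL w. x w ~= 0 --> w : words b d) & (ALL u v. mset u = mset v --> x u = x v)"
  by blast
next
 assume x: "(ALL w. x w ~= 0 --> w : words b d) & (ALL u v. mset u = mset v --> x u = x v)"
 have "x (permute_list sg w) = x w" if "sg permutes {..<b}" "length w = b" for sg w
 proof -
  have "mset (permute_list sg w) = mset w" using that by (intro mset_permute_list) simp
  thus ?thesis using x by blast
 qed
 thus "x : dpow b d" unfolding dpow_simps using x by blast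
qed

lemma dpowD: assumes "(x :: nat list => 'k::field) : dpow b d"
 shows "x w ~= 0 ==> w : words b d" "mset u = mset v ==> x u = x v" using assms unfolding dpow_iff by blast+

definition on_mset :: "(nat list => 'k) => nat multiset => 'k" where
 "on_mset x M = x (sorted_list_of_multiset M)"

lemma on_mset: "x : dpow b d ==> on_mset x (mset u) = (x u :: 'k::field)" unfolding on_mset_def by (rule dpowD(2)) simp_all

lemma sum_mset_nth: "(\<Sum>i<length w. {#w ! i#}) = mset w" by (induction w) (simp_all add: sum.lessThan_Suc_shift del: sum.lessThan_Suc)

definition letter :: "nat => nat multiset \<times> nat multiset" where
 "letter v = ({#v#}, {#})"

text \<open>Duality between divided and symmetric powers: the coordinate of \<open>A x\<close> at
  \<open>w\<close> is \<open>x\<close> paired with the product of the linear forms given by the rows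
  of \<open>A\<close> at the letters of \<open>w\<close>.\<close>

lemma tpow_map_eval: fixes A :: "'k::field mat" assumes A: "A : carrier_mat e d" and w: "w : words b e" and x: "x : dpow b d"
 shows "tpow_map b A x w = pm_eval (%(M, N). on_mset x M) (\<Prod>i<b. \<Sum>v<d. single (letter v) (A $$ (w ! i, v)))"
proof -
 have "(\<Prod>i<b. \<Sum>v<d. single (letter v) (A $$ (w ! i, v))) =
  (SUM u:words b d. single (mset u, {#}) (\<Prod>i<b. A $$ (w ! i, u ! i)))" unfolding prod_sum_words
 proof (rule sum.cong[OF refl])
  fix u assume "u : words b d"
  hence "(\<Sum>i<b. letter (u ! i)) = (mset u, {#})" using sum_mset_nth[of u] by (simp add: letter_def sum_pair words_def)
  thus "(\<Prod>i<b. single (letter (u ! i)) (A $$ (w ! i, u ! i))) =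
   single (mset u, {#}) (\<Prod>i<b. A $$ (w ! i, u ! i))" by (simp add: prod_single)
 qed
 thus ?thesis using A w by (simp add: pm_eval_sum pm_eval_single tpow_map_def on_mset[OF x])
qed

text \<open>The monomial formed by the product of the powers \<open>w_i^(p^(t_i))\<close>, spelled
  out as a word.\<close>

definition pword :: "nat => nat list => nat list => nat list" where
 "pword p w t = concat (map2 (%l i. replicate (p ^ i) l) w t)"

lemma mset_pword: assumes "length w = m" "length t = m" shows "mset (pword p w t) = (\<Sum>i<m. repeat_mset (p ^ (t ! i)) {#w ! i#})"
proof -
 have "length w = length t ==> mset (pword p w t) = (\<Sum>i<length w. repeat_mset (p ^ (t ! i)) {#w ! i#})"
 proof (induction w t rule: list_induct2)
  case (Cons a w b t)
  thus ?case by (simp add: pword_def sum.lessThan_Suc_shift del: sum.lessThan_Suc)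
 qed (simp add: pword_def)
 thus ?thesis using assms by simp
qed

lemma set_pword: "length w = length t ==> set (pword p w t) <= set w"
 by (induction w t rule: list_induct2) (auto simp: pword_def)

lemma length_pword: "length w = length t ==> length (pword p w t) = (\<Sum>a\<leftarrow>t. p ^ a)"
 by (induction w t rule: list_induct2) (auto simp: pword_def)

lemma prod_list_pword: fixes Y :: "nat => 'b::comm_monoid_mult" assumes "length w = m" "length t = m"
 shows "prod_list (map Y (pword p w t)) = (\<Prod>i<m. Y (w ! i) ^ (p ^ (t ! i)))"
proof -
 have "length w = length t ==> prod_list (map Y (pword p w t)) = (\<Prod>i<length w. Y (w ! i) ^ (p ^ (t ! i)))"
 proof (induction w t rule: list_induct2)
  case (Cons a w b t)
  thus ?case by (simp add: pword_def prod.lessThan_Suc_shift del: prod.lessThan_Suc)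
 qed (simp add: pword_def)
 thus ?thesis using assms by simp
qed

lemma prod_list_nth: "prod_list (map Y w) = (\<Prod>i<length w. Y (w ! i))" for Y :: "'a => 'b::comm_monoid_mult"
 by (induction w) (simp_all add: prod.lessThan_Suc_shift del: prod.lessThan_Suc)

text \<open>The exponent lists of products of m additive monomials with total degree c.\<close>

definition expts :: "nat => nat => nat => nat list set" where
 "expts p c m = {t. length t = m & (\<Sum>a\<leftarrow>t. p ^ a) = c}"

lemma finite_expts: assumes "p > 1" shows "finite (expts p c m)"
proof (rule finite_subset)
 show "expts p c m <= {t. set t <= {..c} & length t = m}"
 proof
  fix t assume t: "t : expts p c m"
  have "a <= c" if "a : set t" for a
  proof -
   have "a < p ^ a" using assms by (simp add: power_gt_expt)
   also have "p ^ a <= c" using t that member_le_sum_list[of "p ^ a" "map (%a. p ^ a) t"] by (auto simp: expts_def)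
   finally show ?thesis by simp
  qed
  thus "t : {t. set t <= {..c} & length t = m}" using t by (auto simp: expts_def)
 qed
qed (rule finite_lists_length_eq, simp)

section \<open>Tensors with alternating and symmetric positions\<close>

definition swap_at :: "nat => 'a list => 'a list" where
 "swap_at i w = w[i := w ! Suc i, Suc i := w ! i]"

lemma length_swap_at [simp]: "length (swap_at i w) = length w" by (simp add: swap_at_def)

lemma swap_at_swap_at [simp]: "Suc i < length w ==> swap_at i (swap_at i w) = w"
 by (auto simp: swap_at_def nth_list_update intro!: nth_equalityI)

lemma mset_swap_at [simp]: "Suc i < length w ==> mset (swap_at i w) = mset w" unfolding swap_at_def by (rule mset_swap) auto

lemma nth_swap_at: "Suc i < length w ==> j < length w ==> swap_at i w ! j = w ! (if j = i then Suc i else if j = Suc i then i else j)"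
 by (auto simp: swap_at_def nth_list_update)

lemma prod_swap_reindex: fixes f :: "nat => 'b::comm_monoid_mult" assumes "Suc i < m"
 shows "(\<Prod>j<m. f (if j = i then Suc i else if j = Suc i then i else j)) = (\<Prod>j<m. f j)"
 by (rule prod.reindex_bij_witness[of _ "%j. if j = i then Suc i else if j = Suc i then i else j"
   "%j. if j = i then Suc i else if j = Suc i then i else j"]) (use assms in auto)

lemma mset_pword_swap: assumes "length w = m" "length t = m" "Suc i < m"
 shows "mset (pword p (swap_at i w) (swap_at i t)) = mset (pword p w t)"
proof -
 let ?f = "%j. if j = i then Suc i else if j = Suc i then i else j"
 have "(\<Sum>j<m. repeat_mset (p ^ (swap_at i t ! j)) {#swap_at i w ! j#}) = (\<Sum>j<m. repeat_mset (p ^ (t ! ?f j)) {#w ! ?f j#})"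
  using assms by (intro sum.cong) (auto simp: nth_swap_at)
 also have "... = (\<Sum>j<m. repeat_mset (p ^ (t ! j)) {#w ! j#})" by (rule sum.reindex_bij_witness[of _ ?f ?f]) (use assms in auto)
 finally show ?thesis using assms by (simp add: mset_pword[where m = m])
qed

text \<open>Adjacent transpositions generate the symmetric groups of the first \<open>e\<close> and
  of the remaining positions, and a single one is an involution by which sums are easily
  reindexed.\<close>

definition alt_sym :: "nat => nat => (nat list => 'k::field) => bool" where
 "alt_sym e m x \<longleftrightarrow> (ALL w i. length w = m --> (Suc i < e & Suc i < m --> x (swap_at i w) = - x w) &
   (e <= i & Suc i < m --> x (swap_at i w) = x w))"

text \<open>Treats alternation and symmetry at once: a construction that respects a swap up to a
  common sign \<open>s\<close> inherits both.\<close>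

lemma alt_sym_cong:
 assumes "alt_sym e m x" "!!s w i. length w = m ==> Suc i < m ==> s = 1 | s = - 1 ==>
  (ALL w. length w = m --> x (swap_at i w) = s * x w) ==> y (swap_at i w) = s * (y w :: 'k::field)"
 shows "alt_sym e m y" unfolding alt_sym_def
proof (intro allI impI conjI; elim conjE)
 fix w :: "nat list" and i
 assume w: "length w = m"
 show "y (swap_at i w) = - y w" if "Suc i < e" "Suc i < m" using assms(2)[OF w that(2), of "- 1"] assms(1) that by (simp add: alt_sym_def)
 show "y (swap_at i w) = y w" if "e <= i" "Suc i < m" using assms(2)[OF w that(2), of 1] assms(1) that by (simp add: alt_sym_def)
qed

text \<open>A model of the tensor product of an exterior and a divided power by tensors with
  explicit coordinates. The functor of the statement is compared with it at the end.\<close>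

definition AltSym :: "nat => nat => ('k::field, nat list => 'k) vfunctor" where
 "AltSym e b = \<lparr>
   fobj = (%d. (tpow_vs (e + b) d)\<lparr>carrier := {x \<in> carrier (tpow_vs (e + b) d). alt_sym e (e + b) x}\<rparr>),
   fmor = tpow_map (e + b)\<rparr>"

lemma AltSym_simps [simp]: "carrier (fobj (AltSym e b) d :: ('k::field, _) module) =
  {x. (ALL w. x w ~= 0 --> w : words (e + b) d) & alt_sym e (e + b) x}"
 "0[fobj (AltSym e b) d :: ('k, _) module] = (%w. 0)"
 "x +[fobj (AltSym e b) d :: ('k, _) module] y = (%w. x w + y w)"
 "c *[fobj (AltSym e b) d :: ('k, _) module] x = (%w. c * x w)"
 "fmor (AltSym e b :: ('k, _) vfunctor) = tpow_map (e + b)" by (auto simp: AltSym_def)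

lemma alt_sym_add: "alt_sym e m x ==> alt_sym e m y ==> alt_sym e m (%w. x w + y w)" by (simp add: alt_sym_def)

lemma alt_sym_scale: "alt_sym e m x ==> alt_sym e m (%w. c * x w)" by (simp add: alt_sym_def)

lemma alt_sym_zero: "alt_sym e m (%w. 0)" by (simp add: alt_sym_def)

lemma AltSym_vs: "vspace (fobj (AltSym e b) d :: ('k::field, _) module)" by (rule vectorspace_classI)
  (auto simp: alt_sym_add alt_sym_scale alt_sym_zero algebra_simps, (metis add.right_neutral)+)

lemma dpow_vs: "vspace (fobj (divided_power b) d :: ('k::field, _) module)"
 by (rule vectorspace_classI) (auto simp: algebra_simps, (metis add.right_neutral)+)

text \<open>Dually, a word of letters is sent to the sum over \<open>t\<close> of
  \<open>ka t\<close> times the product of the powers \<open>w_i^(p^(t_i))\<close>: additive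
  polynomials in each letter separately.\<close>

definition nat_eta :: "nat => nat => (nat list => 'k) => nat => (nat list => 'k::{field,finite}) => nat list => 'k" where
 "nat_eta c m ka d = (\<lambda>x\<in>dpow c d. %w. if w : words m d
   then SUM t:expts (CARD('k)) c m. ka t * x (pword (CARD('k)) w t) else 0)"

lemma pword_words: "w : words m d ==> t : expts p c m ==> pword p w t : words c d"
 using set_pword[of w t p] length_pword[of w t p] by (auto simp: words_def expts_def)

text \<open>The natural transformations commute with matrices because Frobenius is additive and fixes the
  matrix entries.\<close>

lemma nat_eta_natural_term: fixes A :: "'k::{field,finite} mat"
 assumes prime: "prime (CARD('k))" and A: "A : carrier_mat e d" and x: "x : dpow c d"
  and w: "w : words m e" and t: "t : expts (CARD('k)) c m" shows "tpow_map c A x (pword (CARD('k)) w t) =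
  (SUM u:words m d. (\<Prod>i<m. A $$ (w ! i, u ! i)) * x (pword (CARD('k)) u t))"
proof -
 let ?p = "CARD('k)" and ?W = "pword (CARD('k)) w t"
 let ?Y = "%a. \<Sum>v<d. single (letter v) (A $$ (a, v))"
 have lw: "length w = m" and lt: "length t = m" using w t by (auto simp: words_def expts_def)
 note W = pword_words[OF w t]
 have "(\<Prod>i<c. ?Y (?W ! i)) = prod_list (map ?Y ?W)" using W by (simp add: prod_list_nth words_def)
 also have "... = (\<Prod>i<m. ?Y (w ! i) ^ (?p ^ (t ! i)))" by (rule prod_list_pword[OF lw lt])
 also have "... = (\<Prod>i<m. \<Sum>v<d. single (repeat_mset (?p ^ (t ! i)) {#v#}, {#}) (A $$ (w ! i, v)))"
  unfolding poly_mapping_freshman[OF prime] letter_def single_power field_power_card_power by simp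
 also have "... = (SUM u:words m d. single (mset (pword ?p u t), {#}) (\<Prod>i<m. A $$ (w ! i, u ! i)))"
  unfolding prod_sum_words
 proof (rule sum.cong[OF refl])
  fix u assume "u : words m d"
  hence "(\<Sum>i<m. (repeat_mset (?p ^ (t ! i)) {#u ! i#}, {#})) = (mset (pword ?p u t), {#} :: nat multiset)"
   using lt by (simp add: mset_pword[where m = m] sum_pair words_def)
  thus "(\<Prod>i<m. single (repeat_mset (?p ^ (t ! i)) {#u ! i#}, {#} :: nat multiset) (A $$ (w ! i, u ! i))) =
   single (mset (pword ?p u t), {#}) (\<Prod>i<m. A $$ (w ! i, u ! i))" by (simp only: prod_single)
 qed
 finally show ?thesis unfolding tpow_map_eval[OF A W x] by (simp add: pm_eval_sum pm_eval_single on_mset[OF x])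
qed

lemma tpow_map_words: "tpow_map b A x w ~= 0 ==> w : words b (dim_row A)" by (auto simp: tpow_map_def split: if_splits)

lemma tpow_map_dpow: fixes A :: "'k::field mat" assumes A: "A : carrier_mat e d" and x: "x : dpow b d" shows "tpow_map b A x : dpow b e"
 unfolding dpow_iff
proof (intro conjI allI impI)
 show "w : words b e" if "tpow_map b A x w ~= 0" for w using tpow_map_words[OF that] A by simp
 fix u v :: "nat list" assume m: "mset u = mset v"
 hence wu: "u : words b e \<longleftrightarrow> v : words b e" unfolding words_def using mset_eq_length[OF m] mset_eq_setD[OF m] by auto
 show "tpow_map b A x u = tpow_map b A x v"
 proof (cases "u : words b e")
  case True
  let ?Y = "%a. \<Sum>v<d. single (letter v) (A $$ (a, v))"
  have "prod_list (map ?Y u) = prod_list (map ?Y v)" using m prod_mset_prod_list[of "map ?Y u"] prod_mset_prod_list[of "map ?Y v"] by simp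
  hence "(\<Prod>i<b. ?Y (u ! i)) = (\<Prod>i<b. ?Y (v ! i))" using True wu by (simp add: prod_list_nth words_def)
  thus ?thesis using tpow_map_eval[OF A _ x] True wu by simp
 next
  case False
  thus ?thesis using wu A by (simp add: tpow_map_def)
 qed
qed

lemma nat_eta_natural: fixes A :: "'k::{field,finite} mat"
 assumes prime: "prime (CARD('k))" and A: "A : carrier_mat e d" and x: "x : dpow c d"
 shows "nat_eta c m ka e (tpow_map c A x) = tpow_map m A (nat_eta c m ka d x)"
proof
 fix w
 let ?p = "CARD('k)"
 show "nat_eta c m ka e (tpow_map c A x) w = tpow_map m A (nat_eta c m ka d x) w"
 proof (cases "w : words m e")
  case True
  have "nat_eta c m ka e (tpow_map c A x) w =
   (SUM t:expts ?p c m. ka t * (SUM u:words m d. (\<Prod>i<m. A $$ (w ! i, u ! i)) * x (pword ?p u t)))"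
   unfolding nat_eta_def restrict_apply'[OF tpow_map_dpow[OF A x]] if_P[OF True]
   by (rule sum.cong) (simp_all add: nat_eta_natural_term[OF prime A x True])
  also have "... = (SUM u:words m d. (\<Prod>i<m. A $$ (w ! i, u ! i)) * (SUM t:expts ?p c m. ka t * x (pword ?p u t)))"
   by (simp add: sum_distrib_left mult_ac) (rule sum.swap)
  also have "... = tpow_map m A (nat_eta c m ka d x) w" using A True x by (simp add: tpow_map_def nat_eta_def del: dpow_simps)
  finally show ?thesis .
 next
  case False
  thus ?thesis using A tpow_map_dpow[OF A x] by (simp add: nat_eta_def tpow_map_def del: dpow_simps)
 qed
qed

text \<open>Swapping the positions of the word and of the exponent list together leaves the monomial
  unchanged, so a swap of the word can be traded for one of \<open>t\<close>.\<close>

lemma nat_eta_alt_sym: fixes ka :: "nat list => 'k::{field,finite}"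
 assumes x: "x : dpow c d" and ka: "alt_sym e m ka" shows "alt_sym e m (nat_eta c m ka d x)"
proof (rule alt_sym_cong[OF ka])
 fix s :: 'k and w :: "nat list" and i
 assume w: "length w = m" and i: "Suc i < m" and s: "ALL w. length w = m --> ka (swap_at i w) = s * ka w"
 let ?p = "CARD('k)" and ?T = "expts (CARD('k)) c m"
 have words: "swap_at i w : words m d \<longleftrightarrow> w : words m d"
  using w i mset_eq_setD[OF mset_swap_at[of i w]] by (simp add: words_def)
 have T: "swap_at i t : ?T" if "t : ?T" for t
 proof -
  have l: "length t = m" using that by (simp add: expts_def)
  hence "mset (map (%a. ?p ^ a) (swap_at i t)) = mset (map (%a. ?p ^ a) t)" using i by simp
  hence "(\<Sum>a\<leftarrow>swap_at i t. ?p ^ a) = (\<Sum>a\<leftarrow>t. ?p ^ a)"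
   using sum_mset_sum_list[of "map (%a. ?p ^ a) t"] sum_mset_sum_list[of "map (%a. ?p ^ a) (swap_at i t)"] by argo
  thus ?thesis using that by (simp add: expts_def)
 qed
 have "(SUM t:?T. ka t * x (pword ?p (swap_at i w) t)) =
  (SUM t:?T. ka (swap_at i t) * x (pword ?p (swap_at i w) (swap_at i t)))"
  by (rule sum.reindex_bij_witness[of _ "swap_at i" "swap_at i"])
   (use T i in \<open>auto simp: expts_def\<close>)
 also have "... = s * (SUM t:?T. ka t * x (pword ?p w t))" unfolding sum_distrib_left
 proof (rule sum.cong[OF refl])
  fix t assume "t : ?T"
  hence l: "length t = m" by (simp add: expts_def)
  have "x (pword ?p (swap_at i w) (swap_at i t)) = x (pword ?p w t)" by (rule dpowD(2)[OF x mset_pword_swap[OF w l i]])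
  thus "ka (swap_at i t) * x (pword ?p (swap_at i w) (swap_at i t)) = s * (ka t * x (pword ?p w t))" using s l by simp
 qed
 finally show "nat_eta c m ka d x (swap_at i w) = s * nat_eta c m ka d x w"
  using x words by (simp add: nat_eta_def del: dpow_simps)
qed

lemma nat_eta_nat_trans: fixes ka :: "nat list => 'k::{field,finite}"
 assumes prime: "prime (CARD('k))" and ka: "alt_sym e (e + b) ka"
 shows "nat_eta c (e + b) ka : nat_trans (divided_power c) (AltSym e b)" unfolding nat_trans_def linear_maps_def
proof (intro CollectI conjI allI ballI IntI)
 fix d
 show "nat_eta c (e + b) ka d : extensional (dpow c d)" by (simp add: nat_eta_def del: dpow_simps)
 show "nat_eta c (e + b) ka d : lin (fobj (divided_power c) d) (fobj (AltSym e b) d)"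
  unfolding module_hom_iff
 proof (intro conjI ballI allI)
  fix x :: "nat list => 'k" assume x: "x : dpow c d"
  show "nat_eta c (e + b) ka d x : carrier (fobj (AltSym e b) d)"
   using nat_eta_alt_sym[OF x ka] x by (auto simp: nat_eta_def split: if_splits simp del: dpow_simps)
  show "nat_eta c (e + b) ka d (r *[fobj (divided_power c) d] x) = r *[fobj (AltSym e b) d] nat_eta c (e + b) ka d x" for r
   using x vs_smult[OF dpow_vs x, of r] unfolding nat_eta_def by (auto simp: sum_distrib_left mult_ac simp del: dpow_simps(1) intro!: ext)
  fix y :: "nat list => 'k" assume y: "y : dpow c d"
  show "nat_eta c (e + b) ka d (x +[fobj (divided_power c) d] y) =
   nat_eta c (e + b) ka d x +[fobj (AltSym e b) d] nat_eta c (e + b) ka d y"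
   using x y vs_add[OF dpow_vs x y] unfolding nat_eta_def by (auto simp: sum.distrib algebra_simps simp del: dpow_simps(1) intro!: ext)
 qed
next
 fix d d' :: nat and A :: "'k mat" and x :: "nat list => 'k"
 assume "A : carrier_mat d' d" "x : dpow c d"
 thus "nat_eta c (e + b) ka d' (fmor (divided_power c) A x) = fmor (AltSym e b) A (nat_eta c (e + b) ka d x)"
  using nat_eta_natural[OF prime] by (simp del: dpow_simps(1))
qed

subsection \<open>Every natural transformation is of this form\<close>

definition mset_ind :: "nat multiset => nat list => 'k::field" where
 "mset_ind M u = (if mset u = M then 1 else 0)"

definition bounded_msets :: "nat => nat => nat multiset set" where
 "bounded_msets c d = mset ` words c d"

lemma bounded_msets_iff: "M : bounded_msets c d \<longleftrightarrow> size M = c & set_mset M <= {..<d}"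
 unfolding bounded_msets_def words_def by (auto simp: image_iff) (metis ex_mset set_mset_mset size_mset)

lemma finite_bounded_msets [simp]: "finite (bounded_msets c d)" by (simp add: bounded_msets_def)

lemma mset_ind_dpow: "M : bounded_msets c d ==> (mset_ind M :: nat list => 'k::field) : dpow c d"
 unfolding dpow_iff mset_ind_def by (auto simp: bounded_msets_iff words_def)

lemma dpow_sum_closed: assumes "!!i. i : I ==> f i : dpow c d"
 shows "(%u. SUM i:I. a i * f i u) : (dpow c d :: (nat list => 'k::field) set)" unfolding dpow_iff
proof (intro conjI allI impI)
 show "w : words c d" if "(SUM i:I. a i * f i w) ~= 0" for w
 proof -
  obtain i where "i : I" "a i * f i w ~= 0" using \<open>_ ~= 0\<close> by (auto elim: sum.not_neutral_contains_not_neutral)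
  thus ?thesis using dpowD(1)[OF assms[of i], of w] by fastforce
 qed
 show "(SUM i:I. a i * f i u) = (SUM i:I. a i * f i v)" if "mset u = mset v" for u v
 proof (rule sum.cong[OF refl])
  fix i assume "i : I"
  thus "a i * f i u = a i * f i v" using dpowD(2)[OF assms[of i] that] by simp
 qed
qed

lemma dpow_decompose: assumes x: "x : (dpow c d :: (nat list => 'k::field) set)"
 shows "x = (%u. SUM M:bounded_msets c d. on_mset x M * mset_ind M u)"
proof
 fix u
 show "x u = (SUM M:bounded_msets c d. on_mset x M * mset_ind M u)"
 proof (cases "mset u : bounded_msets c d")
  case True
  have "(SUM M:bounded_msets c d. on_mset x M * mset_ind M u) = (SUM M:{mset u}. on_mset x M * mset_ind M u)"
   by (rule sum.mono_neutral_right) (use True in \<open>auto simp: mset_ind_def\<close>)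
  thus ?thesis by (simp add: mset_ind_def on_mset[OF x])
 next
  case False
  hence "(SUM M:bounded_msets c d. on_mset x M * mset_ind M u) = 0" by (intro sum.neutral) (auto simp: mset_ind_def)
  moreover have "u ~: words c d" using False by (auto simp: bounded_msets_def)
  ultimately show ?thesis using dpowD(1)[OF x, of u] by argo
 qed
qed

lemma linear_sum: fixes et :: "(nat list => 'k::field) => nat list => 'k"
 assumes hom: "et : lin (fobj (divided_power c) d) (fobj (AltSym e b) d)"
  and f: "!!i. i : I ==> f i : dpow c d" and fin: "finite I"
 shows "et (%u. SUM i:I. a i * f i u) w = (SUM i:I. a i * et (f i) w)" using fin f
proof (induction I)
 case empty
 have "et (%w. 0) = (%w. 0)" using module_hom_zero[OF dpow_vs AltSym_vs hom] by simp
 thus ?case by simp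
next
 case (insert i I)
 let ?y = "%u. SUM i:I. a i * f i u"
 have f: "f i : dpow c d" and y: "?y : dpow c d" using insert.prems by (auto intro!: dpow_sum_closed simp del: dpow_simps)
 have 1: "et ((a i *[fobj (divided_power c) d] f i) +[fobj (divided_power c) d] ?y) =
  (a i *[fobj (AltSym e b) d] et (f i)) +[fobj (AltSym e b) d] et ?y"
  unfolding hom_add[OF hom vs_smult[OF dpow_vs f] y] hom_smult[OF hom f] ..
 have 2: "(%u. SUM i:insert i I. a i * f i u) = (a i *[fobj (divided_power c) d] f i) +[fobj (divided_power c) d] ?y"
  using insert by simp
 show ?case unfolding 2 1 using insert by (simp del: dpow_simps(1))
qed

text \<open>Write N as \<open>p ^ r * m\<close> with m prime to p. If \<open>m > 1\<close>, the
  binomial coefficient of N over \<open>p ^ r\<close> is prime to p although \<open>p ^ r\<close>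
  lies strictly between 0 and N.\<close>

lemma prime_power_of_binomials: fixes N p :: nat
 assumes p: "prime p" and N: "N > 0" and dvd: "!!i. 0 < i ==> i < N ==> p dvd (N choose i)"
 shows "EX k. N = p ^ k"
proof -
 obtain m where m: "N = p ^ multiplicity p N * m" "~ p dvd m" using multiplicity_decompose'[of N p] N p by (metis not_gr_zero not_prime_unit)
 let ?q = "p ^ multiplicity p N"
 have "m > 0" using m N by (auto intro!: gr0I)
 have "m = 1"
 proof (rule ccontr)
  assume "m ~= 1"
  hence "m > 1" using \<open>m > 0\<close> by simp
  moreover have q: "0 < ?q" using p by (simp add: prime_gt_0_nat)
  ultimately have "?q * 1 < ?q * m" by simp
  hence "?q < N" using m(1) by linarith
  hence "p dvd (?q * m choose ?q)" using dvd[OF q] m(1) by simp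
  moreover have "multiplicity p (?q * m choose ?q) = 0"
   using const_p_fac[OF \<open>m > 0\<close> p, of "multiplicity p N"] m(2) by (simp add: not_dvd_imp_multiplicity_0)
  moreover have "(?q * m choose ?q) ~= 0" using \<open>m > 0\<close> by simp
  ultimately show False using p by (metis multiplicity_eq_zero_iff not_prime_unit)
 qed
 thus ?thesis using m(1) by auto
qed

text \<open>Chosen so that the induced map on tensors pulls coordinates back along the renaming
  \<open>l -> w ! l\<close> (\<open>tpow_map_letter_matrix\<close>).\<close>

definition letter_matrix :: "nat => nat => nat list => 'k::field mat" where
 "letter_matrix m d w = mat m d (%(l, v). if v = w ! l then 1 else 0)"

lemma tpow_map_letter_matrix:
 assumes w: "w : words m d" and s: "s : words c m" and x: "!!u. x u ~= 0 ==> u : words c d"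
 shows "tpow_map c (letter_matrix m d w) x s = (x (map ((!) w) s) :: 'k::field)"
proof -
 have ms: "map ((!) w) s : words c d" using w s by (auto simp: words_def subset_iff)
 have one: "(\<Prod>i<c. letter_matrix m d w $$ (s ! i, u ! i)) = (if u = map ((!) w) s then 1 else (0::'k))" if u: "u : words c d" for u
 proof -
  have entry: "letter_matrix m d w $$ (s ! i, u ! i) = (if u ! i = w ! (s ! i) then 1 else (0::'k))" if "i < c" for i
   using words_nth[OF u that] words_nth[OF s that] by (simp add: letter_matrix_def)
  show ?thesis
  proof (cases "u = map ((!) w) s")
   case True
   thus ?thesis using entry words_length[OF s] by simp
  next
   case False
   then obtain i where "i < c" "u ! i ~= w ! (s ! i)" using words_length[OF u] words_length[OF s] by (auto simp: list_eq_iff_nth_eq)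
   thus ?thesis using False entry by (auto intro!: prod_zero)
  qed
 qed
 have "tpow_map c (letter_matrix m d w) x s = (SUM u:words c d. (\<Prod>i<c. letter_matrix m d w $$ (s ! i, u ! i)) * x u)"
  using s by (simp add: tpow_map_def letter_matrix_def)
 also have "... = (SUM u:words c d. if u = map ((!) w) s then x u else 0)" by (rule sum.cong) (simp_all add: one)
 finally show ?thesis using ms by (simp add: sum.delta)
qed

context fixes et :: "nat => (nat list => 'k::{field,finite}) => nat list => 'k" and c e b m :: nat
 assumes prime: "prime (CARD('k))" and et: "et : nat_trans (divided_power c) (AltSym e b)" and m: "m = e + b"
begin

lemma eta_hom: "et d : lin (fobj (divided_power c) d) (fobj (AltSym e b) d)"
 using et by (simp add: nat_trans_def linear_maps_def)

lemma eta_carrier: "x : dpow c d ==> (ALL w. et d x w ~= 0 --> w : words m d) & alt_sym e m (et d x)"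
 using eta_hom[of d] m unfolding module_hom_iff by simp

lemma eta_natural: "A : carrier_mat d' d ==> x : dpow c d ==> et d' (tpow_map c A x) = tpow_map m A (et d x)"
 using et m unfolding nat_trans_def by simp

text \<open>A Yoneda argument: naturality along \<open>letter_matrix\<close> reduces every
  coordinate to the one at the generic word \<open>[0..<m]\<close>.\<close>

lemma eta_word: assumes x: "x : dpow c d" and w: "w : words m d" shows "et d x w = et m (tpow_map c (letter_matrix m d w) x) [0..<m]"
proof -
 have I: "[0..<m] : words m m" by (auto simp: words_def)
 have A: "letter_matrix m d w : carrier_mat m d" by (simp add: letter_matrix_def)
 have "et m (tpow_map c (letter_matrix m d w) x) [0..<m] = tpow_map m (letter_matrix m d w) (et d x) [0..<m]"
  using eta_natural[OF A x] by simp
 also have "... = et d x (map ((!) w) [0..<m])" by (rule tpow_map_letter_matrix[OF w I]) (use eta_carrier[OF x] in blast)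
 also have "map ((!) w) [0..<m] = w" using words_length[OF w] map_nth by blast
 finally show ?thesis by simp
qed

definition eta_coeff :: "nat multiset => 'k" where
 "eta_coeff M = et m (mset_ind M) [0..<m]"

lemma eta_expand: assumes x: "x : dpow c m" shows "et m x [0..<m] = (SUM M:bounded_msets c m. on_mset x M * eta_coeff M)"
 by (subst dpow_decompose[OF x], subst linear_sum[OF eta_hom mset_ind_dpow])
  (simp_all add: eta_coeff_def)

text \<open>On polynomials this is the substitution of \<open>X_l0 + X_m\<close> for
  \<open>X_l0\<close>, with \<open>m\<close> as a new variable.\<close>

definition fold_matrix :: "nat => 'k mat" where
 "fold_matrix l0 = mat m (Suc m) (%(l, v). if v = l | (l = l0 & v = m) then 1 else 0)"

text \<open>The target is a space of tensors and hence multilinear: at the generic word, the row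
  \<open>l0\<close> is the sum of two unit rows and splits the value into two.\<close>

lemma eta_additive: assumes x: "x : dpow c (Suc m)" and l0: "l0 < m" shows "et m (tpow_map c (fold_matrix l0) x) [0..<m] =
  et m (tpow_map c (letter_matrix m (Suc m) [0..<m]) x) [0..<m] + et m (tpow_map c (letter_matrix m (Suc m) ([0..<m][l0 := m])) x) [0..<m]"
proof -
 let ?I = "[0..<m]" and ?I' = "[0..<m][l0 := m]"
 have I: "?I : words m m" "?I : words m (Suc m)" "?I' : words m (Suc m)"
  using set_update_subset_insert[of ?I l0 m] by (auto simp: words_def)
 have A: "fold_matrix l0 : carrier_mat m (Suc m)" by (simp add: fold_matrix_def)
 have ne: "?I ~= ?I'" using l0 by (metis length_upt minus_nat.diff_0 nat_neq_iff nth_list_update_eq nth_upt plus_nat.add_0)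
 have coeff: "(\<Prod>i<m. fold_matrix l0 $$ (?I ! i, u ! i)) = (if u = ?I | u = ?I' then 1 else 0)" if u: "u : words m (Suc m)" for u
 proof -
  have entry: "fold_matrix l0 $$ (?I ! i, u ! i) = (if u ! i = i | (i = l0 & u ! i = m) then 1 else 0)" if "i < m" for i
   using words_nth[OF u that] that by (simp add: fold_matrix_def)
  show ?thesis
  proof (cases "u = ?I | u = ?I'")
   case True
   thus ?thesis using entry by (auto intro!: prod.neutral simp: nth_list_update)
  next
   case False
   have "EX i<m. ~ (u ! i = i | (i = l0 & u ! i = m))"
   proof (rule ccontr)
    assume "~ ?thesis"
    hence *: "!!i. i < m ==> u ! i = i | (i = l0 & u ! i = m)" by blast
    have "u = (if u ! l0 = m then ?I' else ?I)"
    proof (rule nth_equalityI)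
     fix i assume "i < length u"
     hence "i < m" using words_length[OF u] by simp
     thus "u ! i = (if u ! l0 = m then ?I' else ?I) ! i" using *[of i] l0 by (cases "i = l0") (auto simp: nth_list_update)
    qed (simp add: words_length[OF u])
    thus False using False by (auto split: if_splits)
   qed
   thus ?thesis using False entry by (auto intro!: prod_zero)
  qed
 qed
 have "et m (tpow_map c (fold_matrix l0) x) ?I = tpow_map m (fold_matrix l0) (et (Suc m) x) ?I" using eta_natural[OF A x] by simp
 also have "... = (SUM u:words m (Suc m). (\<Prod>i<m. fold_matrix l0 $$ (?I ! i, u ! i)) * et (Suc m) x u)"
  using I(1) A by (simp add: tpow_map_def)
 also have "... = (SUM u:words m (Suc m). if u = ?I | u = ?I' then et (Suc m) x u else 0)"
  by (rule sum.cong[OF refl], simp only: coeff, simp)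
 also have "... = (SUM u:{?I, ?I'}. et (Suc m) x u)" by (rule sum.mono_neutral_cong_right) (use I in auto)
 also have "... = et (Suc m) x ?I + et (Suc m) x ?I'" using ne by simp
 finally show ?thesis using eta_word[OF x I(2)] eta_word[OF x I(3)] by simp
qed

text \<open>The binomial theorem for \<open>(X_l0 + X_m)\<close> raised to
  \<open>count M l0\<close>: the indicator selects the term with \<open>i\<close> letters
  \<open>l0\<close>.\<close>

lemma fold_matrix_indicator: assumes l0: "l0 < m" and M: "M : bounded_msets c m" and i: "i <= count M l0" and s: "s : words c m"
 shows "tpow_map c (fold_matrix l0) (mset_ind (filter_mset (%a. a ~= l0) M + replicate_mset i l0 +
   replicate_mset (count M l0 - i) m)) s = (if mset s = M then of_nat (count M l0 choose i) else 0)"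
proof -
 let ?N = "filter_mset (%a. a ~= l0) M + replicate_mset i l0 + replicate_mset (count M l0 - i) m"
 have Mm: "size M = c" "m ~:# M" "set_mset M <= {..<m}" using M by (auto simp: bounded_msets_iff)
 have "M = filter_mset (%a. a ~= l0) M + replicate_mset (count M l0) l0" by (rule multiset_eqI) simp
 hence "size M = size (filter_mset (%a. a ~= l0) M + replicate_mset (count M l0) l0)" by (rule arg_cong)
 hence sizeM: "size (filter_mset (%a. a ~= l0) M) + count M l0 = c" using Mm(1) by simp
 have Nb: "?N : bounded_msets c (Suc m)" using Mm sizeM i l0 unfolding bounded_msets_iff by auto
 note x = mset_ind_dpow[OF Nb, where 'k = 'k]
 have A: "fold_matrix l0 : carrier_mat m (Suc m)" by (simp add: fold_matrix_def)
 let ?X = "%v. single (letter v) (1::'k)"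
 let ?Y = "%a. \<Sum>v<Suc m. single (letter v) (fold_matrix l0 $$ (a, v))"
 have Y: "?Y a = (if a = l0 then ?X l0 + ?X m else ?X a)" if "a < m" for a
 proof -
  have "?Y a = (SUM v:(if a = l0 then {l0, m} else {a}). ?X v)"
   by (rule sum.mono_neutral_cong_right) (use that in \<open>auto simp: fold_matrix_def split: if_splits\<close>)
  thus ?thesis using l0 by simp
 qed
 have prod: "prod_list (map ?Y u) = single (filter_mset (%a. a ~= l0) (mset u), {#}) 1 * (?X l0 + ?X m) ^ count (mset u) l0"
  if "set u <= {..<m}" for u using that
 proof (induction u)
  case Nil
  thus ?case by (simp flip: zero_prod_def)
 next
  case (Cons a u)
  have "prod_list (map ?Y (a # u)) = ?Y a * (single (filter_mset (%a. a ~= l0) (mset u), {#}) 1 * (?X l0 + ?X m) ^ count (mset u) l0)"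
   using Cons by (simp del: sum.lessThan_Suc)
  moreover have "?Y a = (if a = l0 then ?X l0 + ?X m else ?X a)" using Cons.prems by (intro Y) simp
  moreover have "?X a * (single (filter_mset (%a. a ~= l0) (mset u), {#}) 1 * Q) =
   single (add_mset a (filter_mset (%a. a ~= l0) (mset u)), {#}) 1 * Q" for Q
   unfolding mult.assoc[symmetric] by (simp add: mult_single letter_def)
  ultimately show ?case by (simp add: mult.left_commute del: sum.lessThan_Suc)
 qed
 let ?n = "count (mset s) l0"
 have pw: "?X l0 ^ k * ?X m ^ (?n - k) = single (replicate_mset k l0 + replicate_mset (?n - k) m, {#}) 1" for k
  by (simp add: letter_def single_power mult_single)
 have "tpow_map c (fold_matrix l0) (mset_ind ?N) s = pm_eval (%(M, N). on_mset (mset_ind ?N) M) (prod_list (map ?Y s))"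
  using tpow_map_eval[OF A s x] words_length[OF s] by (simp only: prod_list_nth)
 also have "prod_list (map ?Y s) = (\<Sum>k\<le>?n. single
   (filter_mset (%a. a ~= l0) (mset s) + (replicate_mset k l0 + replicate_mset (?n - k) m), {#}) (of_nat (?n choose k)))"
 proof -
  have ofn: "of_nat n * single K (1::'k) = single K (of_nat n)" for n and K :: "nat multiset \<times> nat multiset"
   by (metis add.left_neutral mult.right_neutral mult_single single_of_nat)
  show ?thesis unfolding prod[of s] binomial_ring sum_distrib_left
   using s by (subst prod) (auto simp: words_def binomial_ring sum_distrib_left mult.assoc pw ofn mult_single intro!: sum.cong)
 qed
 also have "pm_eval (%(M, N). on_mset (mset_ind ?N) M) ... =
  (\<Sum>k\<le>?n. of_nat (?n choose k) * (if filter_mset (%a. a ~= l0) (mset s) + (replicate_mset k l0 + replicate_mset (?n - k) m) = ?N then 1 else 0))"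
  by (simp add: pm_eval_sum pm_eval_single on_mset_def mset_ind_def)
 also have "... = (\<Sum>k\<le>?n. if k = i & mset s = M then of_nat (?n choose k) else 0)"
 proof (rule sum.cong[OF refl])
  fix k assume k: "k : {..?n}"
  have sm: "count (mset s) m = 0" using s unfolding count_eq_zero_iff by (auto simp: words_def)
  have Mm0: "count M m = 0" using Mm(2) unfolding count_eq_zero_iff .
  have "(filter_mset (%a. a ~= l0) (mset s) + (replicate_mset k l0 + replicate_mset (?n - k) m) = ?N) \<longleftrightarrow> k = i & mset s = M"
  proof
   assume eq: "filter_mset (%a. a ~= l0) (mset s) + (replicate_mset k l0 + replicate_mset (?n - k) m) = ?N"
   have cnt: "count (filter_mset (%a. a ~= l0) (mset s) + (replicate_mset k l0 + replicate_mset (?n - k) m)) a = count ?N a" for a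
    using eq by simp
   have "k = i" using cnt[of l0] l0 by simp
   moreover have "?n - k = count M l0 - i" using cnt[of m] l0 sm Mm0 by simp
   ultimately have "?n = count M l0" using k i by simp
   moreover have "count (mset s) a = count M a" if "a ~= l0" for a using cnt[of a] that sm Mm0 by (cases "a = m") auto
   ultimately have "mset s = M" by (intro multiset_eqI) metis
   thus "k = i & mset s = M" using \<open>k = i\<close> by simp
  next
   assume "k = i & mset s = M"
   thus "filter_mset (%a. a ~= l0) (mset s) + (replicate_mset k l0 + replicate_mset (?n - k) m) = ?N" by (simp add: ac_simps)
  qed
  thus "of_nat (?n choose k) * (if filter_mset (%a. a ~= l0) (mset s) + (replicate_mset k l0 + replicate_mset (?n - k) m) = ?N then 1 else 0) =
   (if k = i & mset s = M then of_nat (?n choose k) else (0::'k))" by simp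
 qed
 also have "... = (if mset s = M then of_nat (count M l0 choose i) else 0)" using i by (auto simp: sum.delta)
 finally show ?thesis .
qed

text \<open>Additivity in the letter \<open>l0\<close> is compared with the binomial expansion. The
  mixed terms must vanish, so p divides all inner binomial coefficients of the exponent, which is
  therefore a power of p.\<close>

lemma eta_coeff_power: assumes M: "M : bounded_msets c m" and nz: "eta_coeff M ~= 0" and l0: "l0 < m"
 shows "EX k. count M l0 = CARD('k) ^ k"
proof -
 let ?N = "%i. filter_mset (%a. a ~= l0) M + replicate_mset i l0 + replicate_mset (count M l0 - i) m"
 have Mm: "size M = c" "m ~:# M" "set_mset M <= {..<m}" using M by (auto simp: bounded_msets_iff)
 have "M = filter_mset (%a. a ~= l0) M + replicate_mset (count M l0) l0" by (rule multiset_eqI) simp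
 hence "size M = size (filter_mset (%a. a ~= l0) M + replicate_mset (count M l0) l0)" by (rule arg_cong)
 hence sizeM: "size (filter_mset (%a. a ~= l0) M) + count M l0 = c" using Mm(1) by simp
 have Nb: "?N i : bounded_msets c (Suc m)" if "i <= count M l0" for i using Mm sizeM that l0 unfolding bounded_msets_iff by auto
 have A: "fold_matrix l0 : carrier_mat m (Suc m)" by (simp add: fold_matrix_def)
 have L: "letter_matrix m (Suc m) w : carrier_mat m (Suc m)" for w by (simp add: letter_matrix_def)
 let ?I = "[0..<m]" and ?I' = "[0..<m][l0 := m]"
 have I: "?I : words m (Suc m)" "?I' : words m (Suc m)" using set_update_subset_insert[of ?I l0 m] by (auto simp: words_def)
 have fold: "et m (tpow_map c (fold_matrix l0) (mset_ind (?N i))) ?I = of_nat (count M l0 choose i) * eta_coeff M"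
  if i: "i <= count M l0" for i
 proof -
  note x = mset_ind_dpow[OF Nb[OF i], where 'k = 'k]
  have "on_mset (tpow_map c (fold_matrix l0) (mset_ind (?N i))) M' = (if M' = M then of_nat (count M l0 choose i) else 0)"
   if "M' : bounded_msets c m" for M'
  proof -
   have "sorted_list_of_multiset M' : words c m"
    using that unfolding bounded_msets_iff words_def by auto (metis mset_sorted_list_of_multiset size_mset)
   thus ?thesis using fold_matrix_indicator[OF l0 M i] by (simp add: on_mset_def)
  qed
  hence "et m (tpow_map c (fold_matrix l0) (mset_ind (?N i))) ?I =
   (SUM M':bounded_msets c m. (if M' = M then of_nat (count M l0 choose i) else 0) * eta_coeff M')"
   unfolding eta_expand[OF tpow_map_dpow[OF A x]] by (intro sum.cong) auto
  thus ?thesis using M by (simp add: if_distrib[of "%a. a * _"] sum.delta cong: if_cong)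
 qed
 have letter: "et m (tpow_map c (letter_matrix m (Suc m) w) (mset_ind (?N i))) ?I =
  (SUM M':bounded_msets c m. (if image_mset ((!) w) M' = ?N i then 1 else 0) * eta_coeff M')"
  if i: "i <= count M l0" and w: "w : words m (Suc m)" for i w
 proof -
  note x = mset_ind_dpow[OF Nb[OF i], where 'k = 'k]
  have "on_mset (tpow_map c (letter_matrix m (Suc m) w) (mset_ind (?N i))) M' = (if image_mset ((!) w) M' = ?N i then 1 else (0::'k))"
   if "M' : bounded_msets c m" for M'
  proof -
   have "sorted_list_of_multiset M' : words c m"
    using that unfolding bounded_msets_iff words_def by auto (metis mset_sorted_list_of_multiset size_mset)
   moreover have "(mset_ind (?N i) u :: 'k) ~= 0 ==> u : words c (Suc m)" for u by (rule dpowD(1)[OF x])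
   ultimately show ?thesis
    using tpow_map_letter_matrix[OF w, of "sorted_list_of_multiset M'" c "mset_ind (?N i) :: nat list => 'k"]
    by (simp add: on_mset_def mset_ind_def)
  qed
  thus ?thesis unfolding eta_expand[OF tpow_map_dpow[OF L x]] by (intro sum.cong) auto
 qed
 have idI: "image_mset ((!) ?I) M' = M'" if "M' : bounded_msets c m" for M'
  using that unfolding bounded_msets_iff by (intro multiset.map_ident_strong) auto
 \<comment> \<open>If the letter \<open>l0\<close> does not occur, both summands of the additivity
   formula equal the value itself, which is then 0.\<close>
 have "count M l0 ~= 0"
 proof
  assume z: "count M l0 = 0"
  hence N0: "?N 0 = M" by (auto intro!: multiset_eqI)
  have "et m (tpow_map c (letter_matrix m (Suc m) ?I) (mset_ind (?N 0))) ?I = eta_coeff M"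
  proof -
   have "et m (tpow_map c (letter_matrix m (Suc m) ?I) (mset_ind (?N 0))) ?I =
    (SUM M':bounded_msets c m. (if image_mset ((!) ?I) M' = ?N 0 then 1 else 0) * eta_coeff M')" by (rule letter[OF le0 I(1)])
   also have "... = (SUM M':bounded_msets c m. if M' = M then eta_coeff M' else 0)" unfolding N0 by (rule sum.cong[OF refl]) (simp add: idI)
   finally show ?thesis using M by (simp add: sum.delta)
  qed
  moreover have "et m (tpow_map c (letter_matrix m (Suc m) ?I') (mset_ind (?N 0))) ?I = eta_coeff M"
  proof -
   have idI': "image_mset ((!) ?I') M' = M'" if M': "M' : bounded_msets c m" and "l0 ~:# M'" for M'
   proof (rule multiset.map_ident_strong)
    fix z assume "z \<in># M'"
    hence "z < m" "z ~= l0" using M' \<open>l0 ~:# M'\<close> by (auto simp: bounded_msets_iff)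
    thus "?I' ! z = z" by simp
   qed
   have "image_mset ((!) ?I') M' = M \<longleftrightarrow> M' = M" if M': "M' : bounded_msets c m" for M'
   proof
    assume eq: "image_mset ((!) ?I') M' = M"
    have "l0 ~:# M'"
    proof
     assume "l0 \<in># M'"
     hence "?I' ! l0 \<in># image_mset ((!) ?I') M'" by simp
     thus False using Mm(2) l0 unfolding eq by simp
    qed
    hence "image_mset ((!) ?I') M' = M'" by (rule idI'[OF M'])
    thus "M' = M" using eq by simp
   next
    assume "M' = M"
    thus "image_mset ((!) ?I') M' = M" using idI'[OF M] z by (simp add: count_eq_zero_iff)
   qed
   thus ?thesis
   proof -
    assume eq: "!!M'. M' : bounded_msets c m ==> (image_mset ((!) ?I') M' = M) = (M' = M)"
    have "et m (tpow_map c (letter_matrix m (Suc m) ?I') (mset_ind (?N 0))) ?I =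
     (SUM M':bounded_msets c m. (if image_mset ((!) ?I') M' = ?N 0 then 1 else 0) * eta_coeff M')" by (rule letter[OF le0 I(2)])
    also have "... = (SUM M':bounded_msets c m. if M' = M then eta_coeff M' else 0)" unfolding N0 by (rule sum.cong[OF refl]) (simp add: eq)
    finally show ?thesis using M by (simp add: sum.delta)
   qed
  qed
  ultimately have "eta_coeff M = eta_coeff M + eta_coeff M" using eta_additive[OF mset_ind_dpow[OF Nb[OF le0]] l0] fold[OF le0] z by simp
  hence "eta_coeff M = 0" unfolding add_cancel_right_right .
  thus False using nz by simp
 qed
 \<comment> \<open>A mixed term contains both \<open>l0\<close> and \<open>m\<close>, whereas the
   renaming by \<open>?I\<close> never produces \<open>m\<close> and the one by \<open>?I'\<close>
   never produces \<open>l0\<close>; so the right side of the additivity formula vanishes.\<close>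
 moreover have "CARD('k) dvd (count M l0 choose i)" if i: "0 < i" "i < count M l0" for i
 proof -
  have i': "i <= count M l0" using i by simp
  have z1: "image_mset ((!) ?I) M' ~= ?N i" if "M' : bounded_msets c m" for M'
  proof
   assume "image_mset ((!) ?I) M' = ?N i"
   hence "m \<in># M'" using idI[OF that] i by simp
   thus False using that by (auto simp: bounded_msets_iff)
  qed
  have z2: "image_mset ((!) ?I') M' ~= ?N i" if M': "M' : bounded_msets c m" for M'
  proof
   assume eq: "image_mset ((!) ?I') M' = ?N i"
   have "l0 \<in># ?N i" using i by simp
   then obtain a where "a \<in># M'" "?I' ! a = l0" unfolding eq[symmetric] by auto
   thus False using M' l0 by (auto simp: bounded_msets_iff nth_list_update split: if_splits)
  qed
  have "of_nat (count M l0 choose i) * eta_coeff M = 0" using eta_additive[OF mset_ind_dpow[OF Nb[OF i']] l0]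
   unfolding fold[OF i'] letter[OF i' I(1)] letter[OF i' I(2)] using z1 z2 by (simp cong: sum.cong)
  hence "(of_nat (count M l0 choose i) :: 'k) = 0" using nz by simp
  thus ?thesis using char_prime_field[OF prime] by (simp add: of_nat_eq_0_iff_char_dvd)
 qed
 ultimately show ?thesis using prime_power_of_binomials[OF prime, of "count M l0"] by blast
qed

end

lemma map_pword: "map f (pword p w t) = pword p (map f w) t" by (induction w t rule: list_induct2') (auto simp: pword_def)

lemma count_pword_id: assumes "length t = m" shows "count (mset (pword p [0..<m] t)) a = (if a < m then p ^ (t ! a) else 0)"
proof -
 have "count (mset (pword p [0..<m] t)) a = (\<Sum>i<m. if i = a then p ^ (t ! i) else 0)"
  using assms by (simp add: mset_pword[where m = m] count_sum if_distrib cong: if_cong)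
 thus ?thesis by (simp add: sum.delta)
qed

lemma pword_id_inj: assumes "p > 1" "length t = m" "length t' = m"
  "mset (pword p [0..<m] t) = mset (pword p [0..<m] t')" shows "t = t'"
proof (rule nth_equalityI)
 fix i assume "i < length t"
 hence "p ^ (t ! i) = p ^ (t' ! i)" using count_pword_id[OF assms(2), of p i] count_pword_id[OF assms(3), of p i] assms(2,4) by simp
 thus "t ! i = t' ! i" using assms(1) by simp
qed (use assms in simp)

lemma id_word: "[0..<m] : words m m" by (auto simp: words_def)

lemma pword_id_bounded: "t : expts p c m ==> mset (pword p [0..<m] t) : bounded_msets c m"
 unfolding bounded_msets_def using pword_words[OF id_word] by blast

text \<open>On the generic word distinct exponent lists give distinct monomials, so the indicator of
  one of them isolates a single coefficient.\<close>

lemma nat_eta_extract: fixes ka :: "nat list => 'k::{field,finite}"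
 assumes p: "prime (CARD('k))" and t0: "t0 : expts (CARD('k)) c m"
 shows "nat_eta c m ka m (mset_ind (mset (pword (CARD('k)) [0..<m] t0))) [0..<m] = ka t0"
proof -
 let ?p = "CARD('k)"
 have "(SUM t:expts ?p c m. ka t * mset_ind (mset (pword ?p [0..<m] t0)) (pword ?p [0..<m] t)) =
  (SUM t:expts ?p c m. if t = t0 then ka t else 0)"
 proof (rule sum.cong[OF refl])
  fix t assume t: "t : expts ?p c m"
  have "mset (pword ?p [0..<m] t) = mset (pword ?p [0..<m] t0) \<longleftrightarrow> t = t0"
   using pword_id_inj[OF prime_gt_1_nat[OF p], of t m t0] t t0 by (auto simp: expts_def)
  thus "ka t * mset_ind (mset (pword ?p [0..<m] t0)) (pword ?p [0..<m] t) = (if t = t0 then ka t else 0)"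
   by (simp add: mset_ind_def)
 qed
 thus ?thesis using mset_ind_dpow[OF pword_id_bounded[OF t0], where 'k = 'k] t0
   finite_expts[OF prime_gt_1_nat[OF p], of c m] id_word[of m] by (simp add: nat_eta_def sum.delta del: dpow_simps(1))
qed

lemma nat_eta_eq_zeroD: fixes ka :: "nat list => 'k::{field,finite}"
 assumes p: "prime (CARD('k))" and z: "!!x w. x : dpow c m ==> nat_eta c m ka m x w = 0"
  and t: "t : expts (CARD('k)) c m" shows "ka t = 0"
 using nat_eta_extract[OF p t, of ka] z[OF mset_ind_dpow[OF pword_id_bounded[OF t]]] by simp

text \<open>The coefficients are read off from indicators at the generic word. Since
  \<open>eta_coeff_power\<close> admits only powers of p as exponents, no other indicators
  contribute, and \<open>eta_word\<close> extends the formula to all words.\<close>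

theorem nat_eta_surj: fixes et :: "nat => (nat list => 'k::{field,finite}) => nat list => 'k"
 assumes prime: "prime (CARD('k))" and et: "et : nat_trans (divided_power c) (AltSym e b)"
 obtains ka where "alt_sym e (e + b) ka" "!!t. ka t ~= 0 ==> t : expts (CARD('k)) c (e + b)"
  "et = nat_eta c (e + b) ka"
proof -
 let ?p = "CARD('k)" and ?m = "e + b"
 let ?T = "expts ?p c ?m" and ?I = "[0..<?m]"
 let ?g = "%t. mset (pword ?p ?I t)"
 define ka where "ka t = (if t : ?T then et ?m (mset_ind (?g t)) ?I else 0)" for t
 note E = eta_coeff_def[OF prime et refl]
 have p1: "?p > 1" by (rule prime_gt_1_nat[OF prime])
 have inj: "inj_on ?g ?T" using pword_id_inj[OF p1] by (auto simp: inj_on_def expts_def)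
 have zero: "et ?m (mset_ind M) ?I = 0" if M: "M : bounded_msets c ?m - ?g ` ?T" for M
 proof (rule ccontr)
  assume nz: "et ?m (mset_ind M) ?I ~= 0"
  have "ALL l. EX k. l < ?m --> count M l = ?p ^ k"
   using eta_coeff_power[OF prime et refl, of M] M nz unfolding E by blast
  then obtain f where f: "!!l. l < ?m ==> count M l = ?p ^ f l" by metis
  let ?t = "map f ?I"
  have "M = ?g ?t"
  proof (rule multiset_eqI)
   fix a
   have "count M a = 0" if "~ a < ?m" using M that by (auto simp: bounded_msets_iff count_eq_zero_iff)
   thus "count M a = count (?g ?t) a" using f count_pword_id[of ?t ?m ?p a] by simp
  qed
  moreover have "?t : ?T"
  proof -
   have "c = size (?g ?t)" using M \<open>M = ?g ?t\<close> by (auto simp: bounded_msets_iff)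
   also have "... = (\<Sum>a\<leftarrow>?t. ?p ^ a)" by (simp add: length_pword)
   finally show ?thesis by (simp add: expts_def)
  qed
  ultimately show False using M by blast
 qed
 have formula: "et d x w = nat_eta c ?m ka d x w" if x: "x : dpow c d" for d x w
 proof (cases "w : words ?m d")
  case w: True
  let ?A = "letter_matrix ?m d w :: 'k mat"
  have A: "?A : carrier_mat ?m d" by (simp add: letter_matrix_def)
  have "et d x w = et ?m (tpow_map c ?A x) ?I" by (rule eta_word[OF prime et refl x w])
  also have "... = (SUM M:bounded_msets c ?m. on_mset (tpow_map c ?A x) M * et ?m (mset_ind M) ?I)"
   using eta_expand[OF prime et refl tpow_map_dpow[OF A x]] unfolding E .
  also have "... = (SUM M:?g ` ?T. on_mset (tpow_map c ?A x) M * et ?m (mset_ind M) ?I)"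
   by (rule sum.mono_neutral_right) (use zero pword_id_bounded in auto)
  also have "... = (SUM t:?T. on_mset (tpow_map c ?A x) (?g t) * et ?m (mset_ind (?g t)) ?I)"
   by (rule sum.reindex[OF inj, unfolded o_def])
  also have "... = (SUM t:?T. ka t * x (pword ?p w t))"
  proof (rule sum.cong[OF refl])
   fix t assume t: "t : ?T"
   have "on_mset (tpow_map c ?A x) (?g t) = tpow_map c ?A x (pword ?p ?I t)" by (rule on_mset[OF tpow_map_dpow[OF A x]])
   also have "... = x (map ((!) w) (pword ?p ?I t))" by (rule tpow_map_letter_matrix[OF w pword_words[OF id_word t] dpowD(1)[OF x]])
   also have "map ((!) w) (pword ?p ?I t) = pword ?p w t" using words_length[OF w] map_nth[of w] by (simp only: map_pword)
   finally show "on_mset (tpow_map c ?A x) (?g t) * et ?m (mset_ind (?g t)) ?I = ka t * x (pword ?p w t)"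
    using t by (simp add: ka_def)
  qed
  finally show ?thesis using x w by (simp add: nat_eta_def del: dpow_simps(1))
 next
  case False
  thus ?thesis using eta_carrier[OF prime et refl x] x by (auto simp: nat_eta_def simp del: dpow_simps(1))
 qed
 have eq: "et = nat_eta c ?m ka"
 proof (rule ext, rule ext)
  fix d x
  show "et d x = nat_eta c ?m ka d x"
  proof (cases "x : dpow c d")
   case True
   thus ?thesis using formula by blast
  next
   case False
   moreover have "et d : extensional (dpow c d)" using et by (auto simp: nat_trans_def linear_maps_def simp del: dpow_simps)
   ultimately show ?thesis by (simp add: nat_eta_def extensional_def del: dpow_simps)
  qed
 qed
 have swapT: "swap_at i t : ?T" if "t : ?T" "Suc i < ?m" for i t
 proof -
  have l: "length t = ?m" using that by (simp add: expts_def)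
  hence "mset (map (%a. ?p ^ a) (swap_at i t)) = mset (map (%a. ?p ^ a) t)" using that by simp
  hence "(\<Sum>a\<leftarrow>swap_at i t. ?p ^ a) = (\<Sum>a\<leftarrow>t. ?p ^ a)"
   using sum_mset_sum_list[of "map (%a. ?p ^ a) t"] sum_mset_sum_list[of "map (%a. ?p ^ a) (swap_at i t)"] by argo
  thus ?thesis using that by (simp add: expts_def)
 qed
 \<comment> \<open>Evaluation at the swapped generic word moves the transposition onto the exponent
   list. The relation obtained this way is inverted using that \<open>s\<close> is 1 or -1.\<close>
 have swap: "ka (swap_at i t) = s * ka t"
  if len: "length t = ?m" and i: "Suc i < ?m" and s1: "s = 1 | s = - 1" and s: "!!x. x : dpow c ?m ==> et ?m x (swap_at i ?I) = s * et ?m x ?I" for i t s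
 proof (cases "t : ?T")
  case True
  let ?x = "mset_ind (?g (swap_at i t)) :: nat list => 'k"
  note sT = swapT[OF True i]
  note x = mset_ind_dpow[OF pword_id_bounded[OF sT], where 'k = 'k]
  have sI: "swap_at i ?I : words ?m ?m" using mset_eq_setD[OF mset_swap_at[of i ?I]] i by (auto simp: words_def)
  have "et ?m ?x (swap_at i ?I) = (SUM t':?T. ka t' * ?x (pword ?p (swap_at i ?I) t'))"
   using sI x unfolding eq nat_eta_def by (simp del: dpow_simps(1))
  also have "... = (SUM t':?T. if t' = t then ka t' else 0)"
  proof (rule sum.cong[OF refl])
   fix t' assume t': "t' : ?T"
   have l': "length t' = ?m" using t' by (simp add: expts_def)
   have "mset (pword ?p (swap_at i ?I) t') = ?g (swap_at i t')" using mset_pword_swap[of "swap_at i ?I" ?m t' i ?p] l' i by simp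
   moreover have "?g (swap_at i t') = ?g (swap_at i t) \<longleftrightarrow> t' = t"
    using pword_id_inj[OF p1, of "swap_at i t'" ?m "swap_at i t"] l' len i by (metis length_swap_at swap_at_swap_at)
   ultimately show "ka t' * ?x (pword ?p (swap_at i ?I) t') = (if t' = t then ka t' else 0)" by (simp add: mset_ind_def)
  qed
  also have "... = ka t" using True finite_expts[OF p1] by (simp add: sum.delta)
  finally have "s * ka (swap_at i t) = ka t" using s[OF x] sT by (simp add: ka_def)
  thus ?thesis using s1 minus_equation_iff[of "ka (swap_at i t)" "ka t"] by auto
 next
  case False
  hence "swap_at i t ~: ?T" using swapT[of "swap_at i t" i] i len by auto
  thus ?thesis using False by (simp add: ka_def)
 qed
 have "alt_sym e ?m ka" unfolding alt_sym_def
 proof (intro allI impI conjI; elim conjE)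
  fix t :: "nat list" and i
  assume t: "length t = ?m"
  have alt: "alt_sym e ?m (et ?m x)" if "x : dpow c ?m" for x using eta_carrier[OF prime et refl that] by auto
  have lI: "length ?I = ?m" by simp
  show "ka (swap_at i t) = - ka t" if i: "Suc i < e" "Suc i < ?m"
  proof -
   have "et ?m x (swap_at i ?I) = - 1 * et ?m x ?I" if "x : dpow c ?m" for x using alt[OF that] lI i unfolding alt_sym_def by fastforce
   thus ?thesis using swap[OF t i(2), of "- 1"] by simp
  qed
  show "ka (swap_at i t) = ka t" if i: "e <= i" "Suc i < ?m"
  proof -
   have "et ?m x (swap_at i ?I) = 1 * et ?m x ?I" if "x : dpow c ?m" for x using alt[OF that] lI i unfolding alt_sym_def by fastforce
   thus ?thesis using swap[OF t i(2), of 1] by simp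
  qed
 qed
 moreover have "!!t. ka t ~= 0 ==> t : ?T" by (simp add: ka_def split: if_splits)
 ultimately show ?thesis using eq that by blast
qed

section \<open>The action of Milnor basis elements on natural transformations\<close>

lemma block_concat: "j < length xss ==> block (map length xss) j (concat xss) = xss ! j"
proof -
 assume j: "j < length xss"
 have "concat xss = concat (take j xss) @ xss ! j @ concat (drop (Suc j) xss)" by (subst id_take_nth_drop[OF j]) simp
 moreover have "sum_list (take j (map length xss)) = length (concat (take j xss))" by (simp add: length_concat take_map)
 ultimately show ?thesis using j by (simp add: block_def)
qed

lemma mset_nths: "mset (nths w A) = (\<Sum>i<length w. if i : A then {#w ! i#} else {#})"
proof (induction w rule: rev_induct)
 case (snoc a w)
 have "(\<Sum>i<length w. if i : A then {#(w @ [a]) ! i#} else {#}) = (\<Sum>i<length w. if i : A then {#w ! i#} else {#})"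
  by (rule sum.cong) (auto simp: nth_append)
 thus ?case using snoc by (simp add: nths_append)
qed simp

lemma sum_list_replicate_mset: "(\<Sum>a\<leftarrow>u. replicate_mset q a) = repeat_mset q (mset u)" by (induction u) simp_all

lemma repeat_mset_sum: "repeat_mset q (SUM i:I. f i) = (SUM i:I. repeat_mset q (f i))" by (rule multiset_eqI) (simp add: count_sum sum_distrib_left)

lemma sum_count_list_less: "(\<Sum>j<K. count_list c j) = length (filter (%x. x < K) c)" for K :: nat
proof (induction c)
 case (Cons a c)
 have "(\<Sum>j<K. count_list (a # c) j) = (\<Sum>j<K. count_list c j + (if j = a then 1 else 0))" by (rule sum.cong) auto
 thus ?case using Cons by (simp add: sum.distrib sum.delta)
qed simp

lemma count_list_nth: "count_list c j = (\<Sum>i<length c. if c ! i = j then 1 else 0)"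
 by (induction c) (auto simp: sum.lessThan_Suc_shift simp del: sum.lessThan_Suc)

lemma sum_factor_sizes: assumes "lookup R 0 = 0" "exponent_sum R <= a" shows "sum_list (factor_sizes a R) = a"
proof -
 let ?M = "Max (insert 0 (keys R))"
 have "(\<Sum>j\<leftarrow>[1..<Suc ?M]. lookup R j) = (SUM j:{1..<Suc ?M}. lookup R j)"
  by (simp only: sum_list_distinct_conv_sum_set distinct_upt set_upt)
 also have "... = exponent_sum R" unfolding exponent_sum_def
 proof (rule sum.mono_neutral_right)
  show "keys R <= {1..<Suc ?M}"
  proof
   fix j assume j: "j : keys R"
   hence "j <= ?M" by (intro Max_ge) auto
   moreover have "j ~= 0" using j assms(1) by (intro notI) (simp add: in_keys_iff)
   ultimately show "j : {1..<Suc ?M}" by auto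
  qed
 qed (auto simp: in_keys_iff)
 finally show ?thesis using assms(2) by (simp add: factor_sizes_def)
qed

text \<open>A position assigned to factor \<open>j\<close> has its letter repeated
  \<open>p ^ j\<close> times by the Verschiebung. Only the resulting multiset matters, because
  \<open>x\<close> is symmetric, so the order within and between the blocks disappears.\<close>

lemma theta_eval: fixes x :: "nat list => 'k::{field,finite}"
 assumes rs: "rs = factor_sizes a R" "K = length rs" and R: "lookup R 0 = 0" "exponent_sum R <= a"
  and x: "x : dpow b d" and W: "W : words a d" shows "theta a R d x W = (SUM c:words a K. if ALL j<K. count_list c j = rs ! j
  then on_mset x (\<Sum>i<a. repeat_mset (CARD('k) ^ (c ! i)) {#W ! i#}) else 0)"
proof -
 let ?C = "{c. length c = a & (ALL j<K. count_list c j = rs ! j)}"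
 let ?xss = "%c. map (%j. nths W {i. c ! i = j}) [0..<K]"
 have sum: "sum_list rs = a" using sum_factor_sizes[OF R] rs by simp
 have lW: "length W = a" by (rule words_length[OF W])
 \<comment> \<open>The prescribed multiplicities already add up to the length \<open>a\<close>, so
   no entry of \<open>c\<close> can be \<open>K\<close> or more.\<close>
 have C: "c : words a K" if c: "c : ?C" for c
 proof -
  have "length (filter (%x. x < K) c) = (\<Sum>j<K. rs ! j)" unfolding sum_count_list_less[symmetric] using c by (intro sum.cong) auto
  also have "... = length c" using c sum rs(2) by (simp add: sum_list_sum_nth lessThan_atLeast0)
  finally have "filter (%x. x < K) c = c" using length_filter_le filter_id_conv by (metis length_filter_less nat_less_le)
  thus ?thesis using c by (auto simp: words_def filter_id_conv)
 qed
 have "theta a R d x W = (SUM c:?C. verschiebungs rs d x (concat (?xss c)))" using W rs sum by (simp add: theta_def shuffle_product_def)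
 also have "... = (SUM c:?C. on_mset x (\<Sum>i<a. repeat_mset (CARD('k) ^ (c ! i)) {#W ! i#}))"
 proof (rule sum.cong[OF refl])
  fix c assume c: "c : ?C"
  have len: "length (nths W {i. c ! i = j}) = count_list c j" for j
   using c lW by (simp add: length_nths count_list_eq_length_filter length_filter_conv_card eq_commute[of j])
  have ml: "map length (?xss c) = rs" using c rs(2) by (intro nth_equalityI) (simp_all add: len)
  have block: "block rs j (concat (?xss c)) = nths W {i. c ! i = j}" if "j < K" for j using block_concat[of j "?xss c"] that unfolding ml by simp
  have "concat (?xss c) : words a d"
  proof -
   have "length (concat (?xss c)) = a" using arg_cong[OF ml, of sum_list] sum by (simp only: length_concat)
   moreover have "set (concat (?xss c)) <= set W" using set_nths_subset[of W] by auto
   ultimately show ?thesis using W by (auto simp: words_def)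
  qed
  moreover have "concat (map (%j. concat (map (replicate (CARD('k) ^ j)) (block rs j (concat (?xss c))))) [0..<length rs]) =
   concat (map (%j. concat (map (replicate (CARD('k) ^ j)) (nths W {i. c ! i = j}))) [0..<K])"
   using block by (intro arg_cong[where f = concat] map_cong) (auto simp: rs(2)[symmetric] simp del: map_map)
  ultimately have "verschiebungs rs d x (concat (?xss c)) =
   x (concat (map (%j. concat (map (replicate (CARD('k) ^ j)) (nths W {i. c ! i = j}))) [0..<K]))"
   using sum by (simp only: verschiebungs_def) simp
  also have "... = on_mset x (mset (concat (map (%j. concat (map (replicate (CARD('k) ^ j)) (nths W {i. c ! i = j}))) [0..<K])))"
   by (rule on_mset[OF x, symmetric])
  also have "mset (concat (map (%j. concat (map (replicate (CARD('k) ^ j)) (nths W {i. c ! i = j}))) [0..<K])) =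
   (\<Sum>j<K. repeat_mset (CARD('k) ^ j) (mset (nths W {i. c ! i = j})))"
   by (simp add: sum_list_replicate_mset mset_concat o_def interv_sum_list_conv_sum_set_nat lessThan_atLeast0)
  also have "... = (\<Sum>j<K. \<Sum>i<a. if c ! i = j then repeat_mset (CARD('k) ^ j) {#W ! i#} else {#})"
   unfolding mset_nths repeat_mset_sum lW by (intro sum.cong) auto
  also have "... = (\<Sum>i<a. \<Sum>j<K. if c ! i = j then repeat_mset (CARD('k) ^ j) {#W ! i#} else {#})" by (rule sum.swap)
  also have "... = (\<Sum>i<a. repeat_mset (CARD('k) ^ (c ! i)) {#W ! i#})"
   using words_nth[OF C[OF c]] by (intro sum.cong) (auto simp: sum.delta')
  finally show "verschiebungs rs d x (concat (?xss c)) = on_mset x (\<Sum>i<a. repeat_mset (CARD('k) ^ (c ! i)) {#W ! i#})" .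
 qed
 also have "... = (SUM c:words a K. if ALL j<K. count_list c j = rs ! j
  then on_mset x (\<Sum>i<a. repeat_mset (CARD('k) ^ (c ! i)) {#W ! i#}) else 0)"
  by (rule sum.mono_neutral_cong_left) (use C in \<open>auto simp: words_length\<close>)
 finally show ?thesis .
qed

text \<open>The second variable of the generating polynomial records the factor to which a letter is assigned.\<close>

definition theta_poly :: "nat => nat => nat => 'k::comm_ring_1 bipoly" where
 "theta_poly p K l = (\<Sum>j<K. single (repeat_mset (p ^ j) {#l#}, {#j#}) 1)"

text \<open>Extracts the part in which the \<open>j\<close>-th variable of the second kind has
  degree \<open>rs ! j\<close>, that is, the factor \<open>j\<close> receives the right number of
  letters.\<close>

definition theta_form :: "nat list => (nat list => 'k) => nat multiset \<times> nat multiset => 'k::zero" where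
 "theta_form rs x = (%(M, N). if ALL j<length rs. count N j = rs ! j then on_mset x M else 0)"

lemma count_sum_repeat: "count (\<Sum>i<n. repeat_mset (f i) {#c i#}) j = (\<Sum>i<n. if c i = j then f i else 0)" for n :: nat
 by (simp add: count_sum) (rule sum.cong, auto)

lemma theta_pm_eval: fixes x :: "nat list => 'k::{field,finite}"
 assumes rs: "rs = factor_sizes a R" and R: "lookup R 0 = 0" "exponent_sum R <= a"
  and x: "x : dpow b d" and W: "W : words a d"
 shows "theta a R d x W = pm_eval (theta_form rs x) (prod_list (map (theta_poly (CARD('k)) (length rs)) W))"
proof -
 let ?p = "CARD('k)" and ?K = "length rs"
 have "pm_eval (theta_form rs x) (prod_list (map (theta_poly ?p ?K) W)) = (SUM c:words a ?K. if ALL j<?K. count_list c j = rs ! j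
   then on_mset x (\<Sum>i<a. repeat_mset (?p ^ (c ! i)) {#W ! i#}) else 0)"
  unfolding prod_list_nth words_length[OF W] theta_poly_def prod_sum_words prod_single pm_eval_sum pm_eval_single sum_pair
 proof (rule sum.cong[OF refl])
  fix c assume c: "c : words a ?K"
  have "count (\<Sum>i<a. {#c ! i#}) j = count_list c j" for j
   using count_sum_repeat[of "%_. 1" "(!) c" a j] count_list_nth[of c j] words_length[OF c] by simp
  thus "(\<Prod>i<a. 1) * theta_form rs x (\<Sum>i<a. repeat_mset (?p ^ (c ! i)) {#W ! i#}, \<Sum>i<a. {#c ! i#}) =
   (if ALL j<?K. count_list c j = rs ! j then on_mset x (\<Sum>i<a. repeat_mset (?p ^ (c ! i)) {#W ! i#}) else 0)"
   by (auto simp: theta_form_def)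
 qed
 thus ?thesis using theta_eval[OF rs refl R x W] by simp
qed

lemma theta_dpow: fixes x :: "nat list => 'k::{field,finite}"
 assumes R: "lookup R 0 = 0" "exponent_sum R <= a" and x: "x : dpow b d" shows "theta a R d x : dpow a d" unfolding dpow_iff
proof (intro conjI allI impI)
 have z: "theta a R d x w = 0" if "w ~: words a d" for w using that sum_factor_sizes[OF R] by (simp add: theta_def shuffle_product_def)
 thus "w : words a d" if "theta a R d x w ~= 0" for w using that by blast
 fix u v :: "nat list" assume m: "mset u = mset v"
 hence wu: "u : words a d \<longleftrightarrow> v : words a d" unfolding words_def using mset_eq_length[OF m] mset_eq_setD[OF m] by auto
 let ?Y = "theta_poly (CARD('k)) (length (factor_sizes a R)) :: nat => 'k bipoly"
 have "prod_list (map ?Y u) = prod_list (map ?Y v)" using m prod_mset_prod_list[of "map ?Y u"] prod_mset_prod_list[of "map ?Y v"] by simp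
 thus "theta a R d x u = theta a R d x v" using theta_pm_eval[OF refl R x] z wu by metis
qed

text \<open>The polynomial of a letter enters with the power \<open>p^(t_i)\<close>, and Frobenius
  is additive: only assignments that give all \<open>p^(t_i)\<close> copies of a letter to one
  factor \<open>J_i\<close> survive. The Verschiebung then raises the exponent from
  \<open>t_i\<close> to \<open>t_i + J_i\<close>.\<close>

lemma theta_pword: fixes x :: "nat list => 'k::{field,finite}" assumes prime: "prime (CARD('k))"
  and rs: "rs = factor_sizes a R" "K = length rs" and R: "lookup R 0 = 0" "exponent_sum R <= a"
  and x: "x : dpow b d" and w: "w : words m d" and t: "t : expts (CARD('k)) a m"
 shows "theta a R d x (pword (CARD('k)) w t) =
  (SUM J:words m K. if ALL j<K. rs ! j = (\<Sum>i<m. if J ! i = j then CARD('k) ^ (t ! i) else 0)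
    then x (pword (CARD('k)) w (map2 (+) t J)) else 0)"
proof -
 let ?p = "CARD('k)"
 have lw: "length w = m" and lt: "length t = m" using w t by (auto simp: words_def expts_def)
 have "prod_list (map (theta_poly ?p K) (pword ?p w t)) = (\<Prod>i<m. theta_poly ?p K (w ! i) ^ (?p ^ (t ! i)) :: 'k bipoly)"
  by (rule prod_list_pword[OF lw lt])
 also have "... = (\<Prod>i<m. \<Sum>j<K. single (repeat_mset (?p ^ (t ! i) * ?p ^ j) {#w ! i#}, repeat_mset (?p ^ (t ! i)) {#j#}) (1::'k))"
  unfolding theta_poly_def poly_mapping_freshman[OF prime] single_power repeat_mset_right by simp
 also have "... = (SUM J:words m K. single
   (\<Sum>i<m. repeat_mset (?p ^ (t ! i) * ?p ^ (J ! i)) {#w ! i#}, \<Sum>i<m. repeat_mset (?p ^ (t ! i)) {#J ! i#}) 1)"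
  unfolding prod_sum_words prod_single sum_pair by simp
 also have "... = (SUM J:words m K. single
  (mset (pword ?p w (map2 (+) t J)), \<Sum>i<m. repeat_mset (?p ^ (t ! i)) {#J ! i#}) 1)"
 proof (rule sum.cong[OF refl])
  fix J assume "J : words m K"
  hence lJ: "length J = m" by (rule words_length)
  hence "mset (pword ?p w (map2 (+) t J)) = (\<Sum>i<m. repeat_mset (?p ^ (t ! i) * ?p ^ (J ! i)) {#w ! i#})"
   using lt by (simp add: mset_pword[OF lw] power_add)
  thus "single (\<Sum>i<m. repeat_mset (?p ^ (t ! i) * ?p ^ (J ! i)) {#w ! i#}, \<Sum>i<m. repeat_mset (?p ^ (t ! i)) {#J ! i#}) (1::'k) =
   single (mset (pword ?p w (map2 (+) t J)), \<Sum>i<m. repeat_mset (?p ^ (t ! i)) {#J ! i#}) 1" by simp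
 qed
 finally have "theta a R d x (pword ?p w t) = pm_eval (theta_form rs x) (SUM J:words m K. single
   (mset (pword ?p w (map2 (+) t J)), \<Sum>i<m. repeat_mset (?p ^ (t ! i)) {#J ! i#}) 1)"
  using theta_pm_eval[OF rs(1) R x pword_words[OF w t]] rs(2) by simp
 thus ?thesis unfolding pm_eval_sum pm_eval_single theta_form_def prod.case count_sum_repeat on_mset[OF x]
  using rs(2) by (simp add: eq_commute[of "rs ! _"])
qed

text \<open>If \<open>i\<close> lists the exponents of a word in \<open>Xi\<close>, the atom \<open>Xi (s - j) (p ^ j)\<close> is the left factor
  of the term of the coproduct of \<open>\<xi>\<^sub>s\<close> with right factor \<open>\<xi>\<^sub>j\<close>.\<close>

definition xi_word :: "nat => nat list => nat list => atom list" where
 "xi_word p t i = map2 (%s j. Xi (s - j) (p ^ j)) t i"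

definition below :: "nat list => nat list set" where
 "below t = {i. list_all2 (\<le>) i t}"

lemma below_Nil [simp]: "below [] = {[]}" by (simp add: below_def)

lemma below_Cons: "below (s # t) = (%(j, i). j # i) ` ({..s} \<times> below t)" by (auto simp: below_def list_all2_Cons2 image_iff)

lemma finite_below [simp]: "finite (below t)" by (induction t) (simp_all add: below_Cons)

lemma below_length: "i : below t ==> length i = length t" by (simp add: below_def list_all2_lengthD)

lemma taus_xi_word: "taus (xi_word p t i) = []" by (rule taus_no_tau) (auto simp: xi_word_def)

lemma lookup_xi_word: assumes "length t = m" "length i = m" shows "lookup (snd (wmon (xi_word p t i))) j =
  (if j = 0 then 0 else \<Sum>l<m. if t ! l - i ! l = j then p ^ (i ! l) else 0)"
proof -
 have "length t = length i ==> lookup (snd (wmon (xi_word p t i))) j =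
  (\<Sum>l<length t. if j ~= 0 & t ! l - i ! l = j then p ^ (i ! l) else 0)" by (induction t i rule: list_induct2)
   (auto simp: xi_word_def lookup_add xi_power_def lookup_single when_def sum.lessThan_Suc_shift cong: if_cong simp del: sum.lessThan_Suc)
 thus ?thesis using assms by simp
qed

lemma exponent_sum_add: "exponent_sum (R + S) = exponent_sum R + exponent_sum S" unfolding exponent_sum_def by (rule setsum_keys_plus_distrib) auto

lemma exponent_sum_xi_word: "exponent_sum (snd (wmon (xi_word p t i))) <= (\<Sum>j\<leftarrow>i. p ^ j)"
proof (induction t i rule: list_induct2')
 case (4 s t j i)
 have "exponent_sum (snd (amon (Xi (s - j) (p ^ j)))) <= p ^ j" by (auto simp: exponent_sum_def xi_power_def)
 thus ?case using 4 by (simp add: xi_word_def exponent_sum_add)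
qed (simp_all add: xi_word_def exponent_sum_def)

lemma below_degree: assumes "p > 0" "i : below t"
 shows "2 * (\<Sum>s\<leftarrow>t. p ^ s) = 2 * (\<Sum>j\<leftarrow>i. p ^ j) + word_degree p (xi_word p t i)"
proof -
 have "list_all2 (\<le>) i t ==> ?thesis"
 proof (induction rule: list_all2_induct)
  case (Cons j i s t)
  have "p ^ s = p ^ j * p ^ (s - j)" using Cons(1) by (simp flip: power_add)
  moreover have "p ^ (s - j) > 0" using assms(1) by simp
  ultimately have "2 * p ^ s = 2 * p ^ j + p ^ j * (2 * (p ^ (s - j) - 1))" by (cases "p ^ (s - j)") (auto simp: algebra_simps)
  thus ?case using Cons by (simp add: xi_word_def)
 qed (simp add: xi_word_def)
 thus ?thesis using assms(2) by (simp add: below_def)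
qed

lemma below_expts: assumes "p > 0" "i : below t" "i : expts p a m"
  "milnor_degree p (wmon (xi_word p t i)) = 2 * k" shows "t : expts p (a + k) m"
proof -
 have "word_degree p (xi_word p t i) = 2 * k" using milnor_degree_word[of "xi_word p t i" p] assms(4) by (simp add: taus_xi_word)
 thus ?thesis using below_degree[OF assms(1,2)] below_length[OF assms(2)] assms(3) by (auto simp: expts_def)
qed

text \<open>The effect of an operation on coefficient functions. It has the shape of Milnor's
  coproduct: indices \<open>t\<close> on the left side arise from smaller indices \<open>i\<close>,
  the difference being recorded by \<open>xi_word\<close>.\<close>

definition power_action :: "'k::{field,finite} steenrod_element => (nat list => 'k) => nat list => 'k" where
 "power_action th ka t = (SUM i:below t. th (wmon (xi_word (CARD('k)) t i)) * ka i)"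

lemma nth_factor_sizes: assumes "K = length (factor_sizes a R)" "0 < j" shows "j < K ==> factor_sizes a R ! j = lookup R j"
  and "~ j < K ==> lookup R j = 0"
proof -
 show "factor_sizes a R ! j = lookup R j" if "j < K" using that assms by (cases j) (auto simp: factor_sizes_def simp del: upt_Suc)
 show "lookup R j = 0" if "~ j < K"
 proof (rule ccontr)
  assume "lookup R j ~= 0"
  hence "j <= Max (insert 0 (keys R))" by (intro Max_ge) (auto simp: in_keys_iff)
  thus False using that assms by (simp add: factor_sizes_def)
 qed
qed

lemma xi_word_eq_iff: assumes K: "K = length (factor_sizes a R)" and R: "lookup R 0 = 0" "exponent_sum R <= a"
  and t: "t : expts p a m" and J: "J : words m K" shows "wmon (xi_word p (map2 (+) t J) t) = ({}, R) \<longleftrightarrow>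
  (ALL j<K. factor_sizes a R ! j = (\<Sum>l<m. if J ! l = j then p ^ (t ! l) else 0))"
proof -
 have lt: "length t = m" and lJ: "length J = m" using t words_length[OF J] by (auto simp: expts_def)
 let ?N = "%j. \<Sum>l<m. if J ! l = j then p ^ (t ! l) else 0"
 have lk: "lookup (snd (wmon (xi_word p (map2 (+) t J) t))) j = (if j = 0 then 0 else ?N j)" for j
  using lt lJ by (simp add: lookup_xi_word[where m = m])
 have "wmon (xi_word p (map2 (+) t J) t) = ({}, R) \<longleftrightarrow> (ALL j>0. lookup R j = ?N j)"
  unfolding prod_eq_iff fst_wmon taus_xi_word poly_mapping_eq_iff fun_eq_iff lk using R(1) by auto
 also have "... \<longleftrightarrow> (ALL j<K. 0 < j --> factor_sizes a R ! j = ?N j)"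
 proof -
  have "?N j = 0" if "~ j < K" for j using that words_nth[OF J] by (intro sum.neutral) auto
  hence "lookup R j = ?N j \<longleftrightarrow> (j < K --> factor_sizes a R ! j = ?N j)" if "0 < j" for j
   using nth_factor_sizes[OF K that] by (cases "j < K") simp_all
  thus ?thesis by blast
 qed
 \<comment> \<open>The monomial does not record the exponent of \<open>xi_0\<close>. The condition
   at \<open>j = 0\<close> follows from the others because both sides have the same total
   \<open>a\<close>.\<close>
 also have "... \<longleftrightarrow> (ALL j<K. factor_sizes a R ! j = ?N j)"
 proof
  assume *: "ALL j<K. 0 < j --> factor_sizes a R ! j = ?N j"
  have K0: "K = Suc (K - 1)" using K by (simp add: factor_sizes_def)
  have "(\<Sum>j<K. ?N j) = (\<Sum>l<m. \<Sum>j<K. if J ! l = j then p ^ (t ! l) else 0)" by (rule sum.swap)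
  also have "... = (\<Sum>l<m. p ^ (t ! l))" using words_nth[OF J] by (intro sum.cong) (auto simp: sum.delta')
  also have "... = a" using t lt by (simp add: expts_def sum_list_sum_nth lessThan_atLeast0)
  also have "a = (\<Sum>j<K. factor_sizes a R ! j)" using sum_factor_sizes[OF R] K by (simp add: sum_list_sum_nth lessThan_atLeast0)
  finally have "?N 0 + (\<Sum>j<K - 1. ?N (Suc j)) = factor_sizes a R ! 0 + (\<Sum>j<K - 1. factor_sizes a R ! Suc j)"
   by (simp only: sum.lessThan_Suc_shift[of _ "K - 1", folded K0])
  moreover have "(\<Sum>j<K - 1. ?N (Suc j)) = (\<Sum>j<K - 1. factor_sizes a R ! Suc j)" using * by (intro sum.cong) auto
  ultimately have "factor_sizes a R ! 0 = ?N 0" by simp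
  thus "ALL j<K. factor_sizes a R ! j = ?N j" using * gr0I by blast
 qed blast
 finally show ?thesis .
qed

text \<open>The reindexing \<open>s = t + J\<close>, \<open>i = t\<close> turns the sum over
  assignments in \<open>theta_pword\<close> into the sum over lists below \<open>s\<close>; the
  multiplicity condition becomes \<open>wmon (xi_word ...) = ({}, R)\<close>.\<close>

lemma milnor_op_nat_eta: fixes ka :: "nat list => 'k::{field,finite}"
 assumes prime: "prime (CARD('k))" and R: "lookup R 0 = 0"
  and supp: "!!t. ka t ~= 0 ==> t : expts (CARD('k)) a (e + b)"
  and k: "milnor_degree (CARD('k)) ({}, R) = 2 * k" shows "milnor_op (AltSym e b) a R (nat_eta a (e + b) ka) =
  nat_eta (a + k) (e + b) (power_action (milnor_dual ({}, R)) ka)"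
proof -
 let ?p = "CARD('k)" and ?m = "e + b"
 have p: "?p > 0" "?p > 1" using prime_gt_1_nat[OF prime] by auto
 have "2 * k = 2 * (SUM j:keys R. lookup R j * (?p ^ j - 1))"
  using k by (simp add: milnor_degree_def sum_distrib_left mult.left_commute)
 hence k': "(SUM j:keys R. lookup R j * (?p ^ j - 1)) = k" by simp
 have term0: "power_action (milnor_dual ({}, R)) ka t =
   (SUM i:{i \<in> below t. i : expts ?p a ?m & wmon (xi_word ?p t i) = ({}, R)}. ka i)" for t
  unfolding power_action_def by (rule sum.mono_neutral_cong_right) (use supp in \<open>auto simp: milnor_dual_def\<close>)
 show ?thesis
 proof (cases "exponent_sum R > a")
  \<comment> \<open>The exponents in \<open>xi_word\<close> add up to at most the sum of the powers
    \<open>p ^ j\<close> over \<open>i\<close>, which is \<open>a\<close> on the support of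
    \<open>ka\<close>. So \<open>R\<close> is never reached and the formula agrees with the
    prescribed value 0.\<close>
  case True
  have "power_action (milnor_dual ({}, R)) ka t = 0" for t
  proof -
   have "wmon (xi_word ?p t i) ~= ({}, R)" if "i : expts ?p a ?m" for i
    using exponent_sum_xi_word[of ?p t i] that True by (auto simp: expts_def)
   thus ?thesis unfolding term0 by (intro sum.neutral) auto
  qed
  thus ?thesis
   using True k' by (simp add: milnor_op_def nat_trans_vs_def mk_vs_def nat_eta_def fun_eq_iff restrict_def del: dpow_simps(1))
 next
  case False
  define K where "K = length (factor_sizes a R)"
  let ?T = "expts ?p a ?m" and ?T' = "expts ?p (a + k) ?m"
  have eq: "nat_eta a ?m ka d (theta a R d x) w = nat_eta (a + k) ?m (power_action (milnor_dual ({}, R)) ka) d x w"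
   if x: "x : dpow (a + k) d" for d x w
  proof (cases "w : words ?m d")
   case w: True
   let ?f = "%t s. ka t * x (pword ?p w s)"
   let ?P = "%t J. wmon (xi_word ?p (map2 (+) t J) t) = ({}, R)"
   have "nat_eta a ?m ka d (theta a R d x) w = (SUM t:?T. ka t * theta a R d x (pword ?p w t))"
    using theta_dpow[OF R _ x, of a] False w by (simp add: nat_eta_def del: dpow_simps(1))
   also have "... = (SUM t:?T. SUM J:{J : words ?m K. ?P t J}. ?f t (map2 (+) t J))"
   proof (rule sum.cong[OF refl])
    fix t assume t: "t : ?T"
    have "theta a R d x (pword ?p w t) = (SUM J:words ?m K. if ?P t J then x (pword ?p w (map2 (+) t J)) else 0)"
     unfolding theta_pword[OF prime refl K_def R _ x w t] using False xi_word_eq_iff[OF K_def R _ t]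
     by (subst theta_pword[OF prime refl K_def R _ x w t]) (auto intro!: sum.cong)
    thus "ka t * theta a R d x (pword ?p w t) = (SUM J:{J : words ?m K. ?P t J}. ?f t (map2 (+) t J))"
     by (simp add: sum_distrib_left sum.inter_filter if_distrib cong: if_cong)
   qed
   also have "... = (SUM (t, J):Sigma ?T (%t. {J : words ?m K. ?P t J}). ?f t (map2 (+) t J))"
    by (rule sum.Sigma) (auto simp: finite_expts[OF p(2)])
   also have "... = (SUM (s, i):Sigma ?T' (%s. {i \<in> below s. i : ?T & wmon (xi_word ?p s i) = ({}, R)}). ?f i s)"
   proof (rule sum.reindex_bij_witness[of _ "%(s, i). (i, map2 (-) s i)" "%(t, J). (map2 (+) t J, t)"]; clarsimp)
    fix t J assume t: "t : ?T" and J: "J : words ?m K" and P: "?P t J"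
    have l: "length t = ?m" "length J = ?m" using t words_length[OF J] by (auto simp: expts_def)
    show "map2 (-) (map2 (+) t J) t = J" using l by (intro nth_equalityI) auto
    have "t : below (map2 (+) t J)" using l by (auto simp: below_def list_all2_conv_all_nth)
    thus "map2 (+) t J : ?T' & t : below (map2 (+) t J)" using below_expts[OF p(1) _ t] P k by simp
   next
    fix s i assume s: "s : ?T'" and i: "i : below s" "i : ?T" and P: "wmon (xi_word ?p s i) = ({}, R)"
    have l: "length s = ?m" "length i = ?m" using s below_length[OF i(1)] by (auto simp: expts_def)
    have le: "i ! j <= s ! j" if "j < ?m" for j using i(1) that l by (simp add: below_def list_all2_conv_all_nth)
    show *: "map2 (+) i (map2 (-) s i) = s" using l le by (intro nth_equalityI) auto
    have "s ! j - i ! j < K" if "j < ?m" for j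
    proof (rule ccontr)
     let ?r = "s ! j - i ! j"
     assume r: "~ ?r < K"
     hence "?r > 0" using K_def by (auto simp: factor_sizes_def)
     hence "lookup R ?r = (\<Sum>l<?m. if s ! l - i ! l = ?r then ?p ^ (i ! l) else 0)"
      using lookup_xi_word[OF l, of ?p ?r] P by simp
     moreover have "(if s ! j - i ! j = ?r then ?p ^ (i ! j) else 0) <= (\<Sum>l<?m. if s ! l - i ! l = ?r then ?p ^ (i ! l) else 0)"
      using that by (intro member_le_sum) auto
     ultimately show False using nth_factor_sizes(2)[OF K_def \<open>?r > 0\<close> r] p by simp
    qed
    hence "map2 (-) s i : words ?m K" using l by (auto simp: words_def in_set_conv_nth)
    thus "map2 (-) s i : words ?m K & wmon (xi_word ?p (map2 (+) i (map2 (-) s i)) i) = ({}, R)" using * P by simp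
   qed
   also have "... = (SUM s:?T'. SUM i:{i \<in> below s. i : ?T & wmon (xi_word ?p s i) = ({}, R)}. ?f i s)"
    by (rule sum.Sigma[symmetric]) (auto simp: finite_expts[OF p(2)])
   also have "... = nat_eta (a + k) ?m (power_action (milnor_dual ({}, R)) ka) d x w"
    using x w by (simp add: nat_eta_def term0 sum_distrib_right del: dpow_simps(1))
   finally show ?thesis .
  next
   case w: False
   thus ?thesis using theta_dpow[OF R _ x, of a] False x by (simp add: nat_eta_def del: dpow_simps(1))
  qed
  show ?thesis
  proof (rule ext, rule ext)
   fix d x
   show "milnor_op (AltSym e b) a R (nat_eta a ?m ka) d x = nat_eta (a + k) ?m (power_action (milnor_dual ({}, R)) ka) d x"
    using False k' eq[of x d] by (cases "x : dpow (a + k) d")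
     (auto simp: milnor_op_def fun_eq_iff nat_eta_def simp del: dpow_simps(1))
  qed
 qed
qed

section \<open>Vector spaces of natural transformations\<close>

lemma zero_vs_vs: assumes "vspace (V :: ('k::field, 'v) module)" shows "vspace (zero_vs V)"
 by (rule vectorspace_classI)
  (simp_all add: zero_vs_def vs_zero[OF assms] vs_zero_right[OF assms] vs_smult_zero[OF assms])

lemma zero_vs_simps [simp]: "carrier (zero_vs V) = {0[V]}" "0[zero_vs V] = 0[V]"
 "x +[zero_vs V] y = x +[V] y" "c *[zero_vs V] x = c *[V] x"
 by (simp_all add: zero_vs_def)

lemma nat_trans_vs_simps [simp]: "carrier (nat_trans_vs G F) = nat_trans G F"
 "0[nat_trans_vs G F] = (%d. \<lambda>x\<in>carrier (fobj G d). 0[fobj F d])"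
 "et +[nat_trans_vs G F] et' = (%d. \<lambda>x\<in>carrier (fobj G d). et d x +[fobj F d] et' d x)"
 "c *[nat_trans_vs G F] et = (%d. \<lambda>x\<in>carrier (fobj G d). c *[fobj F d] et d x)"
 by (simp_all add: nat_trans_vs_def)

lemma vs_medial: fixes V :: "('k::field, 'v) module" assumes V: "vspace V"
  and x: "a : carrier V" "b : carrier V" "c : carrier V" "d : carrier V"
 shows "(a +[V] b) +[V] (c +[V] d) = (a +[V] c) +[V] (b +[V] d)"
 using x by (simp only: vs_assoc[OF V] vs_lcomm[OF V x(2) x(3) x(4)] vs_add[OF V])

lemma nat_trans_iff:
 "et : nat_trans G F \<longleftrightarrow> (ALL d. et d : lin (fobj G d) (fobj F d)) &
  (ALL d. et d : extensional (carrier (fobj G d))) &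
  (ALL d e. ALL A:carrier_mat e d. ALL x:carrier (fobj G d). et e (fmor G A x) = fmor F A (et d x))"
 by (auto simp: nat_trans_def linear_maps_def)

lemma nat_transD: assumes "et : nat_trans G F" shows "et d : lin (fobj G d) (fobj F d)"
  and "et d : extensional (carrier (fobj G d))"
  and "A : carrier_mat e d ==> x : carrier (fobj G d) ==> et e (fmor G A x) = fmor F A (et d x)"
 using assms by (auto simp: nat_trans_iff)

lemma nat_trans_eqI:
 assumes "et : nat_trans G F" "et' : nat_trans G F" "!!d x. x : carrier (fobj G d) ==> et d x = et' d x"
 shows "et = et'" by (rule ext, rule extensionalityI[OF nat_transD(2)[OF assms(1)] nat_transD(2)[OF assms(2)] assms(3)])

lemma nat_trans_vs_vectorspace: fixes G :: "('k::field, 'v) vfunctor" and F :: "('k, 'w) vfunctor"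
 assumes G: "!!d. vspace (fobj G d)" and F: "!!d. vspace (fobj F d)"
  and GA: "!!d e A x. A : carrier_mat e d ==> x : carrier (fobj G d) ==> fmor G A x : carrier (fobj G e)"
  and FA: "!!d e A. A : carrier_mat e d ==> fmor F A : lin (fobj F d) (fobj F e)"
 shows "vspace (nat_trans_vs G F)"
proof -
 note c = hom_closed[OF nat_transD(1)]
 note fa = hom_add[OF FA] and fs = hom_smult[OF FA]
 note na = hom_add[OF nat_transD(1)] and ns = hom_smult[OF nat_transD(1)]
 have zero: "(%d. \<lambda>x\<in>carrier (fobj G d). 0[fobj F d]) : nat_trans G F"
  unfolding nat_trans_iff module_hom_iff by (auto simp: vs_zero[OF F] vs_add[OF G] vs_smult[OF G] vs_zero_right[OF F] vs_smult_zero[OF F] GA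
    module_hom_zero[OF F F FA])
 have add: "(%d. \<lambda>x\<in>carrier (fobj G d). et d x +[fobj F d] et' d x) : nat_trans G F"
  if n: "et : nat_trans G F" "et' : nat_trans G F" for et et' unfolding nat_trans_iff module_hom_iff
  by (auto simp: vs_add[OF F] vs_add[OF G] vs_smult[OF G] vs_smult_add[OF F] GA c[OF n(1)] c[OF n(2)]
    na[OF n(1)] na[OF n(2)] ns[OF n(1)] ns[OF n(2)] fa nat_transD(3)[OF n(1)] nat_transD(3)[OF n(2)] intro!: vs_medial[OF F])
 have scale: "(%d. \<lambda>x\<in>carrier (fobj G d). r *[fobj F d] et d x) : nat_trans G F"
  if n: "et : nat_trans G F" for r et unfolding nat_trans_iff module_hom_iff
  by (auto simp: vs_smult[OF F] vs_add[OF G] vs_smult[OF G] vs_smult_add[OF F] vs_smult_smult[OF F] GA c[OF n]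
    na[OF n] ns[OF n] fs nat_transD(3)[OF n] mult.commute)
 show ?thesis
 proof (rule vectorspace_classI)
  fix et assume n: "et : carrier (nat_trans_vs G F)"
  hence n': "et : nat_trans G F" by simp
  note cn = c[OF n']
  have e: "et d x = undefined" if "x ~: carrier (fobj G d)" for d x using nat_transD(2)[OF n'] that by (rule extensional_arb)
  show "et +[nat_trans_vs G F] 0[nat_trans_vs G F] = et"
   by (auto simp: restrict_def cn vs_zero_right[OF F] e intro!: ext)
  show "1 *[nat_trans_vs G F] et = et" by (auto simp: restrict_def cn vs_one_smult[OF F] e intro!: ext)
  show "et +[nat_trans_vs G F] (- 1) *[nat_trans_vs G F] et = 0[nat_trans_vs G F]"
   by (auto simp: restrict_def cn vs_neg[OF F] intro!: ext)
  show "(a * b) *[nat_trans_vs G F] et = a *[nat_trans_vs G F] (b *[nat_trans_vs G F] et)" for a b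
   by (auto simp: restrict_def cn vs_smult_smult[OF F] intro!: ext)
  show "(a + b) *[nat_trans_vs G F] et = a *[nat_trans_vs G F] et +[nat_trans_vs G F] b *[nat_trans_vs G F] et" for a b
   by (auto simp: restrict_def cn vs_add_smult[OF F] intro!: ext)
  show "r *[nat_trans_vs G F] et : carrier (nat_trans_vs G F)" for r using scale[OF n'] by simp
  fix et' assume m: "et' : carrier (nat_trans_vs G F)"
  hence m': "et' : nat_trans G F" by simp
  note cm = c[OF m']
  show "et +[nat_trans_vs G F] et' : carrier (nat_trans_vs G F)" using add[OF n' m'] by simp
  show "et +[nat_trans_vs G F] et' = et' +[nat_trans_vs G F] et"
   unfolding nat_trans_vs_simps by (intro ext restrict_ext) (rule vs_comm[OF F cn cm])
  show "r *[nat_trans_vs G F] (et +[nat_trans_vs G F] et') =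
   r *[nat_trans_vs G F] et +[nat_trans_vs G F] r *[nat_trans_vs G F] et'" for r
   by (auto simp: restrict_def cn cm vs_smult_add[OF F] intro!: ext)
  fix et'' assume l: "et'' : carrier (nat_trans_vs G F)"
  hence l': "et'' : nat_trans G F" by simp
  show "(et +[nat_trans_vs G F] et') +[nat_trans_vs G F] et'' = et +[nat_trans_vs G F] (et' +[nat_trans_vs G F] et'')"
   by (auto simp: restrict_def cn cm c[OF l'] vs_assoc[OF F] intro!: ext)
 qed (use zero in simp)
qed

lemma tpow_map_linear: "tpow_map b A (%w. x w + y w) = (%w. tpow_map b A x w + tpow_map b A y w)"
 "tpow_map b A (%w. c * x w) = (%w. c * tpow_map b A x w)"
 by (auto simp: tpow_map_def fun_eq_iff algebra_simps sum.distrib sum_distrib_left)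

lemma AltSym_hom: fixes A :: "'k::field mat" assumes A: "A : carrier_mat d' d"
 shows "fmor (AltSym e b) A : lin (fobj (AltSym e b) d) (fobj (AltSym e b) d')"
 unfolding module_hom_iff
proof (intro conjI ballI allI)
 fix x :: "nat list => 'k" assume x: "x : carrier (fobj (AltSym e b) d)"
 have "alt_sym e (e + b) (tpow_map (e + b) A x)"
 proof (rule alt_sym_cong)
  show "alt_sym e (e + b) x" using x by simp
  fix s :: 'k and w :: "nat list" and i
  assume w: "length w = e + b" and i: "Suc i < e + b" and s: "s = 1 | s = - 1"
   and x: "ALL w. length w = e + b --> x (swap_at i w) = s * x w"
  let ?W = "words (e + b) (dim_row A)" and ?U = "words (e + b) (dim_col A)"
  have sw: "swap_at i u : words (e + b) n \<longleftrightarrow> u : words (e + b) n" if "length u = e + b" for u n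
   using mset_eq_setD[OF mset_swap_at[of i u]] that i by (simp add: words_def)
  have "(SUM u:?U. (\<Prod>j<e + b. A $$ (swap_at i w ! j, u ! j)) * x u) =
   (SUM u:?U. (\<Prod>j<e + b. A $$ (swap_at i w ! j, swap_at i u ! j)) * x (swap_at i u))"
   by (rule sum.reindex_bij_witness[of _ "swap_at i" "swap_at i"]) (use i sw in \<open>auto simp: words_length\<close>)
  also have "... = (SUM u:?U. s * ((\<Prod>j<e + b. A $$ (w ! j, u ! j)) * x u))"
  proof (rule sum.cong[OF refl])
   fix u assume "u : ?U"
   hence u: "length u = e + b" by (rule words_length)
   let ?f = "%j. if j = i then Suc i else if j = Suc i then i else j"
   have "(\<Prod>j<e + b. A $$ (swap_at i w ! j, swap_at i u ! j)) = (\<Prod>j<e + b. A $$ (w ! ?f j, u ! ?f j))"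
    using w u i by (intro prod.cong) (simp_all add: nth_swap_at)
   also have "... = (\<Prod>j<e + b. A $$ (w ! j, u ! j))" by (rule prod_swap_reindex[OF i, where f = "%j. A $$ (w ! j, u ! j)"])
   finally show "(\<Prod>j<e + b. A $$ (swap_at i w ! j, swap_at i u ! j)) * x (swap_at i u) = s * ((\<Prod>j<e + b. A $$ (w ! j, u ! j)) * x u)"
    using x u by simp
  qed
  finally show "tpow_map (e + b) A x (swap_at i w) = s * tpow_map (e + b) A x w" using sw[OF w] by (simp add: tpow_map_def sum_distrib_left)
 qed
 thus "fmor (AltSym e b) A x : carrier (fobj (AltSym e b) d')" using tpow_map_words[of "e + b" A x] A by auto
qed (simp_all add: tpow_map_linear)

lemma nat_trans_alt_sym_vs: "vspace (nat_trans_vs (divided_power c) (AltSym e b :: ('k::{field,finite}, _) vfunctor))"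
 by (rule nat_trans_vs_vectorspace[OF dpow_vs AltSym_vs _ AltSym_hom])
  (simp del: dpow_simps(1) add: tpow_map_dpow)

section \<open>The cover of a Steenrod module by monomials with a fixed number of factors \<open>\<tau>\<^sub>i\<close>\<close>

lemma nat_eta_cong: fixes ka :: "nat list => 'k::{field,finite}"
 assumes "!!t. t : expts (CARD('k)) c m ==> ka t = ka' t"
 shows "nat_eta c m ka = nat_eta c m ka'"
 using assms by (auto simp: nat_eta_def fun_eq_iff restrict_def simp del: dpow_simps(1) intro!: sum.cong)

lemma nat_eta_linear: fixes ka :: "nat list => 'k::{field,finite}" shows "nat_eta c (e + b) (%t. ka t + ka' t) =
   nat_eta c (e + b) ka +[nat_trans_vs (divided_power c) (AltSym e b)] nat_eta c (e + b) ka'"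
  "nat_eta c (e + b) (%t. r * ka t) =
   r *[nat_trans_vs (divided_power c) (AltSym e b)] nat_eta c (e + b) ka"
  "nat_eta c (e + b) (%t. 0 :: 'k) = 0[nat_trans_vs (divided_power c) (AltSym e b)]"
 by (auto simp: nat_eta_def fun_eq_iff sum.distrib sum_distrib_left algebra_simps restrict_def simp del: dpow_simps(1))

lemma wmon_cong_mset: assumes "mset L = mset L'" "taus L = []" "taus L' = []" shows "wmon L = wmon L'"
proof (rule prod_eqI)
 show "snd (wmon L) = snd (wmon L')" unfolding snd_wmon using assms(1) by (metis mset_map sum_mset_sum_list)
qed (simp add: fst_wmon assms)

lemma below_swap: "i : below t ==> Suc j < length t ==> swap_at j i : below (swap_at j t)"
 by (auto simp: below_def list_all2_conv_all_nth nth_swap_at)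

lemma xi_word_swap: assumes "length t = m" "length i = m" "Suc j < m"
 shows "wmon (xi_word p (swap_at j t) (swap_at j i)) = wmon (xi_word p t i)"
proof (rule wmon_cong_mset)
 have "xi_word p (swap_at j t) (swap_at j i) = swap_at j (xi_word p t i)" using assms by (intro nth_equalityI) (auto simp: xi_word_def nth_swap_at)
 thus "mset (xi_word p (swap_at j t) (swap_at j i)) = mset (xi_word p t i)" using assms by (simp add: xi_word_def)
qed (simp_all add: taus_xi_word)

lemma power_action_alt_sym: fixes ka :: "nat list => 'k::{field,finite}" assumes "alt_sym e m ka"
 shows "alt_sym e m (power_action th ka)" using assms
proof (rule alt_sym_cong)
 fix s :: 'k and t :: "nat list" and j
 assume t: "length t = m" and j: "Suc j < m" and x: "ALL w. length w = m --> ka (swap_at j w) = s * ka w"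
 let ?f = "%t i. th (wmon (xi_word (CARD('k)) t i))"
 have "(SUM i:below (swap_at j t). ?f (swap_at j t) i * ka i) = (SUM i:below t. ?f (swap_at j t) (swap_at j i) * ka (swap_at j i))"
  by (rule sum.reindex_bij_witness[of _ "swap_at j" "swap_at j"])
   (use t j below_swap[of _ "swap_at j t" j] below_swap[of _ t j] in \<open>auto dest: below_length\<close>)
 also have "... = (SUM i:below t. s * (?f t i * ka i))"
 proof (rule sum.cong[OF refl])
  fix i assume "i : below t"
  hence "length i = m" using t by (simp add: below_length)
  thus "?f (swap_at j t) (swap_at j i) * ka (swap_at j i) = s * (?f t i * ka i)"
   using x t j by (simp add: xi_word_swap[where m = m])
 qed
 finally show "power_action th ka (swap_at j t) = s * power_action th ka t" by (simp add: power_action_def sum_distrib_left)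
qed

lemma power_action_linear:
 "power_action (%m. th m + th' m) ka = (%t. power_action th ka t + power_action th' ka t)"
 "power_action (%m. r * th m) ka = (%t. r * power_action th ka t)"
 "power_action (%m. 0) ka = (%t. 0)" by (auto simp: power_action_def fun_eq_iff sum.distrib sum_distrib_left algebra_simps)

lemma power_action_zero: "power_action th (%t. 0) = (%t. 0)" by (simp add: power_action_def fun_eq_iff)

lemma r_prime_component: "part (r_prime F) n = (if even n then nat_trans_vs (divided_power (n div 2)) F
   else zero_vs (nat_trans_vs (divided_power (n div 2)) F))" by (simp add: r_prime_def Let_def)

lemma even_milnor_degree: "even (milnor_degree p ({}, R))" by (auto simp: milnor_degree_def intro!: dvd_sum)

text \<open>Monomials without tau have even degree, so the defining sum is empty when
  \<open>k\<close> is odd.\<close>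

lemma r_prime_act_odd: assumes "odd k" and V: "vspace (part (r_prime F) (n + k))"
 shows "act (r_prime (F :: ('k::{field,finite}, 'v) vfunctor)) k n th f = 0[part (r_prime F) (n + k)]"
proof -
 have e: "{R. ({}, R) : milnor_monomials & milnor_degree p ({}, R) = k} = {}" for p using even_milnor_degree assms(1) by blast
 have "(\<Oplus>\<^bsub>part (r_prime F) (n + k)\<^esub>R\<in>{}. g R) = 0[part (r_prime F) (n + k)]" for g :: "(nat \<Rightarrow>\<^sub>0 nat) => _"
  using abelian_monoid.finsum_empty[OF abelian_group.axioms(1)[OF vs_abelian_group[OF V]]] .
 thus ?thesis using assms(1) unfolding r_prime_def Let_def graded_module.simps e by (cases "even n") (simp_all del: nat_trans_vs_simps)
qed

lemma r_prime_act_even: assumes "even k" shows "act (r_prime F) k (2 * a) th f =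
  (\<Oplus>\<^bsub>nat_trans_vs (divided_power (a + k div 2)) F\<^esub>R\<in>{R. ({}, R) : milnor_monomials & milnor_degree (CARD('k)) ({}, R) = k}.
    th ({}, R) *[nat_trans_vs (divided_power (a + k div 2)) F] milnor_op (F :: ('k::{field,finite}, _) vfunctor) a R f)"
 using assms by (simp add: r_prime_def Let_def del: nat_trans_vs_simps)

text \<open>The sum over \<open>R\<close> is collected into one operation, the part of
  \<open>th\<close> without tau in degree \<open>k\<close>. On the words that occur it has the same
  values as \<open>th\<close>.\<close>

lemma r_prime_act_nat_eta: fixes ka :: "nat list => 'k::{field,finite}"
 assumes prime: "prime (CARD('k))" and k: "even k" and alt: "alt_sym e (e + b) ka"
  and supp: "!!t. ka t ~= 0 ==> t : expts (CARD('k)) a (e + b)"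
 shows "act (r_prime (AltSym e b)) k (2 * a) th (nat_eta a (e + b) ka) =
  nat_eta (a + k div 2) (e + b) (power_action th ka)"
proof -
 let ?p = "CARD('k)" and ?c = "a + k div 2" and ?m = "e + b"
 let ?V = "nat_trans_vs (divided_power ?c) (AltSym e b :: ('k, _) vfunctor)"
 let ?R = "{R. ({}, R) : milnor_monomials & milnor_degree ?p ({}, R) = k}"
 note V = nat_trans_alt_sym_vs[of ?c e b, where 'k = 'k]
 interpret V: abelian_group ?V by (rule vs_abelian_group[OF V])
 have fin: "finite ?R"
 proof (rule finite_subset)
  show "?R <= snd ` {m \<in> milnor_monomials. milnor_degree ?p m = k}" by force
 qed (rule finite_imageI, rule finite_milnor_degree[OF prime_gt_1_nat[OF prime]])
 let ?th = "%A m. SUM R:A. th ({}, R) * milnor_dual ({}, R) m"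
 let ?g = "%R. th ({}, R) *[?V] milnor_op (AltSym e b) a R (nat_eta a ?m ka)"
 have car: "nat_eta ?c ?m (power_action ps ka) : carrier ?V" for ps
  using nat_eta_nat_trans[OF prime power_action_alt_sym[OF alt]] by simp
 have g: "?g R = nat_eta ?c ?m (power_action (%m. th ({}, R) * milnor_dual ({}, R) m) ka)" if "R : ?R" for R
 proof -
  have "lookup R 0 = 0" "milnor_degree ?p ({}, R) = 2 * (k div 2)" using that k by (auto simp: milnor_monomials_def)
  thus ?thesis unfolding power_action_linear nat_eta_linear(2) using milnor_op_nat_eta[OF prime _ supp, where R = R and k = "k div 2"] by simp
 qed
 have "(\<Oplus>\<^bsub>?V\<^esub>R\<in>A. ?g R) = nat_eta ?c ?m (power_action (?th A) ka)" if "finite A" "A <= ?R" for A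
  using that
 proof (induction A)
  case empty
  thus ?case by (simp add: power_action_linear nat_eta_linear del: nat_trans_vs_simps)
 next
  case (insert R A)
  have "(\<Oplus>\<^bsub>?V\<^esub>R\<in>insert R A. ?g R) = ?g R +[?V] (\<Oplus>\<^bsub>?V\<^esub>R\<in>A. ?g R)"
   using insert.hyps insert.prems g car by (intro V.finsum_insert) (auto simp del: nat_trans_vs_simps)
  also have "... = nat_eta ?c ?m (power_action (?th (insert R A)) ka)"
   using insert g[of R] by (simp add: power_action_linear nat_eta_linear del: nat_trans_vs_simps)
  finally show ?case .
 qed
 hence "act (r_prime (AltSym e b)) k (2 * a) th (nat_eta a ?m ka) = nat_eta ?c ?m (power_action (?th ?R) ka)"
  using fin unfolding r_prime_act_even[OF k] by blast
 also have "... = nat_eta ?c ?m (power_action th ka)"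
 proof (rule nat_eta_cong)
  fix t assume t: "t : expts ?p ?c ?m"
  show "power_action (?th ?R) ka t = power_action th ka t" unfolding power_action_def
  proof (rule sum.cong[OF refl])
   fix i assume i: "i : below t"
   show "?th ?R (wmon (xi_word ?p t i)) * ka i = th (wmon (xi_word ?p t i)) * ka i"
   proof (cases "ka i = 0")
    case False
    let ?m' = "wmon (xi_word ?p t i)"
    have m': "?m' = ({}, snd ?m')" by (simp add: prod_eq_iff fst_wmon taus_xi_word)
    \<comment> \<open>The totals of \<open>t\<close> and \<open>i\<close> are fixed by the source
      and target degrees, so the left monomial automatically has the degree of the
      operation.\<close>
    have "milnor_degree ?p ?m' = k"
     using below_degree[OF card_prime_pos[OF prime] i] t supp[OF False] k milnor_degree_word[of "xi_word ?p t i" ?p]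
     by (auto simp: expts_def taus_xi_word)
    hence "snd ?m' : ?R" using m' wmon_milnor[of "xi_word ?p t i"] by simp
    moreover have "th ({}, R) * milnor_dual ({}, R) ?m' = (if R = snd ?m' then th ({}, R) else 0)" for R
     by (subst m') (auto simp: milnor_dual_def)
    ultimately show ?thesis using fin m' by (simp add: sum.delta)
   qed simp
  qed
 qed
 finally show ?thesis .
qed

text \<open>An entry 0 in the second block stands for the unit \<open>xi_0\<close>. All monomials
  with \<open>e\<close> factors tau and a bounded number of xi's are thus written by lists of one
  length.\<close>

definition idx_word :: "nat => nat list => atom list" where
 "idx_word e t = map Tau (take e t) @ map (%j. Xi j 1) (drop e t)"

lemma idx_word_simps [simp]: "idx_word e [] = []"
 "idx_word 0 (j # t) = Xi j 1 # idx_word 0 t"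
 "idx_word (Suc e) (j # t) = Tau j # idx_word e t" by (simp_all add: idx_word_def)

lemma length_idx_word [simp]: "length (idx_word e t) = length t" by (simp add: idx_word_def)

lemma simple_idx_word: "simple_word (idx_word e t)" by (auto simp: simple_word_def idx_word_def)

lemma taus_idx_word: "taus (idx_word e t) = take e t" by (simp add: idx_word_def) (rule taus_no_tau, auto)

lemma idx_word_degree: assumes "length t = e + b" "p > 0" shows "word_degree p (idx_word e t) + (e + 2 * b) = 2 * (\<Sum>j\<leftarrow>t. p ^ j)"
proof -
 have 1: "(\<Sum>j\<leftarrow>u. atom_degree p (Tau j)) + length u = 2 * (\<Sum>j\<leftarrow>u. p ^ j)" for u
 proof (induction u)
  case (Cons j u)
  have "p ^ j > 0" using assms(2) by simp
  hence "atom_degree p (Tau j) + 1 = 2 * p ^ j" by (cases "p ^ j") auto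
  moreover have "A + B + (n + Suc 0) = 2 * (C + D)" if "A + 1 = 2 * C" "B + n = 2 * D" for A B C D n :: nat using that by simp
  ultimately show ?case using Cons by (simp only: list.map sum_list.Cons list.size)
 qed simp
 have 2: "(\<Sum>j\<leftarrow>u. atom_degree p (Xi j 1)) + 2 * length u = 2 * (\<Sum>j\<leftarrow>u. p ^ j)" for u
 proof (induction u)
  case (Cons j u)
  have "p ^ j > 0" using assms(2) by simp
  hence "2 * (p ^ j - 1) + 2 = 2 * p ^ j" by (cases "p ^ j") auto
  thus ?case using Cons by simp
 qed simp
 have "(\<Sum>j\<leftarrow>t. p ^ j) = (\<Sum>j\<leftarrow>take e t. p ^ j) + (\<Sum>j\<leftarrow>drop e t. p ^ j)"
  by (metis append_take_drop_id map_append sum_list_append)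
 thus ?thesis using 1[of "take e t"] 2[of "drop e t"] assms(1) by (simp add: idx_word_def o_def)
qed

text \<open>A split in which no tau goes left lowers each index independently, so it is the same as
  a list below \<open>t\<close>, with left word \<open>xi_word\<close> and right word again of the
  form \<open>idx_word\<close>.\<close>

lemma sum_splits_idx_word: fixes f :: "(atom \<times> atom) list => 'b::comm_monoid_add"
 assumes "!!S. S : splits p (idx_word e t) ==> ntau (map fst S) > 0 ==> f S = 0"
 shows "(SUM S:splits p (idx_word e t). f S) = (SUM i:below t. f (zip (xi_word p t i) (idx_word e i)))" using assms
proof (induction t arbitrary: e f)
 case Nil
 thus ?case by (simp add: xi_word_def)
next
 case (Cons s t)
 let ?r = "\<Sum>j\<le>s. SUM i:below t. f (zip (xi_word p (s # t) (j # i)) (idx_word e (j # i)))"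
 have "(SUM S:splits p (idx_word e (s # t)). f S) = ?r"
 proof (cases e)
  case 0
  have "(SUM S:splits p (idx_word 0 t). f ((Xi (s - j) (p ^ j), Xi j 1) # S)) =
   (SUM i:below t. f ((Xi (s - j) (p ^ j), Xi j 1) # zip (xi_word p t i) (idx_word 0 i)))" if "j <= s" for j
  proof (rule Cons.IH)
   fix S assume "S : splits p (idx_word 0 t)" "ntau (map fst S) > 0"
   thus "f ((Xi (s - j) (p ^ j), Xi j 1) # S) = 0" using that 0 by (intro Cons.prems) auto
  qed
  thus ?thesis by (simp only: 0 idx_word_simps sum_splits_Cons sum_atom_splits_Xi) (simp add: xi_word_def)
 next
  case (Suc e')
  have "(SUM S:splits p (idx_word e' t). f ((Xi (s - j) (p ^ j), Tau j) # S)) =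
   (SUM i:below t. f ((Xi (s - j) (p ^ j), Tau j) # zip (xi_word p t i) (idx_word e' i)))" if "j <= s" for j
  proof (rule Cons.IH)
   fix S assume "S : splits p (idx_word e' t)" "ntau (map fst S) > 0"
   thus "f ((Xi (s - j) (p ^ j), Tau j) # S) = 0" using that Suc by (intro Cons.prems) auto
  qed
  moreover have "f ((Tau s, Xi 0 1) # S) = 0" if "S : splits p (idx_word e' t)" for S by (rule Cons.prems) (use Suc that in auto)
  ultimately show ?thesis by (simp only: Suc idx_word_simps sum_splits_Cons sum_atom_splits_Tau) (simp add: xi_word_def)
 qed
 also have "... = (SUM i:below (s # t). f (zip (xi_word p (s # t) i) (idx_word e i)))"
  by (simp add: below_Cons sum.reindex inj_on_def split_beta sum.cartesian_product)
 finally show ?case .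
qed

lemma tau_sign_swap: "Suc i < length xs ==> tau_sign (swap_at i xs) = - (tau_sign xs :: 'k::field)"
proof (induction i arbitrary: xs)
 case 0
 then obtain x y zs where xs: "xs = x # y # zs" by (cases xs; cases "tl xs") auto
 let ?c = "%x. card {j : set zs. j < x}"
 have c: "card {j. (j = y | j : set zs) & j < x} = (if y < x then Suc (?c x) else ?c x)" if "y ~: set zs" for x y
 proof -
  have "{j. (j = y | j : set zs) & j < x} = (if y < x then insert y {j : set zs. j < x} else {j : set zs. j < x})" by auto
  thus ?thesis using that by simp
 qed
 consider "x = y" | "x < y" | "y < x" by (rule linorder_cases[of x y]) auto
 thus ?case by cases (auto simp: xs swap_at_def c)
next
 case (Suc i)
 then obtain x ys where xs: "xs = x # ys" "Suc i < length ys" by (cases xs) auto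
 have "swap_at (Suc i) xs = x # swap_at i ys" using xs by (simp add: swap_at_def)
 moreover have "set (swap_at i ys) = set ys" using mset_eq_setD[OF mset_swap_at[OF xs(2)]] .
 ultimately show ?case using Suc.IH[OF xs(2)] xs(1) by simp
qed

text \<open>The bridge between operations and transformations: these values serve as the
  coefficients of \<open>nat_eta\<close>. Reordering tau's gives signs and reordering xi's none, so
  the function is alternating and symmetric as required.\<close>

definition cover_coeff :: "nat => nat => 'k::field steenrod_element => nat list => 'k" where
 "cover_coeff e b th t = (if length t = e + b then wval th (idx_word e t) else 0)"

lemma wmon_mset: "mset L = mset L' ==> mset (taus L) = mset (taus L') ==> wmon L = wmon L'"
 unfolding prod_eq_iff snd_wmon fst_wmon by (metis mset_eq_setD mset_map sum_mset_sum_list)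

lemma cover_coeff_alt_sym: "alt_sym e (e + b) (cover_coeff e b th :: _ => 'k::field)" unfolding alt_sym_def
proof (intro allI impI conjI; elim conjE)
 fix t :: "nat list" and i
 assume t: "length t = e + b"
 have wm: "wmon (idx_word e (u @ v)) = wmon (idx_word e (u' @ v'))"
  if "length u = e" "mset u = mset u'" "mset v = mset v'" for u v u' v'
  using that mset_eq_length[OF that(2)] by (intro wmon_mset) (simp_all add: taus_idx_word, simp add: idx_word_def)
 show "cover_coeff e b th (swap_at i t) = - cover_coeff e b th t" if i: "Suc i < e" "Suc i < e + b"
 proof -
  let ?u = "take e t" and ?v = "drop e t"
  have "swap_at i (?u @ ?v) = swap_at i ?u @ ?v"
   using i t unfolding swap_at_def by (simp add: list_update_append nth_append del: append_take_drop_id)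
  hence sw: "swap_at i t = swap_at i ?u @ ?v" by simp
  have "wmon (idx_word e (?u @ ?v)) = wmon (idx_word e (swap_at i ?u @ ?v))" using i t by (intro wm) simp_all
  thus ?thesis using t i tau_sign_swap[of i ?u, where 'k = 'k] unfolding cover_coeff_def wval_def word_sign_taus taus_idx_word sw by simp
 qed
 show "cover_coeff e b th (swap_at i t) = cover_coeff e b th t" if i: "e <= i" "Suc i < e + b"
 proof -
  let ?u = "take e t" and ?v = "drop e t"
  have "swap_at i (?u @ ?v) = ?u @ swap_at (i - e) ?v"
   using i t unfolding swap_at_def by (simp add: list_update_append nth_append Suc_diff_le del: append_take_drop_id)
  hence sw: "swap_at i t = ?u @ swap_at (i - e) ?v" by simp
  have "wmon (idx_word e (?u @ ?v)) = wmon (idx_word e (?u @ swap_at (i - e) ?v))" using i t by (intro wm) simp_all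
  thus ?thesis using t i unfolding cover_coeff_def wval_def word_sign_taus taus_idx_word sw by simp
 qed
qed

lemma cover_coeff_add: "cover_coeff e b (%m. th m + th' m) = (%t. cover_coeff e b th t + cover_coeff e b th' t)"
 and cover_coeff_scale: "cover_coeff e b (%m. c * th m) = (%t. c * cover_coeff e b th t)"
 by (auto simp: cover_coeff_def wval_def fun_eq_iff algebra_simps)

lemma cover_coeff_support: fixes th :: "'k::{field,finite} steenrod_element"
 assumes prime: "prime (CARD('k))" and th: "th : steenrod k" and nz: "cover_coeff e b th t ~= 0"
 shows "even (e + 2 * b + k)" "t : expts (CARD('k)) ((e + 2 * b + k) div 2) (e + b)"
proof -
 have t: "length t = e + b" and wv: "wval th (idx_word e t) ~= 0" using nz by (auto simp: cover_coeff_def split: if_splits)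
 have "2 * (\<Sum>j\<leftarrow>t. CARD('k) ^ j) = e + 2 * b + k"
  using idx_word_degree[OF t card_prime_pos[OF prime]] wval_nonzeroD(2)[OF th wv] by simp
 thus "even (e + 2 * b + k)" "t : expts (CARD('k)) ((e + 2 * b + k) div 2) (e + b)"
  using t by (presburger, auto simp: expts_def)
qed

text \<open>Since \<open>th\<close> vanishes on monomials with fewer than \<open>e\<close> factors
  tau, no split may send a tau to the left. The surviving splits give exactly the formula of
  \<open>power_action\<close>.\<close>

lemma cover_coeff_times: fixes th ps :: "'k::{field,finite} steenrod_element"
 assumes prime: "prime (CARD('k))" and odd: "odd (CARD('k))" and th: "th : st_tau e k"
 shows "cover_coeff e b (steenrod_times ps th) t = power_action ps (cover_coeff e b th) t"
proof (cases "length t = e + b")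
 case True
 let ?p = "CARD('k)"
 let ?f = "%S. split_sign S * wval ps (map fst S) * wval th (map snd S)"
 have "cover_coeff e b (steenrod_times ps th) t = (SUM S:splits ?p (idx_word e t). ?f S)"
  using wval_times[OF prime odd simple_frobenius[OF simple_idx_word], of ps th e t] True by (simp add: cover_coeff_def)
 also have "... = (SUM i:below t. ?f (zip (xi_word ?p t i) (idx_word e i)))"
 proof (rule sum_splits_idx_word)
  fix S assume S: "S : splits ?p (idx_word e t)" and tau: "ntau (map fst S) > 0"
  have "ntau (idx_word e t) = e" using True by (simp flip: length_taus add: taus_idx_word)
  hence lt: "ntau (map snd S) < e" using splits_ntau[OF S] tau by linarith
  have "wval th (map snd S) = 0"
  proof (rule ccontr)
   assume nz: "wval th (map snd S) ~= 0"
   hence "word_sign (map snd S) ~= (0 :: 'k)" "th (wmon (map snd S)) ~= 0" by (auto simp: wval_def)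
   moreover from this(2) have "e <= card (fst (wmon (map snd S)))" using th unfolding st_tau_def by blast
   ultimately show False using card_wmon[where 'k = 'k, of "map snd S"] lt by simp
  qed
  thus "?f S = 0" by simp
 qed
 also have "... = power_action ps (cover_coeff e b th) t" unfolding power_action_def
 proof (rule sum.cong[OF refl])
  fix i assume "i : below t"
  hence li: "length i = length t" by (rule below_length)
  hence lx: "length (xi_word ?p t i) = length (idx_word e i)" by (simp add: xi_word_def)
  have "split_sign (zip (xi_word ?p t i) (idx_word e i)) = (1 :: 'k)" by (rule split_sign_no_tau) (auto simp: xi_word_def dest!: set_zip_leftD)
  moreover have "wval ps (xi_word ?p t i) = ps (wmon (xi_word ?p t i))"
   by (simp add: wval_def word_sign_taus taus_xi_word)
  ultimately show "?f (zip (xi_word ?p t i) (idx_word e i)) = ps (wmon (xi_word ?p t i)) * cover_coeff e b th i"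
   using lx li True by (simp add: cover_coeff_def)
 qed
 finally show ?thesis .
next
 case False
 hence "cover_coeff e b th i = 0" if "i : below t" for i using below_length[OF that] by (simp add: cover_coeff_def)
 thus ?thesis using False by (simp add: cover_coeff_def power_action_def)
qed

section \<open>Functions determined by sorted lists\<close>

lemma adjacent_swap_front: assumes "!!u i. Suc i < length u ==> P (swap_at i u) \<longleftrightarrow> P u"
 shows "P (xs @ a # ys) \<longleftrightarrow> P (a # xs @ ys)"
proof (induction xs arbitrary: ys rule: rev_induct)
 case (snoc x xs)
 have "swap_at (length xs) ((xs @ [x]) @ a # ys) = xs @ a # x # ys" by (simp add: swap_at_def list_update_append nth_append)
 hence "P ((xs @ [x]) @ a # ys) \<longleftrightarrow> P (xs @ a # x # ys)" using assms[of "length xs" "(xs @ [x]) @ a # ys"] by simp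
 thus ?case using snoc[of "x # ys"] by simp
qed simp

text \<open>The head of \<open>u\<close> occurs in \<open>v\<close> and is moved to the front by
  adjacent swaps; the tails are then compared by induction.\<close>

lemma adjacent_swap_invariant: fixes P :: "'a list => bool"
 assumes "!!u i. Suc i < length u ==> P (swap_at i u) \<longleftrightarrow> P u" "mset u = mset v"
 shows "P u \<longleftrightarrow> P v" using assms
proof (induction u arbitrary: v P)
 case (Cons a u)
 have "a : set v" using mset_eq_setD[OF Cons.prems(2)] by auto
 then obtain xs ys where v: "v = xs @ a # ys" by (auto simp: in_set_conv_decomp)
 have "P (a # u) \<longleftrightarrow> P (a # xs @ ys)"
 proof (rule Cons.IH)
  fix w :: "'a list" and i assume i: "Suc i < length w"
  have "swap_at (Suc i) (a # w) = a # swap_at i w" using i by (simp add: swap_at_def)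
  thus "P (a # swap_at i w) \<longleftrightarrow> P (a # w)" using Cons.prems(1)[of "Suc i" "a # w"] i by simp
 qed (use Cons.prems(2) v in simp)
 thus ?case using adjacent_swap_front[of P xs a ys] Cons.prems(1) v by simp
qed simp

lemma swap_at_append: "Suc i < length u ==> swap_at i (u @ v) = swap_at i u @ v"
 "swap_at (length u + i) (u @ v) = u @ swap_at i v" by (auto simp: swap_at_def list_update_append nth_append)

lemma alt_symD: assumes "alt_sym e m x" "length w = m" "Suc i < m"
 shows "Suc i < e ==> x (swap_at i w) = - x w" "e <= i ==> x (swap_at i w) = x w"
 using assms by (simp_all add: alt_sym_def)

lemma alt_sym_tail: assumes "alt_sym e m x" "length u = e" "length u + length v = m" "mset v = mset v'" shows "x (u @ v) = (x (u @ v') :: 'k::field)"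
proof -
 have l: "length v' = length v" using assms(4) by (metis size_mset)
 have "length v = length v & x (u @ v) = x (u @ v) \<longleftrightarrow> length v' = length v & x (u @ v') = x (u @ v)"
 proof (rule adjacent_swap_invariant[OF _ assms(4)])
  fix w :: "nat list" and i assume "Suc i < length w"
  thus "length (swap_at i w) = length v & x (u @ swap_at i w) = x (u @ v) \<longleftrightarrow> length w = length v & x (u @ w) = x (u @ v)"
   using alt_symD(2)[OF assms(1), of "u @ w" "length u + i"] assms(2,3) swap_at_append(2)[of u i w] by auto
 qed
 thus ?thesis using l by simp
qed

text \<open>Sorting the alternating block changes the value by a sign only. If two of its entries
  coincide, they become neighbours after sorting, and the value equals its own negative.\<close>

lemma alt_sym_eq_zeroI: assumes alt: "alt_sym e (e + b) x" and two: "(2 :: 'k::field) ~= 0"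
  and z: "!!u v. length u = e ==> length v = b ==> sorted u ==> distinct u ==> x (u @ v) = 0"
  and t: "length t = e + b" shows "x t = (0 :: 'k)"
proof -
 define u v where "u = take e t" and "v = drop e t"
 have uv: "t = u @ v" "length u = e" "length v = b" using t by (auto simp: u_def v_def)
 have "length u = e & x (u @ v) = 0 \<longleftrightarrow> length (sort u) = e & x (sort u @ v) = 0"
 proof (rule adjacent_swap_invariant)
  fix w :: "nat list" and i assume "Suc i < length w"
  thus "length (swap_at i w) = e & x (swap_at i w @ v) = 0 \<longleftrightarrow> length w = e & x (w @ v) = 0"
   using alt_symD(1)[OF alt, of "w @ v" i] uv(3) swap_at_append(1)[of i w v] by auto
 qed simp
 moreover have "x (sort u @ v) = 0"
 proof (cases "distinct u")
  case True
  thus ?thesis using uv by (intro z) simp_all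
 next
  case False
  hence "~ sorted_wrt (<) (sort u)" by (metis distinct_sort strict_sorted_iff)
  then obtain i where i: "Suc i < length u" "~ sort u ! i < sort u ! Suc i" by (auto simp: sorted_wrt_iff_nth_Suc_transp[OF transp_on_less])
  hence "sort u ! i = sort u ! Suc i" using sorted_nth_mono[of "sort u" i "Suc i"] by simp
  hence "swap_at i (sort u) = sort u" using i by (simp add: swap_at_def) (metis list_update_id)
  hence "x (sort u @ v) = - x (sort u @ v)" using alt_symD(1)[OF alt, of "sort u @ v" i] uv i swap_at_append(1)[of i "sort u" v] by simp
  hence "2 * x (sort u @ v) = 0" by (metis add.right_inverse mult_2)
  thus ?thesis using two by simp
 qed
 ultimately show ?thesis using uv by simp
qed

lemma idx_word_append: "length u = e ==> idx_word e (u @ v) = map Tau u @ map (%j. Xi j 1) v" by (simp add: idx_word_def)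

lemma lookup_idx_word: assumes "length u = e"
 shows "lookup (snd (wmon (idx_word e (u @ v)))) j = (if j = 0 then 0 else count_list v j)"
proof -
 have "count_list (map Tau u) (Xi j q) = 0" for q by (induction u) auto
 moreover have "count_list (map (%j. Xi j (Suc 0)) v) (Xi j (Suc 0)) = count_list v j" by (induction v) auto
 ultimately show ?thesis using lookup_simple_word[OF simple_idx_word[of e "u @ v"], of j] by (simp add: idx_word_append[OF assms])
qed

text \<open>The monomial does not show how many units the tail contains, but the common length of
  the tails does.\<close>

lemma idx_word_tail_unique:
 assumes "length u = e" "length v = length v'" "wmon (idx_word e (u @ v)) = wmon (idx_word e (u' @ v'))" "length u' = e"
 shows "mset v = mset v'"
proof -
 have pos: "count_list v j = count_list v' j" if "j ~= 0" for j
  using lookup_idx_word[OF assms(1), of v j] lookup_idx_word[OF assms(4), of v' j] assms(3) that by simp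
 have len: "length w = count_list w 0 + (SUM j:(set v \<union> set v') - {0}. count_list w j)" if "set w <= set v \<union> set v'" for w
 proof -
  have "length w = (SUM j:insert 0 (set v \<union> set v'). count_list w j)" using that by (intro sum_count_set[symmetric]) auto
  also have "... = count_list w 0 + (SUM j:(set v \<union> set v') - {0}. count_list w j)" by (rule sum.insert_remove) simp
  finally show ?thesis .
 qed
 have "(SUM j:(set v \<union> set v') - {0}. count_list v j) = (SUM j:(set v \<union> set v') - {0}. count_list v' j)"
  by (rule sum.cong) (use pos in auto)
 hence "count_list v 0 = count_list v' 0" using len[of v] len[of v'] assms(2) by simp
 hence "count_list v j = count_list v' j" for j using pos by (cases "j = 0") auto
 thus ?thesis by (intro multiset_eqI) (simp add: count_mset)
qed

lemma idx_word_exists: assumes m: "m : milnor_monomials" and e: "card (fst m) = e" and b: "exponent_sum (snd m) <= b"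
 obtains t where "length t = e + b" "sorted (take e t)" "distinct (take e t)" "wmon (idx_word e t) = m"
proof -
 let ?u = "sorted_list_of_set (fst m)"
 let ?l = "concat (map (%j. replicate (lookup (snd m) j) j) (sorted_list_of_set (keys (snd m))))"
 \<comment> \<open>The zeros stand for the unit \<open>xi_0\<close> and fill the xi block up to
   length \<open>b\<close>.\<close>
 let ?v = "replicate (b - exponent_sum (snd m)) 0 @ ?l"
 have lu: "length ?u = e" using e by simp
 have "length ?l = exponent_sum (snd m)" by (simp add: length_concat o_def sum_list_distinct_conv_sum_set exponent_sum_def)
 hence lt: "length (?u @ ?v) = e + b" using lu b by simp
 have c: "map Tau ?u @ map (%j. Xi j 1) ?l = can_word m" by (simp add: can_word_def map_concat o_def map_replicate_const)
 have "wmon (replicate n (Xi 0 1)) = ({}, 0)" for n by (induction n) (simp_all add: xi_power_def)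
 hence "wmon (idx_word e (?u @ ?v)) = wmon (map Tau ?u @ map (%j. Xi j 1) ?l)"
  unfolding idx_word_append[OF lu] map_append wmon_append map_replicate by (cases "wmon (map (%j. Xi j 1) ?l)") simp
 hence "wmon (idx_word e (?u @ ?v)) = m" using wmon_canonical[OF m] c by simp
 thus ?thesis using that[of "?u @ ?v"] lt lu by simp
qed

lemma cover_coeff_surj: fixes ka :: "nat list => 'k::{field,finite}" assumes prime: "prime (CARD('k))" and odd: "odd (CARD('k))"
  and alt: "alt_sym e (e + b) ka" and supp: "!!t. ka t ~= 0 ==> t : expts (CARD('k)) c (e + b)"
  and k: "e + 2 * b + k = 2 * c"
 obtains th where "th : st_tau e k" "cover_coeff e b th = ka"
proof -
 let ?p = "CARD('k)"
 define word_of where "word_of m t \<longleftrightarrow> length t = e + b & sorted (take e t) & distinct (take e t) & wmon (idx_word e t) = m" for m t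
 \<comment> \<open>Words of the same monomial with sorted tau block differ only in the order of the
   tail, on which \<open>ka\<close> is symmetric; hence any choice gives the same value.\<close>
 define th where "th m = (if EX t. word_of m t then ka (SOME t. word_of m t) else 0)" for m
 have eq: "th m = ka t" if t: "word_of m t" for m t
 proof -
  define t' where "t' = (SOME t. word_of m t)"
  have t': "word_of m t'" unfolding t'_def using t by (rule someI)
  have "take e t = sorted_list_of_set (fst m)" if "word_of m t" for t
  proof -
   have "fst m = set (take e t)" using that by (auto simp: word_of_def fst_wmon taus_idx_word)
   thus ?thesis using that by (simp add: word_of_def sorted_list_of_set.idem_if_sorted_distinct)
  qed
  hence u: "take e t' = take e t" using t t' by simp
  have "mset (drop e t) = mset (drop e t')"
   using idx_word_tail_unique[of "take e t" e "drop e t" "drop e t'" "take e t'"] t t' by (simp add: word_of_def)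
  hence "ka (take e t @ drop e t) = ka (take e t @ drop e t')" using t by (intro alt_sym_tail[OF alt]) (auto simp: word_of_def)
  hence "ka t = ka t'" using u by (metis append_take_drop_id)
  thus ?thesis using t unfolding th_def t'_def by auto
 qed
 have "th : st_tau e k" unfolding st_tau_def steenrod_def mem_Collect_eq
 proof (intro conjI allI impI)
  fix m assume nz: "th m ~= 0"
  then obtain t where t: "word_of m t" unfolding th_def by metis
  hence T: "t : expts ?p c (e + b)" using supp nz eq by simp
  have m: "m = wmon (idx_word e t)" and len: "length t = e + b" and d: "distinct (take e t)" using t by (auto simp: word_of_def)
  show "m : milnor_monomials" unfolding m by (rule wmon_milnor)
  have "milnor_degree ?p m = word_degree ?p (idx_word e t)" unfolding m by (rule milnor_degree_word) (simp add: taus_idx_word d)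
  thus "milnor_degree ?p m = k" using idx_word_degree[OF len card_prime_pos[OF prime]] T k by (simp add: expts_def)
  show "e <= card (fst m)" using m d len by (simp add: fst_wmon taus_idx_word distinct_card)
 qed
 moreover have "cover_coeff e b th t = ka t" for t
 proof (cases "length t = e + b")
  case len: True
  let ?D = "%t. cover_coeff e b th t + (- 1) * ka t"
  have "?D t = 0"
  proof (rule alt_sym_eq_zeroI[OF _ two_neq_zero_field[OF prime odd] _ len])
   show "alt_sym e (e + b) ?D" by (rule alt_sym_add[OF cover_coeff_alt_sym alt_sym_scale[OF alt]])
   fix u v :: "nat list" assume uv: "length u = e" "length v = b" "sorted u" "distinct u"
   hence "th (wmon (idx_word e (u @ v))) = ka (u @ v)" by (intro eq) (simp add: word_of_def)
   moreover have "word_sign (idx_word e (u @ v)) = (1 :: 'k)" using uv by (simp add: word_sign_taus taus_idx_word tau_sign_sorted)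
   ultimately show "?D (u @ v) = 0" using uv by (simp add: cover_coeff_def wval_def)
  qed
  thus ?thesis by simp
 next
  case False
  thus ?thesis using supp[of t] by (auto simp: cover_coeff_def expts_def)
 qed
 ultimately show ?thesis using that by blast
qed

text \<open>Because of the padding by units, the \<open>b\<close> xi positions represent exactly the
  exponent sums up to \<open>b\<close>.\<close>

lemma cover_coeff_zero_iff: fixes th :: "'k::{field,finite} steenrod_element" assumes th: "th : steenrod k"
 shows "cover_coeff e b th = (%t. 0) \<longleftrightarrow> (ALL m. card (fst m) = e --> exponent_sum (snd m) <= b --> th m = 0)"
proof
 assume z: "cover_coeff e b th = (%t. 0)"
 show "ALL m. card (fst m) = e --> exponent_sum (snd m) <= b --> th m = 0"
 proof (intro allI impI)
  fix m :: milnor_monomial assume m: "card (fst m) = e" "exponent_sum (snd m) <= b"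
  show "th m = 0"
  proof (cases "m : milnor_monomials")
   case True
   then obtain t where t: "length t = e + b" "sorted (take e t)" "distinct (take e t)" "wmon (idx_word e t) = m"
    using m by (rule idx_word_exists)
   hence "cover_coeff e b th t = th m" by (simp add: cover_coeff_def wval_def word_sign_taus taus_idx_word tau_sign_sorted)
   thus ?thesis using z by simp
  next
   case False
   thus ?thesis using th unfolding steenrod_def by blast
  qed
 qed
next
 assume z: "ALL m. card (fst m) = e --> exponent_sum (snd m) <= b --> th m = 0"
 have "exponent_sum (snd (wmon (map (%j. Xi j 1) v))) <= length v" for v
  by (induction v) (auto simp: exponent_sum_add, auto simp: exponent_sum_def xi_power_def)
 moreover have "snd (wmon (idx_word e t)) = snd (wmon (map (%j. Xi j 1) (drop e t)))" for t
 proof -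
  have "snd (wmon (map Tau u)) = 0" for u by (induction u) (auto simp: tau_def)
  thus ?thesis by (simp add: idx_word_def snd_wmon)
 qed
 ultimately have sum: "exponent_sum (snd (wmon (idx_word e t))) <= length t - e" for t by (metis length_drop)
 show "cover_coeff e b th = (%t. 0)"
 proof (rule ext, rule ccontr)
  fix t assume "cover_coeff e b th t ~= 0"
  hence t: "length t = e + b" and nz: "tau_sign (take e t) ~= (0 :: 'k)" "th (wmon (idx_word e t)) ~= 0"
   by (auto simp: cover_coeff_def wval_def word_sign_taus taus_idx_word split: if_splits)
  have "card (fst (wmon (idx_word e t))) = e"
   using nz(1) t by (simp add: fst_wmon taus_idx_word distinct_card tau_sign_nonzero_iff)
  thus False using z[rule_format, of "wmon (idx_word e t)"] sum[of t] nz(2) t by simp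
 qed
qed

text \<open>The class has degree \<open>e + 2 * b + k\<close>, and \<open>r_prime\<close> uses half
  the degree as divided power. In odd degrees \<open>cover_coeff_support\<close> makes the
  coefficients vanish, so rounding is harmless.\<close>

definition cover_map :: "nat => nat => nat => 'k::{field,finite} steenrod_element => nat => (nat list => 'k) => nat list => 'k" where
 "cover_map e b k th = nat_eta ((e + 2 * b + k) div 2) (e + b) (cover_coeff e b th)"

abbreviation AltMod :: "nat => nat => ('k::{field,finite}, nat => (nat list => 'k) => nat list => 'k) graded_module" where
 "AltMod e b == r_prime (AltSym e b)"

lemma AltMod_vs: "vspace (part (AltMod e b :: ('k::{field,finite}, _) graded_module) n)"
 by (simp add: r_prime_component nat_trans_alt_sym_vs zero_vs_vs)

lemma AltMod_zero: "0[part (AltMod e b :: ('k::{field,finite}, _) graded_module) n] = nat_eta (n div 2) (e + b) (%t. 0)"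
 by (simp add: r_prime_component nat_eta_linear(3) del: nat_trans_vs_simps)

context fixes ty :: "'k::{field,finite} itself" assumes prime: "prime (CARD('k))" and odd: "odd (CARD('k))"
begin

text \<open>An exponent list of length \<open>e + b\<close> has a sum of powers of p of at least
  \<open>e + b\<close>, which exceeds \<open>n div 2\<close>; so no coefficients are
  available.\<close>

lemma AltMod_low: assumes "n < e + 2 * b"
 shows "carrier (part (AltMod e b :: ('k, _) graded_module) n) = {0[part (AltMod e b :: ('k, _) graded_module) n]}"
proof (cases "even n")
 case True
 have "n div 2 < e + b" using assms by simp
 have "et = nat_eta (n div 2) (e + b) (%t. 0)" if et: "et : nat_trans (divided_power (n div 2)) (AltSym e b :: ('k, _) vfunctor)" for et
 proof -
  obtain ka where supp: "!!t. ka t ~= 0 ==> t : expts (CARD('k)) (n div 2) (e + b)" and eq: "et = nat_eta (n div 2) (e + b) ka"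
   using nat_eta_surj[OF prime et] by metis
  have False if "t : expts (CARD('k)) (n div 2) (e + b)" for t
  proof -
   have "(\<Sum>a\<leftarrow>t. 1) <= (\<Sum>a\<leftarrow>t. CARD('k) ^ a)"
    using card_prime_pos[OF prime] by (intro sum_list_mono) (simp add: Suc_le_eq)
   thus False using that \<open>n div 2 < e + b\<close> by (simp add: expts_def sum_list_triv)
  qed
  hence "ka = (%t. 0)" using supp by blast
  thus ?thesis using eq by simp
 qed
 moreover have "carrier (part (AltMod e b :: ('k, _) graded_module) n) = nat_trans (divided_power (n div 2)) (AltSym e b)"
  using True by (simp add: r_prime_component)
 ultimately show ?thesis using vs_zero[OF AltMod_vs[of e b n, where 'k = 'k]] unfolding AltMod_zero by blast
qed (simp add: r_prime_component)

text \<open>In odd total degree both sides are zero. In even degree \<open>nat_eta_surj\<close>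
  supplies the coefficients of a transformation, and \<open>cover_coeff_surj\<close> an operation
  that has them.\<close>

lemma cover_map_image: "cover_map e b k ` (st_tau e k :: 'k steenrod_element set) = carrier (part (AltMod e b) (e + 2 * b + k))"
proof -
 let ?n = "e + 2 * b + k"
 have zero: "cover_map e b k th = nat_eta (?n div 2) (e + b) (%t. 0)" if "odd ?n" "th : steenrod k" for th :: "'k steenrod_element"
 proof -
  have "cover_coeff e b th = (%t. 0)" using cover_coeff_support(1)[OF prime that(2)] that(1) by blast
  thus ?thesis by (simp add: cover_map_def)
 qed
 show ?thesis
 proof (cases "even ?n")
  case True
  show ?thesis
  proof (intro subset_antisym subsetI)
   fix et assume "et : cover_map e b k ` (st_tau e k :: 'k steenrod_element set)"
   thus "et : carrier (part (AltMod e b) ?n)"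
    using True nat_eta_nat_trans[OF prime cover_coeff_alt_sym] by (auto simp: cover_map_def r_prime_component)
  next
   fix et assume "et : carrier (part (AltMod e b :: ('k, _) graded_module) ?n)"
   hence et: "et : nat_trans (divided_power (?n div 2)) (AltSym e b)" using True by (simp add: r_prime_component)
   obtain ka where alt: "alt_sym e (e + b) ka" and supp: "!!t. ka t ~= 0 ==> t : expts (CARD('k)) (?n div 2) (e + b)"
    and eq: "et = nat_eta (?n div 2) (e + b) ka" using nat_eta_surj[OF prime et] by metis
   have "?n = 2 * (?n div 2)" using True by simp
   then obtain th where "th : st_tau e k" "cover_coeff e b th = ka"
    using cover_coeff_surj[OF prime odd alt supp, of k] by metis
   thus "et : cover_map e b k ` (st_tau e k :: 'k steenrod_element set)" using eq by (auto simp: cover_map_def)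
  qed
 next
  case False
  hence "cover_map e b k ` (st_tau e k :: 'k steenrod_element set) = {nat_eta (?n div 2) (e + b) (%t. 0)}"
   using zero st_tau_zero[of e k] by (auto simp: tau_sub)
  thus ?thesis using False by (simp add: AltMod_zero[symmetric] r_prime_component del: nat_trans_vs_simps)
 qed
qed

lemma cover_map_add: "cover_map e b k (%m. th m + th' m :: 'k) =
  cover_map e b k th +[part (AltMod e b) (e + 2 * b + k)] cover_map e b k th'" and cover_map_scale:
 "cover_map e b k (%m. c * th m :: 'k) = c *[part (AltMod e b) (e + 2 * b + k)] cover_map e b k th"
 unfolding cover_map_def cover_coeff_add cover_coeff_scale nat_eta_linear r_prime_component by (simp_all del: nat_trans_vs_simps)

text \<open>\<open>nat_eta\<close> loses no coefficient on lists with the right sum of powers, and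
  \<open>cover_coeff\<close> is supported there; so the transformation vanishes only if all
  coefficients do.\<close>

lemma cover_map_zero_iff: fixes th :: "'k steenrod_element" assumes th: "th : steenrod k"
 shows "cover_map e b k th = 0[part (AltMod e b) (e + 2 * b + k)] \<longleftrightarrow>
  (ALL m. card (fst m) = e --> exponent_sum (snd m) <= b --> th m = 0)"
proof -
 let ?c = "(e + 2 * b + k) div 2"
 have "cover_coeff e b th = (%t. 0)" if eq: "nat_eta ?c (e + b) (cover_coeff e b th) = nat_eta ?c (e + b) (%t. 0)"
 proof (rule ext, rule ccontr)
  fix t assume nz: "cover_coeff e b th t ~= 0"
  have "nat_eta ?c (e + b) (cover_coeff e b th) (e + b) x w = 0" if "x : dpow ?c (e + b)" for x w
   unfolding eq using that by (simp add: nat_eta_def del: dpow_simps(1))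
  hence "cover_coeff e b th t = 0" by (rule nat_eta_eq_zeroD[OF prime _ cover_coeff_support(2)[OF prime th nz]])
  thus False using nz by simp
 qed
 thus ?thesis unfolding cover_coeff_zero_iff[OF th, symmetric] cover_map_def AltMod_zero by metis
qed

lemma AltMod_act_zero:
 "act (AltMod e b) l n ps 0[part (AltMod e b) n] = 0[part (AltMod e b :: ('k, _) graded_module) (n + l)]"
proof (cases "even n & even l")
 case True
 hence n: "2 * (n div 2) = n" "(n + l) div 2 = n div 2 + l div 2" by auto
 have "act (AltMod e b) l (2 * (n div 2)) ps (nat_eta (n div 2) (e + b) (%t. 0 :: 'k)) =
  nat_eta (n div 2 + l div 2) (e + b) (power_action ps (%t. 0))"
  using True by (intro r_prime_act_nat_eta[OF prime]) (auto simp: alt_sym_zero)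
 thus ?thesis unfolding AltMod_zero n by (simp add: power_action_zero)
next
 case False
 show ?thesis
 proof (cases "even l")
  case True
  thus ?thesis using False by (simp add: r_prime_def Let_def del: nat_trans_vs_simps)
 qed (rule r_prime_act_odd[OF _ AltMod_vs])
qed

lemma cover_map_times: fixes th ps :: "'k steenrod_element"
 assumes th: "th : st_tau e k" and ps: "ps : steenrod l"
 shows "cover_map e b (l + k) (steenrod_times ps th) = act (AltMod e b) l (e + 2 * b + k) ps (cover_map e b k th)"
proof -
 let ?n = "e + 2 * b + k"
 note th' = tau_sub[OF th]
 have times: "cover_coeff e b (steenrod_times ps th) = power_action ps (cover_coeff e b th)"
  by (rule ext, rule cover_coeff_times[OF prime odd th])
 show ?thesis
 proof (cases "even ?n & even l")
  case True
  hence n: "2 * (?n div 2) = ?n" "(e + 2 * b + (l + k)) div 2 = ?n div 2 + l div 2" by auto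
  have "act (AltMod e b) l (2 * (?n div 2)) ps (nat_eta (?n div 2) (e + b) (cover_coeff e b th)) =
   nat_eta (?n div 2 + l div 2) (e + b) (power_action ps (cover_coeff e b th))"
   using True cover_coeff_support(2)[OF prime th'] by (intro r_prime_act_nat_eta[OF prime _ cover_coeff_alt_sym]) auto
  thus ?thesis unfolding cover_map_def times n by simp
 next
  case False
  \<comment> \<open>With an odd operation or an odd source degree, one of the degrees involved is
    odd, and the support condition removes all coefficients.\<close>
  have c0: "cover_coeff e b (steenrod_times ps th) = (%t. 0)"
  proof (cases "even ?n")
   case True
   hence "odd (e + 2 * b + (l + k))" using False by auto
   thus ?thesis using cover_coeff_support(1)[OF prime steenrod_times_closed[OF prime odd ps th']] by blast
  next
   case odd_n: False
   hence "cover_coeff e b th = (%t. 0)" using cover_coeff_support(1)[OF prime th'] by blast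
   thus ?thesis unfolding times by (simp add: power_action_zero)
  qed
  have "act (AltMod e b) l ?n ps (cover_map e b k th) = 0[part (AltMod e b) (?n + l)]"
  proof (cases "even l")
   case True
   thus ?thesis using False by (simp add: r_prime_def Let_def del: nat_trans_vs_simps)
  qed (rule r_prime_act_odd[OF _ AltMod_vs])
  thus ?thesis unfolding cover_map_def c0 AltMod_zero by (simp add: ac_simps)
 qed
qed

end

text \<open>For a fixed number of factors tau the excess has fixed parity. The bounds
  \<open>e + 2 * b\<close> and \<open>e + 2 * b + 1\<close> therefore select the same monomials, and
  the same cover serves both kinds of pieces.\<close>

lemma excess_le_iff: "card (fst m) = e ==> excess m <= e + 2 * b \<longleftrightarrow> exponent_sum (snd m) <= b"
 "card (fst m) = e ==> excess m <= Suc (e + 2 * b) \<longleftrightarrow> exponent_sum (snd m) <= b"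
 unfolding excess_def by presburger+

context fixes F :: "('k::{field,finite}, 'u) graded_module" and n :: nat and \<iota> :: 'u
 assumes prime: "prime (CARD('k))" and odd: "odd (CARD('k))" and inf: "infinite (UNIV :: 'u set)" and free: "free_unstable n F \<iota>"
begin

lemma graded_piece_even: assumes n: "n = e + 2 * b"
 shows "unstable_iso (subquotient F (tau_level F n \<iota> e) (tau_level F n \<iota> (Suc e))) (AltMod e b)"
proof (rule graded_piece_iso[OF prime odd inf free, where s = "cover_map e b"])
 note [simp] = n
 show "vspace (part (AltMod e b :: ('k, _) graded_module) m)" for m by (rule AltMod_vs)
 show "carrier (part (AltMod e b :: ('k, _) graded_module) m) = {0[part (AltMod e b :: ('k, _) graded_module) m]}" if "m < n" for m
  using AltMod_low[OF prime odd] that by simp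
 show "cover_map e b k ` (st_tau e k :: 'k steenrod_element set) = carrier (part (AltMod e b) (n + k))" for k
  using cover_map_image[OF prime odd] by simp
 show "cover_map e b k (%m. th m + th' m :: 'k) = cover_map e b k th +[part (AltMod e b) (n + k)] cover_map e b k th'" for k th th'
  using cover_map_add[OF prime odd] by simp
 show "cover_map e b k (%m. c * th m :: 'k) = c *[part (AltMod e b) (n + k)] cover_map e b k th" for k th c
  using cover_map_scale[OF prime odd] by simp
 show "cover_map e b k th = 0[part (AltMod e b) (n + k)] \<longleftrightarrow> (ALL m. card (fst m) = e --> excess m <= n --> th m = 0)"
  if "th : st_tau e k" for k and th :: "'k steenrod_element"
 proof -
  have "(ALL m. card (fst m) = e --> excess m <= n --> th m = 0) \<longleftrightarrow> (ALL m. card (fst m) = e --> exponent_sum (snd m) <= b --> th m = 0)"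
   unfolding n using excess_le_iff(1) by blast
  thus ?thesis using cover_map_zero_iff[OF prime odd tau_sub[OF that], of e b] by (simp only: n)
 qed
 show "cover_map e b (l + k) (steenrod_times ps th) = act (AltMod e b) l (n + k) ps (cover_map e b k th)"
  if "th : st_tau e k" "ps : steenrod l" for k l and th ps :: "'k steenrod_element"
  using cover_map_times[OF prime odd that] by simp
 show "act (AltMod e b) l m ps 0[part (AltMod e b) m] = 0[part (AltMod e b) (m + l)]"
  for l m and ps :: "'k steenrod_element" by (rule AltMod_act_zero[OF prime odd])
qed

text \<open>The generator now sits one degree above \<open>e + 2 * b\<close>, where the cover
  starts; the suspension absorbs this difference.\<close>

lemma graded_piece_odd: assumes n: "n = Suc (e + 2 * b)"
 shows "unstable_iso (subquotient F (tau_level F n \<iota> e) (tau_level F n \<iota> (Suc e))) (suspension (AltMod e b))"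
proof (rule graded_piece_iso[OF prime odd inf free, where s = "cover_map e b"])
 let ?M = "AltMod e b :: ('k, _) graded_module"
 note [simp] = n
 have sc: "part (suspension ?M) (Suc m) = part ?M m" "part (suspension ?M) 0 = zero_vs (part ?M 0)" for m
  by (simp_all add: suspension_def)
 note V = AltMod_vs[of e b, where 'k = 'k]
 show "vspace (part (suspension ?M) m)" for m by (cases m) (simp_all add: sc zero_vs_vs V)
 show "carrier (part (suspension ?M) m) = {0[part (suspension ?M) m]}" if "m < n" for m
  using AltMod_low[OF prime odd] that by (cases m) (simp_all add: sc)
 show "cover_map e b k ` (st_tau e k :: 'k steenrod_element set) = carrier (part (suspension ?M) (n + k))" for k
  using cover_map_image[OF prime odd] by (simp add: sc)
 show "cover_map e b k (%m. th m + th' m :: 'k) = cover_map e b k th +[part (suspension ?M) (n + k)] cover_map e b k th'" for k th th'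
  using cover_map_add[OF prime odd] by (simp add: sc)
 show "cover_map e b k (%m. c * th m :: 'k) = c *[part (suspension ?M) (n + k)] cover_map e b k th" for k th c
  using cover_map_scale[OF prime odd] by (simp add: sc)
 show "cover_map e b k th = 0[part (suspension ?M) (n + k)] \<longleftrightarrow> (ALL m. card (fst m) = e --> excess m <= n --> th m = 0)"
  if "th : st_tau e k" for k and th :: "'k steenrod_element"
 proof -
  have "(ALL m. card (fst m) = e --> excess m <= n --> th m = 0) \<longleftrightarrow> (ALL m. card (fst m) = e --> exponent_sum (snd m) <= b --> th m = 0)"
   unfolding n using excess_le_iff(2) by blast
  thus ?thesis using cover_map_zero_iff[OF prime odd tau_sub[OF that], of e b] by (simp only: n add_Suc sc)
 qed
 have car: "cover_map e b k th : carrier (part ?M (e + 2 * b + k))" if "th : st_tau e k" for k and th :: "'k steenrod_element"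
  using cover_map_image[OF prime odd, of e b k] that by blast
 show "cover_map e b (l + k) (steenrod_times ps th) = act (suspension ?M) l (n + k) ps (cover_map e b k th)"
  if th: "th : st_tau e k" and ps: "ps : steenrod l" for k l and th ps :: "'k steenrod_element"
 proof -
  have "cover_map e b (l + k) (steenrod_times ps th) : carrier (part ?M (e + 2 * b + (l + k)))"
   using st_tau_times[OF prime odd _ th, of ps 0 l] ps by (intro car) (simp add: st_tau_0)
  \<comment> \<open>The sign of the suspension matters for odd operations only, and these act by
    zero.\<close>
  thus ?thesis unfolding cover_map_times[OF prime odd th ps]
   by (cases "even l") (simp_all add: suspension_def vs_one_smult[OF V] r_prime_act_odd[OF _ V] vs_smult_zero[OF V] ac_simps)
 qed
 show "act (suspension ?M) l m ps 0[part (suspension ?M) m] = 0[part (suspension ?M) (m + l)]"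
  for l m and ps :: "'k steenrod_element"
 proof (cases m)
  case 0
  thus ?thesis by (cases l) (simp_all add: suspension_def)
 next
  case (Suc m')
  thus ?thesis using AltMod_act_zero[OF prime odd, of e b l m' ps] by (simp add: suspension_def vs_smult_zero[OF V])
 qed
qed

end

section \<open>The functor \<open>\<Lambda>\<^sup>a \<otimes> \<Gamma>\<^sup>b\<close>\<close>

lemma span_subspace: assumes "vspace (V :: ('k::field, 'v) module)" "S <= carrier V"
 shows "subsp (lspan V S) V" "S <= lspan V S"
  "subsp H V ==> S <= H ==> lspan V S <= H"
proof -
 interpret vectorspace class_ring V by (rule assms(1))
 show "subsp (lspan V S) V" using span_is_submodule[OF assms(2)] assms(1) by (simp add: VectorSpace.subspace_def)
 show "S <= lspan V S" by (rule in_own_span[OF assms(2)])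
 show "lspan V S <= H" if "subsp H V" "S <= H"
  using that by (intro span_is_subset) (simp_all add: VectorSpace.subspace_def)
qed

text \<open>The map that a linear \<open>g\<close> induces on the cosets of its kernel, evaluated at
  an arbitrary representative.\<close>

definition descend :: "('v => 'w) => 'v set => 'w" where
 "descend g X = g (SOME x. x : X)"

context fixes V :: "('k::field, 'v) module" and W :: "('k, 'w) module" and H g assumes V: "vspace V" and W: "vspace W"
  and H: "subsp H V" and g: "g : lin V W"
  and kernel: "!!x. x : carrier V ==> g x = 0[W] \<longleftrightarrow> x : H"
begin

lemma descend_coset: assumes x: "x : carrier V" shows "descend g (H +>[V] x) = g x"
proof -
 define t where "t = (SOME t. t : H +>[V] x)"
 have "t : H +>[V] x" unfolding t_def by (rule someI[of "%t. t : H +>[V] x"]) (rule coset_self[OF V H x])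
 hence t: "t : carrier V" "t +[V] (- 1) *[V] x : H" by (simp_all add: mem_coset_iff[OF V H x])
 hence "g (t +[V] (- 1) *[V] x) = 0[W]"
  using kernel[of "t +[V] (- 1) *[V] x"] x by (simp add: vs_add[OF V] vs_smult[OF V])
 hence "g t +[W] (- 1) *[W] g x = 0[W]"
  using t x by (simp add: hom_add[OF g] hom_smult[OF g] vs_smult[OF V])
 thus ?thesis using t x by (simp add: vs_eq_iff_diff[OF W] hom_closed[OF g] descend_def t_def[symmetric])
qed

lemma descend_hom: "descend g : lin (quot_vs V H) W" unfolding module_hom_iff
proof (intro conjI ballI allI)
 fix X assume "X : carrier (quot_vs V H)"
 then obtain x where x: "x : carrier V" "X = H +>[V] x" by (rule quot_cosetE[OF V H])
 show "descend g X : carrier W" using x by (simp add: descend_coset hom_closed[OF g])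
 show "descend g (c *[quot_vs V H] X) = c *[W] descend g X" for c
  using x by (simp add: descend_coset quot_smult[OF V H] vs_smult[OF V] hom_smult[OF g])
 fix Y assume "Y : carrier (quot_vs V H)"
 then obtain y where y: "y : carrier V" "Y = H +>[V] y" by (rule quot_cosetE[OF V H])
 show "descend g (X +[quot_vs V H] Y) = descend g X +[W] descend g Y"
  using x y by (simp add: descend_coset quot_add[OF V H] vs_add[OF V] hom_add[OF g])
qed

lemma descend_bij: assumes surj: "g ` carrier V = carrier W" shows "bij_betw (descend g) (carrier (quot_vs V H)) (carrier W)"
proof (rule bij_betw_imageI)
 show "inj_on (descend g) (carrier (quot_vs V H))"
 proof (rule inj_onI)
  fix X Y assume X: "X : carrier (quot_vs V H)" and Y: "Y : carrier (quot_vs V H)" and eq: "descend g X = descend g Y"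
  obtain x where x: "x : carrier V" "X = H +>[V] x" using X by (rule quot_cosetE[OF V H])
  obtain y where y: "y : carrier V" "Y = H +>[V] y" using Y by (rule quot_cosetE[OF V H])
  have "g (x +[V] (- 1) *[V] y) = g x +[W] (- 1) *[W] g y"
   using x y by (simp add: hom_add[OF g] hom_smult[OF g] vs_smult[OF V])
  also have "... = 0[W]" using eq x y by (simp add: descend_coset vs_neg[OF W] hom_closed[OF g])
  finally show "X = Y"
   using x y kernel[of "x +[V] (- 1) *[V] y"] by (simp add: coset_eq_iff[OF V H] vs_add[OF V] vs_smult[OF V])
 qed
 have "descend g ` carrier (quot_vs V H) = g ` carrier V" by (auto simp: quot_carrier[OF V H] image_iff) (metis descend_coset)+
 thus "descend g ` carrier (quot_vs V H) = carrier W" using surj by simp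
qed

end

subsection \<open>Exterior powers as alternating tensors\<close>

lemma tpow_vs_vs: "vspace (tpow_vs b d :: ('k::field, _) module)"
 by (rule vectorspace_classI) (auto simp: algebra_simps, (metis add.right_neutral)+)

text \<open>Antisymmetrisation. It induces the comparison of the exterior power, a quotient, with
  alternating tensors, a subspace. It is not divided by the factorial of \<open>a\<close>, which may
  be 0 in the field.\<close>

definition skew :: "nat => (nat list => 'k::field) => nat list => 'k" where
 "skew a x w = (\<Sum>sg | sg permutes {..<a}. of_int (sign sg) * x (permute_list sg w))"

lemma antisym_linear: "skew a (%w. x w + y w) = (%w. skew a x w + skew a y w)"
 "skew a (%w. c * x w) = (%w. c * skew a x w)"
 by (auto simp: skew_def fun_eq_iff algebra_simps sum.distrib sum_distrib_left)

lemma permutes_permutation: "sg permutes {..<a :: nat} ==> permutation sg" by (rule permutes_imp_permutation) simp_all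

lemma sign_transpose_comp: assumes "sg permutes {..<a :: nat}" "i ~= j"
 shows "sign (transpose i j \<circ> sg) = - sign sg" "sign (sg \<circ> transpose i j) = - sign sg"
 using assms permutes_permutation[OF assms(1)] by (simp_all add: sign_compose permutation_swap_id sign_swap_id)

lemma swap_at_permute: "Suc i < length w ==> swap_at i w = permute_list (transpose i (Suc i)) w"
 by (rule nth_equalityI) (auto simp: permute_list_def nth_swap_at transpose_def)

lemma antisym_swap: assumes "length w = a" "Suc i < a" shows "skew a x (swap_at i w) = - skew a x w"
proof -
 let ?t = "transpose i (Suc i)"
 have t: "?t permutes {..<a}" using assms by (intro permutes_swap_id) auto
 have "skew a x (swap_at i w) = (\<Sum>sg | sg permutes {..<a}. of_int (sign sg) * x (permute_list (?t \<circ> sg) w))"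
  unfolding skew_def by (rule sum.cong) (use assms in \<open>auto simp: swap_at_permute permute_list_compose\<close>)
 also have "... = (\<Sum>sg | sg permutes {..<a}. of_int (sign (?t \<circ> sg)) * x (permute_list sg w))"
  by (rule sum.reindex_bij_witness[of _ "%sg. ?t \<circ> sg" "%sg. ?t \<circ> sg"])
   (auto simp: permutes_compose[OF _ t] o_assoc)
 also have "... = - skew a x w" unfolding skew_def sum_negf[symmetric] by (rule sum.cong) (auto simp: sign_transpose_comp)
 finally show ?thesis .
qed

lemma permute_list_words: "sg permutes {..<a} ==> permute_list sg w : words a d \<longleftrightarrow> w : words a d"
 using set_permute_list[of sg w] by (auto simp: words_def)

lemma antisym_words: assumes "!!w. x w ~= 0 ==> w : words a d" "skew a x w ~= 0" shows "w : words a d"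
proof -
 obtain sg where "sg permutes {..<a}" "x (permute_list sg w) ~= 0"
  using assms(2) unfolding skew_def by (metis (mono_tags, lifting) mem_Collect_eq mult_zero_right sum.neutral)
 thus ?thesis using assms(1) permute_list_words by blast
qed

lemma antisym_carrier: assumes "x : carrier (tpow_vs a d)" shows "skew a x : carrier (fobj (AltSym a 0) d)"
 using assms antisym_words[of x a d] antisym_swap[where x = x] by (auto simp: alt_sym_def)

lemma antisym_natural: fixes A :: "'k::field mat" assumes A: "A : carrier_mat d' d"
 shows "skew a (tpow_map a A x) = tpow_map a A (skew a x)"
proof
 fix w
 show "skew a (tpow_map a A x) w = tpow_map a A (skew a x) w"
 proof (cases "w : words a d'")
  case w: True
  have "tpow_map a A x (permute_list sg w) = (SUM v:words a d. (\<Prod>i<a. A $$ (w ! i, v ! i)) * x (permute_list sg v))"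
   if sg: "sg permutes {..<a}" for sg
  proof -
   have "tpow_map a A x (permute_list sg w) = (SUM v:words a d. (\<Prod>i<a. A $$ (permute_list sg w ! i, v ! i)) * x v)"
    using A w permute_list_words[OF sg] by (simp add: tpow_map_def)
   also have "... = (SUM v:words a d. (\<Prod>i<a. A $$ (permute_list sg w ! i, permute_list sg v ! i)) * x (permute_list sg v))"
    by (rule sum.reindex_bij_witness[of _ "permute_list sg" "permute_list (inv_into UNIV sg)"])
     (use sg permutes_inv[OF sg] in \<open>auto simp: permute_list_words words_length permutes_inv_o simp flip: permute_list_compose\<close>)
   also have "... = (SUM v:words a d. (\<Prod>i<a. A $$ (w ! i, v ! i)) * x (permute_list sg v))"
   proof (rule sum.cong[OF refl])
    fix v assume v: "v : words a d"
    have "(\<Prod>i<a. A $$ (permute_list sg w ! i, permute_list sg v ! i)) = (\<Prod>i<a. A $$ (w ! sg i, v ! sg i))"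
     using sg v w by (intro prod.cong) (auto simp: permute_list_nth words_length)
    also have "... = (\<Prod>i<a. A $$ (w ! i, v ! i))"
     using prod.permute[OF sg, of "%i. A $$ (w ! i, v ! i)"] by (simp add: o_def)
    finally show "(\<Prod>i<a. A $$ (permute_list sg w ! i, permute_list sg v ! i)) * x (permute_list sg v) =
     (\<Prod>i<a. A $$ (w ! i, v ! i)) * x (permute_list sg v)" by simp
   qed
   finally show ?thesis .
  qed
  hence "skew a (tpow_map a A x) w = (\<Sum>sg | sg permutes {..<a}. of_int (sign sg) *
    (SUM v:words a d. (\<Prod>i<a. A $$ (w ! i, v ! i)) * x (permute_list sg v)))" unfolding skew_def by (intro sum.cong) auto
  also have "... = (SUM v:words a d. \<Sum>sg | sg permutes {..<a}. (\<Prod>i<a. A $$ (w ! i, v ! i)) * (of_int (sign sg) * x (permute_list sg v)))"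
   unfolding sum_distrib_left by (subst sum.swap) (simp add: mult_ac)
  also have "... = tpow_map a A (skew a x) w" using w A by (simp add: tpow_map_def skew_def sum_distrib_left)
  finally show ?thesis .
 next
  case False
  thus ?thesis using A antisym_words[of "tpow_map a A x" a d' w] tpow_map_words[of a A x] by (auto simp: tpow_map_def)
 qed
qed

lemma pure_tensor_words: "pure_tensor d vs w ~= 0 ==> w : words (length vs) d" by (simp add: pure_tensor_def split: if_splits)

text \<open>Composing with the transposition of the two equal entries reverses every sign but
  preserves every product, so the sum is its own negative.\<close>

lemma antisym_pure_tensor:
 assumes two: "(2 :: 'k::field) ~= 0" and vs: "length vs = a" "i < a" "j < a" "i ~= j" "vs ! i = (vs ! j :: 'k vec)"
 shows "skew a (pure_tensor d vs) w = 0"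
proof (cases "w : words a d")
 case w: True
 let ?t = "transpose i j"
 let ?f = "%sg. \<Prod>k<a. (vs ! k) $ (w ! sg k)"
 have t: "?t permutes {..<a}" using vs by (intro permutes_swap_id) auto
 have S: "skew a (pure_tensor d vs) w = (\<Sum>sg | sg permutes {..<a}. of_int (sign sg) * ?f sg)"
  unfolding skew_def
 proof (rule sum.cong[OF refl])
  fix sg assume "sg : {sg. sg permutes {..<a}}"
  hence sg: "sg permutes {..<a}" by simp
  have "pure_tensor d vs (permute_list sg w) = (\<Prod>k<a. (vs ! k) $ (permute_list sg w ! k))"
   using permute_list_words[OF sg] w vs(1) by (simp add: pure_tensor_def)
  also have "... = ?f sg" using sg w by (intro prod.cong) (auto simp: permute_list_nth words_length)
  finally show "of_int (sign sg) * pure_tensor d vs (permute_list sg w) = of_int (sign sg) * ?f sg" by simp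
 qed
 also have "... = (\<Sum>sg | sg permutes {..<a}. of_int (sign (sg \<circ> ?t)) * ?f (sg \<circ> ?t))"
  by (rule sum.reindex_bij_witness[of _ "%sg. sg \<circ> ?t" "%sg. sg \<circ> ?t"])
   (auto simp: permutes_compose[OF t] o_assoc[symmetric])
 also have "... = (\<Sum>sg | sg permutes {..<a}. - (of_int (sign sg) * ?f sg))"
 proof (rule sum.cong[OF refl])
  fix sg assume "sg : {sg. sg permutes {..<a}}"
  hence sg: "sg permutes {..<a}" by simp
  have "?f (sg \<circ> ?t) = (\<Prod>k<a. (vs ! ?t k) $ (w ! sg (?t k)))" using vs(5) by (intro prod.cong) (auto simp: transpose_def)
  also have "... = ?f sg" using prod.permute[OF t, of "%k. (vs ! k) $ (w ! sg k)"] by (simp add: o_def)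
  finally show "of_int (sign (sg \<circ> ?t)) * ?f (sg \<circ> ?t) = - (of_int (sign sg) * ?f sg)"
   using sign_transpose_comp(2)[OF sg vs(4)] by simp
 qed
 also have "... = - skew a (pure_tensor d vs) w" unfolding S by (rule sum_negf)
 finally have "2 * skew a (pure_tensor d vs) w = 0" by (metis add.right_inverse mult_2)
 thus ?thesis using two by simp
next
 case False
 thus ?thesis using antisym_words[of "pure_tensor d vs" a d w] pure_tensor_words[of d vs] vs(1) by blast
qed

definition increasing :: "nat => nat => nat list set" where
 "increasing a d = {w \<in> words a d. sorted w & distinct w}"

lemma finite_increasing [simp]: "finite (increasing a d)" by (simp add: increasing_def)

text \<open>A nontrivial permutation of an increasing word is no longer increasing, so only the
  identity contributes.\<close>

lemma antisym_increasing: assumes x: "!!w. x w ~= 0 ==> w : increasing a d" and w: "w : increasing a d"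
 shows "skew a x w = x w"
proof -
 have "x (permute_list sg w) = 0" if sg: "sg permutes {..<a}" and ne: "sg ~= id" for sg
 proof (rule ccontr)
  assume "x (permute_list sg w) ~= 0"
  hence p: "sorted (permute_list sg w)" using x by (auto simp: increasing_def)
  have lw: "length w = a" "sorted w" "distinct w" using w by (auto simp: increasing_def words_def)
  hence eq: "permute_list sg w = w" using p sg by (intro sorted_distinct_set_unique) simp_all
  have "sg k = k" for k
  proof (cases "k < a")
   case True
   hence "w ! sg k = w ! k" using permute_list_nth[of sg w k] sg lw eq by simp
   moreover have "sg k < a" using permutes_in_image[OF sg, of k] True by simp
   ultimately show ?thesis using lw True by (simp add: nth_eq_iff_index_eq)
  next
   case False
   thus ?thesis using sg by (simp add: permutes_def)
  qed
  thus False using ne by (auto simp: fun_eq_iff)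
 qed
 hence "skew a x w = (SUM sg:{id}. of_int (sign sg) * x (permute_list sg w))"
  unfolding skew_def by (intro sum.mono_neutral_right) (auto simp: finite_permutations permutes_id)
 thus ?thesis by simp
qed

definition basis_tensor :: "nat list => nat list => 'k::field" where
 "basis_tensor w u = (if u = w then 1 else 0)"

lemma basis_tensor_pure: assumes w: "w : words a d"
 shows "basis_tensor w = (pure_tensor d (map (unit_vec d) w) :: nat list => 'k::field)"
proof
 fix u
 have lw: "length w = a" by (rule words_length[OF w])
 show "basis_tensor w u = (pure_tensor d (map (unit_vec d) w) u :: 'k)"
 proof (cases "u : words a d")
  case u: True
  have "(\<Prod>i<a. map (unit_vec d) w ! i $ (u ! i) :: 'k) = (\<Prod>i<a. if u ! i = w ! i then 1 else 0)"
   using words_nth[OF u] words_nth[OF w] lw by (intro prod.cong) (auto simp: unit_vec_def)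
  also have "... = (if u = w then 1 else 0)"
  proof (cases "u = w")
   case False
   then obtain i where "i < a" "u ! i ~= w ! i" using nth_equalityI[of u w] words_length[OF u] lw by auto
   hence "(\<Prod>i<a. if u ! i = w ! i then 1 else 0) = (0 :: 'k)" by (intro prod_zero) auto
   thus ?thesis using False by simp
  qed simp
  finally show ?thesis using u lw by (cases "u = w") (simp_all add: pure_tensor_def basis_tensor_def del: prod_zero_iff)
 next
  case False
  thus ?thesis using w lw by (auto simp: pure_tensor_def basis_tensor_def)
 qed
qed

lemma pure_tensor_add: assumes "k < length vs" "x : carrier_vec d" "y : carrier_vec d"
 shows "pure_tensor d (vs[k := x + y]) = (%w. pure_tensor d (vs[k := x]) w + pure_tensor d (vs[k := y]) w)"
proof
 fix w
 show "pure_tensor d (vs[k := x + y]) w = pure_tensor d (vs[k := x]) w + pure_tensor d (vs[k := y]) w"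
 proof (cases "w : words (length vs) d")
  case w: True
  have split: "(\<Prod>i<length vs. vs[k := z] ! i $ (w ! i)) = z $ (w ! k) * (PROD i:{..<length vs} - {k}. vs ! i $ (w ! i))" for z
   using assms(1) by (subst prod.remove[of _ k]) (auto intro!: arg_cong2[where f = "(*)"] prod.cong)
  show ?thesis using w assms words_nth[OF w assms(1)] by (simp add: pure_tensor_def split algebra_simps)
 qed (simp add: pure_tensor_def)
qed

context fixes a d :: nat and ty :: "'k::field itself"
begin

lemma ext_rel_subspace: "subsp (ext_rel a d :: (nat list => 'k) set) (tpow_vs a d)"
 and ext_rel_pure: "length vs = a ==> set vs <= carrier_vec d ==> ~ distinct vs ==> pure_tensor d vs : (ext_rel a d :: (nat list => 'k) set)"
 and ext_rel_least: "subsp H (tpow_vs a d) ==>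
  (!!vs. length vs = a ==> ~ distinct vs ==> pure_tensor d vs : H) ==> (ext_rel a d :: (nat list => 'k) set) <= H"
proof -
 let ?S = "{pure_tensor d vs | vs. length vs = a & set vs <= carrier_vec d & ~ distinct vs} :: (nat list => 'k) set"
 have S: "?S <= carrier (tpow_vs a d)" using pure_tensor_words by auto
 note sp = span_subspace[OF tpow_vs_vs S]
 show "subsp (ext_rel a d :: (nat list => 'k) set) (tpow_vs a d)" unfolding ext_rel_def by (rule sp)
 show "pure_tensor d vs : (ext_rel a d :: (nat list => 'k) set)" if "length vs = a" "set vs <= carrier_vec d" "~ distinct vs" for vs
  using sp(2) that unfolding ext_rel_def by blast
 show "(ext_rel a d :: (nat list => 'k) set) <= H" if "subsp H (tpow_vs a d)"
  "!!vs. length vs = a ==> ~ distinct vs ==> pure_tensor d vs : H"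
  unfolding ext_rel_def using that by (intro sp(3)) auto
qed

lemma ext_rel_closed: "(%w. 0) : (ext_rel a d :: (nat list => 'k) set)"
 "x : ext_rel a d ==> y : ext_rel a d ==> (%w. x w + y w :: 'k) : ext_rel a d"
 "x : ext_rel a d ==> (%w. c * x w :: 'k) : ext_rel a d"
 using quot_subspaceD(2-4)[OF tpow_vs_vs ext_rel_subspace] by simp_all

text \<open>Polarisation: the tensor with \<open>x + y\<close> in both positions is a relation, and
  so are the ones with \<open>x\<close> twice and with \<open>y\<close> twice.\<close>

lemma basis_tensor_swap: assumes w: "w : words a d" and i: "Suc i < a"
 shows "(%u. basis_tensor w u + basis_tensor (swap_at i w) u :: 'k) : ext_rel a d"
proof -
 let ?us = "map (unit_vec d) w :: 'k vec list"
 let ?x = "unit_vec d (w ! i) :: 'k vec" and ?y = "unit_vec d (w ! Suc i) :: 'k vec"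
 let ?P = "%x y. pure_tensor d (?us[i := x, Suc i := y])"
 have lw: "length w = a" by (rule words_length[OF w])
 have c: "set (?us[i := x, Suc i := y]) <= carrier_vec d" if "x : carrier_vec d" "y : carrier_vec d" for x y
  using that set_update_subset_insert[of "?us[i := x]" "Suc i" y] set_update_subset_insert[of ?us i x] by fastforce
 have nd: "~ distinct (?us[i := z, Suc i := z])" for z
 proof -
  have "?us[i := z, Suc i := z] ! i = ?us[i := z, Suc i := z] ! Suc i" using i lw by simp
  thus ?thesis using i lw nth_eq_iff_index_eq[of "?us[i := z, Suc i := z]" i "Suc i"] by auto
 qed
 have r: "?P z z : ext_rel a d" if "z : carrier_vec d" for z by (rule ext_rel_pure) (use lw c nd that in auto)
 have sw: "swap_at i w : words a d" using mset_eq_setD[OF mset_swap_at[of i w]] w i lw by (simp add: words_def)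
 have P1: "?P ?x ?y = basis_tensor w" unfolding basis_tensor_pure[OF w] using i lw
  by (intro arg_cong[where f = "pure_tensor d"] nth_equalityI) (auto simp: nth_list_update)
 have P2: "?P ?y ?x = basis_tensor (swap_at i w)" unfolding basis_tensor_pure[OF sw] using i lw
  by (intro arg_cong[where f = "pure_tensor d"] nth_equalityI) (auto simp: nth_list_update nth_swap_at)
 have add2: "?P z (?x + ?y) = (%u. ?P z ?x u + ?P z ?y u)" for z by (rule pure_tensor_add) (use i lw in auto)
 have add1: "?P (?x + ?y) z = (%u. ?P ?x z u + ?P ?y z u)" for z
  unfolding list_update_swap[OF n_not_Suc_n[of i]] by (rule pure_tensor_add) (use i lw in auto)
 have "(%u. basis_tensor w u + basis_tensor (swap_at i w) u :: 'k) = (%u. ?P (?x + ?y) (?x + ?y) u + (- 1) * (?P ?x ?x u + ?P ?y ?y u))"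
  unfolding add1 add2 P1 P2 by (auto simp: algebra_simps)
 also have "... : ext_rel a d" by (intro ext_rel_closed r) auto
 finally show ?thesis .
qed

text \<open>Modulo relations, basis tensors are sorted by adjacent swaps up to sign, and a word with
  a repeated letter is itself a relation. The tensors that have a normal form are closed under
  linear combinations.\<close>

lemma exterior_normal_form: assumes x: "x : carrier (tpow_vs a d :: ('k, _) module)"
 obtains x' where "!!w. x' w ~= 0 ==> w : increasing a d" "(%w. x w + (- 1) * x' w) : ext_rel a d"
proof -
 define Q where "Q x x' \<longleftrightarrow> (ALL w. x' w ~= 0 --> w : increasing a d) & (%w. x w + (- 1) * x' w) : ext_rel a d"
  for x x' :: "nat list => 'k"
 define N where "N = {x. EX x'. Q x x'}"
 have QD: "ALL w. x' w ~= 0 --> w : increasing a d" "(%w. x w + (- 1) * x' w) : ext_rel a d" if "Q x x'" for x x'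
  using that unfolding Q_def by (erule_tac conjunct1, erule_tac conjunct2)
 have NI: "x : N" if "Q x x'" for x x' using that by (auto simp: N_def)
 have ext: "x : N" if "x : ext_rel a d" for x by (rule NI[of _ "%w. 0"]) (use that in \<open>simp add: Q_def\<close>)
 have add: "(%w. x w + y w) : N" if "x : N" "y : N" for x y
 proof -
  obtain x' y' where "Q x x'" "Q y y'" using \<open>x : N\<close> \<open>y : N\<close> unfolding N_def by blast
  note x' = QD[OF \<open>Q x x'\<close>] and y' = QD[OF \<open>Q y y'\<close>]
  have "ALL w. x' w + y' w ~= 0 --> w : increasing a d" using x'(1) y'(1) add.right_neutral by metis
  moreover have "(%w. x w + y w + (- 1) * (x' w + y' w)) = (%w. (x w + (- 1) * x' w) + (y w + (- 1) * y' w))"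
   by (auto simp: algebra_simps)
  ultimately have "Q (%w. x w + y w) (%w. x' w + y' w)"
   using ext_rel_closed(2)[OF x'(2) y'(2)] unfolding Q_def by (intro conjI) simp_all
  thus ?thesis by (rule NI)
 qed
 have scale: "(%w. c * x w) : N" if "x : N" for x c
 proof -
  obtain x' where "Q x x'" using \<open>x : N\<close> unfolding N_def by blast
  note x' = QD[OF \<open>Q x x'\<close>]
  have "ALL w. c * x' w ~= 0 --> w : increasing a d" using x'(1) by auto
  moreover have "(%w. c * x w + (- 1) * (c * x' w)) = (%w. c * (x w + (- 1) * x' w))" by (auto simp: algebra_simps)
  ultimately have "Q (%w. c * x w) (%w. c * x' w)" using ext_rel_closed(3)[OF x'(2), of c] unfolding Q_def by (intro conjI) simp_all
  thus ?thesis by (rule NI)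
 qed
 have sum: "(%u. SUM w:A. x w * basis_tensor w u) : N" if "finite A" "!!w. w : A ==> basis_tensor w : N" for A
  using that
 proof (induction A)
  case empty
  thus ?case using ext[OF ext_rel_closed(1)] by simp
 next
  case (insert w A)
  thus ?case using add[OF scale[of "basis_tensor w" "x w"], of "%u. SUM w:A. x w * basis_tensor w u"] by simp
 qed
 have basis: "basis_tensor w : N" if w: "w : words a d" for w
 proof -
  have "w : words a d & basis_tensor w : N \<longleftrightarrow> sort w : words a d & basis_tensor (sort w) : N"
  proof (rule adjacent_swap_invariant)
   fix u :: "nat list" and i assume i: "Suc i < length u"
   have uw: "swap_at i u : words a d \<longleftrightarrow> u : words a d"
    using mset_eq_setD[OF mset_swap_at[OF i]] by (simp add: words_def)
   have "basis_tensor (swap_at j v) : N" if "basis_tensor v : N" "v : words a d" "Suc j < a" for v j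
    using add[OF ext[OF basis_tensor_swap[OF that(2,3)]] scale[OF that(1), of "- 1"]] by (simp add: algebra_simps)
   from this[of u i] this[of "swap_at i u" i] show "swap_at i u : words a d & basis_tensor (swap_at i u) : N \<longleftrightarrow> u : words a d & basis_tensor u : N"
    using i uw words_length[of u a d] by auto
  qed simp
  moreover have "sort w : words a d" using w by (simp add: words_def)
  moreover have "basis_tensor (sort w) : N"
  proof (cases "distinct w")
   case True
   hence "sort w : increasing a d" using \<open>sort w : words a d\<close> by (simp add: increasing_def)
   thus ?thesis using ext_rel_closed(1) by (intro NI[of _ "basis_tensor (sort w)"]) (auto simp: basis_tensor_def Q_def)
  next
   case False
   hence "(basis_tensor (sort w) :: nat list => 'k) : ext_rel a d"
    unfolding basis_tensor_pure[OF \<open>sort w : words a d\<close>] using w by (intro ext_rel_pure) (auto simp: words_length distinct_map)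
   thus ?thesis by (rule ext)
  qed
  ultimately show ?thesis using w by simp
 qed
 have "x = (%u. SUM w:words a d. x w * basis_tensor w u)"
 proof
  fix u
  have "(SUM w:words a d. x w * basis_tensor w u) = (SUM w:words a d. if w = u then x w else 0)" by (rule sum.cong) (auto simp: basis_tensor_def)
  also have "... = x u" using x by (auto simp: sum.delta)
  finally show "x u = (SUM w:words a d. x w * basis_tensor w u)" ..
 qed
 hence "x : N" using sum[of "words a d"] basis by simp
 then obtain x' where "Q x x'" unfolding N_def by blast
 thus ?thesis using that[of x'] QD[of x x'] by blast
qed

end

lemma alt_sym_increasing_eqI: assumes two: "(2 :: 'k::field) ~= 0"
  and x: "x : carrier (fobj (AltSym a b) d)" and y: "y : carrier (fobj (AltSym a b) d)"
  and eq: "!!u v. u : increasing a d ==> v : words b d ==> x (u @ v) = (y (u @ v) :: 'k)" shows "x = y"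
proof
 fix w
 show "x w = y w"
 proof (cases "length w = a + b")
  case True
  have "x w + (- 1) * y w = 0"
  proof (rule alt_sym_eq_zeroI[OF _ two _ True])
   show "alt_sym a (a + b) (%w. x w + (- 1) * y w)" using x y by (intro alt_sym_add alt_sym_scale) simp_all
   fix u v :: "nat list" assume uv: "length u = a" "length v = b" "sorted u" "distinct u"
   show "x (u @ v) + (- 1) * y (u @ v) = 0"
   proof (cases "u @ v : words (a + b) d")
    case True
    thus ?thesis using uv eq[of u v] by (simp add: words_def increasing_def)
   next
    case False
    hence "x (u @ v) = 0" "y (u @ v) = 0" using x y by auto
    thus ?thesis by simp
   qed
  qed
  thus ?thesis by simp
 next
  case False
  hence "w ~: words (a + b) d" by (auto simp: words_length)
  hence "x w = 0" "y w = 0" using x y by auto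
  thus ?thesis by simp
 qed
qed

lemma exterior_power_simps: "fobj (exterior_power a) d = quot_vs (tpow_vs a d) (ext_rel a d)"
 "fmor (exterior_power a) A = quot_map (tpow_vs a (dim_row A)) (ext_rel a (dim_row A)) (tpow_map a A)" by (simp_all add: exterior_power_def)

definition ext_coord :: "nat => (nat list => 'k::field) set => nat list => 'k" where
 "ext_coord a = descend (skew a)"

context fixes a :: nat and ty :: "'k::field itself" assumes two: "(2 :: 'k) ~= 0"
begin

lemma antisym_hom: "skew a : lin (tpow_vs a d :: ('k, _) module) (fobj (AltSym a 0) d)"
 unfolding module_hom_iff
proof (intro conjI ballI allI)
 fix x :: "nat list => 'k" assume x: "x : carrier (tpow_vs a d)"
 show "skew a x : carrier (fobj (AltSym a 0) d)" by (rule antisym_carrier[OF x])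
qed (simp_all add: antisym_linear)

text \<open>The relations lie in the kernel, as their generators do. Conversely, the normal form of
  an element of the kernel is antisymmetrised to 0, but it agrees with its antisymmetrisation on
  increasing words; hence it is 0.\<close>

lemma antisym_kernel: assumes x: "x : carrier (tpow_vs a d :: ('k, _) module)"
 shows "skew a x = 0[fobj (AltSym a 0) d :: ('k, _) module] \<longleftrightarrow> x : ext_rel a d"
proof -
 let ?K = "{x \<in> carrier (tpow_vs a d :: ('k, _) module). skew a x = (%w. 0)}"
 have z: "skew a (%w. 0 :: 'k) = (%w. 0)" by (simp add: skew_def fun_eq_iff)
 have "subsp ?K (tpow_vs a d)" unfolding subspace_iff[OF tpow_vs_vs]
  by (auto simp: antisym_linear z) (metis add.right_neutral)
 moreover have "pure_tensor d vs : ?K" if vs: "length vs = a" "~ distinct vs" for vs :: "'k vec list"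
 proof -
  obtain i j where "i < a" "j < a" "i ~= j" "vs ! i = vs ! j" using vs by (auto simp: distinct_conv_nth)
  hence "skew a (pure_tensor d vs) = (%w. 0)" using antisym_pure_tensor[OF two vs(1)] by blast
  thus ?thesis using pure_tensor_words[of d vs] vs(1) by simp
 qed
 ultimately have sub: "ext_rel a d <= ?K" by (rule ext_rel_least)
 have "x : ext_rel a d" if x0: "skew a x = (%w. 0)"
 proof -
  obtain x' where x': "!!w. x' w ~= 0 ==> w : increasing a d" "(%w. x w + (- 1) * x' w) : ext_rel a d"
   using exterior_normal_form[OF x] by blast
  have "skew a (%w. x w + (- 1) * x' w) = (%w. 0)" using sub x'(2) by blast
  hence "skew a x' w = 0" for w unfolding antisym_linear x0 by (auto simp: fun_eq_iff)
  hence "x' = (%w. 0)" using antisym_increasing[of x' a d] x'(1) by (metis)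
  thus ?thesis using x'(2) by simp
 qed
 thus ?thesis using sub by auto
qed

lemma antisym_surj: "skew a ` carrier (tpow_vs a d :: ('k, _) module) = carrier (fobj (AltSym a 0) d)"
proof (intro subset_antisym subsetI)
 fix y :: "nat list => 'k" assume y: "y : carrier (fobj (AltSym a 0) d)"
 \<comment> \<open>Restricting \<open>y\<close> to increasing words gives a preimage with
   coefficient 1, which works even where the factorial of \<open>a\<close> vanishes.\<close>
 let ?x = "%w. if w : increasing a d then y w else 0"
 have x: "?x : carrier (tpow_vs a d)" by (simp add: increasing_def)
 have "skew a ?x = y"
 proof (rule alt_sym_increasing_eqI[OF two antisym_carrier[OF x] y])
  fix u v assume u: "u : increasing a d" and v: "v : words 0 d"
  have "skew a ?x u = ?x u" by (rule antisym_increasing[OF _ u]) (simp split: if_splits)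
  thus "skew a ?x (u @ v) = y (u @ v)" using u v by simp
 qed
 thus "y : skew a ` carrier (tpow_vs a d)" using x by (intro image_eqI[where x = ?x]) simp_all
qed (use antisym_carrier in blast)

lemmas ext_descend = tpow_vs_vs AltSym_vs ext_rel_subspace antisym_hom antisym_kernel

lemma exterior_vs: "vspace (fobj (exterior_power a) d :: ('k, _) module)"
 unfolding exterior_power_simps by (rule vectorspace_quot[OF tpow_vs_vs ext_rel_subspace])

lemma ext_coord_hom:
 "ext_coord a : lin (fobj (exterior_power a) d :: ('k, _) module) (fobj (AltSym a 0) d)"
 unfolding exterior_power_simps ext_coord_def by (rule descend_hom[OF ext_descend])

lemma ext_coord_bij: "bij_betw (ext_coord a) (carrier (fobj (exterior_power a) d :: ('k, _) module)) (carrier (fobj (AltSym a 0) d))"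
 unfolding exterior_power_simps ext_coord_def by (rule descend_bij[OF ext_descend antisym_surj])

lemma ext_coord_coset:
 "x : carrier (tpow_vs a d :: ('k, _) module) ==> ext_coord a (ext_rel a d +>[tpow_vs a d] x) = skew a x"
 unfolding ext_coord_def by (rule descend_coset[OF ext_descend])

lemma tpow_map_hom: fixes A :: "'k mat" assumes A: "A : carrier_mat d' d"
 shows "tpow_map a A : lin (tpow_vs a d) (tpow_vs a d')"
 unfolding module_hom_iff using A tpow_map_words[of a A] by (auto simp: tpow_map_linear)

lemma ext_coord_natural: fixes A :: "'k mat" assumes A: "A : carrier_mat d' d" and X: "X : carrier (fobj (exterior_power a) d)"
 shows "fmor (exterior_power a) A X : carrier (fobj (exterior_power a) d')"
  "ext_coord a (fmor (exterior_power a) A X) = tpow_map a A (ext_coord a X)"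
proof -
 obtain x where x: "x : carrier (tpow_vs a d)" "X = ext_rel a d +>[tpow_vs a d] x"
  using X unfolding exterior_power_simps by (rule quot_cosetE[OF tpow_vs_vs ext_rel_subspace])
 have h: "tpow_map a A h : ext_rel a d'" if h: "h : ext_rel a d" for h
 proof -
  have hc: "h : carrier (tpow_vs a d)" by (rule quot_subspaceD(5)[OF tpow_vs_vs ext_rel_subspace h])
  hence "skew a h = (%w. 0)" using h antisym_kernel by simp
  hence "skew a (tpow_map a A h) = (%w. 0)" unfolding antisym_natural[OF A] by (simp add: tpow_map_def fun_eq_iff)
  thus ?thesis using antisym_kernel[OF hom_closed[OF tpow_map_hom[OF A] hc]] by simp
 qed
 have eq: "fmor (exterior_power a) A X = ext_rel a d' +>[tpow_vs a d'] tpow_map a A x"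
  using A quot_map_coset[OF tpow_vs_vs ext_rel_subspace tpow_vs_vs ext_rel_subspace tpow_map_hom[OF A] h x(1)]
  unfolding exterior_power_simps x(2) by auto
 note tx = hom_closed[OF tpow_map_hom[OF A] x(1)]
 show "fmor (exterior_power a) A X : carrier (fobj (exterior_power a) d')"
  unfolding eq unfolding exterior_power_simps by (rule coset_in_quot[OF tpow_vs_vs ext_rel_subspace tx])
 show "ext_coord a (fmor (exterior_power a) A X) = tpow_map a A (ext_coord a X)"
  unfolding eq unfolding x(2) ext_coord_coset[OF tx] ext_coord_coset[OF x(1)] by (rule antisym_natural[OF A])
qed

end

subsection \<open>Tensor products\<close>

lemma lookup_map_times: "lookup (Poly_Mapping.map ((*) c) t) k = c * (lookup t k :: 'k::field)"
 by (simp add: Poly_Mapping.map.rep_eq when_def)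

lemma free_vs_simps [simp]: "carrier (free_vs S :: ('k::field, _) module) = {t. keys t <= S}"
 "0[free_vs S :: ('k, _) module] = 0"
 "x +[free_vs S :: ('k, _) module] y = x + y"
 "c *[free_vs S :: ('k, _) module] x = Poly_Mapping.map ((*) c) x" by (simp_all add: free_vs_def)

lemma keys_map_times: "keys (Poly_Mapping.map ((*) c) t) <= keys (t :: 'a \<Rightarrow>\<^sub>0 'k::field)"
 by (auto simp: in_keys_iff lookup_map_times)

lemma free_vs_vs: "vspace (free_vs S :: ('k::field, _) module)"
proof (rule vectorspace_classI)
 show "x +[free_vs S] y : carrier (free_vs S :: ('k, _) module)" if "x : carrier (free_vs S)" "y : carrier (free_vs S)" for x y
  using that Poly_Mapping.keys_add[of x y] by auto
 show "c *[free_vs S] x : carrier (free_vs S :: ('k, _) module)" if "x : carrier (free_vs S)" for c x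
  using that keys_map_times[of c x] by auto
qed (auto simp: poly_mapping_eq_iff fun_eq_iff lookup_add lookup_map_times algebra_simps)

lemma pm_eval_add: "pm_eval \<Phi> (s + t) = pm_eval \<Phi> s + pm_eval \<Phi> t"
 unfolding pm_eval_def by (rule setsum_keys_plus_distrib) (simp_all add: algebra_simps)

lemma pm_eval_diff: "pm_eval \<Phi> (s - t) = pm_eval \<Phi> s - pm_eval \<Phi> t" using pm_eval_add[of \<Phi> "s - t" t] by simp

lemma pm_eval_map: "pm_eval \<Phi> (Poly_Mapping.map ((*) c) t) = c * pm_eval \<Phi> (t :: 'a \<Rightarrow>\<^sub>0 'k::field)"
proof -
 have "pm_eval \<Phi> (Poly_Mapping.map ((*) c) t) = (SUM k:keys t. c * lookup t k * \<Phi> k)"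
  unfolding pm_eval_def by (rule sum.mono_neutral_cong_left) (auto simp: in_keys_iff lookup_map_times)
 thus ?thesis by (simp add: pm_eval_def sum_distrib_left mult.assoc)
qed

lemma map_times_single: "Poly_Mapping.map ((*) c) (single k x) = single k (c * x :: 'k::field)"
 by (simp add: poly_mapping_eq_iff fun_eq_iff lookup_map_times lookup_single when_def)

context fixes V :: "('k::field, 'v) module" and W :: "('k, 'w) module" assumes V: "vspace V" and W: "vspace W"
begin

lemma tensor_rel_subspace: "subsp (tensor_rel V W) (free_vs (carrier V \<times> carrier W))" and tensor_rel_gens:
  "x : carrier V ==> x' : carrier V ==> y : carrier W ==>
   single (x +[V] x', y) 1 - single (x, y) 1 - single (x', y) 1 : tensor_rel V W"
  "x : carrier V ==> y : carrier W ==> y' : carrier W ==>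
   single (x, y +[W] y') 1 - single (x, y) 1 - single (x, y') 1 : tensor_rel V W"
  "x : carrier V ==> y : carrier W ==>
   single (c *[V] x, y) 1 - single (x, y) c : tensor_rel V W"
  "x : carrier V ==> y : carrier W ==>
   single (x, c *[W] y) 1 - single (x, y) c : tensor_rel V W" and tensor_rel_pm_eval:
  "(!!x x' y. x : carrier V ==> x' : carrier V ==> y : carrier W ==> \<Phi> (x +[V] x', y) = \<Phi> (x, y) + \<Phi> (x', y)) ==>
   (!!x y y'. x : carrier V ==> y : carrier W ==> y' : carrier W ==> \<Phi> (x, y +[W] y') = \<Phi> (x, y) + \<Phi> (x, y')) ==>
   (!!c x y. x : carrier V ==> y : carrier W ==> \<Phi> (c *[V] x, y) = c * \<Phi> (x, y)) ==>
   (!!c x y. x : carrier V ==> y : carrier W ==> \<Phi> (x, c *[W] y) = c * \<Phi> (x, y)) ==>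
   t : tensor_rel V W ==> pm_eval \<Phi> t = 0"
proof -
 let ?F = "free_vs (carrier V \<times> carrier W) :: ('k, 'v \<times> 'w \<Rightarrow>\<^sub>0 'k) module"
 let ?S = "{single (x +[V] x', y) 1 - single (x, y) 1
     - single (x', y) (1 :: 'k) | x x' y. x : carrier V & x' : carrier V & y : carrier W}
  \<union> {single (x, y +[W] y') 1 - single (x, y) 1 - single (x, y') 1 | x y y'.
     x : carrier V & y : carrier W & y' : carrier W}
  \<union> {single (c *[V] x, y) 1 - single (x, y) c | c x y.
     x : carrier V & y : carrier W}
  \<union> {single (x, c *[W] y) 1 - single (x, y) c | c x y.
     x : carrier V & y : carrier W}"
 have diff: "s - t : carrier ?F" if "s : carrier ?F" "t : carrier ?F" for s t using that keys_diff[of s t] by auto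
 have single: "single (x, y) c : carrier ?F" if "x : carrier V" "y : carrier W" for x y c using that by simp
 have S: "?S <= carrier ?F"
  by (intro Un_least subsetI; clarify; intro diff single vs_add[OF V] vs_add[OF W] vs_smult[OF V] vs_smult[OF W]; assumption)
 note sp = span_subspace[OF free_vs_vs S]
 have R: "tensor_rel V W = lspan ?F ?S" by (simp only: tensor_rel_def)
 show "subsp (tensor_rel V W) ?F" unfolding R by (rule sp)
 show "x : carrier V ==> x' : carrier V ==> y : carrier W ==>
   single (x +[V] x', y) 1 - single (x, y) 1 - single (x', y) 1 : tensor_rel V W"
  unfolding R by (rule subsetD[OF sp(2)]) blast
 show "x : carrier V ==> y : carrier W ==> y' : carrier W ==>
   single (x, y +[W] y') 1 - single (x, y) 1 - single (x, y') 1 : tensor_rel V W"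
  unfolding R by (rule subsetD[OF sp(2)]) blast
 show "x : carrier V ==> y : carrier W ==>
   single (c *[V] x, y) 1 - single (x, y) c : tensor_rel V W"
  unfolding R by (rule subsetD[OF sp(2)]) blast
 show "x : carrier V ==> y : carrier W ==>
   single (x, c *[W] y) 1 - single (x, y) c : tensor_rel V W"
  unfolding R by (rule subsetD[OF sp(2)]) blast
 assume bil: "!!x x' y. x : carrier V ==> x' : carrier V ==> y : carrier W ==> \<Phi> (x +[V] x', y) = \<Phi> (x, y) + \<Phi> (x', y)"
   "!!x y y'. x : carrier V ==> y : carrier W ==> y' : carrier W ==> \<Phi> (x, y +[W] y') = \<Phi> (x, y) + \<Phi> (x, y')"
   "!!c x y. x : carrier V ==> y : carrier W ==> \<Phi> (c *[V] x, y) = c * \<Phi> (x, y)"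
   "!!c x y. x : carrier V ==> y : carrier W ==> \<Phi> (x, c *[W] y) = c * \<Phi> (x, y)"
  and t: "t : tensor_rel V W"
 \<comment> \<open>The bilinear form kills the generating relations, and its kernel is a subspace;
   so it kills their span.\<close>
 let ?K = "{t \<in> carrier ?F. pm_eval \<Phi> t = 0}"
 have "subsp ?K ?F" unfolding subspace_iff[OF free_vs_vs]
 proof (intro conjI ballI allI)
  show "0[?F] : ?K" by (simp add: pm_eval_def)
  show "s +[?F] t : ?K" if "s : ?K" "t : ?K" for s t
   using that vs_add[OF free_vs_vs, of s "carrier V \<times> carrier W" t] by (simp add: pm_eval_add)
  show "c *[?F] t : ?K" if "t : ?K" for c t
   using that vs_smult[OF free_vs_vs, of t "carrier V \<times> carrier W" c] by (simp add: pm_eval_map)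
 qed auto
 moreover have "?S <= ?K"
 proof
  fix s assume s: "s : ?S"
  hence "pm_eval \<Phi> s = 0" by (elim UnE CollectE exE conjE) (simp_all add: pm_eval_diff pm_eval_single bil)
  thus "s : ?K" by (intro CollectI conjI subsetD[OF S s])
 qed
 ultimately have "lspan ?F ?S <= ?K" by (rule sp(3))
 thus "pm_eval \<Phi> t = 0" using t unfolding R by (auto dest: subsetD)
qed

lemma tensor_rel_closed: "0 : tensor_rel V W"
 "s : tensor_rel V W ==> t : tensor_rel V W ==> s + t : tensor_rel V W"
 "t : tensor_rel V W ==> Poly_Mapping.map ((*) c) t : tensor_rel V W"
 "t : tensor_rel V W ==> keys t <= carrier V \<times> carrier W"
 using quot_subspaceD(2-5)[OF free_vs_vs tensor_rel_subspace] by simp_all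

lemma tensor_rel_zero: "y : carrier W ==> single (0[V], y) 1 : tensor_rel V W"
 "x : carrier V ==> single (x, 0[W]) 1 : tensor_rel V W"
 using tensor_rel_gens(3)[OF vs_zero[OF V], of y 0] tensor_rel_gens(4)[OF _ vs_zero[OF W], of x 0]
 by (simp_all add: vs_zero_smult[OF V vs_zero[OF V]] vs_zero_smult[OF W vs_zero[OF W]])

end

lemma sum_words_append: "(SUM w:words (a + b) d. f w) = (SUM u:words a d. SUM v:words b d. f (u @ v))"
proof (induction a arbitrary: f)
 case (Suc a)
 show ?case using Suc[of "%w. f (_ # w)"] by (simp add: sum_words_Suc Suc)
qed simp

lemma prod_add_lessThan: fixes f :: "nat => 'b::comm_monoid_mult"
 shows "(\<Prod>i<a + b. f i) = (\<Prod>i<a. f i) * (\<Prod>i<b. f (a + i))" by (induction b) (simp_all add: mult_ac)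

definition tensor_coord :: "nat => (nat list => 'k::field) set \<times> (nat list => 'k) => nat list => 'k" where
 "tensor_coord a = (%(X, y) w. ext_coord a X (take a w) * y (drop a w))"

definition tensor_eval :: "nat => ((nat list => 'k::field) set \<times> (nat list => 'k) \<Rightarrow>\<^sub>0 'k) => nat list => 'k" where
 "tensor_eval a t w = pm_eval (%k. tensor_coord a k w) t"

abbreviation "ExtDiv a b == tensor_functor (exterior_power a) (divided_power b)"

definition ext_basis :: "nat => nat => nat list => (nat list => 'k::field) set" where
 "ext_basis a d u = ext_rel a d +>[tpow_vs a d] basis_tensor u"

context fixes a b :: nat and ty :: "'k::field itself" assumes two: "(2 :: 'k) ~= 0"
begin

abbreviation (input) E where "E d == fobj (exterior_power a) d :: ('k, (nat list => 'k) set) module"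
abbreviation (input) D where "D d == fobj (divided_power b) d :: ('k, nat list => 'k) module"
abbreviation (input) FV where "FV d == free_vs (carrier (E d) \<times> carrier (D d)) :: ('k, _ \<Rightarrow>\<^sub>0 'k) module"
abbreviation (input) TR where "TR d == tensor_rel (E d) (D d)"

lemma ext_coordD: assumes "X : carrier (E d)" shows "ext_coord a X w ~= 0 ==> w : words a d" "alt_sym a a (ext_coord a X)"
 using hom_closed[OF ext_coord_hom[OF two] assms] by auto

lemma tensor_coord_carrier: assumes X: "X : carrier (E d)" and y: "y : carrier (D d)"
 shows "tensor_coord a (X, y) : carrier (fobj (AltSym a b) d)"
proof -
 have "w : words (a + b) d" if "tensor_coord a (X, y) w ~= 0" for w
 proof -
  have "take a w : words a d" "drop a w : words b d" using that ext_coordD(1)[OF X] dpowD(1)[OF y] by (auto simp: tensor_coord_def)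
  thus ?thesis using set_append[of "take a w" "drop a w"] length_append[of "take a w" "drop a w"] by (simp add: words_def)
 qed
 moreover have "alt_sym a (a + b) (tensor_coord a (X, y))" unfolding alt_sym_def
 proof (intro allI impI conjI; elim conjE)
  fix w :: "nat list" and i
  assume w: "length w = a + b"
  have lt: "length (take a w) = a" using w by simp
  show "tensor_coord a (X, y) (swap_at i w) = - tensor_coord a (X, y) w" if i: "Suc i < a" "Suc i < a + b"
  proof -
   have "swap_at i w = swap_at i (take a w) @ drop a w" using swap_at_append(1)[of i "take a w" "drop a w"] i w by simp
   thus ?thesis using alt_symD(1)[OF ext_coordD(2)[OF X] lt i(1) i(1)] w by (simp add: tensor_coord_def)
  qed
  show "tensor_coord a (X, y) (swap_at i w) = tensor_coord a (X, y) w" if i: "a <= i" "Suc i < a + b"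
  proof -
   have "swap_at i w = take a w @ swap_at (i - a) (drop a w)" using swap_at_append(2)[of "take a w" "i - a" "drop a w"] i w by simp
   moreover have "y (swap_at (i - a) (drop a w)) = y (drop a w)" by (rule dpowD(2)[OF y]) (use i w in simp)
   ultimately show ?thesis using w by (simp add: tensor_coord_def)
  qed
 qed
 ultimately show ?thesis by simp
qed

lemma tensor_coord_bilinear:
 "X : carrier (E d) ==> X' : carrier (E d) ==> tensor_coord a (X +[E d] X', y) w = tensor_coord a (X, y) w + tensor_coord a (X', y) w"
 "tensor_coord a (X, y +[D d] y') w = tensor_coord a (X, y) w + tensor_coord a (X, y') w"
 "X : carrier (E d) ==> tensor_coord a (c *[E d] X, y) w = c * tensor_coord a (X, y) w"
 "tensor_coord a (X, c *[D d] y) w = c * tensor_coord a (X, y) w"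
 by (simp_all add: tensor_coord_def hom_add[OF ext_coord_hom[OF two]] hom_smult[OF ext_coord_hom[OF two]] algebra_simps)

lemma tensor_eval_add: "tensor_eval a (s + t) = (%w. tensor_eval a s w + tensor_eval a t w)"
 and tensor_eval_diff: "tensor_eval a (s - t) = (%w. tensor_eval a s w - tensor_eval a t w)"
 and tensor_eval_map: "tensor_eval a (Poly_Mapping.map ((*) c) t) = (%w. c * (tensor_eval a t w :: 'k))"
 and tensor_eval_single: "tensor_eval a (single k c) = (%w. c * tensor_coord a k w)"
 and tensor_eval_sum: "tensor_eval a (SUM i:I. f i) = (%w. SUM i:I. tensor_eval a (f i) w)"
 by (auto simp: tensor_eval_def pm_eval_add pm_eval_diff pm_eval_map pm_eval_single pm_eval_sum)

lemma tensor_eval_hom: "tensor_eval a : lin (FV d) (fobj (AltSym a b) d)" unfolding module_hom_iff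
proof (intro conjI ballI allI)
 fix t assume "t : carrier (FV d)"
 hence t: "keys t <= carrier (E d) \<times> carrier (D d)" by simp
 note S = AltSym_vs[of a b d, where 'k = 'k]
 have "(%w. SUM k:K. lookup t k * tensor_coord a k w) : carrier (fobj (AltSym a b) d)"
  if "finite K" "K <= carrier (E d) \<times> carrier (D d)" for K using that
 proof (induction K)
  case empty
  thus ?case using vs_zero[OF S] by simp
 next
  case (insert k K)
  hence "tensor_coord a k : carrier (fobj (AltSym a b) d)" using tensor_coord_carrier by (cases k) blast
  thus ?case using insert vs_add[OF S vs_smult[OF S]] by (simp del: AltSym_simps(1))
 qed
 from this[OF finite_keys t] show "tensor_eval a t : carrier (fobj (AltSym a b) d)" unfolding tensor_eval_def[abs_def] pm_eval_def .
qed (simp_all add: tensor_eval_add tensor_eval_map)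

lemma ext_basis: assumes u: "u : increasing a d" shows "ext_basis a d u : carrier (E d)"
  "v : increasing a d ==> ext_coord a (ext_basis a d u) v = (if v = u then 1 else (0 :: 'k))"
proof -
 have w: "u : words a d" using u by (simp add: increasing_def)
 hence c: "basis_tensor u : carrier (tpow_vs a d :: ('k, _) module)" by (auto simp: basis_tensor_def)
 thus "ext_basis a d u : carrier (E d)" unfolding ext_basis_def exterior_power_simps by (rule coset_in_quot[OF tpow_vs_vs ext_rel_subspace])
 show "ext_coord a (ext_basis a d u) v = (if v = u then 1 else (0 :: 'k))" if "v : increasing a d"
 proof -
  have "w : increasing a d" if "basis_tensor u w ~= (0 :: 'k)" for w using that u by (simp add: basis_tensor_def split: if_splits)
  hence "skew a (basis_tensor u) v = (basis_tensor u v :: 'k)" using that by (rule antisym_increasing)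
  thus ?thesis by (simp add: ext_basis_def ext_coord_coset[OF two c] basis_tensor_def)
 qed
qed

abbreviation (input) basis_sum where
 "basis_sum d y == (SUM u:increasing a d. single (ext_basis a d u, y u) (1 :: 'k))"

lemma tensor_eval_basis_sum: assumes "u : increasing a d" shows "tensor_eval a (basis_sum d y) (u @ v) = y u v"
proof -
 have l: "length u = a" using assms by (auto simp: increasing_def words_def)
 have "tensor_eval a (basis_sum d y) (u @ v) = (SUM u':increasing a d. if u = u' then y u' v else 0)"
  unfolding tensor_eval_sum tensor_eval_single using l assms by (intro sum.cong) (auto simp: tensor_coord_def ext_basis(2))
 thus ?thesis using assms by (simp add: sum.delta)
qed

lemmas TR_facts = exterior_vs[OF two, of a] dpow_vs[of b, where 'k = 'k]
lemmas TR_subspace = tensor_rel_subspace[OF TR_facts]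
lemmas TR_gens = tensor_rel_gens[OF TR_facts]
lemmas TR_closed = tensor_rel_closed[OF TR_facts]
lemmas TR_zero = tensor_rel_zero[OF TR_facts]

lemma TR_sum: "finite I ==> (!!i. i : I ==> f i : TR d) ==> (SUM i:I. f i) : TR d"
 by (induction I rule: finite_induct) (simp_all add: TR_closed)

lemma TR_diff: "s : TR d ==> t : TR d ==> s - t : TR d"
proof -
 assume st: "s : TR d" "t : TR d"
 have "s - t = s + Poly_Mapping.map ((*) (- 1)) t" by (simp add: poly_mapping_eq_iff fun_eq_iff lookup_add lookup_minus lookup_map_times)
 thus ?thesis using TR_closed(2)[OF st(1) TR_closed(3)[OF st(2), of "- 1"]] by (simp only:)
qed

text \<open>One term for each increasing word: the classes \<open>ext_basis\<close> span the
  exterior power, and the coefficients \<open>y u\<close> can be recovered by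
  \<open>tensor_eval_basis_sum\<close>. This replaces a basis of the tensor product.\<close>

definition normal_form :: "nat => ((nat list => 'k) set \<times> (nat list => 'k) \<Rightarrow>\<^sub>0 'k) => (nat list => nat list => 'k) => bool" where
 "normal_form d t y \<longleftrightarrow> (ALL u:increasing a d. y u : carrier (D d)) & t - basis_sum d y : TR d"

lemma normal_formD: assumes "normal_form d t y" shows "ALL u:increasing a d. y u : carrier (D d)" "t - basis_sum d y : TR d"
 using assms unfolding normal_form_def by (erule_tac conjunct1, erule_tac conjunct2)

definition normalizable :: "nat => ((nat list => 'k) set \<times> (nat list => 'k) \<Rightarrow>\<^sub>0 'k) => bool" where
 "normalizable d t \<longleftrightarrow> (EX y. normal_form d t y)"

lemma normalizableI: "ALL u:increasing a d. y u : carrier (D d) ==> t - basis_sum d y : TR d ==> normalizable d t"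
 unfolding normalizable_def by (rule exI[of _ y]) (simp only: normal_form_def simp_thms)

lemma normalizable_add: assumes "normalizable d s" "normalizable d t" shows "normalizable d (s + t)"
proof -
 obtain y z where "normal_form d s y" "normal_form d t z" using assms unfolding normalizable_def by blast
 note y = normal_formD[OF this(1)] and z = normal_formD[OF this(2)]
 let ?x = "%u. y u +[D d] z u"
 have "(SUM u:increasing a d. single (ext_basis a d u, ?x u) 1 - single (ext_basis a d u, y u) 1
   - single (ext_basis a d u, z u) 1) : TR d"
  by (rule TR_sum) (use y z ext_basis(1) TR_gens(2) in \<open>simp_all del: dpow_simps\<close>)
 note * = this
 have eq: "s + t - basis_sum d ?x = (s - basis_sum d y) + (t - basis_sum d z) -
  (SUM u:increasing a d. single (ext_basis a d u, ?x u) 1 - single (ext_basis a d u, y u) 1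
   - single (ext_basis a d u, z u) 1)" by (simp add: sum_subtractf del: dpow_simps)
 have "s + t - basis_sum d ?x : TR d" unfolding eq by (rule TR_diff[OF TR_closed(2)[OF y(2) z(2)] *])
 moreover have "ALL u:increasing a d. ?x u : carrier (D d)" using y(1) z(1) vs_add[OF dpow_vs] by blast
 ultimately show ?thesis by (rule normalizableI[rotated])
qed

lemma map_times_diff: "Poly_Mapping.map ((*) c) (s - t) = Poly_Mapping.map ((*) c) s - Poly_Mapping.map ((*) c) (t :: 'b \<Rightarrow>\<^sub>0 'k)"
 by (simp add: poly_mapping_eq_iff fun_eq_iff lookup_minus lookup_map_times algebra_simps)

lemma map_times_sum: "Poly_Mapping.map ((*) c) (SUM i:I. f i) = (SUM i:I. Poly_Mapping.map ((*) c) (f i :: 'b \<Rightarrow>\<^sub>0 'k))"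
 by (simp add: poly_mapping_eq_iff fun_eq_iff lookup_sum lookup_map_times sum_distrib_left)

lemma normalizable_scale: assumes "normalizable d t" shows "normalizable d (Poly_Mapping.map ((*) c) t)"
proof -
 obtain y where "normal_form d t y" using assms unfolding normalizable_def by blast
 note y = normal_formD[OF this]
 let ?x = "%u. c *[D d] y u"
 have "(SUM u:increasing a d. single (ext_basis a d u, ?x u) 1 - single (ext_basis a d u, y u) c) : TR d"
  by (rule TR_sum) (use y ext_basis(1) TR_gens(4) in \<open>simp_all del: dpow_simps\<close>)
 note * = this
 have eq: "Poly_Mapping.map ((*) c) t - basis_sum d ?x = Poly_Mapping.map ((*) c) (t - basis_sum d y) -
  (SUM u:increasing a d. single (ext_basis a d u, ?x u) 1 - single (ext_basis a d u, y u) c)"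
  by (simp add: sum_subtractf map_times_diff map_times_sum map_times_single del: dpow_simps)
 have "Poly_Mapping.map ((*) c) t - basis_sum d ?x : TR d" unfolding eq by (rule TR_diff[OF TR_closed(3)[OF y(2)] *])
 moreover have "ALL u:increasing a d. ?x u : carrier (D d)" using y(1) vs_smult[OF dpow_vs] by blast
 ultimately show ?thesis by (rule normalizableI[rotated])
qed

lemma normalizable_TR: assumes "t : TR d" shows "normalizable d t"
proof (rule normalizableI; (intro ballI)?)
 show "0[D d] : carrier (D d)" by (rule vs_zero[OF dpow_vs])
 show "t - basis_sum d (%u. 0[D d]) : TR d" by (intro TR_diff[OF assms] TR_sum TR_zero(2) ext_basis(1)) simp_all
qed

lemma normalizable_basis: assumes u: "u : increasing a d" and y: "y : carrier (D d)"
 shows "normalizable d (single (ext_basis a d u, y) 1)"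
proof -
 let ?x = "%v. if v = u then y else 0[D d]"
 have eq: "basis_sum d ?x = single (ext_basis a d u, y) 1 + (SUM v:increasing a d - {u}. single (ext_basis a d v, ?x v) 1)"
  by (subst sum.remove[OF finite_increasing u]) simp
 have *: "(SUM v:increasing a d - {u}. single (ext_basis a d v, ?x v) 1) : TR d"
  by (rule TR_sum) (use TR_zero(2)[OF ext_basis(1)] in \<open>simp_all del: dpow_simps\<close>)
 have "single (ext_basis a d u, y) 1 - basis_sum d ?x : TR d"
 proof -
  have "A - (A + B) = 0 - B" for A B :: "_ \<Rightarrow>\<^sub>0 'k" by simp
  thus ?thesis unfolding eq using TR_diff[OF TR_closed(1) *] by simp
 qed
 thus ?thesis using y vs_zero[OF dpow_vs, of b d, where 'k = 'k] by (intro normalizableI[of d ?x]) (simp_all del: dpow_simps)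
qed

text \<open>Induction over a finite set of increasing words outside which the coordinates of
  \<open>X\<close> vanish: one basis component is split off at a time, and at the end injectivity of
  \<open>ext_coord\<close> shows that nothing remains.\<close>

lemma normalizable_single: assumes y: "y : carrier (D d)" and X: "X : carrier (E d)" shows "normalizable d (single (X, y) 1)"
proof -
 note EV = exterior_vs[OF two, of a d]
 have "normalizable d (single (X, y) 1)"
  if "finite U" "U <= increasing a d" "X : carrier (E d)" "!!u. u : increasing a d - U ==> ext_coord a X u = 0" for U X
  using that
 proof (induction U arbitrary: X)
  case empty
  have z: "ext_coord a 0[E d] = (%w. 0)" using module_hom_zero[OF EV AltSym_vs ext_coord_hom[OF two]] by simp
  have "ext_coord a X = (%w. 0)"
  proof (rule alt_sym_increasing_eqI[OF two hom_closed[OF ext_coord_hom[OF two] empty(2)]])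
   show "(%w. 0 :: 'k) : carrier (fobj (AltSym a 0) d)" using vs_zero[OF AltSym_vs, of a 0 d, where 'k = 'k] by simp
  qed (use empty(3) in simp)
  hence "X = 0[E d]"
   using inj_onD[OF bij_betw_imp_inj_on[OF ext_coord_bij[OF two, of a d]], of X "0[E d]"] empty(2) vs_zero[OF EV] z by simp
  thus ?case using normalizable_TR[OF TR_zero(1)[OF y]] by simp
 next
  case (insert u U)
  have u: "u : increasing a d" using insert.prems by simp
  let ?e = "ext_basis a d u" and ?c = "ext_coord a X u"
  let ?X = "X +[E d] (- ?c) *[E d] ?e"
  note e = ext_basis(1)[OF u]
  have X': "?X : carrier (E d)" by (intro vs_add[OF EV] vs_smult[OF EV] e insert.prems(2))
  have "normalizable d (single (?X, y) 1)"
  proof (rule insert.IH[OF _ X'])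
   fix v assume v: "v : increasing a d - U"
   have "ext_coord a ?X v = ext_coord a X v - ?c * ext_coord a ?e v"
    using insert.prems(2) e by (simp add: hom_add[OF ext_coord_hom[OF two]] hom_smult[OF ext_coord_hom[OF two]] vs_smult[OF EV])
   thus "ext_coord a ?X v = 0" using v insert.prems(3)[of v] ext_basis(2)[OF u, of v] by auto
  qed (use insert.prems in simp)
  moreover have "normalizable d (single (?c *[E d] ?e, y) 1)"
  proof -
   have "normalizable d (single (?c *[E d] ?e, y) 1 - single (?e, y) ?c)"
    by (rule normalizable_TR[OF TR_gens(3)[OF e y]])
   moreover have "normalizable d (single (?e, y) ?c)"
    using normalizable_scale[OF normalizable_basis[OF u y], of ?c] by (simp add: map_times_single)
   ultimately show ?thesis using normalizable_add by fastforce
  qed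
  moreover have "X = ?X +[E d] ?c *[E d] ?e"
  proof -
   have "(- ?c) *[E d] ?e +[E d] ?c *[E d] ?e = 0[E d]"
    using vs_add_smult[OF EV e, of "- ?c" ?c] vs_zero_smult[OF EV e] by simp
   thus ?thesis using insert.prems(2) e by (simp add: vs_assoc[OF EV] vs_smult[OF EV] vs_zero_right[OF EV])
  qed
  moreover have "normalizable d (single (?X +[E d] ?c *[E d] ?e, y) 1 - single (?X, y) 1
   - single (?c *[E d] ?e, y) 1)" by (rule normalizable_TR[OF TR_gens(1)[OF X' vs_smult[OF EV e] y]])
  ultimately show ?case using normalizable_add by (metis diff_add_cancel)
 qed
 from this[OF finite_increasing subset_refl X] show ?thesis by simp
qed

lemma normalizable: assumes "t : carrier (FV d)" shows "normalizable d t"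
proof -
 have "normalizable d (SUM k:K. single k (lookup t k))"
  if "finite K" "K <= carrier (E d) \<times> carrier (D d)" for K using that
 proof (induction K)
  case empty
  thus ?case using normalizable_TR[OF TR_closed(1)] by simp
 next
  case (insert k K)
  obtain X y where k: "k = (X, y)" "X : carrier (E d)" "y : carrier (D d)" using insert.prems by (cases k) auto
  hence "normalizable d (single k (lookup t k))"
   using normalizable_scale[OF normalizable_single[OF k(3,2)], of "lookup t k"] by (simp add: map_times_single)
  thus ?case using insert normalizable_add by simp
 qed
 from this[of "keys t"] show ?thesis using assms by (simp add: poly_mapping_sum_single)
qed

text \<open>Coordinates are bilinear and hence kill the relations. For a normal form they return the
  coefficients \<open>y u\<close>, so if they all vanish, each term is a relation.\<close>

lemma tensor_eval_kernel: assumes t: "t : carrier (FV d)"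
 shows "tensor_eval a t = 0[fobj (AltSym a b) d :: ('k, _) module] \<longleftrightarrow> t : TR d"
proof
 have ker: "tensor_eval a s = (%w. 0)" if "s : TR d" for s unfolding tensor_eval_def
  by (rule ext, rule tensor_rel_pm_eval[OF TR_facts _ _ _ _ that]) (simp_all add: tensor_coord_bilinear del: dpow_simps)
 thus "t : TR d ==> tensor_eval a t = 0[fobj (AltSym a b) d :: ('k, _) module]" by simp
 assume "tensor_eval a t = 0[fobj (AltSym a b) d :: ('k, _) module]"
 hence z: "tensor_eval a t = (%w. 0)" by simp
 obtain y where "normal_form d t y" using normalizable[OF t] unfolding normalizable_def by blast
 note y = normal_formD[OF this]
 have "tensor_eval a (basis_sum d y) = (%w. 0)" using ker[OF y(2)] unfolding tensor_eval_diff z by (simp add: fun_eq_iff)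
 hence "y u = 0[D d]" if "u : increasing a d" for u using tensor_eval_basis_sum[OF that, of y] by (simp add: fun_eq_iff)
 hence "basis_sum d y : TR d" by (intro TR_sum) (use TR_zero(2)[OF ext_basis(1)] in \<open>simp_all del: dpow_simps\<close>)
 thus "t : TR d" using TR_closed(2)[OF y(2)] by fastforce
qed

lemma tensor_eval_surj: "tensor_eval a ` carrier (FV d) = carrier (fobj (AltSym a b) d :: ('k, _) module)"
proof (intro subset_antisym subsetI)
 fix z :: "nat list => 'k" assume z: "z : carrier (fobj (AltSym a b) d)"
 \<comment> \<open>With the increasing front part \<open>u\<close> held fixed, \<open>z\<close> is
   symmetric in the tail and so gives an element of the divided power.\<close>
 let ?y = "%u v. if length v = b then z (u @ v) else 0"
 have y: "?y u : carrier (D d)" if u: "u : increasing a d" for u unfolding dpow_iff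
 proof (intro conjI allI impI)
  have lu: "length u = a" using u by (auto simp: increasing_def words_def)
  show "v : words b d" if "?y u v ~= 0" for v
  proof -
   have "u @ v : words (a + b) d" "length v = b" using that z by (auto split: if_splits)
   thus ?thesis by (simp add: words_def)
  qed
  show "?y u v = ?y u v'" if "mset v = mset v'" for v v' using alt_sym_tail[of a "a + b" z u v v'] z lu that mset_eq_length[OF that] by auto
 qed
 let ?t = "basis_sum d ?y"
 have single: "single (ext_basis a d u, ?y u) 1 : carrier (FV d)" if "u : increasing a d" for u
  using y[OF that] ext_basis(1)[OF that] by (simp del: dpow_simps)
 have "(SUM u:U. single (ext_basis a d u, ?y u) 1) : carrier (FV d)" if "finite U" "U <= increasing a d" for U using that
 proof (induction U)
  case (insert u U)
  thus ?case using vs_add[OF free_vs_vs single] by (simp del: dpow_simps free_vs_simps(1))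
 qed simp
 hence t: "?t : carrier (FV d)" by simp
 have "tensor_eval a ?t = z" by (rule alt_sym_increasing_eqI[OF two hom_closed[OF tensor_eval_hom t] z])
   (simp add: tensor_eval_basis_sum words_length)
 thus "z : tensor_eval a ` carrier (FV d)" using t by (intro image_eqI[where x = ?t]) simp_all
qed (use hom_closed[OF tensor_eval_hom] in blast)

end

lemma ExtDiv_simps:
 "fobj (ExtDiv a b) d = quot_vs (free_vs (carrier (fobj (exterior_power a) d) \<times> carrier (fobj (divided_power b) d)))
   (tensor_rel (fobj (exterior_power a) d) (fobj (divided_power b) d))"
 "fmor (ExtDiv a b) A = quot_map
   (free_vs (carrier (fobj (exterior_power a) (dim_row A)) \<times> carrier (fobj (divided_power b) (dim_row A))))
   (tensor_rel (fobj (exterior_power a) (dim_row A)) (fobj (divided_power b) (dim_row A)))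
   (%t. SUM (x, y):keys t. single (fmor (exterior_power a) A x, tpow_map b A y) (lookup t (x, y)))"
 by (simp_all add: tensor_functor_def tensor_vs_def tensor_map_def del: dpow_simps(1))

lemma tpow_map_sum: "tpow_map b A (%w. SUM i:I. f i w) = (%w. SUM i:I. tpow_map b A (f i) w)"
 by (induction I rule: infinite_finite_induct) (simp_all add: tpow_map_linear, simp_all add: tpow_map_def fun_eq_iff)

section \<open>Comparison of the tensor functor with its model\<close>

definition push :: "('k::field, 'v) vfunctor => (nat => 'w => 'x) => (nat => 'v => 'w) => nat => 'v => 'x" where
 "push G L et = (%d. \<lambda>x\<in>carrier (fobj G d). L d (et d x))"

lemma push_nat_trans: fixes G :: "('k::field, 'v) vfunctor" and F :: "('k, 'w) vfunctor" and F' :: "('k, 'x) vfunctor"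
 assumes G: "!!d. vspace (fobj G d)"
  and GA: "!!d e A x. A : carrier_mat e d ==> x : carrier (fobj G d) ==> fmor G A x : carrier (fobj G e)"
  and L: "!!d. L d : lin (fobj F d) (fobj F' d)"
  and nat: "!!d e A z. A : carrier_mat e d ==> z : carrier (fobj F d) ==> L e (fmor F A z) = fmor F' A (L d z)"
  and et: "et : nat_trans G F" shows "push G L et : nat_trans G F'" unfolding nat_trans_iff module_hom_iff push_def
 by (auto simp: vs_add[OF G] vs_smult[OF G] GA hom_closed[OF L] hom_closed[OF nat_transD(1)[OF et]]
   hom_add[OF nat_transD(1)[OF et]] hom_smult[OF nat_transD(1)[OF et]] hom_add[OF L] hom_smult[OF L]
   nat_transD(3)[OF et] nat)

definition from_tensor :: "nat => nat => ((nat list => 'k::field) set \<times> (nat list => 'k) \<Rightarrow>\<^sub>0 'k) set => nat list => 'k" where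
 "from_tensor a d = descend (tensor_eval a)"

definition to_tensor :: "nat => nat => nat => (nat list => 'k::field) => ((nat list => 'k) set \<times> (nat list => 'k) \<Rightarrow>\<^sub>0 'k) set" where
 "to_tensor a b d = inv_into (carrier (fobj (ExtDiv a b) d)) (from_tensor a d)"

context fixes a b :: nat and ty :: "'k::field itself" assumes two: "(2 :: 'k) ~= 0"
begin

abbreviation (input) T where "T d == fobj (ExtDiv a b) d :: ('k, _) module"
abbreviation (input) S where "S d == fobj (AltSym a b) d :: ('k, _) module"

lemmas T_descend = free_vs_vs AltSym_vs TR_subspace[OF two] tensor_eval_hom[OF two] tensor_eval_kernel[OF two]

lemma T_vs: "vspace (T d)" unfolding ExtDiv_simps by (rule vectorspace_quot[OF free_vs_vs TR_subspace[OF two]])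

lemma from_tensor_hom: "from_tensor a d : lin (T d) (S d)"
 unfolding ExtDiv_simps from_tensor_def by (rule descend_hom[OF T_descend])

lemma from_tensor_bij: "bij_betw (from_tensor a d) (carrier (T d)) (carrier (S d))"
 unfolding ExtDiv_simps from_tensor_def by (rule descend_bij[OF T_descend tensor_eval_surj[OF two]])

lemma from_tensor_coset:
 "t : carrier (free_vs (carrier (fobj (exterior_power a) d) \<times> dpow b d) :: ('k, _ \<Rightarrow>\<^sub>0 'k) module) ==>
  from_tensor a d (tensor_rel (fobj (exterior_power a) d) (fobj (divided_power b) d)
   +>[free_vs (carrier (fobj (exterior_power a) d) \<times> dpow b d)] t) = tensor_eval a t"
 unfolding from_tensor_def by (rule descend_coset[OF T_descend])

text \<open>Cutting words after \<open>a\<close> positions separates both the sum over source words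
  and the product of matrix entries.\<close>

lemma tensor_coord_natural: fixes A :: "'k mat"
 assumes A: "A : carrier_mat d' d" and X: "X : carrier (fobj (exterior_power a) d)" and y: "y : dpow b d"
 shows "tensor_coord a (fmor (exterior_power a) A X, tpow_map b A y) = tpow_map (a + b) A (tensor_coord a (X, y))"
proof
 fix w
 note X' = ext_coord_natural[OF two A X]
 have y': "tpow_map b A y : dpow b d'" by (rule tpow_map_dpow[OF A y])
 show "tensor_coord a (fmor (exterior_power a) A X, tpow_map b A y) w = tpow_map (a + b) A (tensor_coord a (X, y)) w"
 proof (cases "w : words (a + b) d'")
  case w: True
  have tw: "take a w : words a d'" "drop a w : words b d'" using w set_take_subset[of a w] set_drop_subset[of a w] by (auto simp: words_def)
  have "tensor_coord a (fmor (exterior_power a) A X, tpow_map b A y) w =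
   (SUM u:words a d. (\<Prod>i<a. A $$ (take a w ! i, u ! i)) * ext_coord a X u) * (SUM v:words b d. (\<Prod>i<b. A $$ (drop a w ! i, v ! i)) * y v)"
   using A tw by (simp add: tensor_coord_def X'(2) tpow_map_def)
  also have "... = (SUM u:words a d. SUM v:words b d. (\<Prod>i<a + b. A $$ (w ! i, (u @ v) ! i)) * tensor_coord a (X, y) (u @ v))"
   unfolding sum_product
  proof (intro sum.cong refl)
   fix u v assume u: "u : words a d" and v: "v : words b d"
   have "(\<Prod>i<a + b. A $$ (w ! i, (u @ v) ! i)) = (\<Prod>i<a. A $$ (take a w ! i, u ! i)) * (\<Prod>i<b. A $$ (drop a w ! i, v ! i))"
    unfolding prod_add_lessThan using words_length[OF u] words_length[OF v] words_length[OF w]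
    by (intro arg_cong2[where f = "(*)"] prod.cong) (auto simp: nth_append)
   thus "(\<Prod>i<a. A $$ (take a w ! i, u ! i)) * ext_coord a X u * ((\<Prod>i<b. A $$ (drop a w ! i, v ! i)) * y v) =
    (\<Prod>i<a + b. A $$ (w ! i, (u @ v) ! i)) * tensor_coord a (X, y) (u @ v)" using words_length[OF u] by (simp add: tensor_coord_def mult_ac)
  qed
  also have "... = tpow_map (a + b) A (tensor_coord a (X, y)) w" using w A by (simp add: tpow_map_def sum_words_append)
  finally show ?thesis .
 next
  case False
  thus ?thesis using tensor_coord_carrier[OF two X'(1) y'] A by (auto simp: tpow_map_def)
 qed
qed

lemma from_tensor_natural: fixes A :: "'k mat" assumes A: "A : carrier_mat d' d" and X: "X : carrier (T d)"
 shows "fmor (ExtDiv a b) A X : carrier (T d')"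
  "from_tensor a d' (fmor (ExtDiv a b) A X) = tpow_map (a + b) A (from_tensor a d X)"
proof -
 let ?F = "%d. free_vs (carrier (fobj (exterior_power a) d) \<times> dpow b d) ::
  ('k, (nat list => 'k) set \<times> (nat list => 'k) \<Rightarrow>\<^sub>0 'k) module"
 let ?R = "%d. tensor_rel (fobj (exterior_power a) d) (fobj (divided_power b) d) ::
  ((nat list => 'k) set \<times> (nat list => 'k) \<Rightarrow>\<^sub>0 'k) set"
 let ?f = "%k. (fmor (exterior_power a) A (fst k), tpow_map b A (snd k))"
 define h where "h t = (SUM k:keys t. single (?f k) (lookup t k))"
  for t :: "(nat list => 'k) set \<times> (nat list => 'k) \<Rightarrow>\<^sub>0 'k"
 have h': "(%t. SUM (x, y):keys t. single (fmor (exterior_power a) A x, tpow_map b A y) (lookup t (x, y))) = h"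
  by (simp add: h_def fun_eq_iff split_beta)
 obtain t where t: "t : carrier (?F d)" "X = ?R d +>[?F d] t"
  using X unfolding ExtDiv_simps by (rule quot_cosetE[OF free_vs_vs TR_subspace[OF two]])
 have f: "?f k : carrier (fobj (exterior_power a) d') \<times> dpow b d'"
  if "k : carrier (fobj (exterior_power a) d) \<times> dpow b d" for k
  using ext_coord_natural(1)[OF two A, of "fst k" a] tpow_map_dpow[OF A, of "snd k" b] that by (auto simp del: dpow_simps(1))
 have hom: "h : lin (?F d) (?F d')" unfolding module_hom_iff
 proof (intro conjI ballI allI)
  fix s assume "s : carrier (?F d)"
  hence s: "keys s <= carrier (fobj (exterior_power a) d) \<times> dpow b d" by simp
  have "keys (h s) <= (UN k:keys s. {?f k})"
   unfolding h_def by (rule order_trans[OF keys_sum_subset]) (auto split: if_splits)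
  also have "... <= carrier (fobj (exterior_power a) d') \<times> dpow b d'" using f s by blast
  finally show "h s : carrier (?F d')" by simp
  show "h (c *[?F d] s) = c *[?F d'] h s" for c
  proof -
   have "h (Poly_Mapping.map ((*) c) s) = (SUM k:keys s. single (?f k) (c * lookup s k))"
    unfolding h_def by (rule sum.mono_neutral_cong_left) (auto simp: in_keys_iff lookup_map_times)
   thus ?thesis by (simp add: h_def map_times_sum[OF two] map_times_single)
  qed
  show "h (s +[?F d] t) = h s +[?F d'] h t" for t
   unfolding free_vs_simps h_def by (rule setsum_keys_plus_distrib) (simp_all add: single_add)
 qed
 have eval: "tensor_eval a (h s) = tpow_map (a + b) A (tensor_eval a s)" if "s : carrier (?F d)"
  for s :: "(nat list => 'k) set \<times> (nat list => 'k) \<Rightarrow>\<^sub>0 'k"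
 proof -
  have s: "k : carrier (fobj (exterior_power a) d) \<times> dpow b d" if "k : keys s" for k
   using \<open>s : carrier (?F d)\<close> that by auto
  have "tensor_eval a (h s) = (%w. SUM k:keys s. lookup s k * tensor_coord a (?f k) w)"
   unfolding h_def tensor_eval_sum[OF two] tensor_eval_single[OF two] ..
  also have "... = (%w. SUM k:keys s. tpow_map (a + b) A (%w. lookup s k * tensor_coord a k w) w)"
   unfolding tpow_map_linear using s tensor_coord_natural[OF A] by (intro ext sum.cong) (auto simp del: dpow_simps(1))
  also have "... = tpow_map (a + b) A (tensor_eval a s)" unfolding tpow_map_sum[symmetric] tensor_eval_def[abs_def] pm_eval_def ..
  finally show ?thesis .
 qed
 have hR: "h r : ?R d'" if r: "r : ?R d" for r
 proof -
  have rc: "r : carrier (?F d)" by (rule quot_subspaceD(5)[OF free_vs_vs TR_subspace[OF two] r])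
  hence "tensor_eval a r = (%w. 0)" using r tensor_eval_kernel[OF two] by simp
  hence "tensor_eval a (h r) = (%w. 0)" unfolding eval[OF rc] by (simp add: tpow_map_def fun_eq_iff)
  thus ?thesis using tensor_eval_kernel[OF two hom_closed[OF hom rc]] by simp
 qed
 note ht = hom_closed[OF hom t(1)]
 have eq: "fmor (ExtDiv a b) A X = ?R d' +>[?F d'] h t"
  using A quot_map_coset[OF free_vs_vs TR_subspace[OF two] free_vs_vs TR_subspace[OF two] hom hR t(1)]
  unfolding ExtDiv_simps t(2) h' by auto
 show "fmor (ExtDiv a b) A X : carrier (T d')"
  unfolding eq unfolding ExtDiv_simps by (rule coset_in_quot[OF free_vs_vs TR_subspace[OF two] ht])
 show "from_tensor a d' (fmor (ExtDiv a b) A X) = tpow_map (a + b) A (from_tensor a d X)"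
  unfolding eq unfolding t(2) from_tensor_coset[OF ht] from_tensor_coset[OF t(1)] by (rule eval[OF t(1)])
qed

lemma to_tensor: "z : carrier (S d) ==> to_tensor a b d z : carrier (T d)"
 "z : carrier (S d) ==> from_tensor a d (to_tensor a b d z) = z"
 "X : carrier (T d) ==> to_tensor a b d (from_tensor a d X) = X" using from_tensor_bij[of d] unfolding to_tensor_def bij_betw_def
 by (auto simp: inv_into_f_f f_inv_into_f simp del: AltSym_simps(1) intro: inv_into_into)

lemma to_tensor_eqI: assumes "z : carrier (S d)" "X : carrier (T d)" "from_tensor a d X = z" shows "to_tensor a b d z = X"
 using to_tensor(3)[OF assms(2)] assms(3) by simp

lemma to_tensor_hom: "to_tensor a b d : lin (S d) (T d)" unfolding module_hom_iff
proof (intro conjI ballI allI)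
 fix x assume x: "x : carrier (S d)"
 show "to_tensor a b d x : carrier (T d)" by (rule to_tensor(1)[OF x])
 show "to_tensor a b d (c *[S d] x) = c *[T d] to_tensor a b d x" for c
  by (rule to_tensor_eqI[OF vs_smult[OF AltSym_vs x] vs_smult[OF T_vs to_tensor(1)[OF x]]])
   (simp only: hom_smult[OF from_tensor_hom to_tensor(1)[OF x]] to_tensor(2)[OF x])
 fix y assume y: "y : carrier (S d)"
 show "to_tensor a b d (x +[S d] y) = to_tensor a b d x +[T d] to_tensor a b d y"
  by (rule to_tensor_eqI[OF vs_add[OF AltSym_vs x y] vs_add[OF T_vs to_tensor(1)[OF x] to_tensor(1)[OF y]]])
   (simp only: hom_add[OF from_tensor_hom to_tensor(1)[OF x] to_tensor(1)[OF y]] to_tensor(2)[OF x] to_tensor(2)[OF y])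
qed

lemma to_tensor_natural: fixes A :: "'k mat" assumes A: "A : carrier_mat d' d" and z: "z : carrier (S d)"
 shows "to_tensor a b d' (fmor (AltSym a b) A z) = fmor (ExtDiv a b) A (to_tensor a b d z)"
 by (rule to_tensor_eqI[OF hom_closed[OF AltSym_hom[OF A] z] from_tensor_natural(1)[OF A to_tensor(1)[OF z]]])
  (simp only: from_tensor_natural(2)[OF A to_tensor(1)[OF z]] to_tensor(2)[OF z] AltSym_simps(5))

text \<open>The map is conjugate, by linear bijections, to the one on \<open>AltSym\<close>;
  linearity follows without a look at representatives.\<close>

lemma ExtDiv_hom: fixes A :: "'k mat" assumes A: "A : carrier_mat d' d"
 shows "fmor (ExtDiv a b) A : lin (T d) (T d')"
proof -
 have eq: "fmor (ExtDiv a b) A X = to_tensor a b d' (fmor (AltSym a b) A (from_tensor a d X))" if "X : carrier (T d)" for X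
  using to_tensor_natural[OF A hom_closed[OF from_tensor_hom that]] to_tensor(3)[OF that] by (simp only:)
 note f = hom_closed[OF from_tensor_hom] and s = hom_closed[OF AltSym_hom[OF A]]
 show ?thesis unfolding module_hom_iff by (intro conjI ballI allI)
   (simp_all only: eq vs_add[OF T_vs] vs_smult[OF T_vs] hom_add[OF from_tensor_hom] hom_smult[OF from_tensor_hom]
    hom_add[OF AltSym_hom[OF A]] hom_smult[OF AltSym_hom[OF A]] hom_add[OF to_tensor_hom]
    hom_smult[OF to_tensor_hom] f s to_tensor(1))
qed

end

section \<open>Isomorphisms of graded modules\<close>

lemma unstable_iso_trans:
 assumes closed: "!!k n th x. th : steenrod k ==> x : carrier (part L n) ==> act L k n th x : carrier (part L (n + k))"
  and L: "!!n. vspace (part L n)" and iso: "unstable_iso L M" "unstable_iso M N" shows "unstable_iso L N"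
proof -
 obtain ph where ph: "ph : unstable_hom L M" "!!n. bij_betw (ph n) (carrier (part L n)) (carrier (part M n))"
  using iso(1) unfolding unstable_iso_def by blast
 obtain ps where ps: "ps : unstable_hom M N" "!!n. bij_betw (ps n) (carrier (part M n)) (carrier (part N n))"
  using iso(2) unfolding unstable_iso_def by blast
 have h: "ph n : lin (part L n) (part M n)"
  "ps n : lin (part M n) (part N n)"
  "ph n : extensional (carrier (part L n))" for n using ph(1) ps(1) by (auto simp: unstable_hom_def linear_maps_def)
 have act: "th : steenrod k ==> x : carrier (part L n) ==> ph (n + k) (act L k n th x) = act M k n th (ph n x)"
  "th : steenrod k ==> y : carrier (part M n) ==> ps (n + k) (act M k n th y) = act N k n th (ps n y)" for k n th x y
  using ph(1) ps(1) by (auto simp: unstable_hom_def)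
 let ?c = "%n. \<lambda>x\<in>carrier (part L n). ps n (ph n x)"
 have bij: "bij_betw (?c n) (carrier (part L n)) (carrier (part N n))" for n
  using bij_betw_trans[OF ph(2) ps(2), of n] by (rule iffD1[OF bij_betw_cong, rotated]) simp
 have "?c n : linear_maps (part L n) (part N n)" for n
 proof -
  have "ps n \<circ> ph n : lin (part L n) (part N n)" unfolding module_hom_iff
   by (auto simp: hom_closed[OF h(1)] hom_closed[OF h(2)] hom_add[OF h(1)] hom_add[OF h(2)] hom_smult[OF h(1)] hom_smult[OF h(2)])
  moreover have "x +[part L n] y : carrier (part L n)" "c *[part L n] x : carrier (part L n)"
   if "x : carrier (part L n)" "y : carrier (part L n)" for x y c using that by (auto intro: vs_add[OF L] vs_smult[OF L])
  ultimately show ?thesis unfolding linear_maps_def Int_iff module_hom_iff by simp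
 qed
 moreover have "?c (n + k) (act L k n th x) = act N k n th (?c n x)" if "th : steenrod k" "x : carrier (part L n)" for k n th x
  using that act closed hom_closed[OF h(1)] by simp
 ultimately have "?c : unstable_hom L N" unfolding unstable_hom_def by blast
 thus ?thesis unfolding unstable_iso_def by (rule bexI[rotated]) (rule allI, rule bij)
qed

lemma suspension_iso: fixes M :: "('k::{field,finite}, 'u) graded_module" and N :: "('k, 'v) graded_module"
 assumes M: "!!n. vspace (part M n)" and N: "!!n. vspace (part N n)"
  and closed: "!!k n th x. th : steenrod k ==> x : carrier (part M n) ==> act M k n th x : carrier (part M (n + k))"
  and iso: "unstable_iso M N" shows "unstable_iso (suspension M) (suspension N)"
proof -
 obtain ph where ph: "ph : unstable_hom M N" "!!n. bij_betw (ph n) (carrier (part M n)) (carrier (part N n))"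
  using iso unfolding unstable_iso_def by blast
 have h: "ph n : lin (part M n) (part N n)"
  and e: "ph n : extensional (carrier (part M n))" for n using ph(1) by (auto simp: unstable_hom_def linear_maps_def)
 have act: "ph (n + k) (act M k n th x) = act N k n th (ph n x)" if "th : steenrod k" "x : carrier (part M n)" for k n th x
  using ph(1) that by (auto simp: unstable_hom_def)
 have z: "ph n 0[part M n] = 0[part N n]" for n by (rule module_hom_zero[OF M N h])
 \<comment> \<open>The suspension has a zero space in degree 0, which needs its own map with the
   correct domain; all other degrees are shifted by one.\<close>
 define ps where "ps n = (case n of 0 => \<lambda>x\<in>{0[part M 0]}. 0[part N 0] | Suc n' => ph n')" for n
 have sc: "part (suspension L) 0 = zero_vs (part L 0)" "part (suspension L) (Suc n) = part L n"
  for L :: "('k, 'w) graded_module" and n by (simp_all add: suspension_def)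
 have "ps n : linear_maps (part (suspension M) n) (part (suspension N) n)" for n
  using h e by (cases n) (simp_all add: ps_def sc linear_maps_def module_hom_iff vs_zero_right[OF M vs_zero[OF M]]
   vs_zero_right[OF N vs_zero[OF N]] vs_smult_zero[OF M] vs_smult_zero[OF N])
 moreover have "ps (n + k) (act (suspension M) k n th x) = act (suspension N) k n th (ps n x)"
  if "th : steenrod k" "x : carrier (part (suspension M) n)" for k n th x
 proof (cases n)
  case 0
  thus ?thesis by (cases k) (simp_all add: ps_def suspension_def z)
 next
  case (Suc n')
  thus ?thesis using that act[OF that(1), of x n'] closed[OF that(1), of x n'] by (simp add: ps_def suspension_def hom_smult[OF h])
 qed
 moreover have "bij_betw (ps n) (carrier (part (suspension M) n)) (carrier (part (suspension N) n))" for n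
  using ph(2) by (cases n) (simp_all add: ps_def sc bij_betw_def)
 ultimately show ?thesis unfolding unstable_iso_def unstable_hom_def by blast
qed

context fixes a b :: nat and ty :: "'k::{field,finite} itself" assumes prime: "prime (CARD('k))" and odd: "odd (CARD('k))"
begin

abbreviation (input) RS where "RS == r_prime (AltSym a b) :: ('k, _) graded_module"
abbreviation (input) RT where "RT == r_prime (ExtDiv a b) :: ('k, _) graded_module"

lemmas two = two_neq_zero_field[OF prime odd]

lemma ext_tensor_nat_trans_vs: "vspace (nat_trans_vs (divided_power c) (ExtDiv a b :: ('k, _) vfunctor))"
 by (rule nat_trans_vs_vectorspace[OF dpow_vs T_vs[OF two] _ ExtDiv_hom[OF two]])
  (simp del: dpow_simps(1) add: tpow_map_dpow)

lemma RT_vs: "vspace (part RT n)"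
 unfolding r_prime_component by (simp del: nat_trans_vs_simps add: ext_tensor_nat_trans_vs zero_vs_vs)

lemma dpow_fmor: "A : carrier_mat e d ==> x : dpow c d ==> fmor (divided_power c) A x : dpow c e" for x :: "nat list => 'k"
 by (simp del: dpow_simps(1) add: tpow_map_dpow)

abbreviation (input) to_RT where
 "to_RT c == push (divided_power c) (to_tensor a b :: nat => (nat list => 'k) => _)"

lemma to_RT_closed:
 "et : nat_trans (divided_power c) (AltSym a b) ==> to_RT c et : nat_trans (divided_power c) (ExtDiv a b)"
proof (rule push_nat_trans[OF dpow_vs])
 show "fmor (divided_power c) A x : dpow c e" if "A : carrier_mat e d" "x : dpow c d" for d e A and x :: "nat list => 'k"
  by (rule dpow_fmor[OF that])
 show "to_tensor a b d : lin (fobj (AltSym a b) d :: ('k, _) module) (fobj (ExtDiv a b) d)" for d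
  by (rule to_tensor_hom[OF two])
 show "to_tensor a b e (fmor (AltSym a b) A z) = fmor (ExtDiv a b) A (to_tensor a b d z)"
  if "A : carrier_mat e d" "z : carrier (fobj (AltSym a b) d)" for d e z and A :: "'k mat" by (rule to_tensor_natural[OF two that])
qed

lemma to_RT_bij: "bij_betw (to_RT c) (nat_trans (divided_power c) (AltSym a b)) (nat_trans (divided_power c) (ExtDiv a b))"
proof (rule bij_betw_byWitness[where f' = "push (divided_power c) (from_tensor a)"])
 have from_closed: "push (divided_power c) (from_tensor a) et : nat_trans (divided_power c) (AltSym a b)"
  if "et : nat_trans (divided_power c) (ExtDiv a b)" for et :: "nat => (nat list => 'k) => _"
 proof (rule push_nat_trans[OF dpow_vs _ _ _ that])
  show "fmor (divided_power c) A x : dpow c e" if "A : carrier_mat e d" "x : dpow c d" for d e A and x :: "nat list => 'k"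
   by (rule dpow_fmor[OF that])
  show "from_tensor a d : lin (fobj (ExtDiv a b) d) (fobj (AltSym a b) d :: ('k, _) module)" for d
   by (rule from_tensor_hom[OF two])
  show "from_tensor a e (fmor (ExtDiv a b) A z) = fmor (AltSym a b) A (from_tensor a d z)"
   if "A : carrier_mat e d" "z : carrier (fobj (ExtDiv a b) d)" for d e z and A :: "'k mat"
   using from_tensor_natural(2)[OF two that] by simp
 qed
 show "to_RT c ` nat_trans (divided_power c) (AltSym a b) <= nat_trans (divided_power c) (ExtDiv a b)"
  using to_RT_closed by blast
 show "push (divided_power c) (from_tensor a) ` nat_trans (divided_power c) (ExtDiv a b) <=
  nat_trans (divided_power c) (AltSym a b :: ('k, _) vfunctor)" using from_closed by blast
 show "ALL et:nat_trans (divided_power c) (AltSym a b). push (divided_power c) (from_tensor a) (to_RT c et) = et"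
 proof
  fix et :: "nat => (nat list => 'k) => nat list => 'k" assume et: "et : nat_trans (divided_power c) (AltSym a b)"
  show "push (divided_power c) (from_tensor a) (to_RT c et) = et" by (rule nat_trans_eqI[OF from_closed[OF to_RT_closed[OF et]] et])
    (simp del: dpow_simps(1) AltSym_simps(1) add: push_def to_tensor(2)[OF two] hom_closed[OF nat_transD(1)[OF et]])
 qed
 show "ALL et:nat_trans (divided_power c) (ExtDiv a b). to_RT c (push (divided_power c) (from_tensor a) et) = et"
 proof
  fix et :: "nat => (nat list => 'k) => _" assume et: "et : nat_trans (divided_power c) (ExtDiv a b)"
  show "to_RT c (push (divided_power c) (from_tensor a) et) = et" by (rule nat_trans_eqI[OF to_RT_closed[OF from_closed[OF et]] et])
    (simp del: dpow_simps(1) AltSym_simps(1) add: push_def to_tensor(3)[OF two] hom_closed[OF nat_transD(1)[OF et]])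
 qed
qed

lemma to_RT_zero: "to_RT c 0[nat_trans_vs (divided_power c) (AltSym a b)] = 0[nat_trans_vs (divided_power c) (ExtDiv a b)]"
proof -
 have "to_tensor a b d 0[fobj (AltSym a b) d] = 0[fobj (ExtDiv a b :: ('k, _) vfunctor) d]" for d
  by (rule module_hom_zero[OF AltSym_vs T_vs[OF two] to_tensor_hom[OF two]])
 thus ?thesis by (auto simp: push_def restrict_def fun_eq_iff simp del: dpow_simps(1) AltSym_simps)
qed

lemma to_RT_linear: assumes et: "et : nat_trans (divided_power c) (AltSym a b)"
 shows "to_RT c (r *[nat_trans_vs (divided_power c) (AltSym a b)] et) = r *[nat_trans_vs (divided_power c) (ExtDiv a b)] to_RT c et"
  "et' : nat_trans (divided_power c) (AltSym a b) ==>
   to_RT c (et +[nat_trans_vs (divided_power c) (AltSym a b)] et') = to_RT c et +[nat_trans_vs (divided_power c) (ExtDiv a b)] to_RT c et'"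
proof -
 note c = hom_closed[OF nat_transD(1)]
 show "to_RT c (r *[nat_trans_vs (divided_power c) (AltSym a b)] et) = r *[nat_trans_vs (divided_power c) (ExtDiv a b)] to_RT c et"
  by (intro ext) (simp add: push_def restrict_def hom_smult[OF to_tensor_hom[OF two] c[OF et]] del: dpow_simps(1) AltSym_simps)
 assume et': "et' : nat_trans (divided_power c) (AltSym a b)"
 show "to_RT c (et +[nat_trans_vs (divided_power c) (AltSym a b)] et') = to_RT c et +[nat_trans_vs (divided_power c) (ExtDiv a b)] to_RT c et'"
  by (intro ext) (simp add: push_def restrict_def hom_add[OF to_tensor_hom[OF two] c[OF et] c[OF et']] del: dpow_simps(1) AltSym_simps)
qed

text \<open>\<open>milnor_op\<close> precomposes and \<open>to_RT\<close> postcomposes, so they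
  commute. That the result is again a natural transformation is seen from the coefficient
  formula.\<close>

lemma milnor_op_closed: assumes R: "({}, R) : milnor_monomials" "milnor_degree (CARD('k)) ({}, R) = k"
  and et: "et : nat_trans (divided_power c) (AltSym a b)"
 shows "milnor_op (AltSym a b :: ('k, _) vfunctor) c R et : nat_trans (divided_power (c + k div 2)) (AltSym a b)"
  "to_RT (c + k div 2) (milnor_op (AltSym a b) c R et) = milnor_op (ExtDiv a b) c R (to_RT c et)"
proof -
 have R0: "lookup R 0 = 0" using R(1) by (simp add: milnor_monomials_def)
 have k: "milnor_degree (CARD('k)) ({}, R) = 2 * (k div 2)" using R(2) even_milnor_degree[of "CARD('k)" R] by simp
 obtain ka where alt: "alt_sym a (a + b) ka" and supp: "!!t. ka t ~= 0 ==> t : expts (CARD('k)) c (a + b)"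
  and eq: "et = nat_eta c (a + b) ka" using nat_eta_surj[OF prime et] by metis
 have "milnor_op (AltSym a b) c R et = nat_eta (c + k div 2) (a + b) (power_action (milnor_dual ({}, R)) ka)"
  unfolding eq using supp by (intro milnor_op_nat_eta[OF prime R0 _ k])
 thus "milnor_op (AltSym a b) c R et : nat_trans (divided_power (c + k div 2)) (AltSym a b)"
  using nat_eta_nat_trans[OF prime power_action_alt_sym[OF alt]] by simp
 have "2 * (k div 2) = 2 * (SUM j:keys R. lookup R j * (CARD('k) ^ j - 1))"
  using k by (simp add: milnor_degree_def sum_distrib_left mult.left_commute)
 hence k': "(SUM j:keys R. lookup R j * (CARD('k) ^ j - 1)) = k div 2" by simp
 show "to_RT (c + k div 2) (milnor_op (AltSym a b) c R et) = milnor_op (ExtDiv a b) c R (to_RT c et)"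
 proof (cases "exponent_sum R > c")
  case True
  thus ?thesis unfolding milnor_op_def Let_def k' by (simp only: if_True to_RT_zero)
 next
  case False
  hence th: "theta c R d x : dpow c d" if "x : dpow (c + k div 2) d" for d and x :: "nat list => 'k"
   using theta_dpow[OF R0 _ that, of c] by simp
  show ?thesis unfolding milnor_op_def Let_def k' using False th by (auto simp: push_def restrict_def fun_eq_iff simp del: dpow_simps(1))
 qed
qed

lemma RS_act_closed: assumes "th : steenrod k" "x : carrier (part RS n)"
 shows "act RS k n th x : carrier (part RS (n + k))"
proof (cases "even n & even k")
 case True
 define c where "c = n div 2"
 have n: "n = 2 * c" using True by (simp add: c_def)
 hence x: "x : nat_trans (divided_power c) (AltSym a b)" using assms(2) by (simp add: r_prime_component)
 interpret abelian_group "nat_trans_vs (divided_power (c + k div 2)) (AltSym a b :: ('k, _) vfunctor)"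
  by (rule vs_abelian_group[OF nat_trans_alt_sym_vs])
 have cmp: "part RS (n + k) = nat_trans_vs (divided_power (c + k div 2)) (AltSym a b)"
  using True by (simp add: r_prime_component n del: nat_trans_vs_simps)
 show ?thesis unfolding cmp unfolding n r_prime_act_even[OF conjunct2[OF True]]
 proof (intro finsum_closed funcsetI vs_smult[OF nat_trans_alt_sym_vs])
  fix R assume "R : {R. ({}, R) : milnor_monomials & milnor_degree (CARD('k)) ({}, R) = k}"
  thus "milnor_op (AltSym a b) c R x : carrier (nat_trans_vs (divided_power (c + k div 2)) (AltSym a b))"
   using milnor_op_closed(1)[OF _ _ x] by simp
 qed
next
 case False
 have "act RS k n th x = 0[part RS (n + k)]"
 proof (cases "even k")
  case True
  thus ?thesis using False by (simp add: r_prime_def Let_def del: nat_trans_vs_simps)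
 qed (rule r_prime_act_odd[OF _ AltMod_vs])
 thus ?thesis by (simp only: vs_zero[OF AltMod_vs])
qed

text \<open>Postcomposition with \<open>to_tensor\<close> is a linear bijection that commutes with
  every \<open>milnor_op\<close>, hence with the finite sums that define the action.\<close>

lemma RS_iso_RT: "unstable_iso RS RT"
proof -
 let ?S = "%c. nat_trans_vs (divided_power c) (AltSym a b :: ('k, _) vfunctor)"
 let ?T = "%c. nat_trans_vs (divided_power c) (ExtDiv a b :: ('k, _) vfunctor)"
 define ph where "ph n = restrict (to_RT (n div 2)) (carrier (part RS n))" for n
 have zS: "0[part RS n] = 0[?S (n div 2)]" and zT: "0[part RT n] = 0[?T (n div 2)]" for n
  by (simp_all add: r_prime_component del: nat_trans_vs_simps)
 have sub: "carrier (part RS n) <= nat_trans (divided_power (n div 2)) (AltSym a b)" for n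
  using vs_zero[OF nat_trans_alt_sym_vs[of "n div 2" a b, where 'k = 'k]] by (auto simp: r_prime_component simp del: nat_trans_vs_simps(2-4))
 have bij: "bij_betw (to_RT (n div 2)) (carrier (part RS n)) (carrier (part RT n))" for n
 proof (cases "even n")
  case True
  thus ?thesis using to_RT_bij[of "n div 2"] by (simp add: r_prime_component)
 next
  case False
  thus ?thesis using to_RT_zero[of "n div 2"] by (simp add: r_prime_component bij_betw_def del: nat_trans_vs_simps)
 qed
 have ph0: "ph n 0[part RS n] = 0[part RT n]" for n
  using vs_zero[OF AltMod_vs[of a b n, where 'k = 'k]] to_RT_zero[of "n div 2"] unfolding ph_def zS zT by (simp only: restrict_apply' if_True)
 have "ph n : linear_maps (part RS n) (part RT n)" for n unfolding linear_maps_def Int_iff module_hom_iff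
 proof (intro conjI ballI allI)
  show "ph n : extensional (carrier (part RS n))" by (simp add: ph_def)
  fix x assume x: "x : carrier (part RS n)"
  note x' = subsetD[OF sub x]
  show "ph n x : carrier (part RT n)" using bij_betwE[OF bij, of n] x by (simp add: ph_def)
  show "ph n (r *[part RS n] x) = r *[part RT n] ph n x" for r
   using vs_smult[OF AltMod_vs x, of r] x to_RT_linear(1)[OF x', of r]
   by (simp add: ph_def) (simp add: r_prime_component split: if_splits)
  fix y assume y: "y : carrier (part RS n)"
  show "ph n (x +[part RS n] y) = ph n x +[part RT n] ph n y"
   using vs_add[OF AltMod_vs x y] x y to_RT_linear(2)[OF x' subsetD[OF sub y]]
   by (simp add: ph_def) (simp add: r_prime_component split: if_splits)
 qed
 moreover have "ph (n + k) (act RS k n th x) = act RT k n th (ph n x)"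
  if th: "th : steenrod k" and x: "x : carrier (part RS n)" for k n th x
 proof (cases "even n & even k")
  case True
  define c where "c = n div 2"
  have n: "n = 2 * c" using True by (simp add: c_def)
  let ?c = "c + k div 2"
  have x': "x : nat_trans (divided_power c) (AltSym a b)" using subsetD[OF sub x] by (simp add: c_def)
  let ?R = "{R. ({}, R) : milnor_monomials & milnor_degree (CARD('k)) ({}, R) = k}"
  let ?g = "%R. th ({}, R) *[?S ?c] milnor_op (AltSym a b) c R x"
  let ?h = "%R. th ({}, R) *[?T ?c] milnor_op (ExtDiv a b) c R (to_RT c x)"
  interpret A: abelian_group "?S ?c" by (rule vs_abelian_group[OF nat_trans_alt_sym_vs])
  interpret B: abelian_group "?T ?c" by (rule vs_abelian_group[OF ext_tensor_nat_trans_vs])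
  have m: "milnor_op (AltSym a b) c R x : nat_trans (divided_power ?c) (AltSym a b)"
   "to_RT ?c (milnor_op (AltSym a b) c R x) = milnor_op (ExtDiv a b) c R (to_RT c x)" if "R : ?R" for R
   using milnor_op_closed[OF _ _ x', of R k] that by blast+
  have g: "?g R : carrier (?S ?c)" if "R : ?R" for R
   using vs_smult[OF nat_trans_alt_sym_vs, of "milnor_op (AltSym a b) c R x" ?c a b] m(1)[OF that] by (simp del: nat_trans_vs_simps(2-4))
  have h: "?h R = to_RT ?c (?g R)" if "R : ?R" for R unfolding to_RT_linear(1)[OF m(1)[OF that]] m(2)[OF that] ..
  have hc: "?h R : carrier (?T ?c)" if "R : ?R" for R
   unfolding h[OF that] using to_RT_closed[of "?g R" ?c] g[OF that] by (simp del: nat_trans_vs_simps(2-4))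
  have fin: "finite ?R"
  proof (rule finite_subset)
   show "?R <= snd ` {m \<in> milnor_monomials. milnor_degree (CARD('k)) m = k}" by force
  qed (rule finite_imageI, rule finite_milnor_degree[OF prime_gt_1_nat[OF prime]])
  have "to_RT ?c (finsum (?S ?c) ?g A) = finsum (?T ?c) ?h A" if "finite A" "A <= ?R" for A using that
  proof (induction A)
   case empty
   thus ?case by (simp only: A.finsum_empty B.finsum_empty to_RT_zero)
  next
   case (insert R A)
   have gA: "?g : A \<rightarrow> carrier (?S ?c)" and hA: "?h : A \<rightarrow> carrier (?T ?c)" using insert.prems g hc by blast+
   have R: "R : ?R" using insert.prems by blast
   have "finsum (?S ?c) ?g A : carrier (?S ?c)" by (rule A.finsum_closed[OF gA])
   hence "to_RT ?c (?g R +[?S ?c] finsum (?S ?c) ?g A) = to_RT ?c (?g R) +[?T ?c] to_RT ?c (finsum (?S ?c) ?g A)"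
    using g[OF R] by (intro to_RT_linear(2)) (simp_all only: nat_trans_vs_simps(1))
   moreover have "to_RT ?c (finsum (?S ?c) ?g A) = finsum (?T ?c) ?h A" using insert.IH insert.prems by blast
   ultimately show ?case unfolding A.finsum_insert[OF insert.hyps gA g[OF R]] B.finsum_insert[OF insert.hyps hA hc[OF R]] h[OF R] by (simp only:)
  qed
  from this[OF fin subset_refl]
  have "to_RT ?c (act RS k (2 * c) th x) = act RT k (2 * c) th (to_RT c x)" unfolding r_prime_act_even[OF conjunct2[OF True]] .
  moreover have "(n + k) div 2 = ?c" using True n by auto
  moreover have "act RS k n th x : carrier (part RS (n + k))" by (rule RS_act_closed[OF th x])
  ultimately show ?thesis using x n by (simp add: ph_def)
 next
  case False
  have "act RS k n th x = 0[part RS (n + k)] & act RT k n th (ph n x) = 0[part RT (n + k)]"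
  proof (cases "even k")
   case True
   thus ?thesis using False by (simp add: r_prime_def Let_def del: nat_trans_vs_simps)
  qed (simp add: r_prime_act_odd AltMod_vs RT_vs)
  thus ?thesis using ph0 by simp
 qed
 moreover have "bij_betw (ph n) (carrier (part RS n)) (carrier (part RT n))" for n
  using bij[of n] unfolding ph_def by (rule iffD1[OF bij_betw_cong, rotated]) simp
 ultimately show ?thesis unfolding unstable_iso_def unstable_hom_def by blast
qed

end

text \<open>The index set of the pieces is the disjoint union of the images of \<open>f\<close> and
  \<open>g\<close>, so the sum of all pieces regroups into a pair of sums, component by
  component.\<close>

lemma direct_sum_iso: fixes P :: "nat => ('k::{field,finite}, 'u) graded_module"
  and M :: "'i => ('k, 'v) graded_module" and N :: "'j => ('k, 'w) graded_module"
 assumes V: "!!i n. i : K ==> vspace (part (P i) n)"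
  and closed: "!!i k n th x. i : K ==> th : steenrod k ==> x : carrier (part (P i) n) ==>
   act (P i) k n th x : carrier (part (P i) (n + k))"
  and f: "inj_on f I" "inj_on g J" "f ` I \<inter> g ` J = {}" "K = f ` I \<union> g ` J"
  and isoM: "!!i. i : I ==> unstable_iso (P (f i)) (M i)" and isoN: "!!j. j : J ==> unstable_iso (P (g j)) (N j)"
 shows "unstable_iso (finite_direct_sum K P) (direct_sum_pair (finite_direct_sum I M) (finite_direct_sum J N))"
proof -
 let ?is = "%P M ph. ph : unstable_hom P M & (ALL n. bij_betw (ph n) (carrier (part P n)) (carrier (part M n)))"
 have "ALL i:I. EX ph. ?is (P (f i)) (M i) ph" "ALL j:J. EX ph. ?is (P (g j)) (N j) ph"
  using isoM isoN unfolding unstable_iso_def by blast+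
 then obtain ph ps where ph: "ALL i:I. ?is (P (f i)) (M i) (ph i)" and ps: "ALL j:J. ?is (P (g j)) (N j) (ps j)"
  unfolding bchoice_iff by blast
 note fK = f(4)
 have h: "i : I ==> ph i n : lin (part (P (f i)) n) (part (M i) n)"
  "j : J ==> ps j n : lin (part (P (g j)) n) (part (N j) n)" for i j n
  using ph ps by (auto simp: unstable_hom_def linear_maps_def)
 have act: "i : I ==> th : steenrod k ==> x : carrier (part (P (f i)) n) ==> ph i (n + k) (act (P (f i)) k n th x) = act (M i) k n th (ph i n x)"
  "j : J ==> th : steenrod k ==> x : carrier (part (P (g j)) n) ==> ps j (n + k) (act (P (g j)) k n th x) = act (N j) k n th (ps j n x)" for i j k n th x
  using ph ps by (auto simp: unstable_hom_def)
 have bij: "i : I ==> bij_betw (ph i n) (carrier (part (P (f i)) n)) (carrier (part (M i) n))"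
  "j : J ==> bij_betw (ps j n) (carrier (part (P (g j)) n)) (carrier (part (N j) n))" for i j n
  using ph ps by auto
 let ?P = "finite_direct_sum K P" and ?N = "direct_sum_pair (finite_direct_sum I M) (finite_direct_sum J N)"
 have fds: "carrier (part (finite_direct_sum I' M') n) = (\<Pi>\<^sub>E i\<in>I'. carrier (part (M' i) n))"
  "x +[part (finite_direct_sum I' M') n] y = (\<lambda>i\<in>I'. x i +[part (M' i) n] y i)"
  "c *[part (finite_direct_sum I' M') n] x = (\<lambda>i\<in>I'. c *[part (M' i) n] x i)"
  "act (finite_direct_sum I' M') k n th x = (\<lambda>i\<in>I'. act (M' i) k n th (x i))"
  for I' :: "'x set" and M' :: "'x => ('k, 'y) graded_module" and n k x y c th by (simp_all add: finite_direct_sum_def)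
 have dsp: "carrier (part (direct_sum_pair A B) n) = carrier (part A n) \<times> carrier (part B n)"
  "(x, x') +[part (direct_sum_pair A B) n] (y, y') = (x +[part A n] y, x' +[part B n] y')"
  "c *[part (direct_sum_pair A B) n] (x, x') = (c *[part A n] x, c *[part B n] x')"
  "act (direct_sum_pair A B) k n th (x, x') = (act A k n th x, act B k n th x')"
  for A :: "('k, 'x) graded_module" and B :: "('k, 'y) graded_module" and n k x y x' y' c th by (simp_all add: direct_sum_pair_def)
 define \<Phi> where "\<Phi> n = (\<lambda>x\<in>carrier (part ?P n). (\<lambda>i\<in>I. ph i n (x (f i)), \<lambda>j\<in>J. ps j n (x (g j))))" for n
 have mem: "i : I ==> f i : K" "j : J ==> g j : K" for i j using f(4) by auto
 have comp: "i : I ==> x (f i) : carrier (part (P (f i)) n)" "j : J ==> x (g j) : carrier (part (P (g j)) n)"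
  if "x : carrier (part ?P n)" for x i j n using that mem unfolding fds by (auto simp: PiE_iff)
 have "\<Phi> n : linear_maps (part ?P n) (part ?N n)" for n unfolding linear_maps_def Int_iff module_hom_iff
 proof (intro conjI ballI allI)
  show "\<Phi> n : extensional (carrier (part ?P n))" by (simp add: \<Phi>_def)
  fix x assume x: "x : carrier (part ?P n)"
  show "\<Phi> n x : carrier (part ?N n)"
   using x by (auto simp: \<Phi>_def dsp fds(1) intro!: hom_closed[OF h(1)] hom_closed[OF h(2)] comp[OF x])
  have sm: "c *[part ?P n] x : carrier (part ?P n)" for c
   using x vs_smult[OF V] unfolding fds by (auto simp: PiE_iff)
  show "\<Phi> n (c *[part ?P n] x) = c *[part ?N n] \<Phi> n x" for c
   using x sm[of c] by (simp add: \<Phi>_def dsp fds(2-4) mem comp[OF x] hom_smult[OF h(1)] hom_smult[OF h(2)] cong: restrict_cong)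
  fix y assume y: "y : carrier (part ?P n)"
  have ad: "x +[part ?P n] y : carrier (part ?P n)" using x y vs_add[OF V] unfolding fds by (auto simp: PiE_iff)
  show "\<Phi> n (x +[part ?P n] y) = \<Phi> n x +[part ?N n] \<Phi> n y"
   using x y ad by (simp add: \<Phi>_def dsp fds(2-4) mem comp[OF x] comp[OF y] hom_add[OF h(1)] hom_add[OF h(2)] cong: restrict_cong)
 qed
 moreover have "\<Phi> (n + k) (act ?P k n th x) = act ?N k n th (\<Phi> n x)"
  if th: "th : steenrod k" and x: "x : carrier (part ?P n)" for k n th x
 proof -
  have "act ?P k n th x : carrier (part ?P (n + k))" using x closed[OF _ th] unfolding fds by (auto simp: PiE_iff)
  thus ?thesis using x by (simp add: \<Phi>_def dsp fds(2-4) mem comp[OF x] act(1)[OF _ th] act(2)[OF _ th] cong: restrict_cong)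
 qed
 moreover have "bij_betw (\<Phi> n) (carrier (part ?P n)) (carrier (part ?N n))" for n
 proof (rule bij_betw_imageI)
  show "inj_on (\<Phi> n) (carrier (part ?P n))"
  proof (rule inj_onI)
   fix x y assume x: "x : carrier (part ?P n)" and y: "y : carrier (part ?P n)" and eq: "\<Phi> n x = \<Phi> n y"
   have 1: "ph i n (x (f i)) = ph i n (y (f i))" if "i : I" for i
    using fun_cong[OF arg_cong[OF eq, of fst], of i] x y that by (simp add: \<Phi>_def)
   have 2: "ps j n (x (g j)) = ps j n (y (g j))" if "j : J" for j
    using fun_cong[OF arg_cong[OF eq, of snd], of j] x y that by (simp add: \<Phi>_def)
   have "x l = y l" if l: "l : K" for l
   proof -
    consider i where "i : I" "l = f i" | j where "j : J" "l = g j" using l f(4) by blast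
    thus ?thesis
    proof cases
     case 1
     thus ?thesis
      using inj_onD[OF bij_betw_imp_inj_on[OF bij(1)[OF 1(1)]] \<open>!!i. i : I ==> ph i n (x (f i)) = ph i n (y (f i))\<close>[OF 1(1)]] comp[OF x] comp[OF y] by blast
    next
     case 2
     thus ?thesis
      using inj_onD[OF bij_betw_imp_inj_on[OF bij(2)[OF 2(1)]] \<open>!!j. j : J ==> ps j n (x (g j)) = ps j n (y (g j))\<close>[OF 2(1)]] comp[OF x] comp[OF y] by blast
    qed
   qed
   thus "x = y" using x y unfolding fds(1) by (intro PiE_ext) auto
  qed
  show "\<Phi> n ` carrier (part ?P n) = carrier (part ?N n)"
  proof (intro subset_antisym subsetI)
   show "z : carrier (part ?N n)" if "z : \<Phi> n ` carrier (part ?P n)" for z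
    using that \<open>!!n. \<Phi> n : linear_maps (part ?P n) (part ?N n)\<close>[of n] by (auto simp: linear_maps_def hom_closed)
   fix z assume "z : carrier (part ?N n)"
   then obtain u v where z: "z = (u, v)" and u: "u : (\<Pi>\<^sub>E i\<in>I. carrier (part (M i) n))" and v: "v : (\<Pi>\<^sub>E j\<in>J. carrier (part (N j) n))"
    unfolding dsp fds(1) by auto
   \<comment> \<open>Since \<open>f\<close> and \<open>g\<close> are injective with disjoint images,
     exactly one component of \<open>u\<close> or \<open>v\<close> constrains the index
     \<open>l\<close>.\<close>
   have "EX y:carrier (part (P l) n). (ALL i:I. f i = l --> ph i n y = u i) & (ALL j:J. g j = l --> ps j n y = v j)" if l: "l : K" for l
   proof -
    consider i where "i : I" "l = f i" | j where "j : J" "l = g j" using l f(4) by blast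
    thus ?thesis
    proof cases
     case 1
     then obtain y where "y : carrier (part (P l) n)" "ph i n y = u i"
      using bij_betw_imp_surj_on[OF bij(1)[OF 1(1), of n]] u by (metis PiE_mem imageE)
     moreover have "g j ~= l" if "j : J" for j using f(3) 1 that by blast
     ultimately show ?thesis using 1 inj_onD[OF f(1)] by metis
    next
     case 2
     then obtain y where "y : carrier (part (P l) n)" "ps j n y = v j"
      using bij_betw_imp_surj_on[OF bij(2)[OF 2(1), of n]] v by (metis PiE_mem imageE)
     moreover have "f i ~= l" if "i : I" for i using f(3) 2 that by blast
     ultimately show ?thesis using 2 inj_onD[OF f(2)] by metis
    qed
   qed
   then obtain y where y: "!!l. l : K ==> y l : carrier (part (P l) n) & (ALL i:I. f i = l --> ph i n (y l) = u i) & (ALL j:J. g j = l --> ps j n (y l) = v j)"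
    by metis
   let ?y = "restrict y K"
   have c: "?y : carrier (part ?P n)" using y unfolding fds(1) by auto
   have "(\<lambda>i\<in>I. ph i n (?y (f i))) = u"
    by (rule extensionalityI[OF restrict_extensional]) (use u y mem in \<open>auto simp: PiE_iff\<close>)
   moreover have "(\<lambda>j\<in>J. ps j n (?y (g j))) = v"
    by (rule extensionalityI[OF restrict_extensional]) (use v y mem in \<open>auto simp: PiE_iff\<close>)
   ultimately have "\<Phi> n ?y = z" using c unfolding \<Phi>_def z by simp
   thus "z : \<Phi> n ` carrier (part ?P n)" using c by blast
  qed
 qed
 ultimately show ?thesis unfolding unstable_iso_def unstable_hom_def by blast
qed

lemma subquotient_facts: fixes M :: "('k::{field,finite}, 'u) graded_module"
 assumes M: "steenrod_module M" and G: "is_submodule G M" and H: "is_submodule H M" and sub: "!!n. H n <= G n"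
 shows "vspace (part (subquotient M G H) n)"
  "th : steenrod k ==> X : carrier (part (subquotient M G H) n) ==>
   act (subquotient M G H) k n th X : carrier (part (subquotient M G H) (n + k))"
proof -
 note GD = is_submoduleD[OF M G] and HD = is_submoduleD[OF M H]
 let ?V = "%n. (part M n)\<lparr>carrier := G n\<rparr>"
 have V: "vspace (?V n)" for n by (rule subspace_vectorspace[OF GD(7)])
 have HV: "subsp (H n) (?V n)" for n unfolding subspace_iff[OF V] using sub HD(2-4) by simp
 have Q: "part (subquotient M G H) n = quot_vs (?V n) (H n)" for n by (simp add: subquotient_def)
 show "vspace (part (subquotient M G H) n)" unfolding Q by (rule vectorspace_quot[OF V HV])
 assume th: "th : steenrod k" and X: "X : carrier (part (subquotient M G H) n)"
 have c: "H n +>[?V n] x = H n +>[part M n] x" for n x by (simp add: a_r_coset_def')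
 obtain x where x: "x : G n" "X = H n +>[part M n] x" using quot_cosetE[OF V HV X[unfolded Q]] unfolding c by auto
 have "act (subquotient M G H) k n th X = H (n + k) +>[part M (n + k)] act M k n th x" unfolding x(2) subquotient_def
  using quot_map_coset[OF sm_vs[OF M] HD(7) sm_vs[OF M] HD(7) sm_hom[OF M th] HD(6)[OF th] GD(5)[OF x(1)]] by simp
 also have "... : carrier (quot_vs (?V (n + k)) (H (n + k)))"
  using coset_in_quot[OF V HV, of "act M k n th x"] GD(6)[OF th x(1)] unfolding c by simp
 finally show "act (subquotient M G H) k n th X : carrier (part (subquotient M G H) (n + k))" unfolding Q .
qed

section \<open>Assembly of the pieces\<close>

theorem proposition2:
  fixes p n :: nat
    and F :: "('k::{field,finite}, 'u) graded_module"
    and \<iota> :: 'u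
  assumes "prime p" "odd p" "CARD('k) = p"
    and "n > 0"
    and "infinite (UNIV :: 'u set)"
    and "free_unstable n F \<iota>"
  shows "\<exists>r Fil. finite_filtration F r Fil \<and>
    unstable_iso (associated_graded F r Fil)
      (direct_sum_pair
        (finite_direct_sum {(a, b). a + 2 * b = n}
          (\<lambda>(a, b). r_prime (tensor_functor (exterior_power a) (divided_power b))))
        (finite_direct_sum {(a, b). a + 2 * b = n \<and> a \<ge> 1}
          (\<lambda>(a, b). suspension
            (r_prime (tensor_functor (exterior_power (a - 1)) (divided_power b))))))"
proof -
 have prime: "prime (CARD('k))" and odd: "odd (CARD('k))" using assms by auto
 note inf = assms(5) and free = assms(6)
 note F = free_unstableD[OF prime odd inf free]
 let ?Fil = "tau_filtration F n \<iota>"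
 let ?P = "%i. subquotient F (?Fil (Suc i)) (?Fil i)"
 let ?I = "{(a, b). a + 2 * b = n}" and ?J = "{(a, b). a + 2 * b = n & a \<ge> 1}"
 \<comment> \<open>The piece with index \<open>i\<close> has \<open>n - i\<close> factors tau. For
   \<open>i = 2 * b\<close> this number is \<open>a\<close>, the unsuspended case; for
   \<open>i = Suc (2 * b)\<close> it is \<open>a - 1\<close>, the suspended one.\<close>
 let ?f = "%(a :: nat, b). 2 * b" and ?g = "%(a :: nat, b). Suc (2 * b)"
 note fil = tau_filtration[OF prime odd inf free]
 have sub: "is_submodule (?Fil i) F" if "i <= Suc n" for i using fil that by (simp add: finite_filtration_def)
 have mono: "?Fil i m <= ?Fil (Suc i) m" if "i < Suc n" for i m using fil that by (simp add: finite_filtration_def)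
 have facts: "vspace (part (?P i) m)"
  "th : steenrod k ==> X : carrier (part (?P i) m) ==> act (?P i) k m th X : carrier (part (?P i) (m + k))"
  if "i : {..<Suc n}" for i m k th X
 proof -
  have i: "Suc i <= Suc n" "i <= Suc n" "i < Suc n" using that by auto
  note sf = subquotient_facts[OF F(2) sub[OF i(1)] sub[OF i(2)] mono[OF i(3)]]
  show "vspace (part (?P i) m)" by (rule sf(1))
  show "th : steenrod k ==> X : carrier (part (?P i) m) ==> act (?P i) k m th X : carrier (part (?P i) (m + k))"
   by (rule sf(2))
 qed
 \<comment> \<open>Stage \<open>i\<close> is level \<open>Suc n - i\<close>, so the quotient of
   stage \<open>Suc i\<close> by stage \<open>i\<close> is level \<open>n - i\<close> modulo the
   next level.\<close>
 have piece: "?P i = subquotient F (tau_level F n \<iota> (n - i)) (tau_level F n \<iota> (Suc (n - i)))" if "i <= n" for i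
  using that by (simp add: tau_filtration_def Suc_diff_le)
 have "unstable_iso (finite_direct_sum {..<Suc n} ?P) (direct_sum_pair (finite_direct_sum ?I (%(a, b). r_prime (ExtDiv a b)))
    (finite_direct_sum ?J (%(a, b). suspension (r_prime (ExtDiv (a - 1) b)))))"
 proof (rule direct_sum_iso[where f = ?f and g = ?g])
  show "inj_on ?f ?I" "inj_on ?g ?J" "?f ` ?I \<inter> ?g ` ?J = {}" by (auto simp: inj_on_def) presburger
  show "{..<Suc n} = ?f ` ?I \<union> ?g ` ?J"
  proof (intro subset_antisym subsetI)
   fix i assume i: "i : {..<Suc n}"
   show "i : ?f ` ?I \<union> ?g ` ?J"
   proof (cases "even i")
    case True
    hence "i = ?f (n - i, i div 2)" "(n - i, i div 2) : ?I" using i by auto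
    thus ?thesis by blast
   next
    case False
    hence "i = ?g (n - 2 * (i div 2), i div 2)" "(n - 2 * (i div 2), i div 2) : ?J" using i by (auto, presburger+)
    thus ?thesis by blast
   qed
  qed auto
  show "vspace (part (?P i) m)" if "i : {..<Suc n}" for i m by (rule facts(1)[OF that])
  show "act (?P i) k m th X : carrier (part (?P i) (m + k))"
   if "i : {..<Suc n}" "th : steenrod k" "X : carrier (part (?P i) m)" for i k m th X by (rule facts(2)[OF that])
  show "unstable_iso (?P (?f i)) ((%(a, b). r_prime (ExtDiv a b)) i)" if "i : ?I" for i
  proof -
   obtain a b where i: "i = (a, b)" "n = a + 2 * b" using \<open>i : ?I\<close> by auto
   have "unstable_iso (?P (2 * b)) (AltMod a b)" using graded_piece_even[OF prime odd inf free i(2)] piece[of "2 * b"] i(2) by simp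
   hence "unstable_iso (?P (2 * b)) (r_prime (ExtDiv a b))"
    by (rule unstable_iso_trans[rotated 2, OF _ RS_iso_RT[OF prime odd]]) (use facts i(2) in auto)
   thus ?thesis using i by simp
  qed
  show "unstable_iso (?P (?g j)) ((%(a, b). suspension (r_prime (ExtDiv (a - 1) b))) j)" if "j : ?J" for j
  proof -
   obtain a b where j: "j = (a, b)" "n = a + 2 * b" "a \<ge> 1" using \<open>j : ?J\<close> by auto
   hence n: "n = Suc ((a - 1) + 2 * b)" by simp
   have "unstable_iso (?P (Suc (2 * b))) (suspension (AltMod (a - 1) b))"
    using graded_piece_odd[OF prime odd inf free n] piece[of "Suc (2 * b)"] n by simp
   moreover have "unstable_iso (suspension (AltMod (a - 1) b)) (suspension (r_prime (ExtDiv (a - 1) b :: ('k, _) vfunctor)))"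
    by (rule suspension_iso[OF AltMod_vs RT_vs[OF prime odd] RS_act_closed[OF prime odd] RS_iso_RT[OF prime odd]])
   ultimately have "unstable_iso (?P (Suc (2 * b))) (suspension (r_prime (ExtDiv (a - 1) b)))"
    by (rule unstable_iso_trans[rotated 2]) (use facts n in auto)
   thus ?thesis using j by simp
  qed
 qed
 thus ?thesis using fil unfolding associated_graded_def by blast
qed

end
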